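(* Let $T$ be a Calderón-Zygmund operator on $\mathbb{R}^d$, acting componentwise on $\mathbb{C}^n$-valued functions, let $W$ be an $n\times n$ matrix weight on $\mathbb{R}^d$ with $W\in \mathrm{A}_1$, and let $$T_Wf(x)=W(x)\,T(W^{-1}f)(x).$$ Then there is a constant $C$, depending only on $n$, $d$ and $T$ (and not on $W$), such that for all $f\in L^1(\mathbb{R}^d,\mathbb{C}^n)$ and all $\lambda>0$, $$|\{x\in\mathbb{R}^d: |T_Wf(x)|>\lambda\}|\le C\,\frac{[W]_{\mathrm{A}_1}[W]_{\mathrm{A}_\infty^{\mathrm{sc}}}}{\lambda}\int_{\mathbb{R}^d}|f(x)|\,dx .$$
   Context: Cubes $Q\subset\mathbb{R}^d$ have sides parallel to the coordinate axes. A matrix weight $W$ is a self-adjoint $n\times n$ matrix-valued function on $\mathbb{R}^d$ with locally integrable entries such that $W(x)$ is positive definite for a.e. $x$. $|A|_{\mathrm{op}}=\sup_{e\in\mathbb{C}^n,|e|=1}|Ae|$ is the operator norm. $W\in\mathrm{A}_1$ means $$[W]_{\mathrm{A}_1}=\operatorname*{ess\,sup}_{x\in\mathbb{R}^d}\ \sup_{Q\ni x}\frac{1}{|Q|}\int_Q|W(y)W^{-1}(x)|_{\mathrm{op}}\,dy<\infty .$$ The scalar $A_\infty$ constant of $W$ is $[W]_{\mathrm{A}_\infty^{\mathrm{sc}}}=\sup_{e\in\mathbb{C}^n\setminus\{0\}}[\,|W(\cdot)e|\,]_{A_\infty}$, where for a scalar weight $w$ the (Fujii-Wilson) constant is $[w]_{A_\infty}=\sup_Q\frac{1}{\int_Q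 w}\int_Q M(w\chi_Q)(x)\,dx$, with $M$ the Hardy-Littlewood maximal operator over cubes. A Calderón-Zygmund operator (CZO) is a linear operator $T$ bounded on $L^2(\mathbb{R}^d)$ with a kernel $K$ such that $Tf(x)=\int K(x,y)f(y)\,dy$ for $x\notin\operatorname{supp} f$, satisfying the size bound $|K(x,y)|\le c_K|x-y|^{-d}$ for $x\ne y$ and the smoothness bound $|K(x,y)-K(x',y)|+|K(y,x)-K(y,x')|\le \omega\big(\tfrac{|x-x'|}{|x-y|}\big)|x-y|^{-d}$ whenever $|x-y|>2|x-x'|$, where the modulus of continuity $\omega$ (increasing, subadditive, $\omega(0)=0$) satisfies the Dini condition $\|\omega\|_{\mathrm{Dini}}=\int_0^1\omega(t)\frac{dt}{t}<\infty$. *)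

theory Defs
  imports "HOL-Analysis.Analysis" "HOL-Probability.Essential_Supremum"
begin

section \<open>Cubes, averages and scalar \<open>A\<^sub>\<infinity>\<close> constants\<close>

definition cubes :: "(real^'d::finite) set set" where
  "cubes = {cbox a (a + vec l) | a l. 0 < l}"

text \<open>
  Cubes are closed; open or half-open cubes give the same averages and, by continuity of
  averages under dilation, the same suprema over cubes containing a point.
\<close>

definition average :: "(real^'d::finite) set \<Rightarrow> (real^'d \<Rightarrow> real) \<Rightarrow> ennreal" where
  "average Q g = (\<integral>\<^sup>+ y\<in>Q. ennreal \<bar>g y\<bar> \<partial>lebesgue) / emeasure lebesgue Q"

definition maximal :: "(real^'d::finite \<Rightarrow> real) \<Rightarrow> real^'d \<Rightarrow> ennreal" where
  "maximal g x = (SUP Q\<in>{Q\<in>cubes. x \<in> Q}. average Q g)"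

definition A_infinity_const :: "(real^'d::finite \<Rightarrow> real) \<Rightarrow> ennreal" where
  "A_infinity_const w =
     (SUP Q\<in>cubes. (\<integral>\<^sup>+ x\<in>Q. maximal (\<lambda>y. w y * indicator Q y) x \<partial>lebesgue) /
                    (\<integral>\<^sup>+ x\<in>Q. ennreal (w x) \<partial>lebesgue))"

section \<open>Matrix weights\<close>

definition self_adjoint :: "complex^'n^'n \<Rightarrow> bool" where
  "self_adjoint A \<longleftrightarrow> (\<forall>i j. A $ i $ j = cnj (A $ j $ i))"

definition positive_definite :: "complex^'n::finite^'n \<Rightarrow> bool" where
  "positive_definite A \<longleftrightarrow>
     self_adjoint A \<and> (\<forall>v. v \<noteq> 0 \<longrightarrow> 0 < Re (\<Sum>i\<in>UNIV. (A *v v) $ i * cnj (v $ i)))"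

definition matrix_weight :: "(real^'d::finite \<Rightarrow> complex^'n::finite^'n) \<Rightarrow> bool" where
  "matrix_weight W \<longleftrightarrow>
     (\<forall>x. self_adjoint (W x)) \<and>
     (\<forall>i j S. compact S \<longrightarrow> (\<lambda>x. W x $ i $ j) absolutely_integrable_on S) \<and>
     (AE x in lebesgue. positive_definite (W x))"

definition op_norm :: "complex^'n::finite^'n \<Rightarrow> real" where
  "op_norm A = onorm (\<lambda>e. A *v e)"

definition A1_const :: "(real^'d::finite \<Rightarrow> complex^'n::finite^'n) \<Rightarrow> ennreal" where
  "A1_const W = esssup lebesgue
     (\<lambda>x. SUP Q\<in>{Q\<in>cubes. x \<in> Q}. average Q (\<lambda>y. op_norm (W y ** matrix_inv (W x))))"

definition A_infinity_sc_const :: "(real^'d::finite \<Rightarrow> complex^'n::finite^'n) \<Rightarrow> ennreal" where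
  "A_infinity_sc_const W = (SUP e\<in>-{0}. A_infinity_const (\<lambda>x. norm (W x *v e)))"

section \<open>Calderon-Zygmund operators\<close>

definition dini_modulus :: "(real \<Rightarrow> real) \<Rightarrow> bool" where
  "dini_modulus \<omega> \<longleftrightarrow>
     mono_on {0..} \<omega> \<and> (\<forall>s\<ge>0. \<forall>t\<ge>0. \<omega> (s + t) \<le> \<omega> s + \<omega> t) \<and> \<omega> 0 = 0 \<and>
     (\<integral>\<^sup>+ t\<in>{0<..<1}. ennreal (\<omega> t / t) \<partial>lborel) < \<infinity>"

definition cz_kernel :: "(real^'d::finite \<Rightarrow> real^'d \<Rightarrow> complex) \<Rightarrow> bool" where
  "cz_kernel K \<longleftrightarrow>
     (\<exists>c::real. \<forall>x y. x \<noteq> y \<longrightarrow> norm (K x y) \<le> c / norm (x - y) ^ CARD('d)) \<and>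
     (\<exists>\<omega>. dini_modulus \<omega> \<and>
        (\<forall>x x' y. norm (x - y) > 2 * norm (x - x') \<longrightarrow>
           norm (K x y - K x' y) + norm (K y x - K y x')
             \<le> \<omega> (norm (x - x') / norm (x - y)) / norm (x - y) ^ CARD('d)))"

definition L2_function :: "(real^'d::finite \<Rightarrow> complex) \<Rightarrow> bool" where
  "L2_function f \<longleftrightarrow>
     f \<in> borel_measurable lebesgue \<and> integrable lebesgue (\<lambda>x. (norm (f x))\<^sup>2)"

definition L2_norm_of :: "(real^'d::finite \<Rightarrow> complex) \<Rightarrow> real" where
  "L2_norm_of f = sqrt (\<integral>x. (norm (f x))\<^sup>2 \<partial>lebesgue)"

text \<open>
  An operator on \<open>L\<^sup>2\<close> is modelled as a map on representatives, constrained only on square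
  integrable arguments. Linearity holds up to null sets; together with boundedness
  it implies that functions that are equal almost everywhere have images equal almost
  everywhere. The closure of \<open>{y. f y \<noteq> 0}\<close> depends on the representative and contains the
  essential support; since \<open>f\<close> may be replaced by a representative vanishing off its essential
  support, the kernel representation holds off the essential support as well.
\<close>

definition cz_operator :: "((real^'d::finite \<Rightarrow> complex) \<Rightarrow> (real^'d \<Rightarrow> complex)) \<Rightarrow> bool" where
  "cz_operator T \<longleftrightarrow>
     (\<forall>f. L2_function f \<longrightarrow> L2_function (T f)) \<and>
     (\<forall>f g a b. L2_function f \<longrightarrow> L2_function g \<longrightarrow>
        (AE x in lebesgue. T (\<lambda>y. a * f y + b * g y) x = a * T f x + b * T g x)) \<and>
     (\<exists>B. \<forall>f. L2_function f \<longrightarrow> L2_norm_of (T f) \<le> B * L2_norm_of f) \<and>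
     (\<exists>K. cz_kernel K \<and>
        (\<forall>f. L2_function f \<longrightarrow>
           (AE x in lebesgue. x \<notin> closure {y. f y \<noteq> 0} \<longrightarrow>
              T f x = (\<integral>y. K x y * f y \<partial>lebesgue))))"

section \<open>Extension beyond \<open>L\<^sup>2\<close> and the weighted operator\<close>

text \<open>
  For integrable \<open>f\<close> and a weight in \<open>A\<^sub>1\<close>, the components of \<open>W\<^sup>-\<^sup>1 f\<close> need be neither
  square integrable nor integrable; they only satisfy
  \<open>\<integral> norm (g x) / (1 + norm x) ^ d dx < \<infinity>\<close>. On such \<open>g\<close> the operator is
  understood through its usual extension: truncate \<open>g\<close> to bounded functions with bounded
  support, which are in \<open>L\<^sup>2\<close>, and take the limit of the images in measure on bounded sets.
  The limit exists for these \<open>g\<close> by the unweighted weak type bound near a given ball and by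
  absolute convergence of the kernel integral away from it, it is unique up to null sets, and
  it agrees with \<open>T g\<close> for square integrable \<open>g\<close>.
\<close>

definition truncation :: "nat \<Rightarrow> (real^'d::finite \<Rightarrow> complex) \<Rightarrow> real^'d \<Rightarrow> complex" where
  "truncation k g x = (if norm x \<le> real k \<and> norm (g x) \<le> real k then g x else 0)"

definition local_limit_in_measure ::
  "(nat \<Rightarrow> real^'d::finite \<Rightarrow> complex) \<Rightarrow> (real^'d \<Rightarrow> complex) \<Rightarrow> bool" where
  "local_limit_in_measure u v \<longleftrightarrow>
     (\<forall>k. u k \<in> borel_measurable lebesgue) \<and> v \<in> borel_measurable lebesgue \<and>
     (\<forall>R>0. \<forall>\<epsilon>>0.
        (\<lambda>k. emeasure lebesgue {x \<in> ball 0 R. norm (u k x - v x) > \<epsilon>}) \<longlonglongrightarrow> 0)"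

definition extension ::
  "((real^'d::finite \<Rightarrow> complex) \<Rightarrow> (real^'d \<Rightarrow> complex)) \<Rightarrow>
   (real^'d \<Rightarrow> complex) \<Rightarrow> (real^'d \<Rightarrow> complex)" where
  "extension T g = (SOME v. local_limit_in_measure (\<lambda>k. T (truncation k g)) v)"

lemma local_limit_in_measure_unique:
  assumes "local_limit_in_measure u v" "local_limit_in_measure u w"
  shows "AE x in lebesgue. v x = w x"
proof -
  have [measurable]: "u k \<in> borel_measurable lebesgue" "v \<in> borel_measurable lebesgue"
    "w \<in> borel_measurable lebesgue" for k
    using assms by (auto simp: local_limit_in_measure_def)
  have meas: "{x \<in> ball 0 R. norm (p x - q x) > c} \<in> sets lebesgue"
    if [measurable]: "p \<in> borel_measurable lebesgue" "q \<in> borel_measurable lebesgue"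
    for p q :: "real^'a \<Rightarrow> complex" and R c :: real
  proof -
    have "ball 0 R \<inter> {x \<in> space lebesgue. norm (p x - q x) > c} \<in> sets lebesgue"
      by (intro sets.Int fmeasurableD[OF lmeasurable_ball]) measurable
    then show ?thesis by (simp add: Int_def)
  qed
  have null: "emeasure lebesgue {x \<in> ball 0 R. norm (v x - w x) > 2 * \<epsilon>} = 0"
    if "R > 0" "\<epsilon> > 0" for R \<epsilon> :: real
  proof -
    let ?P = "\<lambda>k. {x \<in> ball 0 R. norm (u k x - v x) > \<epsilon>}"
    let ?Q = "\<lambda>k. {x \<in> ball 0 R. norm (u k x - w x) > \<epsilon>}"
    have PQ: "?P k \<in> sets lebesgue" "?Q k \<in> sets lebesgue" "?P k \<union> ?Q k \<in> sets lebesgue" for k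
      by (intro meas sets.Un; simp)+
    have tri: "norm (v x - w x) \<le> norm (u k x - v x) + norm (u k x - w x)" for x k
      using norm_triangle_ineq4[of "u k x - w x" "u k x - v x"] by simp
    have "{x \<in> ball 0 R. norm (v x - w x) > 2 * \<epsilon>} \<subseteq> ?P k \<union> ?Q k" for k
    proof
      fix x assume "x \<in> {x \<in> ball 0 R. norm (v x - w x) > 2 * \<epsilon>}"
      then show "x \<in> ?P k \<union> ?Q k"
        using tri[of x k] by (cases "norm (u k x - v x) > \<epsilon>") auto
    qed
    then have le: "emeasure lebesgue {x \<in> ball 0 R. norm (v x - w x) > 2 * \<epsilon>}
        \<le> emeasure lebesgue (?P k) + emeasure lebesgue (?Q k)" for k
      by (rule order_trans[OF emeasure_mono[OF _ PQ(3)] emeasure_subadditive[OF PQ(1,2)]])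
    have "(\<lambda>k. emeasure lebesgue (?P k)) \<longlonglongrightarrow> 0" "(\<lambda>k. emeasure lebesgue (?Q k)) \<longlonglongrightarrow> 0"
      using assms that unfolding local_limit_in_measure_def by blast+
    from tendsto_add[OF this]
    have "emeasure lebesgue {x \<in> ball 0 R. norm (v x - w x) > 2 * \<epsilon>} \<le> 0 + 0"
      by (rule LIMSEQ_le_const) (intro exI allI impI le)
    then show ?thesis by simp
  qed
  have "AE x in lebesgue. \<forall>m::nat. \<not> (x \<in> ball 0 (real (Suc m)) \<and>
      norm (v x - w x) > 2 * inverse (real (Suc m)))"
    unfolding AE_all_countable
  proof
    fix m :: nat
    have "{x \<in> ball 0 (real (Suc m)). norm (v x - w x) > 2 * inverse (real (Suc m))} \<in> null_sets lebesgue"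
      by (intro null_setsI null meas) (auto simp del: of_nat_Suc)
    then show "AE x in lebesgue. \<not> (x \<in> ball 0 (real (Suc m)) \<and>
        norm (v x - w x) > 2 * inverse (real (Suc m)))"
      by (rule AE_I') auto
  qed
  then show ?thesis
  proof eventually_elim
    case (elim x)
    show ?case
    proof (rule ccontr)
      assume "v x \<noteq> w x"
      then have pos: "norm (v x - w x) / 2 > 0" by simp
      obtain m1 where m1: "norm x < real m1" using reals_Archimedean2 by blast
      obtain m2 where m2: "inverse (real (Suc m2)) < norm (v x - w x) / 2"
        using reals_Archimedean[OF pos] by blast
      have "inverse (real (Suc (max m1 m2))) \<le> inverse (real (Suc m2))"
        by (intro le_imp_inverse_le) auto
      then have "norm (v x - w x) > 2 * inverse (real (Suc (max m1 m2)))"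
        using m2 by linarith
      moreover have "x \<in> ball 0 (real (Suc (max m1 m2)))"
        using m1 by simp
      ultimately show False using elim by blast
    qed
  qed
qed

lemma extension_eq_on_L2:
  assumes T: "cz_operator T" and f: "L2_function f"
  shows "AE x in lebesgue. extension T f x = T f x"
proof -
  have TL2: "L2_function (T g)" if "L2_function g" for g
    using T that unfolding cz_operator_def by blast
  have [measurable]: "f \<in> borel_measurable lebesgue"
    and int: "integrable lebesgue (\<lambda>x. (norm (f x))\<^sup>2)"
    using f by (auto simp: L2_function_def)
  have tr_meas [measurable]: "truncation k f \<in> borel_measurable lebesgue" for k
  proof -
    have "(norm :: real^'a \<Rightarrow> real) \<in> borel_measurable lebesgue"
      by (intro measurable_completion) auto
    note [measurable] = this
    show ?thesis unfolding truncation_def by measurable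
  qed
  define h where "h k y = 1 * truncation k f y + (- 1) * f y" for k y
  have tr: "L2_function (truncation k f)" for k
    unfolding L2_function_def
  proof (intro conjI tr_meas Bochner_Integration.integrable_bound[OF int])
    show "(\<lambda>x. (norm (truncation k f x))\<^sup>2) \<in> borel_measurable lebesgue" by measurable
  qed (auto simp: truncation_def)
  have [measurable]: "h k \<in> borel_measurable lebesgue" for k
    unfolding h_def by measurable
  have hbound: "(norm (h k x))\<^sup>2 \<le> (norm (f x))\<^sup>2" for k x
    by (simp add: h_def truncation_def)
  have h: "L2_function (h k)" for k
    unfolding L2_function_def
  proof (intro conjI Bochner_Integration.integrable_bound[OF int] AE_I2)
    show "norm ((norm (h k x))\<^sup>2) \<le> norm ((norm (f x))\<^sup>2)" for x
      using hbound[of k x] by (simp only: real_norm_def abs_power2 abs_of_nonneg zero_le_power2)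
  qed measurable
  have lin: "\<forall>f g a b. L2_function f \<longrightarrow> L2_function g \<longrightarrow>
      (AE x in lebesgue. T (\<lambda>y. a * f y + b * g y) x = a * T f x + b * T g x)"
    using T unfolding cz_operator_def by blast
  have "AE x in lebesgue. T (h k) x = 1 * T (truncation k f) x + (- 1) * T f x" for k
    unfolding h_def using lin tr[of k] f by blast
  then have Th: "AE x in lebesgue. T (h k) x = T (truncation k f) x - T f x" for k
    by simp
  obtain B where B: "\<And>g. L2_function g \<Longrightarrow> L2_norm_of (T g) \<le> B * L2_norm_of g"
    using T unfolding cz_operator_def by blast
  have nonneg: "0 \<le> L2_norm_of g" for g :: "real^'a \<Rightarrow> complex"
    by (simp add: L2_norm_of_def)
  have "(\<lambda>k. \<integral>x. (norm (h k x))\<^sup>2 \<partial>lebesgue) \<longlonglongrightarrow> (\<integral>x. 0 \<partial>(lebesgue :: (real^'a) measure))"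
  proof (rule integral_dominated_convergence[OF _ _ int])
    have "(\<lambda>k. (norm (h k x))\<^sup>2) \<longlonglongrightarrow> 0" for x
    proof (rule tendsto_eventually)
      obtain m where "max (norm x) (norm (f x)) < real m" using reals_Archimedean2 by blast
      then have "h k x = 0" if "k \<ge> m" for k
        using that by (auto simp: h_def truncation_def not_le)
      then show "\<forall>\<^sub>F k in sequentially. (norm (h k x))\<^sup>2 = 0"
        by (auto simp: eventually_sequentially)
    qed
    then show "AE x in lebesgue. (\<lambda>k. (norm (h k x))\<^sup>2) \<longlonglongrightarrow> 0" by simp
  qed (auto simp: hbound)
  then have "(\<lambda>k. B * L2_norm_of (h k)) \<longlonglongrightarrow> B * sqrt 0"
    unfolding L2_norm_of_def by (intro tendsto_intros) simp
  then have "(\<lambda>k. B * L2_norm_of (h k)) \<longlonglongrightarrow> 0"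
    by simp
  then have "(\<lambda>k. L2_norm_of (T (h k))) \<longlonglongrightarrow> 0"
    by (rule tendsto_sandwich[OF _ _ tendsto_const, rotated 2])
       (intro always_eventually allI nonneg B h)+
  then have "(\<lambda>k. (L2_norm_of (T (h k)))\<^sup>2) \<longlonglongrightarrow> 0\<^sup>2"
    by (rule tendsto_power)
  then have lim: "(\<lambda>k. \<integral>x. (norm (T (h k) x))\<^sup>2 \<partial>lebesgue) \<longlonglongrightarrow> 0"
    by (simp add: L2_norm_of_def)
  have TM [measurable]: "T f \<in> borel_measurable lebesgue" "T (truncation k f) \<in> borel_measurable lebesgue"
    "T (h k) \<in> borel_measurable lebesgue" for k
    using TL2 f tr h by (auto simp: L2_function_def)
  have loc: "local_limit_in_measure (\<lambda>k. T (truncation k f)) (T f)"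
    unfolding local_limit_in_measure_def
  proof (intro conjI allI impI TM)
    fix R \<epsilon> :: real assume "R > 0" "\<epsilon> > 0"
    have bd: "emeasure lebesgue {x \<in> ball 0 R. norm (T (truncation k f) x - T f x) > \<epsilon>}
        \<le> ennreal ((1 / \<epsilon>\<^sup>2) * (\<integral>x. (norm (T (h k) x))\<^sup>2 \<partial>lebesgue))" for k
    proof -
      have "emeasure lebesgue {x \<in> ball 0 R. norm (T (truncation k f) x - T f x) > \<epsilon>}
          \<le> emeasure lebesgue {x \<in> space lebesgue. (norm (T (h k) x))\<^sup>2 \<ge> \<epsilon>\<^sup>2}"
      proof (rule emeasure_mono_AE)
        show "AE x in lebesgue. x \<in> {x \<in> ball 0 R. norm (T (truncation k f) x - T f x) > \<epsilon>} \<longrightarrow>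
            x \<in> {x \<in> space lebesgue. (norm (T (h k) x))\<^sup>2 \<ge> \<epsilon>\<^sup>2}"
          using Th[of k] by eventually_elim (use \<open>\<epsilon> > 0\<close> in \<open>auto intro!: power_mono\<close>)
        show "{x \<in> space lebesgue. (norm (T (h k) x))\<^sup>2 \<ge> \<epsilon>\<^sup>2} \<in> sets lebesgue"
          by measurable
      qed
      also have "\<dots> \<le> ennreal ((1 / \<epsilon>\<^sup>2) * (\<integral>x. (norm (T (h k) x))\<^sup>2 \<partial>lebesgue))"
        using TL2[OF h[of k]] \<open>\<epsilon> > 0\<close> unfolding L2_function_def
        by (intro integral_Markov_inequality) auto
      finally show ?thesis .
    qed
    have "(\<lambda>k. ennreal ((1 / \<epsilon>\<^sup>2) * (\<integral>x. (norm (T (h k) x))\<^sup>2 \<partial>lebesgue))) \<longlonglongrightarrow> ennreal ((1 / \<epsilon>\<^sup>2) * 0)"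
      by (intro tendsto_ennrealI tendsto_mult tendsto_const lim)
    then have "(\<lambda>k. ennreal ((1 / \<epsilon>\<^sup>2) * (\<integral>x. (norm (T (h k) x))\<^sup>2 \<partial>lebesgue))) \<longlonglongrightarrow> 0"
      by simp
    then show "(\<lambda>k. emeasure lebesgue {x \<in> ball 0 R. norm (T (truncation k f) x - T f x) > \<epsilon>}) \<longlonglongrightarrow> 0"
      by (rule tendsto_sandwich[OF _ _ tendsto_const, rotated 2]) (intro always_eventually allI zero_le bd)+
  qed
  then have "local_limit_in_measure (\<lambda>k. T (truncation k f)) (extension T f)"
    unfolding extension_def by (rule someI[where P = "local_limit_in_measure (\<lambda>k. T (truncation k f))"])
  then show ?thesis
    using loc by (rule local_limit_in_measure_unique)
qed

definition weighted_operator ::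
  "((real^'d::finite \<Rightarrow> complex) \<Rightarrow> (real^'d \<Rightarrow> complex)) \<Rightarrow>
   (real^'d \<Rightarrow> complex^'n::finite^'n) \<Rightarrow> (real^'d \<Rightarrow> complex^'n) \<Rightarrow> real^'d \<Rightarrow> complex^'n" where
  "weighted_operator T W f x =
     W x *v (\<chi> i. extension T (\<lambda>y. (matrix_inv (W y) *v f y) $ i) x)"

end

theory Submission imports Defs begin

text \<open>
  Write \<open>f = W g\<close>. For a grid cube \<open>Q\<close>, the norm \<open>v \<mapsto> avg\<^sub>Q |W v|\<close> has an Auerbach basis \<open>(e\<^sub>i)\<close>, and
  by the \<open>A\<^sub>1\<close> condition the coordinates of \<open>g\<close> in this basis are at most a multiple of
  \<open>[W]\<^sub>A\<^sub>1 |f|\<close> on a dilate \<open>Q\<^sup>*\<close> of \<open>Q\<close>. The unweighted weak type inequality, applied to these scalar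
  coordinates, therefore controls \<open>T\<close> on \<open>Q\<close> off a small exceptional set. Stopping at the maximal
  subcubes that this set fills too much, one gets a sparse bound
  \<open>|T\<^sub>W f| \<le> C [W]\<^sub>A\<^sub>1 (\<Sum>\<^sub>Q b\<^sub>Q \<phi>\<^sub>Q)\<close> with \<open>b\<^sub>Q\<close> the average of \<open>|f|\<close> over \<open>Q\<^sup>*\<close> and \<open>\<phi>\<^sub>Q = \<Sum>\<^sub>i |W e\<^sub>i|\<close> on \<open>Q\<close>.

  The functions \<open>|W e\<^sub>i|\<close> are scalar \<open>A\<^sub>\<infinity>\<close> weights of average at most one on \<open>Q\<close>, so by the reverse
  Hoelder inequality \<open>\<phi>\<^sub>Q\<close> is bounded in \<open>L\<^sup>1\<^sup>+\<^sup>\<delta>(Q, dx / |Q|)\<close> with \<open>\<delta>\<close> comparable to the inverse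
  of \<open>[W]\<^sub>A\<^sub>\<infinity>\<close>. For a sparse sum with such coefficients the weak type constant is at most
  \<open>C / \<delta>\<close>: outside the set where some \<open>b\<^sub>Q\<close> exceeds the level, the cubes with \<open>b\<^sub>Q\<close> in a fixed
  dyadic range are handled by \<open>z \<le> \<rho> + \<rho>\<^sup>-\<^sup>\<delta> z\<^sup>1\<^sup>+\<^sup>\<delta>\<close> with \<open>\<rho>\<close> summable over the ranges and over the
  generations. Truncations of \<open>g\<close> suffice because \<open>|W(x)\<^sup>-\<^sup>1|\<close> grows at most like \<open>(1 + |x|)\<^sup>d\<close>.
\<close>

section \<open>Cells and adapted functions\<close>

text \<open>\<open>W\<close> is evaluated at the output point while \<open>T\<close> integrates
  \<open>W^-1 f\<close> elsewhere, so scalar inequalities for \<open>T\<close> say nothing directly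
  about the composition. A basis, by contrast, belongs to a whole cell: its coordinate matrix is
  constant there and commutes with \<open>T\<close>, which reduces vectors to scalars. The two
  weight constants enter at separate places, each to the first power: the A1 constant when a
  coordinate of \<open>g\<close> is bounded on a star, the A-infinity constant through
  \<open>1 / \<delta>\<close>.

  Families of cells are encoded as predicates of a time and a point that are constant on the cells
  of that time. Selection, packing and enlargement then become statements about sums over times and
  integrals over the space, and no collection of cubes is ever enumerated. Stars do the work of
  several shifted grids: the nested cells of one grid with a corner at the origin never exhaust the
  space, but their stars do, and the star of a descendant lies in the star of its ancestor.\<close>

text \<open>Cells are indexed by points: \<open>dcell s x\<close> is the half-open cube of side \<open>1 / s\<close> of the grid
  \<open>(1 / s) \<int>\<^sup>d\<close> that contains \<open>x\<close>. The star must be large enough that the kernel is smooth on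
  the cell as seen from outside the star.\<close>

definition dcell :: "real \<Rightarrow> real^'d::finite \<Rightarrow> (real^'d) set" where
  "dcell s x = {y. \<forall>i. \<lfloor>s * y $ i\<rfloor> = \<lfloor>s * x $ i\<rfloor>}"

definition dstar :: "real \<Rightarrow> real^'d::finite \<Rightarrow> (real^'d) set" where
  "dstar s x = {y. \<forall>i. \<bar>\<lfloor>s * y $ i\<rfloor> - \<lfloor>s * x $ i\<rfloor>\<bar> \<le> 2 * int CARD('d)}"

text \<open>Measurability with respect to the grid of scale \<open>s\<close>; as \<open>s\<close>
  doubles the grids form a filtration. The value type is arbitrary so that chosen bases, exceptional
  sets and predicates can be adapted as well as numbers.\<close>

definition adapted :: "real \<Rightarrow> (real^'d::finite \<Rightarrow> 'b) \<Rightarrow> bool" where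
  "adapted s c \<longleftrightarrow> (\<forall>x. \<forall>y\<in>dcell s x. c y = c x)"

definition corner :: "real \<Rightarrow> real^'d::finite \<Rightarrow> real^'d" where
  "corner s x = (\<chi> i. of_int \<lfloor>s * x $ i\<rfloor> / s)"

text \<open>The volume of a star in units of its cell: in each direction there are
  \<open>2 d\<close> cells on either side of the central one.\<close>

definition kappa :: "'d::finite itself \<Rightarrow> real" where
  "kappa _ = (4 * real CARD('d) + 1) ^ CARD('d)"

lemma kappa_ge_1: "1 \<le> kappa TYPE('d::finite)"
  unfolding kappa_def by (intro one_le_power) simp

lemma kappa_pos [simp]: "0 < kappa TYPE('d::finite)"
  using kappa_ge_1[where 'd='d] by linarith

section \<open>Geometry of cells and stars\<close>

lemma dcell_self [simp]: "x \<in> dcell s x"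
  by (simp add: dcell_def)

lemma dcell_sym: "y \<in> dcell s x \<longleftrightarrow> x \<in> dcell s y"
  by (auto simp: dcell_def)

lemma dstar_sym: "y \<in> dstar s x \<longleftrightarrow> x \<in> dstar s y"
  by (simp add: dstar_def abs_minus_commute)

lemma dcell_eq: "y \<in> dcell s x \<Longrightarrow> dcell s y = dcell s x"
  by (simp add: dcell_def)

lemma dstar_eq: "y \<in> dcell s x \<Longrightarrow> dstar s y = dstar s x"
  by (simp add: dcell_def dstar_def)

lemma dcell_subset_dstar: "dcell s x \<subseteq> dstar s x"
  by (auto simp: dcell_def dstar_def)

lemma dcell_in_dstar: "y \<in> dstar s x \<Longrightarrow> dcell s y \<subseteq> dstar s x"
  by (auto simp: dcell_def dstar_def)

lemma adaptedD: "adapted s c \<Longrightarrow> y \<in> dcell s x \<Longrightarrow> c y = c x"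
  by (auto simp: adapted_def)

lemma floor_double: "\<lfloor>2 * a\<rfloor> = 2 * \<lfloor>a\<rfloor> \<or> \<lfloor>2 * a\<rfloor> = 2 * \<lfloor>a\<rfloor> + 1" for a :: real
  by linarith

lemma dcell_double: "dcell (2 * s) x \<subseteq> dcell s x"
proof
  fix y assume y: "y \<in> dcell (2 * s) x"
  have "\<lfloor>s * y $ i\<rfloor> = \<lfloor>s * x $ i\<rfloor>" for i
  proof -
    have "\<lfloor>2 * (s * y $ i)\<rfloor> = \<lfloor>2 * (s * x $ i)\<rfloor>"
      using y by (simp add: dcell_def mult.assoc)
    then show ?thesis
      using floor_double[of "s * y $ i"] floor_double[of "s * x $ i"] by presburger
  qed
  then show "y \<in> dcell s x" by (simp add: dcell_def)
qed

text \<open>An index gap of at most \<open>2 d\<close> on the finer grid is a gap of at most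
  \<open>d + 1/2\<close> on the coarser one, and this is below \<open>2 d\<close> because
  \<open>d \<ge> 1\<close>.\<close>

lemma dstar_double: "dstar (2 * s) x \<subseteq> dstar s (x :: real^'d::finite)"
proof
  fix y assume y: "y \<in> dstar (2 * s) x"
  have c: "int CARD('d) \<ge> 1" by (simp add: Suc_leI)
  have "\<bar>\<lfloor>s * y $ i\<rfloor> - \<lfloor>s * x $ i\<rfloor>\<bar> \<le> 2 * int CARD('d)" for i
  proof -
    have "\<bar>\<lfloor>2 * (s * y $ i)\<rfloor> - \<lfloor>2 * (s * x $ i)\<rfloor>\<bar> \<le> 2 * int CARD('d)"
      using y by (simp add: dstar_def mult.assoc)
    then show ?thesis
      using floor_double[of "s * y $ i"] floor_double[of "s * x $ i"] c by linarith
  qed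
  then show "y \<in> dstar s x" by (simp add: dstar_def)
qed

lemma dcell_pow: "dcell (2 ^ k * s) x \<subseteq> dcell s x"
  by (induction k) (use dcell_double in \<open>force simp: mult.assoc\<close>)+

lemma dstar_pow: "dstar (2 ^ k * s) x \<subseteq> dstar s x"
  by (induction k) (use dstar_double in \<open>force simp: mult.assoc\<close>)+

lemma dcell_mono: "j \<le> k \<Longrightarrow> dcell (2 ^ k * s) x \<subseteq> dcell (2 ^ j * s) x"
  using dcell_pow[of "k - j" "2 ^ j * s" x] by (simp add: power_add[symmetric] mult.assoc[symmetric])

lemma dstar_mono: "j \<le> k \<Longrightarrow> dstar (2 ^ k * s) x \<subseteq> dstar (2 ^ j * s) x"
  using dstar_pow[of "k - j" "2 ^ j * s" x] by (simp add: power_add[symmetric] mult.assoc[symmetric])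

lemma adapted_mono: "adapted (2 ^ j * s) c \<Longrightarrow> j \<le> k \<Longrightarrow> adapted (2 ^ k * s) c"
  using dcell_mono[of j k s] unfolding adapted_def by blast

text \<open>Anything computed from the cell as a set is adapted, averages as well as values of a
  choice operator. Most adaptedness claims below reduce to this or to its analogue for
  stars.\<close>

lemma adapted_dcell: "adapted s (\<lambda>x. P (dcell s x))"
  unfolding adapted_def by (auto dest: dcell_eq)

lemma adapted_dstar: "adapted s (\<lambda>x. P (dstar s x))"
  unfolding adapted_def by (auto dest: dstar_eq)

lemma adapted_comp2:
  assumes "adapted s f" "adapted s g"
  shows "adapted s (\<lambda>x. h (f x) (g x))"
  using assms unfolding adapted_def by simp

lemma adapted_comp: "adapted s f \<Longrightarrow> adapted s (\<lambda>x. h (f x))"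
  unfolding adapted_def by simp

lemma adapted_corner: "adapted s (corner s)"
  by (auto simp: adapted_def corner_def dcell_def)

lemma dstar_eq_dcell_in:
  assumes "y \<in> dcell s x" shows "y \<in> dstar s z \<longleftrightarrow> x \<in> dstar s z"
  using assms by (auto simp: dcell_def dstar_def)

lemma floor_eq_bounds:
  fixes s y :: real assumes "s > 0"
  shows "m \<le> \<lfloor>s * y\<rfloor> \<longleftrightarrow> of_int m / s \<le> y" "\<lfloor>s * y\<rfloor> < m \<longleftrightarrow> y < of_int m / s"
  using assms by (auto simp: le_floor_iff floor_less_iff field_simps)

lemma dcell_box:
  assumes s: "s > 0"
  shows "dcell s x = {y. \<forall>i. corner s x $ i \<le> y $ i \<and> y $ i < (corner s x + vec (1 / s)) $ i}"
proof -
  have "(\<lfloor>s * y $ i\<rfloor> = \<lfloor>s * x $ i\<rfloor>) \<longleftrightarrow>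
      corner s x $ i \<le> y $ i \<and> y $ i < (corner s x + vec (1 / s)) $ i" for y i
  proof -
    have "(\<lfloor>s * y $ i\<rfloor> = \<lfloor>s * x $ i\<rfloor>) \<longleftrightarrow>
        \<lfloor>s * x $ i\<rfloor> \<le> \<lfloor>s * y $ i\<rfloor> \<and> \<lfloor>s * y $ i\<rfloor> < \<lfloor>s * x $ i\<rfloor> + 1" by auto
    also have "\<dots> \<longleftrightarrow> corner s x $ i \<le> y $ i \<and> y $ i < (corner s x + vec (1 / s)) $ i"
      unfolding floor_eq_bounds[OF s] by (simp add: corner_def add_divide_distrib)
    finally show ?thesis .
  qed
  then show ?thesis by (simp add: dcell_def)
qed

lemma dstar_box:
  fixes x :: "real^'d::finite"
  assumes s: "s > 0"
  shows "dstar s x = {y. \<forall>i. (corner s x - vec (2 * real CARD('d) / s)) $ i \<le> y $ i \<and>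
     y $ i < (corner s x - vec (2 * real CARD('d) / s) + vec ((4 * real CARD('d) + 1) / s)) $ i}"
proof -
  have "(\<bar>\<lfloor>s * y $ i\<rfloor> - \<lfloor>s * x $ i\<rfloor>\<bar> \<le> 2 * int CARD('d)) \<longleftrightarrow>
      (corner s x - vec (2 * real CARD('d) / s)) $ i \<le> y $ i \<and>
     y $ i < (corner s x - vec (2 * real CARD('d) / s) + vec ((4 * real CARD('d) + 1) / s)) $ i" for y i
  proof -
    have "(\<bar>\<lfloor>s * y $ i\<rfloor> - \<lfloor>s * x $ i\<rfloor>\<bar> \<le> 2 * int CARD('d)) \<longleftrightarrow>
        \<lfloor>s * x $ i\<rfloor> - 2 * int CARD('d) \<le> \<lfloor>s * y $ i\<rfloor> \<and>
        \<lfloor>s * y $ i\<rfloor> < \<lfloor>s * x $ i\<rfloor> + 2 * int CARD('d) + 1" by auto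
    also have "\<dots> \<longleftrightarrow> (corner s x - vec (2 * real CARD('d) / s)) $ i \<le> y $ i \<and>
     y $ i < (corner s x - vec (2 * real CARD('d) / s) + vec ((4 * real CARD('d) + 1) / s)) $ i"
      unfolding floor_eq_bounds[OF s]
      by (simp add: corner_def add_divide_distrib diff_divide_distrib algebra_simps)
    finally show ?thesis .
  qed
  then show ?thesis by (simp add: dstar_def)
qed

text \<open>The half-open box lies between the open and the closed box, whose measures
  agree.\<close>

lemma halfopen_box_measure:
  fixes a :: "real^'d::finite"
  assumes l: "l > 0"
  defines "H \<equiv> {y. \<forall>i. a $ i \<le> y $ i \<and> y $ i < (a + vec l) $ i}"
  shows "H \<in> sets borel" "emeasure lebesgue H = ennreal (l ^ CARD('d))"
    "H \<subseteq> cbox a (a + vec l)" "emeasure lebesgue (cbox a (a + vec l)) = ennreal (l ^ CARD('d))"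
proof -
  have sub: "box a (a + vec l) \<subseteq> H" and sup: "H \<subseteq> cbox a (a + vec l)"
    using l by (auto simp: H_def mem_box_cart less_imp_le)
  show "H \<in> sets borel"
  proof -
    have eq: "H = (\<Inter>i\<in>UNIV. {y \<in> space borel. a $ i \<le> y $ i} \<inter> {y \<in> space borel. y $ i < (a + vec l) $ i})"
      by (auto simp: H_def)
    show ?thesis unfolding eq
      by (intro sets.finite_INT sets.Int borel_measurable_le borel_measurable_less) auto
  qed
  then have Hl: "H \<in> sets lebesgue" by simp
  have ne: "cbox a (a + vec l) \<noteq> {}"
    using l by (simp add: interval_ne_empty_cart)
  have c: "measure lborel (cbox a (a + vec l)) = l ^ CARD('d)"
    using content_cbox_cart[OF ne] by simp
  show cb: "emeasure lebesgue (cbox a (a + vec l)) = ennreal (l ^ CARD('d))"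
    using c emeasure_eq_ennreal_measure[of lborel "cbox a (a + vec l)"]
      emeasure_lborel_cbox_finite[of a "a + vec l"] by auto
  have bx: "emeasure lebesgue (box a (a + vec l)) = ennreal (l ^ CARD('d))"
    using cb by (simp add: emeasure_lborel_box_eq emeasure_lborel_cbox_eq)
  have "emeasure lebesgue (box a (a + vec l)) \<le> emeasure lebesgue H"
    by (rule emeasure_mono[OF sub Hl])
  moreover have "emeasure lebesgue H \<le> emeasure lebesgue (cbox a (a + vec l))"
    by (rule emeasure_mono[OF sup]) simp
  ultimately show "emeasure lebesgue H = ennreal (l ^ CARD('d))"
    using cb bx by simp
  show "H \<subseteq> cbox a (a + vec l)" by (rule sup)
qed

lemma dcell_sets [measurable, simp]: "s > 0 \<Longrightarrow> dcell s x \<in> sets lebesgue"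
  using halfopen_box_measure(1)[of "1 / s"] by (simp add: dcell_box)

lemma dstar_sets [measurable, simp]: "s > 0 \<Longrightarrow> dstar s x \<in> sets lebesgue"
proof -
  assume s: "s > 0"
  then have "(4 * real CARD('a) + 1) / s > 0" by simp
  from halfopen_box_measure(1)[OF this] show ?thesis by (simp add: dstar_box[OF s])
qed

lemma emeasure_dcell: "s > 0 \<Longrightarrow> emeasure lebesgue (dcell s (x::real^'d::finite)) = ennreal (1 / s ^ CARD('d))"
  using halfopen_box_measure(2)[of "1 / s" "corner s x"] by (simp add: dcell_box power_one_over)

lemma emeasure_dstar:
  fixes x :: "real^'d::finite"
  assumes s: "s > 0"
  shows "emeasure lebesgue (dstar s x) = ennreal (kappa TYPE('d) / s ^ CARD('d))"
proof -
  from s have "(4 * real CARD('d) + 1) / s > 0" by simp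
  from halfopen_box_measure(2)[OF this, of "corner s x - vec (2 * real CARD('d) / s)"] show ?thesis
    by (simp add: dstar_box[OF s] kappa_def power_divide)
qed

lemma scale_abs_diff: "s > 0 \<Longrightarrow> s * \<bar>(x - y) $ i\<bar> = \<bar>s * x $ i - s * y $ i\<bar>" for s :: real
  by (metis abs_mult abs_of_pos right_diff_distrib vector_minus_component)

lemma dcell_dist:
  fixes x :: "real^'d::finite"
  assumes s: "s > 0" and y: "y \<in> dcell s x"
  shows "norm (x - y) \<le> real CARD('d) / s"
proof -
  have "\<bar>(x - y) $ i\<bar> \<le> 1 / s" for i
  proof -
    have "\<lfloor>s * y $ i\<rfloor> = \<lfloor>s * x $ i\<rfloor>" using y by (simp add: dcell_def)
    then have "\<bar>s * x $ i - s * y $ i\<bar> \<le> 1" by linarith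
    then have "s * \<bar>(x - y) $ i\<bar> \<le> 1"
      by (simp only: scale_abs_diff[OF s])
    then show ?thesis using s by (simp add: field_simps)
  qed
  then have "(\<Sum>i\<in>UNIV. \<bar>(x - y) $ i\<bar>) \<le> (\<Sum>i\<in>(UNIV::'d set). 1 / s)"
    by (intro sum_mono) auto
  then show ?thesis using norm_le_l1_cart[of "x - y"] by simp
qed

text \<open>Here the width \<open>2 d\<close> of the star pays off: two points of a cell are at most
  \<open>d / s\<close> apart by \<open>dcell_dist\<close>, so a point outside the star is strictly
  more than twice as far away, as the smoothness condition of the kernel demands.\<close>

lemma not_dstar_dist:
  fixes x :: "real^'d::finite"
  assumes s: "s > 0" and y: "y \<notin> dstar s x"
  shows "norm (x - y) > 2 * real CARD('d) / s"
proof -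
  obtain i where "\<bar>\<lfloor>s * y $ i\<rfloor> - \<lfloor>s * x $ i\<rfloor>\<bar> > 2 * int CARD('d)"
    using y by (auto simp: dstar_def not_le)
  then have "\<bar>s * x $ i - s * y $ i\<bar> > 2 * real CARD('d)" by linarith
  then have "s * \<bar>(x - y) $ i\<bar> > 2 * real CARD('d)"
    by (simp only: scale_abs_diff[OF s])
  then have "2 * real CARD('d) / s < \<bar>(x - y) $ i\<bar>"
    using s by (simp add: field_simps)
  also have "\<dots> \<le> norm (x - y)" by (rule component_le_norm_cart)
  finally show ?thesis .
qed

text \<open>Points of norm below \<open>1 / s\<close> have grid indices \<open>-1\<close> or
  \<open>0\<close>, hence lie in neighbouring cells. Since the origin is a corner of every grid, no
  single cell contains a ball around it, however large the cell; a star does.\<close>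

lemma small_in_dstar:
  fixes x y :: "real^'d::finite"
  assumes "s > 0" "s * norm x < 1" "s * norm y < 1"
  shows "y \<in> dstar s x"
proof -
  have "\<lfloor>s * v $ i\<rfloor> \<in> {-1, 0}" if v: "s * norm v < 1" for v :: "real^'d" and i
  proof -
    have "\<bar>s * v $ i\<bar> \<le> s * norm v"
      using assms(1) component_le_norm_cart[of v i] by (simp add: abs_mult)
    with v have "\<bar>s * v $ i\<bar> < 1" by simp
    then show ?thesis by (simp, linarith)
  qed
  note * = this[OF assms(2)] this[OF assms(3)]
  have c: "int CARD('d) \<ge> 1" by (simp add: Suc_leI)
  have "\<bar>\<lfloor>s * y $ i\<rfloor> - \<lfloor>s * x $ i\<rfloor>\<bar> \<le> 2 * int CARD('d)" for i
    using *[of i] order_trans[OF c, of "2 * int CARD('d)"] by fastforce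
  then show ?thesis by (simp add: dstar_def)
qed

lemma eventually_in_dstar:
  fixes x y :: "real^'d::finite"
  assumes s: "s > 0"
  shows "\<exists>i. y \<in> dstar (s / 2 ^ i) x"
proof -
  obtain i where i: "s * (norm x + norm y) < 2 ^ i"
    using real_arch_pow[of 2 "s * (norm x + norm y)"] by auto
  have "0 \<le> s * norm x" "0 \<le> s * norm y" using s by simp_all
  then have "s * norm x < 2 ^ i" "s * norm y < 2 ^ i"
    using i by (simp_all add: distrib_left)
  then have "s / 2 ^ i * norm x < 1" "s / 2 ^ i * norm y < 1"
    by (simp_all add: field_simps)
  then show ?thesis using s by (intro exI small_in_dstar) auto
qed

lemma small_dcell_in_open:
  fixes x :: "real^'d::finite"
  assumes s: "s > 0" and U: "open U" "x \<in> U"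
  shows "\<exists>k. dcell (2 ^ k * s) x \<subseteq> U"
proof -
  obtain e where e: "e > 0" "ball x e \<subseteq> U" using U by (auto simp: open_contains_ball)
  obtain k where k: "real CARD('d) / (s * e) < 2 ^ k"
    using real_arch_pow[of 2 "real CARD('d) / (s * e)"] by auto
  have "real CARD('d) / (2 ^ k * s) < e"
    using k s e by (simp add: field_simps)
  then have "dcell (2 ^ k * s) x \<subseteq> ball x e"
    using dcell_dist[of "2 ^ k * s" _ x] s by (force simp: dist_norm)
  then show ?thesis using e by blast
qed

section \<open>Countability of the cells: measurability and integration cell by cell\<close>

definition cell_index :: "real \<Rightarrow> real^'d::finite \<Rightarrow> int^'d" where
  "cell_index s x = (\<chi> i. \<lfloor>s * x $ i\<rfloor>)"

lemma dcell_index: "dcell s x = {y. cell_index s y = cell_index s x}"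
  by (simp add: dcell_def cell_index_def vec_eq_iff)

lemma cell_index_measurable:
  fixes s :: real
  assumes s: "s > 0"
  shows "(cell_index s :: real^'d::finite \<Rightarrow> _) \<in> lebesgue \<rightarrow>\<^sub>M count_space UNIV"
proof -
  have "cell_index s -` {a} \<inter> space lebesgue \<in> sets lebesgue" for a :: "int^'d"
  proof (cases "\<exists>x. cell_index s x = a")
    case True
    then obtain x where "cell_index s x = a" by blast
    then have "cell_index s -` {a} \<inter> space lebesgue = dcell s x" by (auto simp: dcell_index)
    then show ?thesis using s by simp
  next
    case False
    then have "cell_index s -` {a} \<inter> space lebesgue = {}" by auto
    then show ?thesis by simp
  qed
  then show ?thesis by (subst measurable_count_space_eq_countable) auto
qed

text \<open>An adapted function factors through the countable set of indices, so it is measurable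
  into every space that contains its values.\<close>

lemma adapted_measurable:
  fixes c :: "real^'d::finite \<Rightarrow> 'b"
  assumes s: "s > 0" and c: "adapted s c" and sp: "\<And>x. c x \<in> space N"
  shows "c \<in> lebesgue \<rightarrow>\<^sub>M N"
proof -
  have eq: "c = (\<lambda>m. c (SOME x. cell_index s x = m \<or> (\<nexists>x. cell_index s x = m))) \<circ> cell_index s"
  proof
    fix x :: "real^'d"
    have "(SOME y. cell_index s y = cell_index s x \<or> (\<nexists>y. cell_index s y = cell_index s x)) \<in> dcell s x"
      unfolding dcell_index using someI[of "\<lambda>y. cell_index s y = cell_index s x \<or> (\<nexists>y. cell_index s y = cell_index s x)" x] by auto
    from adaptedD[OF c this]
    show "c x = ((\<lambda>m. c (SOME x. cell_index s x = m \<or> (\<nexists>x. cell_index s x = m))) \<circ> cell_index s) x"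
      by simp
  qed
  show ?thesis
    by (subst eq, rule measurable_comp[OF cell_index_measurable[OF s]]) (use sp in auto)
qed

lemma adapted_borel_measurable:
  "s > 0 \<Longrightarrow> adapted s c \<Longrightarrow> c \<in> borel_measurable lebesgue"
  by (rule adapted_measurable) auto

lemma adapted_sets:
  assumes "s > 0" "adapted s P" shows "{x. P x} \<in> sets lebesgue"
proof -
  have "P \<in> lebesgue \<rightarrow>\<^sub>M count_space UNIV" by (rule adapted_measurable) (use assms in auto)
  then have "{x \<in> space lebesgue. P x} \<in> sets lebesgue" by measurable
  then show ?thesis by simp
qed

lemma nn_integral_cells:
  fixes u :: "real^'d::finite \<Rightarrow> ennreal"
  assumes s: "s > 0" and [measurable]: "u \<in> borel_measurable lebesgue"
  shows "(\<integral>\<^sup>+x. u x \<partial>lebesgue) =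
    (\<Sum>n. \<integral>\<^sup>+x. u x * indicator {x. to_nat (cell_index s x) = n} x \<partial>lebesgue)"
proof -
  have A: "{x. to_nat (cell_index s x) = n} \<in> sets lebesgue" for n
    by (rule adapted_sets[OF s]) (auto simp: adapted_def dcell_index)
  have "u x = (\<Sum>n. u x * indicator {x. to_nat (cell_index s x) = n} x)" for x
    by (subst suminf_finite[of "{to_nat (cell_index s x)}"]) (auto simp: indicator_def)
  then have "(\<integral>\<^sup>+x. u x \<partial>lebesgue) =
      (\<integral>\<^sup>+x. (\<Sum>n. u x * indicator {x. to_nat (cell_index s x) = n} x) \<partial>lebesgue)"
    by simp
  also have "\<dots> = (\<Sum>n. \<integral>\<^sup>+x. u x * indicator {x. to_nat (cell_index s x) = n} x \<partial>lebesgue)"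
    using A by (intro nn_integral_suminf borel_measurable_times_ennreal borel_measurable_indicator) auto
  finally show ?thesis .
qed

text \<open>The cells are summed over the codes of their indices, and a natural number that codes no
  cell contributes the empty set.\<close>

lemma cell_index_set_cases:
  obtains "{x :: real^'d::finite. to_nat (cell_index s x) = n} = {}" |
    z where "{x. to_nat (cell_index s x) = n} = dcell s (z :: real^'d)"
proof (cases "\<exists>z :: real^'d. to_nat (cell_index s z) = n")
  case True
  then obtain z :: "real^'d" where z: "to_nat (cell_index s z) = n" by blast
  have "{x. to_nat (cell_index s x) = n} = dcell s z"
    using z by (auto simp: dcell_index)
  then show ?thesis by (rule that(2))
next
  case False
  then have "{x :: real^'d. to_nat (cell_index s x) = n} = {}" by blast
  then show ?thesis by (rule that(1))
qed

text \<open>The substitute for conditional expectation: an adapted factor is constant on cells, so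
  an inequality between cell integrals may be multiplied by it and summed. The inequality is asked
  only where the factor is nonzero, so the factor can also encode a selection of cells.\<close>

lemma adapted_nn_integral_le:
  fixes c u v :: "real^'d::finite \<Rightarrow> ennreal"
  assumes s: "s > 0" and c: "adapted s c"
    and [measurable]: "u \<in> borel_measurable lebesgue" "v \<in> borel_measurable lebesgue"
    and le: "\<And>x. c x \<noteq> 0 \<Longrightarrow> (\<integral>\<^sup>+y\<in>dcell s x. u y \<partial>lebesgue) \<le> (\<integral>\<^sup>+y\<in>dcell s x. v y \<partial>lebesgue)"
  shows "(\<integral>\<^sup>+x. c x * u x \<partial>lebesgue) \<le> (\<integral>\<^sup>+x. c x * v x \<partial>lebesgue)"
proof -
  note [measurable] = adapted_borel_measurable[OF s c]
  have "(\<integral>\<^sup>+x. c x * u x * indicator {x. to_nat (cell_index s x) = n} x \<partial>lebesgue)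
      \<le> (\<integral>\<^sup>+x. c x * v x * indicator {x. to_nat (cell_index s x) = n} x \<partial>lebesgue)" for n
  proof (rule cell_index_set_cases[of s n])
    fix z :: "real^'d" assume z: "{x. to_nat (cell_index s x) = n} = dcell s z"
    have m: "dcell s z \<in> sets lebesgue" using s by simp
    have *: "c x * w x * indicator (dcell s z) x = c z * (w x * indicator (dcell s z) x)" for x w
      using adaptedD[OF c, of x z] by (auto simp: indicator_def)
    show ?thesis
    proof (cases "c z = 0")
      case True
      then show ?thesis unfolding z * by simp
    next
      case False
      have "(\<integral>\<^sup>+x. c z * (u x * indicator (dcell s z) x) \<partial>lebesgue) =
          c z * (\<integral>\<^sup>+x. u x * indicator (dcell s z) x \<partial>lebesgue)"
        using m by (intro nn_integral_cmult) auto
      also have "\<dots> \<le> c z * (\<integral>\<^sup>+x. v x * indicator (dcell s z) x \<partial>lebesgue)"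
        by (intro mult_left_mono le False) auto
      also have "\<dots> = (\<integral>\<^sup>+x. c z * (v x * indicator (dcell s z) x) \<partial>lebesgue)"
        using m by (intro nn_integral_cmult[symmetric]) auto
      finally show ?thesis unfolding z * .
    qed
  next
    assume "{x :: real^'d. to_nat (cell_index s x) = n} = {}"
    then show ?thesis by (simp only:) simp
  qed
  then show ?thesis
    by (subst (1 2) nn_integral_cells[OF s]) (auto intro!: suminf_le)
qed

text \<open>A family of almost everywhere statements, one for each cell, yields a single one because
  there are only countably many cells.\<close>

lemma AE_cells:
  fixes P :: "real^'d::finite \<Rightarrow> real^'d \<Rightarrow> bool"
  assumes ae: "\<And>z. AE x in lebesgue. x \<in> dcell s z \<longrightarrow> P z x"
    and ad: "adapted s P"
  shows "AE x in lebesgue. P x x"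
proof -
  define R where "R m = (SOME z :: real^'d. cell_index s z = m)" for m
  have "AE x in lebesgue. \<forall>m\<in>UNIV. x \<in> dcell s (R m) \<longrightarrow> P (R m) x"
    by (subst AE_ball_countable) (auto intro: ae)
  then show ?thesis
  proof eventually_elim
    case (elim x)
    have "cell_index s (R (cell_index s x)) = cell_index s x"
      unfolding R_def by (rule someI[of _ x]) simp
    then have *: "x \<in> dcell s (R (cell_index s x))" by (simp add: dcell_index)
    with elim have "P (R (cell_index s x)) x" by blast
    with adaptedD[OF ad *] show ?case by simp
  qed
qed

section \<open>Stopping times: the maximal cells with a property\<close>

definition first_time :: "(nat \<Rightarrow> 'a \<Rightarrow> bool) \<Rightarrow> nat \<Rightarrow> 'a \<Rightarrow> bool" where
  "first_time P k x \<longleftrightarrow> P k x \<and> (\<forall>j<k. \<not> P j x)"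

lemma first_time_unique: "first_time P k x \<Longrightarrow> first_time P j x \<Longrightarrow> j = k"
  unfolding first_time_def by (metis linorder_neqE_nat)

lemma first_time_exists: "P k x \<Longrightarrow> \<exists>j\<le>k. first_time P j x"
  unfolding first_time_def
  by (induction k rule: less_induct) (meson less_imp_le order_trans order_refl)

lemma adapted_first_time:
  assumes "\<And>k. adapted (2 ^ k * s) (P k)"
  shows "adapted (2 ^ k * s) (first_time P k)"
proof -
  have "adapted (2 ^ k * s) (P j)" if "j \<le> k" for j
    using adapted_mono[OF assms that] .
  then show ?thesis unfolding adapted_def first_time_def by auto
qed

lemma suminf_first_time:
  fixes v :: ennreal
  shows "(\<Sum>k. v * indicator {x. first_time P k x} x) = v * indicator {x. \<exists>k. P k x} x"
proof (cases "\<exists>k. P k x")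
  case True
  then obtain j where j: "first_time P j x" using first_time_exists by metis
  then have "(\<Sum>k. v * indicator {x. first_time P k x} x) = (\<Sum>k\<in>{j}. v * indicator {x. first_time P k x} x)"
    by (intro suminf_finite) (auto simp: indicator_def dest: first_time_unique)
  then show ?thesis using j True by simp
next
  case False
  then have "\<not> first_time P k x" for k by (auto simp: first_time_def)
  then show ?thesis using False by simp
qed

lemma nn_integral_first_time:
  fixes v :: "real^'d::finite \<Rightarrow> ennreal"
  assumes s: "s > 0" and P: "\<And>k. adapted (2 ^ k * s) (P k)"
    and [measurable]: "v \<in> borel_measurable lebesgue"
  shows "(\<Sum>k. \<integral>\<^sup>+x. v x * indicator {x. first_time P k x} x \<partial>lebesgue) =
    (\<integral>\<^sup>+x. v x * indicator {x. \<exists>k. P k x} x \<partial>lebesgue)"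
proof -
  have "{x. first_time P k x} \<in> sets lebesgue" for k
    by (rule adapted_sets[OF _ adapted_first_time[OF P]]) (use s in auto)
  then have "(\<Sum>k. \<integral>\<^sup>+x. v x * indicator {x. first_time P k x} x \<partial>lebesgue) =
      (\<integral>\<^sup>+x. (\<Sum>k. v x * indicator {x. first_time P k x} x) \<partial>lebesgue)"
    by (intro nn_integral_suminf[symmetric] borel_measurable_times_ennreal borel_measurable_indicator) auto
  then show ?thesis by (simp only: suminf_first_time)
qed

lemma sets_ex_adapted:
  assumes s: "s > 0" and P: "\<And>k::nat. adapted (2 ^ k * s) (P k)"
  shows "{x. \<exists>k. P k x} \<in> sets lebesgue"
proof -
  have "{x. \<exists>k. P k x} = (\<Union>k. {x. P k x})" by auto
  also have "\<dots> \<in> sets lebesgue"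
    by (intro sets.countable_UN image_subsetI adapted_sets[OF _ P]) (use s in auto)
  finally show ?thesis .
qed

text \<open>The maximal cells are disjoint and fill the set where \<open>P\<close> ever holds, so an
  inequality valid on each of them holds on the whole set.\<close>

lemma first_time_integral_bound:
  fixes v :: "real^'d::finite \<Rightarrow> ennreal"
  assumes s: "s > 0" and P: "\<And>k. adapted (2 ^ k * s) (P k)"
    and [measurable]: "u \<in> borel_measurable lebesgue" "v \<in> borel_measurable lebesgue"
    and le: "\<And>k x. P k x \<Longrightarrow> (\<integral>\<^sup>+y\<in>dcell (2 ^ k * s) x. u y \<partial>lebesgue) \<le>
      (\<integral>\<^sup>+y\<in>dcell (2 ^ k * s) x. v y \<partial>lebesgue)"
  shows "(\<integral>\<^sup>+x. u x * indicator {x. \<exists>k. P k x} x \<partial>lebesgue) \<le>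
    (\<integral>\<^sup>+x. v x * indicator {x. \<exists>k. P k x} x \<partial>lebesgue)"
proof -
  have *: "(\<integral>\<^sup>+x. indicator {x. first_time P k x} x * u x \<partial>lebesgue) \<le>
      (\<integral>\<^sup>+x. indicator {x. first_time P k x} x * v x \<partial>lebesgue)" for k
  proof (rule adapted_nn_integral_le[where s = "2 ^ k * s"])
    show "adapted (2 ^ k * s) (indicator {x. first_time P k x} :: _ \<Rightarrow> ennreal)"
      using adapted_first_time[of s P k, OF P] by (simp add: adapted_def indicator_def)
  qed (use s le in \<open>auto simp: first_time_def indicator_def split: if_splits\<close>)
  show ?thesis
    unfolding nn_integral_first_time[OF s P, symmetric, OF assms(3)]
      nn_integral_first_time[OF s P, symmetric, OF assms(4)]
    using * by (intro suminf_le) (auto simp: mult.commute)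
qed

text \<open>The dyadic maximal inequality with the level absorbed into \<open>v\<close>. Maximal
  cells are disjoint, hence there is no covering constant, and the integral on the right may be
  restricted to the selected set.\<close>

lemma maximal_weak_type:
  fixes v :: "real^'d::finite \<Rightarrow> ennreal"
  assumes s: "s > 0" and P: "\<And>k. adapted (2 ^ k * s) (P k)"
    and [measurable]: "v \<in> borel_measurable lebesgue"
    and le: "\<And>k x. P k x \<Longrightarrow> emeasure lebesgue (dcell (2 ^ k * s) x) \<le>
      (\<integral>\<^sup>+y\<in>dcell (2 ^ k * s) x. v y \<partial>lebesgue)"
  shows "emeasure lebesgue {x. \<exists>k. P k x} \<le> (\<integral>\<^sup>+x. v x * indicator {x. \<exists>k. P k x} x \<partial>lebesgue)"
proof -
  have "emeasure lebesgue {x. \<exists>k. P k x} = (\<integral>\<^sup>+x. 1 * indicator {x. \<exists>k. P k x} x \<partial>lebesgue)"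
    using sets_ex_adapted[OF s P] by simp
  also have "\<dots> \<le> (\<integral>\<^sup>+x. v x * indicator {x. \<exists>k. P k x} x \<partial>lebesgue)"
    by (rule first_time_integral_bound[OF s P]) (use le s in auto)
  finally show ?thesis .
qed

section \<open>Differentiation along cells\<close>


declare emeasure_completion [simp del]

lemma sigma_finite_lebesgue: "sigma_finite_measure (lebesgue :: (real^'d::finite) measure)"
proof (rule sigma_finite_measure.intro)
  let ?A = "range (\<lambda>n::nat. ball (0 :: real^'d) (real n))"
  have un: "\<Union> ?A = space lebesgue"
  proof -
    have "\<exists>n::nat. x \<in> ball 0 (real n)" for x :: "real^'d"
      using reals_Archimedean2[of "norm x"] by simp
    then show ?thesis by auto
  qed
  have fin: "\<forall>a\<in>?A. emeasure lebesgue a \<noteq> \<infinity>"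
  proof
    fix a :: "(real^'d) set" assume "a \<in> ?A"
    then obtain n :: nat where "a = ball 0 (real n)" by blast
    then show "emeasure lebesgue a \<noteq> \<infinity>" using fmeasurableD2[OF lmeasurable_ball, of 0 "real n"] by simp
  qed
  have "countable ?A" "?A \<subseteq> sets lebesgue" by auto
  with un fin have "countable ?A \<and> ?A \<subseteq> sets lebesgue \<and> \<Union> ?A = space lebesgue \<and>
      (\<forall>a\<in>?A. emeasure lebesgue a \<noteq> \<infinity>)" by (intro conjI)
  then show "\<exists>A. countable A \<and> A \<subseteq> sets lebesgue \<and> \<Union> A = space (lebesgue :: (real^'d) measure) \<and>
      (\<forall>a\<in>A. emeasure lebesgue a \<noteq> \<infinity>)" by (rule exI)
qed

interpretation lebesgue_pair: pair_sigma_finite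
    "lebesgue :: (real^'d::finite) measure" "lebesgue :: (real^'e::finite) measure"
  by (rule pair_sigma_finite.intro; rule sigma_finite_lebesgue)

text \<open>Lebesgue differentiation along cells, in one-sided form: an open set of measure close to
  that of the part of \<open>B\<close> where \<open>u > c\<close> is a disjoint union of maximal cells, and \<open>u\<close> has average
  at most \<open>c\<close> on those that meet \<open>B\<close>.\<close>

lemma cell_differentiation:
  fixes u :: "real^'d::finite \<Rightarrow> ennreal"
  assumes s: "s > 0" and um [measurable]: "u \<in> borel_measurable lebesgue" and B: "B \<in> sets lebesgue"
    and c: "c \<ge> 0"
    and le: "\<And>x k. x \<in> B \<Longrightarrow> (\<integral>\<^sup>+y\<in>dcell (2 ^ k * s) x. u y \<partial>lebesgue) \<le>
      ennreal c * emeasure lebesgue (dcell (2 ^ k * s) x)"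
  shows "AE x in lebesgue. x \<in> B \<longrightarrow> u x \<le> ennreal c"
proof -
  define D where "D m = B \<inter> {x. ennreal (c + 1 / real (Suc m)) \<le> u x} \<inter> ball 0 (real m)" for m
  have Dl: "D m \<in> lmeasurable" for m
  proof -
    have "{x \<in> space lebesgue. ennreal (c + 1 / real (Suc m)) \<le> u x} \<in> sets lebesgue" by measurable
    then have "B \<inter> {x. ennreal (c + 1 / real (Suc m)) \<le> u x} \<in> sets lebesgue"
      using B by simp
    then show ?thesis unfolding D_def by (simp add: fmeasurable_Int_fmeasurable Int_commute)
  qed
  have D0: "measure lebesgue (D m) = 0" for m
  proof -
    let ?e = "1 / real (Suc m)"
    \<comment> \<open>On the one side \<open>u\<close> is at least \<open>c + ?e\<close> on
      \<open>D m\<close>; on the other, its average is at most \<open>c\<close> on cells that cover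
      \<open>D m\<close> inside an open set of measure at most that of \<open>D m\<close> plus
      \<open>h\<close>.\<close>
    have key: "(c + ?e) * measure lebesgue (D m) \<le> c * (measure lebesgue (D m) + h)" if h: "h > 0" for h
    proof -
      obtain U where U: "open U" "D m \<subseteq> U" "U - D m \<in> lmeasurable" "emeasure lebesgue (U - D m) < ennreal h"
        using sets_lebesgue_outer_open[OF fmeasurableD[OF Dl[of m]] h] by metis
      have Ul: "emeasure lebesgue U \<le> ennreal (measure lebesgue (D m) + h)"
      proof -
        have "emeasure lebesgue U = emeasure lebesgue (D m \<union> (U - D m))"
          using U(2) by (intro arg_cong[where f = "emeasure lebesgue"]) auto
        also have "\<dots> \<le> emeasure lebesgue (D m) + emeasure lebesgue (U - D m)"
          using Dl[of m] U(3) by (intro emeasure_subadditive) auto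
        also have "\<dots> \<le> ennreal (measure lebesgue (D m)) + ennreal h"
          using Dl[of m] U(4) by (intro add_mono) (auto simp: emeasure_eq_measure2)
        finally show ?thesis using h by (simp add: ennreal_plus)
      qed
      define P where "P k x \<longleftrightarrow> dcell (2 ^ k * s) x \<subseteq> U" for k :: nat and x
      \<comment> \<open>Only maximal cells that meet \<open>D m\<close> are kept: such a cell is the
        cell of a point of \<open>B\<close>, where the hypothesis on averages is available.\<close>
      define Q where "Q k x \<longleftrightarrow> first_time P k x \<and> dcell (2 ^ k * s) x \<inter> D m \<noteq> {}" for k x
      have Pa: "adapted (2 ^ k * s) (P k)" for k
        unfolding P_def by (rule adapted_dcell)
      have Qa: "adapted (2 ^ k * s) (Q k)" for k
        unfolding Q_def by (rule adapted_comp2[OF adapted_first_time[OF Pa] adapted_dcell])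
      have DQ: "D m \<subseteq> {x. \<exists>k. Q k x}"
      proof
        fix x assume x: "x \<in> D m"
        then obtain k where "P k x"
          using small_dcell_in_open[OF s U(1), of x] U(2) by (auto simp: P_def)
        then obtain j where "first_time P j x" using first_time_exists by metis
        then have "Q j x" using x dcell_self[of x "2 ^ j * s"] unfolding Q_def by blast
        then show "x \<in> {x. \<exists>k. Q k x}" by blast
      qed
      have QU: "{x. \<exists>k. Q k x} \<subseteq> U"
        using dcell_self unfolding Q_def first_time_def P_def by blast
      have "ennreal (c + ?e) * emeasure lebesgue (D m) = (\<integral>\<^sup>+x. ennreal (c + ?e) * indicator (D m) x \<partial>lebesgue)"
        using Dl[of m] by (intro nn_integral_cmult_indicator[symmetric]) auto
      also have "\<dots> \<le> (\<integral>\<^sup>+x. u x * indicator {x. \<exists>k. Q k x} x \<partial>lebesgue)"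
        using DQ by (intro nn_integral_mono) (auto simp: D_def indicator_def)
      also have "\<dots> \<le> (\<integral>\<^sup>+x. ennreal c * indicator {x. \<exists>k. Q k x} x \<partial>lebesgue)"
      proof (rule first_time_integral_bound[OF s Qa])
        fix k x assume "Q k x"
        then obtain z where z: "z \<in> dcell (2 ^ k * s) x" "z \<in> D m" by (auto simp: Q_def)
        have eq: "dcell (2 ^ k * s) z = dcell (2 ^ k * s) x" by (rule dcell_eq[OF z(1)])
        show "(\<integral>\<^sup>+y\<in>dcell (2 ^ k * s) x. u y \<partial>lebesgue) \<le> (\<integral>\<^sup>+y\<in>dcell (2 ^ k * s) x. ennreal c \<partial>lebesgue)"
          using le[of z k] z(2) s unfolding eq by (simp add: D_def nn_integral_cmult_indicator)
      qed auto
      also have "\<dots> = ennreal c * emeasure lebesgue {x. \<exists>k. Q k x}"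
        using sets_ex_adapted[OF s Qa] by (intro nn_integral_cmult_indicator) auto
      also have "\<dots> \<le> ennreal c * emeasure lebesgue U"
        using U(1) by (intro mult_left_mono emeasure_mono QU) auto
      also have "\<dots> \<le> ennreal c * ennreal (measure lebesgue (D m) + h)"
        by (intro mult_left_mono Ul) auto
      finally have "ennreal ((c + ?e) * measure lebesgue (D m)) \<le> ennreal (c * (measure lebesgue (D m) + h))"
        using c h by (subst (1 2) ennreal_mult) (auto simp del: ennreal_plus simp: emeasure_eq_measure2[OF Dl])
      then show ?thesis
        by (rule iffD1[OF ennreal_le_iff, rotated]) (use c h in simp)
    qed
    have "?e * measure lebesgue (D m) \<le> 0 + h" if h: "h > 0" for h
    proof -
      \<comment> \<open>Dividing by \<open>c + 1\<close> makes the error at most \<open>h\<close>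
        after multiplication by \<open>c\<close>, including the case \<open>c = 0\<close>.\<close>
      have "?e * measure lebesgue (D m) \<le> c * (h / (c + 1))"
        using key[of "h / (c + 1)"] h c by (simp add: algebra_simps)
      also have "\<dots> \<le> h" using c h by (simp add: field_simps)
      finally show ?thesis by simp
    qed
    then have "?e * measure lebesgue (D m) \<le> 0" by (rule field_le_epsilon)
    then show ?thesis using measure_nonneg[of lebesgue "D m"] by (simp add: field_simps)
  qed
  have "AE x in lebesgue. \<forall>m. x \<notin> D m"
    unfolding AE_all_countable
  proof
    fix m
    have "D m \<in> null_sets lebesgue"
      using D0[of m] Dl[of m] by (auto simp: null_sets_def emeasure_eq_measure2)
    then show "AE x in lebesgue. x \<notin> D m" by (rule AE_not_in)
  qed
  then show ?thesis
  proof eventually_elim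
    case (elim x)
    show ?case
    proof (rule impI, rule ccontr)
      assume x: "x \<in> B" and "\<not> u x \<le> ennreal c"
      then have lt: "ennreal c < u x" by simp
      then obtain q where q: "ennreal c < q" "q < u x" using dense by blast
      then obtain r where r: "q = ennreal r" "r \<ge> 0" by (cases q) auto
      have "c < r" using q r c by (simp add: ennreal_less_iff)
      then obtain m1 where m1: "inverse (real (Suc m1)) < r - c"
        using reals_Archimedean[of "r - c"] by auto
      obtain m2 where m2: "norm x < real m2" using reals_Archimedean2 by blast
      let ?m = "max m1 m2"
      have "1 / real (Suc ?m) \<le> inverse (real (Suc m1))"
        by (simp add: divide_simps)
      then have "c + 1 / real (Suc ?m) \<le> r" using m1 by linarith
      then have "ennreal (c + 1 / real (Suc ?m)) \<le> u x"
        using q r by (metis ennreal_leI less_imp_le order_trans)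
      then have "x \<in> D ?m" using x m2 by (auto simp: D_def)
      then show False using elim by blast
    qed
  qed
qed

section \<open>Fubini over stars and maximal inequalities for stars\<close>

lemma star_indicator_measurable:
  fixes s :: real
  assumes s: "s > 0"
  shows "(\<lambda>(x, y). indicator (dstar s x) y :: ennreal) \<in>
    borel_measurable (lebesgue \<Otimes>\<^sub>M (lebesgue :: (real^'d::finite) measure))"
proof -
  note [measurable] = cell_index_measurable[OF s, where 'd='d]
  have eq: "(\<lambda>(x :: real^'d, y). indicator (dstar s x) y :: ennreal) =
      (\<lambda>p. (\<lambda>m p. (\<lambda>k. if \<forall>i. \<bar>k $ i - m $ i\<bar> \<le> 2 * int CARD('d) then 1 else 0) (cell_index s (snd p)))
        (cell_index s (fst p)) p)"
    by (auto simp: fun_eq_iff dstar_def cell_index_def indicator_def)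
  have fst: "(\<lambda>p. cell_index s (fst p)) \<in> lebesgue \<Otimes>\<^sub>M (lebesgue :: (real^'d) measure) \<rightarrow>\<^sub>M count_space UNIV"
    by (rule measurable_compose[OF measurable_fst cell_index_measurable[OF s]])
  have snd: "(\<lambda>p. cell_index s (snd p)) \<in> (lebesgue :: (real^'d) measure) \<Otimes>\<^sub>M lebesgue \<rightarrow>\<^sub>M count_space UNIV"
    by (rule measurable_compose[OF measurable_snd cell_index_measurable[OF s]])
  show ?thesis unfolding eq
    by (rule measurable_compose_countable[OF _ fst], rule measurable_compose[OF snd]) simp
qed

text \<open>The star relation is symmetric, so each \<open>y\<close> is counted on a set of
  \<open>x\<close> that is itself one star.\<close>

lemma star_fubini:
  fixes v :: "real^'d::finite \<Rightarrow> ennreal"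
  assumes s: "s > 0" and [measurable]: "v \<in> borel_measurable lebesgue"
  shows "(\<integral>\<^sup>+x. (\<integral>\<^sup>+y\<in>dstar s x. v y \<partial>lebesgue) \<partial>lebesgue) =
    ennreal (kappa TYPE('d) / s ^ CARD('d)) * (\<integral>\<^sup>+y. v y \<partial>lebesgue)"
proof -
  note [measurable] = star_indicator_measurable[OF s, where 'd='d]
  have "(\<integral>\<^sup>+x. (\<integral>\<^sup>+y\<in>dstar s x. v y \<partial>lebesgue) \<partial>lebesgue) =
      (\<integral>\<^sup>+y. (\<integral>\<^sup>+x. v y * indicator (dstar s x) y \<partial>lebesgue) \<partial>lebesgue)"
  proof (rule lebesgue_pair.Fubini'[symmetric])
    have "(\<lambda>p. v (snd p) * (\<lambda>(x, y). indicator (dstar s x) y) p)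
        \<in> borel_measurable (lebesgue \<Otimes>\<^sub>M lebesgue)"
      by (intro borel_measurable_times_ennreal star_indicator_measurable[OF s]) measurable
    then show "(\<lambda>(x, y). v y * indicator (dstar s x) y) \<in> borel_measurable (lebesgue \<Otimes>\<^sub>M lebesgue)"
      by (simp add: case_prod_beta')
  qed
  also have "\<dots> = (\<integral>\<^sup>+y. ennreal (kappa TYPE('d) / s ^ CARD('d)) * v y \<partial>lebesgue)"
  proof (rule nn_integral_cong)
    fix y :: "real^'d"
    have "(\<integral>\<^sup>+x. v y * indicator (dstar s x) y \<partial>lebesgue) = (\<integral>\<^sup>+x. v y * indicator (dstar s y) x \<partial>lebesgue)"
      by (intro nn_integral_cong) (auto simp: indicator_def dstar_sym)
    also have "\<dots> = v y * emeasure lebesgue (dstar s y)"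
      by (intro nn_integral_cmult_indicator dstar_sets s)
    finally show "(\<integral>\<^sup>+x. v y * indicator (dstar s x) y \<partial>lebesgue) = ennreal (kappa TYPE('d) / s ^ CARD('d)) * v y"
      by (simp add: emeasure_dstar[OF s] mult.commute)
  qed
  also have "\<dots> = ennreal (kappa TYPE('d) / s ^ CARD('d)) * (\<integral>\<^sup>+y. v y \<partial>lebesgue)"
    by (intro nn_integral_cmult) measurable
  finally show ?thesis .
qed

text \<open>A star that meets \<open>A\<close> contains a whole cell of \<open>A\<close>, so
  \<open>s ^ d\<close> times the measure of \<open>A\<close> inside the star of \<open>x\<close> is
  at least one on the enlarged set. Integrating with \<open>star_fubini\<close> leaves the factor
  \<open>kappa\<close>.\<close>

lemma emeasure_star_enlargement:
  fixes A :: "real^'d::finite \<Rightarrow> bool"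
  assumes s: "s > 0" and A: "adapted s A"
  shows "emeasure lebesgue {x. \<exists>z\<in>dstar s x. A z} \<le> ennreal (kappa TYPE('d)) * emeasure lebesgue {z. A z}"
    and "{x. \<exists>z\<in>dstar s x. A z} \<in> sets lebesgue"
proof -
  have "adapted s (\<lambda>x. \<exists>z\<in>dstar s x. A z)" by (rule adapted_dstar)
  then show m: "{x. \<exists>z\<in>dstar s x. A z} \<in> sets lebesgue" by (rule adapted_sets[OF s])
  have Am [measurable]: "{z. A z} \<in> sets lebesgue" by (rule adapted_sets[OF s A])
  have sp: "s ^ CARD('d) > 0" using s by simp
  have ind: "indicator {x. \<exists>z\<in>dstar s x. A z} x \<le>
      ennreal (s ^ CARD('d)) * (\<integral>\<^sup>+y\<in>dstar s x. indicator {z. A z} y \<partial>lebesgue)" for x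
  proof (cases "\<exists>z\<in>dstar s x. A z")
    case True
    then obtain z where z: "z \<in> dstar s x" "A z" by blast
    have "1 = ennreal (s ^ CARD('d)) * emeasure lebesgue (dcell s z)"
      using s sp by (simp add: emeasure_dcell[OF s] ennreal_mult[symmetric])
    also have "emeasure lebesgue (dcell s z) = (\<integral>\<^sup>+y. indicator (dcell s z) y \<partial>lebesgue)"
      using s by simp
    also have "\<dots> \<le> (\<integral>\<^sup>+y\<in>dstar s x. indicator {z. A z} y \<partial>lebesgue)"
      using dcell_in_dstar[OF z(1)] adaptedD[OF A] z(2)
      by (intro nn_integral_mono) (auto simp: indicator_def)
    finally show ?thesis using True by (simp add: mult_left_mono)
  qed simp
  have "emeasure lebesgue {x. \<exists>z\<in>dstar s x. A z} = (\<integral>\<^sup>+x. indicator {x. \<exists>z\<in>dstar s x. A z} x \<partial>lebesgue)"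
    using m by simp
  also have "\<dots> \<le> (\<integral>\<^sup>+x. ennreal (s ^ CARD('d)) * (\<integral>\<^sup>+y\<in>dstar s x. indicator {z. A z} y \<partial>lebesgue) \<partial>lebesgue)"
    by (intro nn_integral_mono ind)
  also have "\<dots> = ennreal (s ^ CARD('d)) * (\<integral>\<^sup>+x. (\<integral>\<^sup>+y\<in>dstar s x. indicator {z. A z} y \<partial>lebesgue) \<partial>lebesgue)"
    by (intro nn_integral_cmult adapted_borel_measurable[OF s] adapted_dstar)
  also have "\<dots> = ennreal (s ^ CARD('d)) * (ennreal (kappa TYPE('d) / s ^ CARD('d)) * emeasure lebesgue {z. A z})"
    by (subst star_fubini[OF s]) auto
  also have "\<dots> = ennreal (kappa TYPE('d)) * emeasure lebesgue {z. A z}"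
    using s by (simp add: mult.assoc[symmetric] ennreal_mult[symmetric] less_imp_le[OF kappa_pos])
  finally show "emeasure lebesgue {x. \<exists>z\<in>dstar s x. A z} \<le> ennreal (kappa TYPE('d)) * emeasure lebesgue {z. A z}" .
qed

text \<open>The enlargements of different times may overlap, but the first-time sets are disjoint,
  so summing over the times loses nothing beyond the \<open>kappa\<close> of a single
  enlargement.\<close>

lemma emeasure_first_time_enlargement:
  fixes P :: "nat \<Rightarrow> real^'d::finite \<Rightarrow> bool"
  assumes s: "s > 0" and P: "\<And>k. adapted (2 ^ k * s) (P k)"
  shows "emeasure lebesgue {x. \<exists>k. \<exists>z\<in>dstar (2 ^ k * s) x. first_time P k z} \<le>
      ennreal (kappa TYPE('d)) * emeasure lebesgue {x. \<exists>k. P k x}"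
    and "{x. \<exists>k. \<exists>z\<in>dstar (2 ^ k * s) x. first_time P k z} \<in> sets lebesgue"
proof -
  let ?A = "\<lambda>k. {x. \<exists>z\<in>dstar (2 ^ k * s) x. first_time P k z}"
  have sk: "2 ^ k * s > 0" for k using s by simp
  note est = emeasure_star_enlargement[OF sk adapted_first_time[OF P]]
  have eq: "{x. \<exists>k. \<exists>z\<in>dstar (2 ^ k * s) x. first_time P k z} = (\<Union>k. ?A k)" by auto
  show "{x. \<exists>k. \<exists>z\<in>dstar (2 ^ k * s) x. first_time P k z} \<in> sets lebesgue"
    unfolding eq using est(2) by blast
  have "emeasure lebesgue (\<Union>k. ?A k) \<le> (\<Sum>k. emeasure lebesgue (?A k))"
    using est(2) by (intro emeasure_subadditive_countably) auto
  also have "\<dots> \<le> (\<Sum>k. ennreal (kappa TYPE('d)) * emeasure lebesgue {z. first_time P k z})"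
    by (intro suminf_le est(1)) auto
  also have "\<dots> = ennreal (kappa TYPE('d)) * (\<Sum>k. emeasure lebesgue {z. first_time P k z})"
    by (rule ennreal_suminf_cmult)
  also have "(\<Sum>k. emeasure lebesgue {z. first_time P k z}) =
      (\<Sum>k. \<integral>\<^sup>+x. 1 * indicator {x. first_time P k x} x \<partial>lebesgue)"
    by (simp add: adapted_sets[OF sk adapted_first_time[OF P]])
  also have "\<dots> = emeasure lebesgue {x. \<exists>k. P k x}"
    by (subst nn_integral_first_time[OF s P]) (auto simp: sets_ex_adapted[OF s P])
  finally show "emeasure lebesgue {x. \<exists>k. \<exists>z\<in>dstar (2 ^ k * s) x. first_time P k z} \<le>
      ennreal (kappa TYPE('d)) * emeasure lebesgue {x. \<exists>k. P k x}"
    unfolding eq .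
qed

lemma star_integral_le_cells:
  fixes v :: "real^'d::finite \<Rightarrow> ennreal"
  assumes s: "s > 0" and [measurable]: "v \<in> borel_measurable lebesgue" and t: "t \<ge> 0"
    and le: "\<And>z. z \<in> dstar s x \<Longrightarrow> (\<integral>\<^sup>+y\<in>dcell s z. v y \<partial>lebesgue) \<le> ennreal t * emeasure lebesgue (dcell s x)"
  shows "(\<integral>\<^sup>+y\<in>dstar s x. v y \<partial>lebesgue) \<le> ennreal (kappa TYPE('d) * t) * emeasure lebesgue (dcell s x)"
proof -
  have "(\<integral>\<^sup>+y. indicator (dstar s x) y * v y \<partial>lebesgue) \<le> (\<integral>\<^sup>+y. indicator (dstar s x) y * ennreal t \<partial>lebesgue)"
  proof (rule adapted_nn_integral_le[OF s])
    show "adapted s (indicator (dstar s x) :: _ \<Rightarrow> ennreal)"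
      using dstar_eq_dcell_in[of _ s] by (auto simp: adapted_def indicator_def)
    fix z assume "indicator (dstar s x) z \<noteq> (0 :: ennreal)"
    then have z: "z \<in> dstar s x" by (auto simp: indicator_def split: if_splits)
    show "(\<integral>\<^sup>+y\<in>dcell s z. v y \<partial>lebesgue) \<le> (\<integral>\<^sup>+y\<in>dcell s z. ennreal t \<partial>lebesgue)"
      using le[OF z] s by (simp add: nn_integral_cmult_indicator emeasure_dcell)
  qed auto
  also have "\<dots> = ennreal t * emeasure lebesgue (dstar s x)"
    using s by (simp add: nn_integral_cmult_indicator mult.commute)
  also have "\<dots> = ennreal (kappa TYPE('d) * t) * emeasure lebesgue (dcell s x)"
    using s t by (simp add: emeasure_dstar emeasure_dcell ennreal_mult[symmetric] less_imp_le[OF kappa_pos])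
  finally show ?thesis by (simp add: mult.commute)
qed

text \<open>One factor \<open>kappa\<close> is lost because a star with large integral only
  guarantees one of its \<open>kappa\<close> cells with integral above the level
  \<open>t / kappa\<close>; the other because \<open>x\<close> lies in the star of that cell, not in
  the cell.\<close>

lemma maximal_star_weak_type:
  fixes v :: "real^'d::finite \<Rightarrow> ennreal"
  assumes s: "s > 0" and [measurable]: "v \<in> borel_measurable lebesgue" and t: "t > 0"
  defines "M \<equiv> {x. \<exists>k::nat. ennreal t * emeasure lebesgue (dcell (2 ^ k * s) x) < (\<integral>\<^sup>+y\<in>dstar (2 ^ k * s) x. v y \<partial>lebesgue)}"
  shows "emeasure lebesgue M \<le> ennreal ((kappa TYPE('d))\<^sup>2 / t) * (\<integral>\<^sup>+y. v y \<partial>lebesgue)"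
    and "M \<in> sets lebesgue"
proof -
  let ?k = "kappa TYPE('d)"
  have sk: "2 ^ k * s > 0" for k :: nat using s by simp
  have "adapted (2 ^ k * s) (\<lambda>x. ennreal t * emeasure lebesgue (dcell (2 ^ k * s) x) < (\<integral>\<^sup>+y\<in>dstar (2 ^ k * s) x. v y \<partial>lebesgue))" for k
    by (intro adapted_comp2[of _ "\<lambda>x. emeasure lebesgue (dcell (2 ^ k * s) x)"
        "\<lambda>x. (\<integral>\<^sup>+y\<in>dstar (2 ^ k * s) x. v y \<partial>lebesgue)" "\<lambda>a b. ennreal t * a < b"] adapted_dcell adapted_dstar)
  from sets_ex_adapted[OF s this] show "M \<in> sets lebesgue" by (simp add: M_def)
  define P where "P k x \<longleftrightarrow> ennreal (t / ?k) * emeasure lebesgue (dcell (2 ^ k * s) x) < (\<integral>\<^sup>+y\<in>dcell (2 ^ k * s) x. v y \<partial>lebesgue)"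
    for k :: nat and x
  have Pa: "adapted (2 ^ k * s) (P k)" for k unfolding P_def by (rule adapted_dcell)
  have sub: "M \<subseteq> {x. \<exists>k. \<exists>z\<in>dstar (2 ^ k * s) x. first_time P k z}"
  proof
    fix x assume "x \<in> M"
    then obtain k :: nat where k: "ennreal t * emeasure lebesgue (dcell (2 ^ k * s) x) < (\<integral>\<^sup>+y\<in>dstar (2 ^ k * s) x. v y \<partial>lebesgue)"
      by (auto simp: M_def)
    have "\<exists>z\<in>dstar (2 ^ k * s) x. P k z"
    proof (rule ccontr)
      assume neg: "\<not> ?thesis"
      have "(\<integral>\<^sup>+y\<in>dstar (2 ^ k * s) x. v y \<partial>lebesgue) \<le> ennreal (?k * (t / ?k)) * emeasure lebesgue (dcell (2 ^ k * s) x)"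
        using neg t by (intro star_integral_le_cells[OF sk]) (auto simp: P_def emeasure_dcell[OF sk] not_less less_imp_le)
      then show False using k by (simp add: less_imp_neq[OF kappa_pos, symmetric])
    qed
    then obtain z where z: "z \<in> dstar (2 ^ k * s) x" "P k z" by blast
    from first_time_exists[where P = P, OF z(2)] obtain j where j: "j \<le> k" "first_time P j z" by blast
    \<comment> \<open>Passing to an earlier maximal cell only makes the star larger.\<close>
    have "z \<in> dstar (2 ^ j * s) x" using dstar_mono[OF j(1)] z(1) by blast
    with j show "x \<in> {x. \<exists>k. \<exists>z\<in>dstar (2 ^ k * s) x. first_time P k z}" by blast
  qed
  have tk: "t / ?k > 0" using t by simp
  have "emeasure lebesgue M \<le> emeasure lebesgue {x. \<exists>k. \<exists>z\<in>dstar (2 ^ k * s) x. first_time P k z}"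
    by (rule emeasure_mono[OF sub emeasure_first_time_enlargement(2)[OF s Pa]])
  also have "\<dots> \<le> ennreal ?k * emeasure lebesgue {x. \<exists>k. P k x}"
    by (rule emeasure_first_time_enlargement(1)[OF s Pa])
  also have "emeasure lebesgue {x. \<exists>k. P k x} \<le> (\<integral>\<^sup>+x. ennreal (?k / t) * v x * indicator {x. \<exists>k. P k x} x \<partial>lebesgue)"
  proof (rule maximal_weak_type[OF s Pa])
    fix k x assume P: "P k x"
    have "emeasure lebesgue (dcell (2 ^ k * s) x) = ennreal (?k / t) * (ennreal (t / ?k) * emeasure lebesgue (dcell (2 ^ k * s) x))"
      using t by (simp add: mult.assoc[symmetric] ennreal_mult[symmetric] less_imp_le less_imp_neq[OF kappa_pos, symmetric])
    also have "\<dots> \<le> ennreal (?k / t) * (\<integral>\<^sup>+y\<in>dcell (2 ^ k * s) x. v y \<partial>lebesgue)"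
      using P by (intro mult_left_mono) (auto simp: P_def)
    also have "\<dots> = (\<integral>\<^sup>+y\<in>dcell (2 ^ k * s) x. ennreal (?k / t) * v y \<partial>lebesgue)"
      using sk by (subst nn_integral_cmult[symmetric]) (auto simp: mult.assoc)
    finally show "emeasure lebesgue (dcell (2 ^ k * s) x) \<le> (\<integral>\<^sup>+y\<in>dcell (2 ^ k * s) x. ennreal (?k / t) * v y \<partial>lebesgue)" .
  qed measurable
  also have "\<dots> \<le> (\<integral>\<^sup>+x. ennreal (?k / t) * v x \<partial>lebesgue)"
    by (intro nn_integral_mono) (auto simp: indicator_def)
  also have "\<dots> = ennreal (?k / t) * (\<integral>\<^sup>+x. v x \<partial>lebesgue)"
    by (intro nn_integral_cmult) measurable
  finally show "emeasure lebesgue M \<le> ennreal (?k\<^sup>2 / t) * (\<integral>\<^sup>+y. v y \<partial>lebesgue)"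
    using t by (simp add: mult_left_mono mult.assoc[symmetric] ennreal_mult[symmetric] less_imp_le power2_eq_square)
qed

section \<open>Kernel estimates\<close>

lemma ennreal_term_le_suminf: "f n \<le> (\<Sum>l. f l)" for f :: "nat \<Rightarrow> ennreal"
  using sum_le_suminf[OF summableI, of "{n}" f] by simp

text \<open>Bounded functions of bounded support, with one number serving for size and radius. They
  are integrable and square integrable and stable under cutoffs and linear combinations, so both the
  L2 theory and the weak type bound of \<open>T\<close> apply to them.\<close>

definition nice :: "(real^'d::finite \<Rightarrow> complex) \<Rightarrow> bool" where
  "nice h \<longleftrightarrow> h \<in> borel_measurable lebesgue \<and> (\<exists>M. \<forall>x. norm (h x) \<le> M \<and> (norm x > M \<longrightarrow> h x = 0))"

lemma nice_measurable: "nice h \<Longrightarrow> h \<in> borel_measurable lebesgue"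
  by (simp add: nice_def)

lemma nice_integrable_gen:
  fixes h :: "real^'d::finite \<Rightarrow> complex"
  assumes h: "nice h" shows "integrable lebesgue (\<lambda>x. norm (h x) ^ Suc p)"
proof -
  obtain M where M: "\<And>x. norm (h x) \<le> M" "\<And>x. norm x > M \<Longrightarrow> h x = 0"
    using h by (auto simp: nice_def)
  have [measurable]: "h \<in> borel_measurable lebesgue" by (rule nice_measurable[OF h])
  have "integrable lebesgue (\<lambda>x. M ^ Suc p * indicator (cball (0::real^'d) M) x :: real)"
    using lmeasurable_cball by (intro integrable_mult_right integrable_real_indicator)
      (auto simp: fmeasurable_def)
  then show ?thesis
  proof (rule Bochner_Integration.integrable_bound)
    show "AE x in lebesgue. norm (norm (h x) ^ Suc p) \<le> norm (M ^ Suc p * indicator (cball 0 M) x)"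
    proof (intro AE_I2)
      fix x
      have "norm (h x) ^ Suc p \<le> M ^ Suc p" by (intro power_mono M) auto
      moreover have "0 \<le> M" using order_trans[OF norm_ge_zero M(1)] .
      ultimately show "norm (norm (h x) ^ Suc p) \<le> norm (M ^ Suc p * indicator (cball 0 M) x)"
        using M(2)[of x] by (auto simp: indicator_def abs_mult)
    qed
  qed measurable
qed

lemma nice_L2: "nice h \<Longrightarrow> L2_function h"
  using nice_integrable_gen[of h 1] by (simp add: L2_function_def nice_measurable numeral_2_eq_2)

lemma nice_integrable: "nice h \<Longrightarrow> integrable lebesgue h"
  using nice_integrable_gen[of h 0] integrable_norm_iff[OF nice_measurable] by auto

lemma nice_bound:
  assumes h: "nice h" and m: "g \<in> borel_measurable lebesgue" and le: "\<And>x. norm (g x) \<le> C * norm (h x)"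
  shows "nice g"
proof -
  obtain M where M: "\<And>x. norm (h x) \<le> M" "\<And>x. norm x > M \<Longrightarrow> h x = 0"
    using h by (auto simp: nice_def)
  have "norm (g x) \<le> max M (\<bar>C\<bar> * \<bar>M\<bar>) \<and> (norm x > max M (\<bar>C\<bar> * \<bar>M\<bar>) \<longrightarrow> g x = 0)" for x
  proof
    have "norm (g x) \<le> \<bar>C\<bar> * norm (h x)"
      using le[of x] mult_right_mono[OF abs_ge_self norm_ge_zero] by (rule order_trans)
    also have "\<dots> \<le> \<bar>C\<bar> * \<bar>M\<bar>" using M(1)[of x] by (intro mult_left_mono) auto
    finally show "norm (g x) \<le> max M (\<bar>C\<bar> * \<bar>M\<bar>)" by simp
    show "norm x > max M (\<bar>C\<bar> * \<bar>M\<bar>) \<longrightarrow> g x = 0" using le[of x] M(2)[of x] by auto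
  qed
  then show ?thesis using m unfolding nice_def by blast
qed

lemma nice_indicator: "nice h \<Longrightarrow> S \<in> sets lebesgue \<Longrightarrow> nice (\<lambda>y. h y * indicator S y)"
  by (rule nice_bound[where C = 1], assumption)
    (auto simp: nice_measurable indicator_def intro!: borel_measurable_times borel_measurable_indicator)

lemma nice_add:
  assumes "nice h" "nice g" shows "nice (\<lambda>y. a * h y + b * g y)"
proof -
  obtain M where M: "\<And>x. norm (h x) \<le> M" "\<And>x. norm x > M \<Longrightarrow> h x = 0"
    using assms(1) by (auto simp: nice_def)
  obtain L where L: "\<And>x. norm (g x) \<le> L" "\<And>x. norm x > L \<Longrightarrow> g x = 0"
    using assms(2) by (auto simp: nice_def)
  have [measurable]: "h \<in> borel_measurable lebesgue" "g \<in> borel_measurable lebesgue"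
    using assms by (auto simp: nice_def)
  let ?C = "max (max M L) (norm a * M + norm b * L)"
  have "norm (a * h x + b * g x) \<le> ?C \<and> (norm x > ?C \<longrightarrow> a * h x + b * g x = 0)" for x
  proof
    have "norm (a * h x + b * g x) \<le> norm a * M + norm b * L"
      by (intro norm_triangle_le add_mono) (auto simp: norm_mult intro!: mult_left_mono M L)
    then show "norm (a * h x + b * g x) \<le> ?C" by simp
    show "norm x > ?C \<longrightarrow> a * h x + b * g x = 0" using M(2)[of x] L(2)[of x] by auto
  qed
  moreover have "(\<lambda>y. a * h y + b * g y) \<in> borel_measurable lebesgue" by measurable
  ultimately show ?thesis unfolding nice_def by blast
qed

lemma nice_zero: "nice (\<lambda>y. 0)"
  by (auto simp: nice_def intro!: exI[of _ 0])

lemma nice_sum: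
  assumes "finite I" "\<And>i. i \<in> I \<Longrightarrow> nice (h i)" shows "nice (\<lambda>y. \<Sum>i\<in>I. a i * h i y)"
  using assms
proof (induction rule: finite_induct)
  case empty
  show ?case using nice_zero by simp
next
  case (insert i I)
  then show ?case using nice_add[of "h i" "\<lambda>y. \<Sum>i\<in>I. a i * h i y" "a i" 1] by simp
qed

lemma L2_add:
  assumes f: "L2_function f" and g: "L2_function g"
  shows "L2_function (\<lambda>y. a * f y + b * g y)"
proof -
  have [measurable]: "f \<in> borel_measurable lebesgue" "g \<in> borel_measurable lebesgue"
    using f g by (auto simp: L2_function_def)
  have "integrable lebesgue (\<lambda>x. 2 * (norm a)\<^sup>2 * (norm (f x))\<^sup>2 + 2 * (norm b)\<^sup>2 * (norm (g x))\<^sup>2)"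
    using f g by (auto simp: L2_function_def)
  then have "integrable lebesgue (\<lambda>x. (norm (a * f x + b * g x))\<^sup>2)"
  proof (rule Bochner_Integration.integrable_bound)
    show "AE x in lebesgue. norm ((norm (a * f x + b * g x))\<^sup>2)
       \<le> norm (2 * (norm a)\<^sup>2 * (norm (f x))\<^sup>2 + 2 * (norm b)\<^sup>2 * (norm (g x))\<^sup>2)"
    proof (intro AE_I2)
      fix x
      have "(norm (a * f x + b * g x))\<^sup>2 \<le> (norm a * norm (f x) + norm b * norm (g x))\<^sup>2"
        by (intro power_mono norm_triangle_le) (auto simp: norm_mult)
      also have "\<dots> \<le> 2 * (norm a * norm (f x))\<^sup>2 + 2 * (norm b * norm (g x))\<^sup>2"
        using sum_squares_bound[of "norm a * norm (f x)" "norm b * norm (g x)"]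
        by (simp add: power2_sum)
      also have "\<dots> = 2 * (norm a)\<^sup>2 * (norm (f x))\<^sup>2 + 2 * (norm b)\<^sup>2 * (norm (g x))\<^sup>2"
        by (simp add: power_mult_distrib mult_ac)
      finally show "norm ((norm (a * f x + b * g x))\<^sup>2)
       \<le> norm (2 * (norm a)\<^sup>2 * (norm (f x))\<^sup>2 + 2 * (norm b)\<^sup>2 * (norm (g x))\<^sup>2)" by simp
    qed
  qed measurable
  then show ?thesis by (simp add: L2_function_def)
qed

lemma L2_bound:
  assumes f: "L2_function f" and m: "g \<in> borel_measurable lebesgue" and le: "\<And>x. norm (g x) \<le> norm (f x)"
  shows "L2_function g"
proof -
  have "integrable lebesgue (\<lambda>x. (norm (f x))\<^sup>2)" using f by (simp add: L2_function_def)
  then have "integrable lebesgue (\<lambda>x. (norm (g x))\<^sup>2)"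
    by (rule Bochner_Integration.integrable_bound)
      (use m le in \<open>auto intro!: AE_I2 power_mono simp: borel_measurable_power\<close>)
  then show ?thesis using m by (simp add: L2_function_def)
qed

text \<open>The constants that \<open>cz_operator\<close> merely asserts to exist become parameters.
  Bounds can then name them, and it is visible that no weight is involved.\<close>

locale cz_op =
  fixes T :: "(real^'d::finite \<Rightarrow> complex) \<Rightarrow> real^'d \<Rightarrow> complex"
    and K :: "real^'d \<Rightarrow> real^'d \<Rightarrow> complex" and cK :: real and \<omega> :: "real \<Rightarrow> real" and B :: real
  assumes T_L2: "\<And>f. L2_function f \<Longrightarrow> L2_function (T f)"
    and T_linear: "\<And>f g a b. L2_function f \<Longrightarrow> L2_function g \<Longrightarrow>
      AE x in lebesgue. T (\<lambda>y. a * f y + b * g y) x = a * T f x + b * T g x"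
    and T_bound: "\<And>f. L2_function f \<Longrightarrow> L2_norm_of (T f) \<le> B * L2_norm_of f"
    and K_size: "\<And>x y. x \<noteq> y \<Longrightarrow> norm (K x y) \<le> cK / norm (x - y) ^ CARD('d)"
    and dini: "dini_modulus \<omega>"
    and K_smooth: "\<And>x x' y. norm (x - y) > 2 * norm (x - x') \<Longrightarrow>
      norm (K x y - K x' y) + norm (K y x - K y x') \<le> \<omega> (norm (x - x') / norm (x - y)) / norm (x - y) ^ CARD('d)"
    and K_rep: "\<And>f. L2_function f \<Longrightarrow> AE x in lebesgue. x \<notin> closure {y. f y \<noteq> 0} \<longrightarrow>
      T f x = (\<integral>y. K x y * f y \<partial>lebesgue)"
begin

lemma T_measurable: "L2_function f \<Longrightarrow> T f \<in> borel_measurable lebesgue"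
  using T_L2 by (simp add: L2_function_def)

lemma T_square:
  assumes f: "L2_function f"
  shows "(\<integral>x. (norm (T f x))\<^sup>2 \<partial>lebesgue) \<le> B\<^sup>2 * (\<integral>x. (norm (f x))\<^sup>2 \<partial>lebesgue)"
proof -
  have "(L2_norm_of (T f))\<^sup>2 \<le> (B * L2_norm_of f)\<^sup>2"
    by (intro power_mono T_bound f) (simp add: L2_norm_of_def)
  then show ?thesis by (simp add: L2_norm_of_def power_mult_distrib)
qed

lemma T_markov:
  assumes f: "L2_function f" and t: "t > 0"
  shows "emeasure lebesgue {x. norm (T f x) > t} \<le> ennreal (B\<^sup>2 / t\<^sup>2 * (\<integral>x. (norm (f x))\<^sup>2 \<partial>lebesgue))"
proof -
  have [measurable]: "T f \<in> borel_measurable lebesgue" by (rule T_measurable[OF f])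
  have "emeasure lebesgue {x. norm (T f x) > t} \<le> emeasure lebesgue {x \<in> space lebesgue. (norm (T f x))\<^sup>2 \<ge> t\<^sup>2}"
  proof (rule emeasure_mono)
    show "{x \<in> space lebesgue. (norm (T f x))\<^sup>2 \<ge> t\<^sup>2} \<in> sets lebesgue" by measurable
  qed (use t in \<open>auto intro!: power_mono\<close>)
  also have "\<dots> \<le> ennreal ((1 / t\<^sup>2) * (\<integral>x. (norm (T f x))\<^sup>2 \<partial>lebesgue))"
    using T_L2[OF f] t by (intro integral_Markov_inequality) (auto simp: L2_function_def)
  also have "\<dots> \<le> ennreal ((1 / t\<^sup>2) * (B\<^sup>2 * (\<integral>x. (norm (f x))\<^sup>2 \<partial>lebesgue)))"
    by (intro ennreal_leI mult_left_mono T_square f) auto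
  finally show ?thesis by simp
qed

text \<open>\<open>T\<close> acts on representatives, so vanishing almost everywhere is not the zero
  function; boundedness on L2 bridges the gap.\<close>

lemma T_null:
  assumes f: "L2_function f" and z: "AE x in lebesgue. f x = 0"
  shows "AE x in lebesgue. T f x = 0"
proof -
  have "(\<integral>x. (norm (f x))\<^sup>2 \<partial>lebesgue) = (\<integral>x. 0 \<partial>(lebesgue :: (real^'d) measure))"
    using z f by (intro integral_cong_AE) (auto simp: L2_function_def)
  then have "(\<integral>x. (norm (T f x))\<^sup>2 \<partial>lebesgue) \<le> 0" using T_square[OF f] by simp
  then have "(\<integral>x. (norm (T f x))\<^sup>2 \<partial>lebesgue) = 0"
    by (intro antisym Bochner_Integration.integral_nonneg) auto
  then have "AE x in lebesgue. (norm (T f x))\<^sup>2 = 0"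
    using T_L2[OF f] by (subst (asm) integral_nonneg_eq_0_iff_AE) (auto simp: L2_function_def)
  then show ?thesis by simp
qed

lemma T_add:
  assumes "L2_function f" "L2_function g"
  shows "AE x in lebesgue. T (\<lambda>y. f y + g y) x = T f x + T g x"
  using T_linear[OF assms, of 1 1] by simp

lemma T_diff:
  assumes "L2_function f" "L2_function g"
  shows "AE x in lebesgue. T (\<lambda>y. f y - g y) x = T f x - T g x"
  using T_linear[OF assms, of 1 "-1"] by simp

lemma T_sum:
  assumes "finite I" "\<And>i. i \<in> I \<Longrightarrow> nice (h i)"
  shows "AE x in lebesgue. T (\<lambda>y. \<Sum>i\<in>I. a i * h i y) x = (\<Sum>i\<in>I. a i * T (h i) x)"
  using assms
proof (induction rule: finite_induct)
  case empty
  show ?case using T_null[OF nice_L2[OF nice_zero]] by simp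
next
  case (insert i I)
  have "L2_function (h i)" "L2_function (\<lambda>y. \<Sum>i\<in>I. a i * h i y)"
    using insert nice_sum[of I h a] by (auto intro: nice_L2)
  from T_linear[OF this, of "a i" 1] insert.IH[OF insert.prems, simplified]
  have "AE x in lebesgue. T (\<lambda>y. a i * h i y + 1 * (\<Sum>i\<in>I. a i * h i y)) x = a i * T (h i) x + (\<Sum>i\<in>I. a i * T (h i) x)"
    by eventually_elim simp
  then show ?case using insert.hyps by simp
qed

lemma omega_mono: "0 \<le> s \<Longrightarrow> s \<le> t \<Longrightarrow> \<omega> s \<le> \<omega> t"
  using dini unfolding dini_modulus_def mono_on_def by auto

lemma omega_nonneg: "0 \<le> t \<Longrightarrow> 0 \<le> \<omega> t"
  using omega_mono[of 0 t] dini by (simp add: dini_modulus_def)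

definition om :: "nat \<Rightarrow> real" where "om l = \<omega> ((1/2) ^ Suc l)"

lemma om_nonneg: "0 \<le> om l"
  by (simp add: om_def omega_nonneg)

text \<open>On the interval from \<open>2^-(l+1)\<close> to \<open>2^-l\<close> monotonicity gives
  \<open>\<omega> t / t \<ge> om l * 2^l\<close>, and the interval has length
  \<open>2^-(l+1)\<close>. Hence the sum of \<open>om l / 2\<close> is at most the Dini
  integral.\<close>

lemma om_summable: "summable om"
proof -
  define I where "I l = {(1/2)^Suc l <..< (1/2::real)^l}" for l
  have Isub: "t \<in> I l \<Longrightarrow> t \<in> I k \<Longrightarrow> l \<le> k" for t l k
  proof (rule ccontr)
    assume t: "t \<in> I l" "t \<in> I k" and "\<not> l \<le> k"
    then have "(1/2::real)^l \<le> (1/2)^Suc k" by (intro power_decreasing) auto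
    with t show False by (auto simp: I_def)
  qed
  then have Idisj: "t \<in> I l \<Longrightarrow> t \<in> I k \<Longrightarrow> k = l" for t l k by (meson antisym)
  have fin: "(\<integral>\<^sup>+t\<in>{0<..<1}. ennreal (\<omega> t / t) \<partial>lborel) < \<infinity>"
    using dini by (simp add: dini_modulus_def)
  have "(\<Sum>l. ennreal (om l * 2^l) * indicator (I l) t) \<le> ennreal (\<omega> t / t) * indicator {0<..<1} t" for t
  proof (cases "\<exists>l. t \<in> I l")
    case True
    then obtain l where l: "t \<in> I l" by blast
    have "(\<Sum>l. ennreal (om l * 2^l) * indicator (I l) t) = (\<Sum>l\<in>{l}. ennreal (om l * 2^l) * indicator (I l) t)"
      using Idisj[OF l] by (intro suminf_finite) (auto simp: indicator_def)
    also have "\<dots> = ennreal (om l * 2^l)" using l by simp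
    also have "\<dots> \<le> ennreal (\<omega> t / t) * indicator {0<..<1} t"
    proof -
      have t0: "0 < t" "(1/2)^Suc l \<le> t" "t < (1/2)^l"
        using l by (auto simp: I_def intro: less_trans[of 0 "(1/2)^l / 2"])
      have "(1/2::real)^l \<le> 1" by (simp add: power_le_one)
      with t0 have t1: "t < 1" by linarith
      have "om l \<le> \<omega> t" unfolding om_def using t0 by (intro omega_mono) auto
      moreover have "2^l \<le> 1 / t" using t0 by (simp add: field_simps power_one_over)
      ultimately have "om l * 2^l \<le> \<omega> t * (1 / t)"
        using om_nonneg[of l] by (intro mult_mono) (auto intro: order_trans)
      then show ?thesis using t0 t1 by (simp add: ennreal_leI)
    qed
    finally show ?thesis .
  next
    case False
    then have "(\<Sum>l. ennreal (om l * 2^l) * indicator (I l) t) = 0" by simp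
    then show ?thesis by simp
  qed
  then have "(\<integral>\<^sup>+t. (\<Sum>l. ennreal (om l * 2^l) * indicator (I l) t) \<partial>lborel) \<le>
      (\<integral>\<^sup>+t\<in>{0<..<1}. ennreal (\<omega> t / t) \<partial>lborel)"
    by (intro nn_integral_mono) auto
  also have "(\<integral>\<^sup>+t. (\<Sum>l. ennreal (om l * 2^l) * indicator (I l) t) \<partial>lborel) =
      (\<Sum>l. \<integral>\<^sup>+t. ennreal (om l * 2^l) * indicator (I l) t \<partial>lborel)"
    by (intro nn_integral_suminf) (auto simp: I_def)
  also have "\<dots> = (\<Sum>l. ennreal (om l / 2))"
  proof (rule suminf_cong)
    fix l
    have "(\<integral>\<^sup>+t. ennreal (om l * 2^l) * indicator (I l) t \<partial>lborel) = ennreal (om l * 2^l) * emeasure lborel (I l)"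
      by (intro nn_integral_cmult_indicator) (auto simp: I_def)
    also have "emeasure lborel (I l) = ennreal ((1/2)^Suc l)"
      unfolding I_def by (subst emeasure_lborel_Ioo) (auto simp: )
    also have "ennreal (om l * 2^l) * ennreal ((1/2)^Suc l) = ennreal (om l / 2)"
      using om_nonneg[of l] by (subst ennreal_mult[symmetric]) (auto simp: power_one_over field_simps)
    finally show "(\<integral>\<^sup>+t. ennreal (om l * 2^l) * indicator (I l) t \<partial>lborel) = ennreal (om l / 2)" .
  qed
  finally have "(\<Sum>l. ennreal (om l / 2)) < \<infinity>" using fin by (rule le_less_trans)
  then have "summable (\<lambda>l. om l / 2)"
    using om_nonneg by (intro summable_suminf_not_top) (auto simp: less_top)
  then show ?thesis using summable_mult[of "\<lambda>l. om l / 2" 2] by simp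
qed

definition dini_const :: real where "dini_const = (\<Sum>l. om l)"

lemma dini_const_nonneg: "0 \<le> dini_const"
  unfolding dini_const_def by (intro suminf_nonneg om_summable om_nonneg)

lemma suminf_om: "(\<Sum>l. ennreal (om l)) = ennreal dini_const"
  unfolding dini_const_def by (intro suminf_ennreal2 om_nonneg om_summable)

text \<open>Summability forces \<open>om\<close> to tend to zero, and then the smoothness bound is
  continuity in the second variable away from the diagonal. It serves to make \<open>K x\<close>
  measurable.\<close>

lemma K_continuous: "continuous_on (- {x}) (K x)"
  unfolding continuous_on_iff
proof (intro ballI allI impI)
  fix y :: "real^'d" and e :: real assume y: "y \<in> - {x}" and e: "e > 0"
  define r where "r = norm (y - x)"
  have r: "r > 0" using y by (simp add: r_def)
  have "om \<longlonglongrightarrow> 0" using om_summable by (rule summable_LIMSEQ_zero)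
  moreover have er: "0 < e * r ^ CARD('d)" using e r by simp
  ultimately obtain l where l: "norm (om l - 0) < e * r ^ CARD('d)"
    by (meson LIMSEQ_D order_refl)
  show "\<exists>d>0. \<forall>x'\<in>- {x}. dist x' y < d \<longrightarrow> dist (K x x') (K x y) < e"
  proof (intro exI[of _ "r * (1/2)^Suc l"] conjI ballI impI)
    show "r * (1/2)^Suc l > 0" using r by simp
    fix z assume "dist z y < r * (1/2)^Suc l"
    then have z: "norm (y - z) < r * (1/2)^Suc l" by (simp add: dist_norm norm_minus_commute)
    have "r * (1/2)^Suc l \<le> r * (1/2)^1" using r by (intro mult_left_mono power_decreasing) auto
    then have "norm (y - x) > 2 * norm (y - z)" using z by (simp add: r_def)
    from K_smooth[OF this] have "norm (K x y - K x z) \<le> \<omega> (norm (y - z) / r) / r ^ CARD('d)"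
      using norm_ge_zero[of "K y x - K z x"] unfolding r_def by linarith
    also have "\<dots> \<le> om l / r ^ CARD('d)"
      unfolding om_def using z r by (intro divide_right_mono omega_mono) (auto simp: field_simps)
    also have "\<dots> < e" using l r by (simp add: field_simps)
    finally show "dist (K x z) (K x y) < e" by (simp add: dist_norm norm_minus_commute)
  qed
qed

lemma K_measurable [measurable]: "K x \<in> borel_measurable lebesgue"
proof -
  have "(\<lambda>y. indicator (- {x}) y *\<^sub>R K x y) \<in> borel_measurable borel"
    by (intro borel_measurable_continuous_on_indicator K_continuous) auto
  then have "(\<lambda>y. indicator (- {x}) y *\<^sub>R K x y + indicator {x} y *\<^sub>R K x x) \<in> borel_measurable borel"
    by (intro borel_measurable_add) auto
  also have "(\<lambda>y. indicator (- {x}) y *\<^sub>R K x y + indicator {x} y *\<^sub>R K x x) = K x"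
    by (auto simp: indicator_def)
  finally show ?thesis by (rule measurable_completion[of _ lborel, unfolded measurable_lborel2])
qed

text \<open>The annuli between consecutive dilates of a cell are the ranges on which the modulus of
  continuity is evaluated.\<close>

lemma K_oscillation:
  assumes s: "s > 0" and x': "x' \<in> dcell s x" and y: "y \<notin> dstar s x"
  shows "ennreal (norm (K x y - K x' y) + norm (K y x - K y x')) \<le>
    (\<Sum>l. ennreal (om l * (s / 2 ^ Suc l) ^ CARD('d)) * indicator (dstar (s / 2 ^ Suc l) x) y)"
proof -
  \<comment> \<open>The first dilate whose star reaches \<open>y\<close>. That the previous star
    does not reach it bounds \<open>norm (x - y)\<close> from below, hence the argument of
    \<open>\<omega>\<close> from above.\<close>
  define i where "i = (LEAST i. y \<in> dstar (s / 2 ^ i) x)"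
  have yi: "y \<in> dstar (s / 2 ^ i) x"
    unfolding i_def using eventually_in_dstar[OF s] by (rule LeastI_ex)
  with y have "i \<noteq> 0" by (intro notI) simp
  then obtain l where l: "i = Suc l" by (cases i) auto
  have "l < i" using l by simp
  then have yl: "y \<notin> dstar (s / 2 ^ l) x" unfolding i_def by (rule not_less_Least)
  let ?d = "real CARD('d)"
  have sl: "s / 2 ^ l > 0" and sl': "s / 2 ^ Suc l > 0" using s by auto
  have d1: "?d \<ge> 1" by (simp add: Suc_leI)
  have far: "norm (x - y) > ?d * 2 ^ Suc l / s"
    using not_dstar_dist[OF sl yl] by (simp add: field_simps)
  have near: "norm (x - x') \<le> ?d / s" by (rule dcell_dist[OF s x'])
  have far0: "norm (x - y) > 2 * ?d / s" by (rule not_dstar_dist[OF s y])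
  have pos: "norm (x - y) > 0" using far0 s by (smt (verit) divide_nonneg_pos of_nat_0_le_iff)
  have "norm (x - y) > 2 * norm (x - x')" using far0 near by simp
  note K_smooth[OF this]
  also have "\<omega> (norm (x - x') / norm (x - y)) / norm (x - y) ^ CARD('d) \<le> om l / norm (x - y) ^ CARD('d)"
  proof (intro divide_right_mono)
    have "norm (x - x') \<le> (1/2)^Suc l * (?d * 2 ^ Suc l / s)"
      using near by (simp add: power_one_over)
    also have "\<dots> \<le> (1/2)^Suc l * norm (x - y)" using far by (intro mult_left_mono) auto
    finally show "\<omega> (norm (x - x') / norm (x - y)) \<le> om l"
      unfolding om_def using pos by (intro omega_mono) (auto simp: field_simps)
  qed auto
  also have "\<dots> = om l * (1 / norm (x - y)) ^ CARD('d)" by (simp add: power_one_over)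
  also have "\<dots> \<le> om l * (s / 2 ^ Suc l) ^ CARD('d)"
  proof (intro mult_left_mono power_mono om_nonneg)
    have "2 ^ Suc l / s \<le> ?d * 2 ^ Suc l / s" using d1 s by (intro divide_right_mono) auto
    then have "2 ^ Suc l / s \<le> norm (x - y)" using far by linarith
    then show "1 / norm (x - y) \<le> s / 2 ^ Suc l" using pos s by (simp add: field_simps)
  qed auto
  finally have "ennreal (norm (K x y - K x' y) + norm (K y x - K y x')) \<le>
      ennreal (om l * (s / 2 ^ Suc l) ^ CARD('d)) * indicator (dstar (s / 2 ^ Suc l) x) y"
    using yi l by (simp add: ennreal_leI del: ennreal_plus)
  also have "\<dots> \<le> (\<Sum>l. ennreal (om l * (s / 2 ^ Suc l) ^ CARD('d)) * indicator (dstar (s / 2 ^ Suc l) x) y)"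
    by (rule ennreal_term_le_suminf)
  finally show ?thesis .
qed

end

section \<open>The unweighted weak type inequality\<close>

lemma corner_in_dcell: "s > 0 \<Longrightarrow> corner s x \<in> dcell s x"
  by (simp add: corner_def dcell_def)

text \<open>The adapted factor is constant on each cell, where \<open>f\<close> has mean zero. In
  the application the factor is the kernel evaluated at the corner of the cell, and this is the
  cancellation of the bad part.\<close>

lemma integral_adapted_zero:
  fixes c f :: "real^'d::finite \<Rightarrow> complex"
  assumes s: "s > 0" and c: "adapted s c" and cf: "integrable lebesgue (\<lambda>x. c x * f x)"
    and zero: "\<And>x. (\<integral>y. indicator (dcell s x) y *\<^sub>R f y \<partial>lebesgue) = 0"
  shows "(\<integral>x. c x * f x \<partial>lebesgue) = 0"
proof -
  define A where "A n = {x :: real^'d. to_nat (cell_index s x) = n}" for n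
  have Am: "A n \<in> sets lebesgue" for n
    unfolding A_def by (rule adapted_sets[OF s]) (auto simp: adapted_def dcell_index)
  have U: "(\<Union>n. A n) = UNIV" by (auto simp: A_def)
  have "(LINT x:(\<Union>n. A n)|lebesgue. c x * f x) = (\<Sum>n. LINT x:A n|lebesgue. c x * f x)"
    using cf by (intro lebesgue_integral_countable_add Am) (auto simp: A_def U set_integrable_def)
  also have "\<dots> = (\<Sum>n. 0)"
  proof (rule suminf_cong)
    fix n
    show "(LINT x:A n|lebesgue. c x * f x) = 0"
    proof (rule cell_index_set_cases[of s n, where 'd='d])
      assume "{x :: real^'d. to_nat (cell_index s x) = n} = {}"
      then have "A n = {}" by (simp add: A_def)
      then show ?thesis by (simp add: set_lebesgue_integral_def)
    next
      fix z :: "real^'d" assume "{x. to_nat (cell_index s x) = n} = dcell s z"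
      then have An: "A n = dcell s z" by (simp add: A_def)
      have "(\<lambda>x. indicator (dcell s z) x *\<^sub>R (c x * f x)) = (\<lambda>x. c z * (indicator (dcell s z) x *\<^sub>R f x))"
      proof
        fix x
        show "indicator (dcell s z) x *\<^sub>R (c x * f x) = c z * (indicator (dcell s z) x *\<^sub>R f x)"
          using adaptedD[OF c, of x z] by (cases "x \<in> dcell s z") auto
      qed
      then show ?thesis
        unfolding set_lebesgue_integral_def An by (simp only: integral_mult_right_zero zero mult_zero_right)
    qed
  qed
  finally show ?thesis by (simp add: U set_lebesgue_integral_def)
qed

text \<open>The Calderon-Zygmund decomposition of \<open>h\<close> at height \<open>t\<close>. The
  assumption \<open>top\<close> makes the initial cells so large that none is selected; every
  selected cell therefore has an unselected parent.\<close>

locale cz_decomposition = cz_op T K cK \<omega> B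
  for T :: "(real^'d::finite \<Rightarrow> complex) \<Rightarrow> real^'d \<Rightarrow> complex" and K cK \<omega> B +
  fixes h :: "real^'d \<Rightarrow> complex" and s t I :: real
  assumes h: "nice h" and s: "s > 0" and t: "t > 0"
    and I: "I = (\<integral>x. norm (h x) \<partial>lebesgue)" and top: "s ^ CARD('d) * I \<le> t"
begin

lemma hm [measurable]: "h \<in> borel_measurable lebesgue"
  by (rule nice_measurable[OF h])

lemma hi: "integrable lebesgue h" by (rule nice_integrable[OF h])

lemma I_nonneg: "0 \<le> I" by (simp add: I)

lemma nn_h: "(\<integral>\<^sup>+x. ennreal (norm (h x)) \<partial>lebesgue) = ennreal I"
  unfolding I using hi by (intro nn_integral_eq_integral) auto

abbreviation sc :: "nat \<Rightarrow> real" where "sc k \<equiv> 2 ^ k * s"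

lemma sc: "sc k > 0" using s by simp

definition P :: "nat \<Rightarrow> real^'d \<Rightarrow> bool" where
  "P k x \<longleftrightarrow> ennreal t * emeasure lebesgue (dcell (sc k) x) < (\<integral>\<^sup>+y\<in>dcell (sc k) x. ennreal (norm (h y)) \<partial>lebesgue)"

lemma P_adapted: "adapted (sc k) (P k)"
  unfolding P_def by (rule adapted_dcell)

lemma not_P_0: "\<not> P 0 x"
proof -
  have "(\<integral>\<^sup>+y\<in>dcell (sc 0) x. ennreal (norm (h y)) \<partial>lebesgue) \<le> ennreal I"
    unfolding nn_h[symmetric] by (intro nn_integral_mono) (auto simp: indicator_def)
  also have "\<dots> \<le> ennreal t * emeasure lebesgue (dcell (sc 0) x)"
    using top s t by (simp add: emeasure_dcell ennreal_mult[symmetric] ennreal_leI field_simps)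
  finally show ?thesis by (simp add: P_def not_less)
qed

definition F :: "nat \<Rightarrow> (real^'d) set" where "F k = {x. first_time P k x}"

lemma F_sets [measurable]: "F k \<in> sets lebesgue"
  unfolding F_def by (rule adapted_sets[OF sc adapted_first_time[OF P_adapted]])

lemma F_cell: "y \<in> dcell (sc k) x \<Longrightarrow> y \<in> F k \<longleftrightarrow> x \<in> F k"
  using adaptedD[OF adapted_first_time[OF P_adapted], of y k x] by (simp add: F_def)

definition mean :: "nat \<Rightarrow> real^'d \<Rightarrow> complex" where
  "mean k x = of_real (sc k ^ CARD('d)) * (\<integral>y. indicator (dcell (sc k) x) y *\<^sub>R h y \<partial>lebesgue)"

lemma mean_adapted: "adapted (sc k) (mean k)"
  unfolding mean_def by (rule adapted_dcell)

lemma mean_measurable [measurable]: "mean k \<in> borel_measurable lebesgue"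
  by (rule adapted_borel_measurable[OF sc mean_adapted])

lemma cell_integrable: "integrable lebesgue (\<lambda>y. indicator (dcell (sc k) x) y *\<^sub>R h y)"
  by (intro integrable_mult_indicator dcell_sets sc hi)

lemma norm_mean: "ennreal (norm (mean k x)) * emeasure lebesgue (dcell (sc k) x) \<le>
    (\<integral>\<^sup>+y\<in>dcell (sc k) x. ennreal (norm (h y)) \<partial>lebesgue)"
proof -
  have "ennreal (norm (mean k x)) * emeasure lebesgue (dcell (sc k) x) =
      ennreal (norm (\<integral>y. indicator (dcell (sc k) x) y *\<^sub>R h y \<partial>lebesgue))"
    using s by (simp add: emeasure_dcell[OF sc] mean_def norm_mult norm_power ennreal_mult[symmetric])
  also have "\<dots> \<le> (\<integral>\<^sup>+y. ennreal (norm (indicator (dcell (sc k) x) y *\<^sub>R h y)) \<partial>lebesgue)"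
    by (rule integral_norm_bound_ennreal[OF cell_integrable])
  also have "\<dots> = (\<integral>\<^sup>+y\<in>dcell (sc k) x. ennreal (norm (h y)) \<partial>lebesgue)"
    by (intro nn_integral_cong) (auto simp: indicator_def)
  finally show ?thesis .
qed

text \<open>The parent was not selected, so its average is at most \<open>t\<close>, and its volume
  is \<open>2 ^ d\<close> times that of the cell.\<close>

lemma norm_mean_first:
  assumes x: "x \<in> F k" shows "norm (mean k x) \<le> 2 ^ CARD('d) * t"
proof -
  have "P k x" using x by (simp add: F_def first_time_def)
  then have "k \<noteq> 0" using not_P_0 by metis
  then obtain j where k: "k = Suc j" by (cases k) auto
  have "\<not> P j x" using x k by (simp add: F_def first_time_def)
  then have "(\<integral>\<^sup>+y\<in>dcell (sc j) x. ennreal (norm (h y)) \<partial>lebesgue) \<le> ennreal t * emeasure lebesgue (dcell (sc j) x)"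
    by (simp add: P_def not_less)
  moreover have "(\<integral>\<^sup>+y\<in>dcell (sc k) x. ennreal (norm (h y)) \<partial>lebesgue) \<le> (\<integral>\<^sup>+y\<in>dcell (sc j) x. ennreal (norm (h y)) \<partial>lebesgue)"
    using dcell_mono[of j k s x] k by (intro nn_integral_mono) (auto simp: indicator_def)
  ultimately have "ennreal (norm (mean k x)) * emeasure lebesgue (dcell (sc k) x) \<le> ennreal t * emeasure lebesgue (dcell (sc j) x)"
    using norm_mean[of k x] by (meson order_trans)
  then have "ennreal (norm (mean k x) * (1 / sc k ^ CARD('d))) \<le> ennreal (t * (1 / sc j ^ CARD('d)))"
    using t s unfolding emeasure_dcell[OF sc] by (subst (1 2) ennreal_mult) auto
  then have le: "norm (mean k x) * (1 / sc k ^ CARD('d)) \<le> t * (1 / sc j ^ CARD('d))"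
    by (rule iffD1[OF ennreal_le_iff, rotated]) (use t s in simp)
  have "sc k ^ CARD('d) = 2 ^ CARD('d) * sc j ^ CARD('d)" by (simp add: k power_mult_distrib)
  moreover have "sc j ^ CARD('d) > 0" using s by simp
  moreover have "v \<le> C * t" if "v * (1 / (C * a)) \<le> t * (1 / a)" "a > 0" "C > 0" for v C a :: real
    using that by (simp add: field_simps)
  ultimately show ?thesis using le by simp
qed

definition b :: "nat \<Rightarrow> real^'d \<Rightarrow> complex" where
  "b k y = indicator (F k) y * (h y - mean k y)"

lemma b_measurable [measurable]: "b k \<in> borel_measurable lebesgue"
  unfolding b_def by measurable

lemma mean_F_integral: "(\<integral>\<^sup>+y. indicator (F k) y * ennreal (norm (mean k y)) \<partial>lebesgue) \<le>
    (\<integral>\<^sup>+y. indicator (F k) y * ennreal (norm (h y)) \<partial>lebesgue)"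
proof (rule adapted_nn_integral_le[OF sc])
  show "adapted (sc k) (indicator (F k) :: _ \<Rightarrow> ennreal)"
    using F_cell by (auto simp: adapted_def indicator_def)
  fix x
  have "(\<integral>\<^sup>+y\<in>dcell (sc k) x. ennreal (norm (mean k y)) \<partial>lebesgue) =
      (\<integral>\<^sup>+y. ennreal (norm (mean k x)) * indicator (dcell (sc k) x) y \<partial>lebesgue)"
    using adaptedD[OF mean_adapted] by (intro nn_integral_cong) (auto simp: indicator_def)
  also have "\<dots> = ennreal (norm (mean k x)) * emeasure lebesgue (dcell (sc k) x)"
    by (intro nn_integral_cmult_indicator dcell_sets sc)
  finally show "(\<integral>\<^sup>+y\<in>dcell (sc k) x. ennreal (norm (mean k y)) \<partial>lebesgue) \<le>
      (\<integral>\<^sup>+y\<in>dcell (sc k) x. ennreal (norm (h y)) \<partial>lebesgue)"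
    using norm_mean by simp
qed measurable

lemma F_sum: "(\<Sum>k. \<integral>\<^sup>+y. indicator (F k) y * ennreal (norm (h y)) \<partial>lebesgue) =
    (\<integral>\<^sup>+y. ennreal (norm (h y)) * indicator {y. \<exists>k. P k y} y \<partial>lebesgue)"
  using nn_integral_first_time[where P = P, OF s P_adapted, of "\<lambda>y. ennreal (norm (h y))"]
  by (simp add: F_def mult.commute)

text \<open>Selected cells are disjoint and taking means does not increase the L1 norm, so
  \<open>h\<close> and its means contribute at most \<open>I\<close> each.\<close>

lemma b_sum: "(\<Sum>k. \<integral>\<^sup>+y. ennreal (norm (b k y)) \<partial>lebesgue) \<le> ennreal (2 * I)"
proof -
  have "(\<integral>\<^sup>+y. ennreal (norm (b k y)) \<partial>lebesgue) \<le> 2 * (\<integral>\<^sup>+y. indicator (F k) y * ennreal (norm (h y)) \<partial>lebesgue)" for k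
  proof -
    have "(\<integral>\<^sup>+y. ennreal (norm (b k y)) \<partial>lebesgue) \<le>
        (\<integral>\<^sup>+y. indicator (F k) y * ennreal (norm (h y)) + indicator (F k) y * ennreal (norm (mean k y)) \<partial>lebesgue)"
    proof (rule nn_integral_mono)
      fix y
      have "ennreal (norm (h y - mean k y)) \<le> ennreal (norm (h y)) + ennreal (norm (mean k y))"
        by (subst ennreal_plus[symmetric]) (auto intro!: ennreal_leI norm_triangle_ineq4 simp del: ennreal_plus)
      then show "ennreal (norm (b k y)) \<le> indicator (F k) y * ennreal (norm (h y)) + indicator (F k) y * ennreal (norm (mean k y))"
        by (auto simp: b_def indicator_def)
    qed
    also have "\<dots> = (\<integral>\<^sup>+y. indicator (F k) y * ennreal (norm (h y)) \<partial>lebesgue) + (\<integral>\<^sup>+y. indicator (F k) y * ennreal (norm (mean k y)) \<partial>lebesgue)"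
      by (intro nn_integral_add) measurable
    also have "\<dots> \<le> 2 * (\<integral>\<^sup>+y. indicator (F k) y * ennreal (norm (h y)) \<partial>lebesgue)"
      unfolding mult_2 by (intro add_left_mono mean_F_integral)
    finally show ?thesis .
  qed
  then have "(\<Sum>k. \<integral>\<^sup>+y. ennreal (norm (b k y)) \<partial>lebesgue) \<le> (\<Sum>k. 2 * (\<integral>\<^sup>+y. indicator (F k) y * ennreal (norm (h y)) \<partial>lebesgue))"
    by (intro suminf_le) auto
  also have "\<dots> = 2 * (\<integral>\<^sup>+y. ennreal (norm (h y)) * indicator {y. \<exists>k. P k y} y \<partial>lebesgue)"
    by (simp add: ennreal_suminf_cmult F_sum)
  also have "\<dots> \<le> 2 * ennreal I"
    unfolding nn_h[symmetric] by (intro mult_left_mono nn_integral_mono) (auto simp: indicator_def)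
  finally show ?thesis using I_nonneg by (simp add: ennreal_mult)
qed

lemma b_integrable: "integrable lebesgue (b k)"
proof (rule integrableI_bounded)
  have "(\<integral>\<^sup>+y. ennreal (norm (b k y)) \<partial>lebesgue) \<le> (\<Sum>k. \<integral>\<^sup>+y. ennreal (norm (b k y)) \<partial>lebesgue)"
    by (rule ennreal_term_le_suminf)
  also have "\<dots> \<le> ennreal (2 * I)" by (rule b_sum)
  finally show "(\<integral>\<^sup>+y. ennreal (norm (b k y)) \<partial>lebesgue) < \<infinity>" by (simp add: le_less_trans)
qed measurable

lemma b_cell_zero: "(\<integral>y. indicator (dcell (sc k) x) y *\<^sub>R b k y \<partial>lebesgue) = 0"
proof (cases "x \<in> F k")
  case True
  have cm: "emeasure lebesgue (dcell (sc k) x) < \<infinity>" by (simp add: emeasure_dcell[OF sc])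
  have m: "measure lebesgue (dcell (sc k) x) = 1 / sc k ^ CARD('d)"
    using s by (simp add: measure_def emeasure_dcell[OF sc])
  have ind: "has_bochner_integral lebesgue (\<lambda>y. indicator (dcell (sc k) x) y *\<^sub>R mean k x)
      ((1 / sc k ^ CARD('d)) *\<^sub>R mean k x)"
    using has_bochner_integral_indicator[OF dcell_sets[OF sc, of k x] cm] by (simp add: m)
  have "indicator (dcell (sc k) x) y *\<^sub>R b k y =
      indicator (dcell (sc k) x) y *\<^sub>R h y - indicator (dcell (sc k) x) y *\<^sub>R mean k x" for y
    using F_cell[of y k x] True adaptedD[OF mean_adapted, of y k x] by (auto simp: b_def indicator_def)
  then have "(\<integral>y. indicator (dcell (sc k) x) y *\<^sub>R b k y \<partial>lebesgue) =
      (\<integral>y. indicator (dcell (sc k) x) y *\<^sub>R h y - indicator (dcell (sc k) x) y *\<^sub>R mean k x \<partial>lebesgue)" by simp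
  also have "\<dots> = (\<integral>y. indicator (dcell (sc k) x) y *\<^sub>R h y \<partial>lebesgue) - (1 / sc k ^ CARD('d)) *\<^sub>R mean k x"
    using cell_integrable[of k x] ind by (simp add: has_bochner_integral_iff)
  also have "\<dots> = 0" using s by (simp add: mean_def scaleR_conv_of_real)
  finally show ?thesis .
next
  case False
  have "(\<lambda>y. indicator (dcell (sc k) x) y *\<^sub>R b k y) = (\<lambda>y. 0)"
  proof (rule ext)
    fix y :: "real^'d"
    show "indicator (dcell (sc k) x) y *\<^sub>R b k y = 0"
      by (cases "y \<in> dcell (sc k) x") (use F_cell[of y k x] False in \<open>auto simp: b_def\<close>)
  qed
  then show ?thesis by (simp only: Bochner_Integration.integral_zero)
qed

section \<open>Good and bad part\<close>

definition \<tau> :: "real^'d \<Rightarrow> nat" where "\<tau> y = (LEAST k. P k y)"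

lemma first_tau: "P k y \<Longrightarrow> first_time P (\<tau> y) y \<and> \<tau> y \<le> k"
  unfolding first_time_def \<tau>_def by (metis LeastI not_less_Least Least_le)

text \<open>The bad part \<open>bt\<close> is reached through finitely many generations: the kernel
  represents \<open>T\<close> only outside the closure of the support, and the first
  \<open>n\<close> generations stay at distance at least \<open>2 d / sc n\<close> from every point
  outside \<open>\<Omega>\<close>, a gap that closes as \<open>n\<close> grows.\<close>

definition bn :: "nat \<Rightarrow> real^'d \<Rightarrow> complex" where "bn n y = (\<Sum>k<n. b k y)"
definition bt :: "real^'d \<Rightarrow> complex" where "bt y = (if \<exists>k. P k y then b (\<tau> y) y else 0)"

lemma bn_eq: "bn n y = (if \<exists>k. P k y \<and> \<tau> y < n then bt y else 0)"
proof (cases "\<exists>k. P k y")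
  case True
  then have f: "y \<in> F (\<tau> y)" using first_tau by (auto simp: F_def)
  have "b k y = (if k = \<tau> y then bt y else 0)" for k
    using True f first_time_unique[of P] by (auto simp: b_def bt_def F_def indicator_def)
  then show ?thesis using True by (simp add: bn_def)
next
  case False
  then have "y \<notin> F k" for k by (auto simp: F_def first_time_def)
  then show ?thesis using False by (simp add: bn_def b_def)
qed

lemma bn_measurable [measurable]: "bn n \<in> borel_measurable lebesgue"
  unfolding bn_def by measurable

lemma bn_lim: "(\<lambda>n. bn n y) \<longlonglongrightarrow> bt y"
proof (rule tendsto_eventually)
  have "bn n y = bt y" if "n > \<tau> y" for n
    using that by (auto simp: bn_eq bt_def)
  then show "\<forall>\<^sub>F n in sequentially. bn n y = bt y"
    unfolding eventually_sequentially by (meson Suc_le_eq)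
qed

lemma bt_measurable [measurable]: "bt \<in> borel_measurable lebesgue"
  by (rule borel_measurable_LIMSEQ_metric[OF _ bn_lim]) measurable

definition G :: "real^'d \<Rightarrow> complex" where "G y = h y - bt y"

lemma G_measurable [measurable]: "G \<in> borel_measurable lebesgue"
  unfolding G_def by measurable

lemma G_cases:
  "P k y \<Longrightarrow> G y = mean (\<tau> y) y" "(\<nexists>k. P k y) \<Longrightarrow> G y = h y"
  using first_tau[of k y] by (auto simp: G_def bt_def b_def F_def)

text \<open>Where no cell is ever selected all averages of \<open>h\<close> are at most
  \<open>t\<close>, hence so is \<open>h\<close> by differentiation along cells. On a selected cell
  \<open>G\<close> is the mean, bounded through the parent.\<close>

lemma G_bound: "AE y in lebesgue. norm (G y) \<le> 2 ^ CARD('d) * t"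
proof -
  have nP: "{y. \<nexists>k. P k y} \<in> sets lebesgue"
    using sets.compl_sets[OF sets_ex_adapted[where P = P, OF s P_adapted]]
    by (simp add: Compl_eq_Diff_UNIV[symmetric] Collect_neg_eq[symmetric])
  have "AE y in lebesgue. y \<in> {y. \<nexists>k. P k y} \<longrightarrow> ennreal (norm (h y)) \<le> ennreal t"
    by (rule cell_differentiation[OF s _ nP]) (use t in \<open>auto simp: P_def not_less\<close>)
  then show ?thesis
  proof eventually_elim
    case (elim y)
    show ?case
    proof (cases "\<exists>k. P k y")
      case True
      then obtain k where k: "P k y" by blast
      then show ?thesis
        using G_cases(1)[OF k] first_tau[OF k] by (auto intro: norm_mean_first simp: F_def)
    next
      case False
      then have "norm (h y) \<le> t" using elim t by (simp add: ennreal_le_iff)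
      moreover have "1 * t \<le> 2 ^ CARD('d) * t" using t by (intro mult_right_mono one_le_power) auto
      ultimately show ?thesis using G_cases(2)[OF False] by simp
    qed
  qed
qed

lemma G_nn: "(\<integral>\<^sup>+y. ennreal (norm (G y)) \<partial>lebesgue) \<le> ennreal I"
proof -
  let ?N = "{y. \<exists>k. P k y}"
  have N [measurable]: "?N \<in> sets lebesgue" by (rule sets_ex_adapted[where P = P, OF s P_adapted])
  have "(\<integral>\<^sup>+y. ennreal (norm (G y)) \<partial>lebesgue) \<le>
      (\<integral>\<^sup>+y. (\<Sum>k. indicator (F k) y * ennreal (norm (mean k y))) + ennreal (norm (h y)) * indicator (- ?N) y \<partial>lebesgue)"
  proof (rule nn_integral_mono)
    fix y
    show "ennreal (norm (G y)) \<le> (\<Sum>k. indicator (F k) y * ennreal (norm (mean k y))) + ennreal (norm (h y)) * indicator (- ?N) y"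
    proof (cases "\<exists>k. P k y")
      case True
      then obtain k where k: "P k y" by blast
      have "ennreal (norm (G y)) = indicator (F (\<tau> y)) y * ennreal (norm (mean (\<tau> y) y))"
        using G_cases(1)[OF k] first_tau[OF k] by (simp add: F_def)
      also have "\<dots> \<le> (\<Sum>k. indicator (F k) y * ennreal (norm (mean k y)))"
        by (rule ennreal_term_le_suminf)
      finally show ?thesis by (simp add: add_increasing2)
    next
      case False
      then show ?thesis using G_cases(2)[OF False] by (simp add: add_increasing)
    qed
  qed
  also have "\<dots> = (\<Sum>k. \<integral>\<^sup>+y. indicator (F k) y * ennreal (norm (mean k y)) \<partial>lebesgue) +
      (\<integral>\<^sup>+y. ennreal (norm (h y)) * indicator (- ?N) y \<partial>lebesgue)"
  proof (subst nn_integral_add)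
    show "(\<lambda>y. ennreal (norm (h y)) * indicator (- ?N) y) \<in> borel_measurable lebesgue"
      using sets.compl_sets[OF N] by (intro borel_measurable_times_ennreal borel_measurable_indicator) (auto simp: Compl_eq_Diff_UNIV)
  qed (auto intro!: nn_integral_suminf)
  also have "\<dots> \<le> (\<integral>\<^sup>+y. ennreal (norm (h y)) * indicator ?N y \<partial>lebesgue) + (\<integral>\<^sup>+y. ennreal (norm (h y)) * indicator (- ?N) y \<partial>lebesgue)"
    unfolding F_sum[symmetric] by (intro add_right_mono suminf_le mean_F_integral) auto
  also have "\<dots> = (\<integral>\<^sup>+y. ennreal (norm (h y)) * indicator ?N y + ennreal (norm (h y)) * indicator (- ?N) y \<partial>lebesgue)"
    using sets.compl_sets[OF N] by (intro nn_integral_add[symmetric] borel_measurable_times_ennreal borel_measurable_indicator) (auto simp: Compl_eq_Diff_UNIV)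
  also have "\<dots> = ennreal I"
    unfolding nn_h[symmetric] by (intro nn_integral_cong) (auto simp: indicator_def)
  finally show ?thesis .
qed

lemma G_L2: "L2_function G" and G_square: "(\<integral>y. (norm (G y))\<^sup>2 \<partial>lebesgue) \<le> 2 ^ CARD('d) * t * I"
proof -
  have Gi: "integrable lebesgue G"
    by (rule integrableI_bounded) (use G_nn in \<open>auto intro: le_less_trans\<close>)
  have sq: "AE y in lebesgue. (norm (G y))\<^sup>2 \<le> 2 ^ CARD('d) * t * norm (G y)"
    using G_bound by eventually_elim (simp add: power2_eq_square mult_right_mono)
  have "integrable lebesgue (\<lambda>y. (norm (G y))\<^sup>2)"
  proof (rule Bochner_Integration.integrable_bound)
    show "integrable lebesgue (\<lambda>y. 2 ^ CARD('d) * t * norm (G y))" using Gi by simp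
    show "AE y in lebesgue. norm ((norm (G y))\<^sup>2) \<le> norm (2 ^ CARD('d) * t * norm (G y))"
      using sq by eventually_elim (use t in simp)
  qed measurable
  then show "L2_function G" by (simp add: L2_function_def)
  have "(\<integral>y. (norm (G y))\<^sup>2 \<partial>lebesgue) \<le> (\<integral>y. 2 ^ CARD('d) * t * norm (G y) \<partial>lebesgue)"
    using \<open>integrable lebesgue (\<lambda>y. (norm (G y))\<^sup>2)\<close> Gi sq by (intro integral_mono_AE) auto
  also have "\<dots> = 2 ^ CARD('d) * t * (\<integral>y. norm (G y) \<partial>lebesgue)" by simp
  also have "\<dots> \<le> 2 ^ CARD('d) * t * I"
  proof (intro mult_left_mono)
    have "ennreal (\<integral>y. norm (G y) \<partial>lebesgue) \<le> ennreal I"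
      using G_nn Gi by (subst nn_integral_eq_integral[symmetric]) auto
    then show "(\<integral>y. norm (G y) \<partial>lebesgue) \<le> I" using I_nonneg by (simp add: ennreal_le_iff)
  qed (use t in auto)
  finally show "(\<integral>y. (norm (G y))\<^sup>2 \<partial>lebesgue) \<le> 2 ^ CARD('d) * t * I" .
qed

lemma bt_L2: "L2_function bt"
  using L2_add[OF nice_L2[OF h] G_L2, of 1 "-1"] by (simp add: G_def)

lemma bn_L2: "L2_function (bn n)"
  by (rule L2_bound[OF bt_L2]) (auto simp: bn_eq)

lemma e_bound: "norm (bt y - bn n y) \<le> norm (bt y)"
  by (auto simp: bn_eq)

lemma e_L2: "L2_function (\<lambda>y. bt y - bn n y)"
  by (rule L2_bound[OF bt_L2 _ e_bound]) measurable

text \<open>The tail of the bad part need only be small in L2, where \<open>T\<close> is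
  bounded.\<close>

lemma e_lim: "(\<lambda>n. \<integral>y. (norm (bt y - bn n y))\<^sup>2 \<partial>lebesgue) \<longlonglongrightarrow> 0"
proof -
  have "(\<lambda>n. \<integral>y. (norm (bt y - bn n y))\<^sup>2 \<partial>lebesgue) \<longlonglongrightarrow> (\<integral>y. 0 \<partial>(lebesgue :: (real^'d) measure))"
  proof (rule integral_dominated_convergence)
    show "integrable lebesgue (\<lambda>y. (norm (bt y))\<^sup>2)" using bt_L2 by (simp add: L2_function_def)
    have "(\<lambda>n. (norm (bt y - bn n y))\<^sup>2) \<longlonglongrightarrow> (norm (bt y - bt y))\<^sup>2" for y
      by (intro tendsto_intros bn_lim)
    then show "AE y in lebesgue. (\<lambda>n. (norm (bt y - bn n y))\<^sup>2) \<longlonglongrightarrow> 0" by simp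
    show "AE y in lebesgue. norm ((norm (bt y - bn n y))\<^sup>2) \<le> (norm (bt y))\<^sup>2" for n
      using power_mono[OF e_bound norm_ge_zero, of _ n 2] by auto
  qed measurable
  then show ?thesis by simp
qed

section \<open>The exceptional set and the kernel estimate outside it\<close>

definition \<Omega> :: "(real^'d) set" where
  "\<Omega> = {x. \<exists>k. \<exists>z\<in>dstar (sc k) x. first_time P k z}"

lemma \<Omega>_sets [measurable]: "\<Omega> \<in> sets lebesgue"
  unfolding \<Omega>_def by (rule emeasure_first_time_enlargement(2)[where P = P, OF s P_adapted])

lemma \<Omega>_measure: "emeasure lebesgue \<Omega> \<le> ennreal (kappa TYPE('d) * I / t)"
proof -
  have "emeasure lebesgue {x. \<exists>k. P k x} \<le> (\<integral>\<^sup>+x. ennreal (1 / t) * ennreal (norm (h x)) * indicator {x. \<exists>k. P k x} x \<partial>lebesgue)"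
  proof (rule maximal_weak_type[where P = P, OF s P_adapted])
    fix k x assume P: "P k x"
    have "emeasure lebesgue (dcell (sc k) x) = ennreal (1 / t) * (ennreal t * emeasure lebesgue (dcell (sc k) x))"
      using t by (simp add: mult.assoc[symmetric] ennreal_mult[symmetric])
    also have "\<dots> \<le> ennreal (1 / t) * (\<integral>\<^sup>+y\<in>dcell (sc k) x. ennreal (norm (h y)) \<partial>lebesgue)"
      using P by (intro mult_left_mono) (auto simp: P_def)
    also have "\<dots> = (\<integral>\<^sup>+y\<in>dcell (sc k) x. ennreal (1 / t) * ennreal (norm (h y)) \<partial>lebesgue)"
      using sc by (subst nn_integral_cmult[symmetric]) (auto simp: mult.assoc)
    finally show "emeasure lebesgue (dcell (sc k) x) \<le> (\<integral>\<^sup>+y\<in>dcell (sc k) x. ennreal (1 / t) * ennreal (norm (h y)) \<partial>lebesgue)" .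
  qed measurable
  also have "\<dots> \<le> (\<integral>\<^sup>+x. ennreal (1 / t) * ennreal (norm (h x)) \<partial>lebesgue)"
    by (intro nn_integral_mono) (auto simp: indicator_def)
  also have "\<dots> = ennreal (1 / t) * ennreal I"
    by (subst nn_integral_cmult) (auto simp: nn_h)
  finally have *: "emeasure lebesgue {x. \<exists>k. P k x} \<le> ennreal (1 / t) * ennreal I" .
  have "emeasure lebesgue \<Omega> \<le> ennreal (kappa TYPE('d)) * emeasure lebesgue {x. \<exists>k. P k x}"
    unfolding \<Omega>_def by (rule emeasure_first_time_enlargement(1)[where P = P, OF s P_adapted])
  also have "\<dots> \<le> ennreal (kappa TYPE('d)) * (ennreal (1 / t) * ennreal I)"
    by (intro mult_left_mono *) auto
  also have "\<dots> = ennreal (kappa TYPE('d) * I / t)"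
    using t I_nonneg by (simp add: ennreal_mult[symmetric] less_imp_le[OF kappa_pos])
  finally show ?thesis .
qed

definition majorant :: "nat \<Rightarrow> real^'d \<Rightarrow> ennreal" where
  "majorant n x = (\<Sum>k<n. \<Sum>l. ennreal (om l * (sc k / 2 ^ Suc l) ^ CARD('d)) *
      (\<integral>\<^sup>+y\<in>dstar (sc k / 2 ^ Suc l) x. ennreal (norm (b k y)) \<partial>lebesgue))"

lemma majorant_measurable [measurable]: "majorant n \<in> borel_measurable lebesgue"
proof -
  have "(\<lambda>x. \<integral>\<^sup>+y\<in>dstar (sc k / 2 ^ Suc l) x. ennreal (norm (b k y)) \<partial>lebesgue) \<in> borel_measurable lebesgue" for k l
    by (rule adapted_borel_measurable[OF _ adapted_dstar]) (use s in auto)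
  then show ?thesis unfolding majorant_def by measurable
qed

text \<open>For each annulus \<open>star_fubini\<close> returns the volume of the star, which
  cancels the factor in front up to \<open>kappa\<close>; what remains is \<open>om l\<close> times
  the L1 norm of \<open>b k\<close>.\<close>

lemma majorant_integral: "(\<integral>\<^sup>+x. majorant n x \<partial>lebesgue) \<le> ennreal (2 * kappa TYPE('d) * dini_const * I)"
proof -
  have m [measurable]: "(\<lambda>x. \<integral>\<^sup>+y\<in>dstar (sc k / 2 ^ Suc l) x. ennreal (norm (b k y)) \<partial>lebesgue) \<in> borel_measurable lebesgue" for k l
    by (rule adapted_borel_measurable[OF _ adapted_dstar]) (use s in auto)
  have "(\<integral>\<^sup>+x. majorant n x \<partial>lebesgue) = (\<Sum>k<n. \<Sum>l. ennreal (om l * (sc k / 2 ^ Suc l) ^ CARD('d)) *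
      (\<integral>\<^sup>+x. (\<integral>\<^sup>+y\<in>dstar (sc k / 2 ^ Suc l) x. ennreal (norm (b k y)) \<partial>lebesgue) \<partial>lebesgue))"
    unfolding majorant_def
    by (simp add: nn_integral_sum nn_integral_suminf nn_integral_cmult m del: power_Suc)
  also have "\<dots> = (\<Sum>k<n. \<Sum>l. ennreal (om l) * (ennreal (kappa TYPE('d)) * (\<integral>\<^sup>+y. ennreal (norm (b k y)) \<partial>lebesgue)))"
  proof (intro sum.cong refl suminf_cong)
    fix k l
    let ?r = "sc k / 2 ^ Suc l"
    have r: "?r > 0" using s by simp
    have "ennreal (om l * ?r ^ CARD('d)) * (\<integral>\<^sup>+x. (\<integral>\<^sup>+y\<in>dstar ?r x. ennreal (norm (b k y)) \<partial>lebesgue) \<partial>lebesgue) =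
        ennreal (om l * ?r ^ CARD('d)) * (ennreal (kappa TYPE('d) / ?r ^ CARD('d)) * (\<integral>\<^sup>+y. ennreal (norm (b k y)) \<partial>lebesgue))"
      by (subst star_fubini[OF r]) auto
    also have "ennreal (om l * ?r ^ CARD('d)) * (ennreal (kappa TYPE('d) / ?r ^ CARD('d)) * (\<integral>\<^sup>+y. ennreal (norm (b k y)) \<partial>lebesgue)) =
        ennreal (om l * ?r ^ CARD('d) * (kappa TYPE('d) / ?r ^ CARD('d))) * (\<integral>\<^sup>+y. ennreal (norm (b k y)) \<partial>lebesgue)"
      using r om_nonneg[of l] by (subst ennreal_mult) (auto simp: mult.assoc less_imp_le[OF kappa_pos])
    also have "om l * ?r ^ CARD('d) * (kappa TYPE('d) / ?r ^ CARD('d)) = om l * kappa TYPE('d)"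
      using r by (metis (no_types, lifting) mult.assoc nonzero_mult_div_cancel_left power_not_zero less_irrefl times_divide_eq_right)
    finally show "ennreal (om l * ?r ^ CARD('d)) * (\<integral>\<^sup>+x. (\<integral>\<^sup>+y\<in>dstar ?r x. ennreal (norm (b k y)) \<partial>lebesgue) \<partial>lebesgue) =
        ennreal (om l) * (ennreal (kappa TYPE('d)) * (\<integral>\<^sup>+y. ennreal (norm (b k y)) \<partial>lebesgue))"
      using om_nonneg[of l] by (simp add: ennreal_mult mult.assoc less_imp_le[OF kappa_pos])
  qed
  also have "\<dots> = (\<Sum>k<n. (\<Sum>l. ennreal (om l)) * (ennreal (kappa TYPE('d)) * (\<integral>\<^sup>+y. ennreal (norm (b k y)) \<partial>lebesgue)))"
    by (intro sum.cong refl ennreal_suminf_multc)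
  also have "\<dots> = ennreal dini_const * ennreal (kappa TYPE('d)) * (\<Sum>k<n. \<integral>\<^sup>+y. ennreal (norm (b k y)) \<partial>lebesgue)"
    by (simp add: suminf_om sum_distrib_left mult.assoc)
  also have "\<dots> \<le> ennreal dini_const * ennreal (kappa TYPE('d)) * (\<Sum>k. \<integral>\<^sup>+y. ennreal (norm (b k y)) \<partial>lebesgue)"
    by (intro mult_left_mono sum_le_suminf) auto
  also have "\<dots> \<le> ennreal dini_const * ennreal (kappa TYPE('d)) * ennreal (2 * I)"
    by (intro mult_left_mono b_sum) auto
  also have "\<dots> = ennreal (2 * kappa TYPE('d) * dini_const * I)"
    using dini_const_nonneg I_nonneg by (simp add: ennreal_mult[symmetric] less_imp_le[OF kappa_pos] mult_ac)
  finally show ?thesis .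
qed

lemma far_from_F:
  assumes x: "x \<notin> \<Omega>" and y: "y \<in> F k" shows "x \<notin> dstar (sc k) y" "norm (x - y) > 2 * real CARD('d) / sc k"
proof -
  show *: "x \<notin> dstar (sc k) y" using x y by (auto simp: \<Omega>_def F_def dstar_sym)
  show "norm (x - y) > 2 * real CARD('d) / sc k"
    using not_dstar_dist[OF sc *] by (simp add: norm_minus_commute)
qed

text \<open>Since \<open>b k\<close> has mean zero on cells, the kernel value at the corner of the
  cell of \<open>y\<close> may be subtracted. The difference is an oscillation of the kernel in its
  second variable, away from the star of \<open>y\<close> because \<open>x\<close> is not in
  \<open>\<Omega>\<close>.\<close>

lemma T_bn_bound:
  "AE x in lebesgue. x \<notin> \<Omega> \<longrightarrow> ennreal (norm (T (bn n) x)) \<le> majorant n x"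
  using K_rep[OF bn_L2[of n]]
proof eventually_elim
  case (elim x)
  show ?case
  proof
    assume x: "x \<notin> \<Omega>"
    have d: "real CARD('d) > 0" by simp
    have "x \<notin> closure {y. bn n y \<noteq> 0}"
    proof
      assume "x \<in> closure {y. bn n y \<noteq> 0}"
      moreover have "2 * real CARD('d) / sc n > 0" using s by simp
      ultimately obtain y where y: "bn n y \<noteq> 0" "dist y x < 2 * real CARD('d) / sc n"
        unfolding closure_approachable by blast
      then obtain k where k: "k < n" "b k y \<noteq> 0" unfolding bn_def by (meson lessThan_iff sum.neutral)
      then have "y \<in> F k" by (auto simp: b_def indicator_def split: if_splits)
      from far_from_F(2)[OF x this] y(2) have "2 * real CARD('d) / sc k < 2 * real CARD('d) / sc n"
        by (simp add: dist_norm norm_minus_commute)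
      moreover have "2 * real CARD('d) / sc n \<le> 2 * real CARD('d) / sc k"
        using s k(1) by (intro divide_left_mono mult_right_mono power_increasing) auto
      ultimately show False by simp
    qed
    then have T: "T (bn n) x = (\<integral>y. K x y * bn n y \<partial>lebesgue)" using elim by blast
    have bd: "norm (K x z) \<le> \<bar>cK\<bar> / (2 * real CARD('d) / sc k) ^ CARD('d)" if "norm (x - z) > 2 * real CARD('d) / sc k" for k z
    proof -
      have p: "2 * real CARD('d) / sc k > 0" using s by simp
      then have "x \<noteq> z" using that by auto
      then have "norm (K x z) \<le> cK / norm (x - z) ^ CARD('d)" by (rule K_size)
      also have "\<dots> \<le> \<bar>cK\<bar> / norm (x - z) ^ CARD('d)" by (intro divide_right_mono) auto
      also have "\<dots> \<le> \<bar>cK\<bar> / (2 * real CARD('d) / sc k) ^ CARD('d)"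
        using p that by (intro divide_left_mono power_mono mult_pos_pos zero_less_power) auto
      finally show ?thesis .
    qed
    have corner_far: "norm (x - corner (sc k) y) > 2 * real CARD('d) / sc k" if y: "y \<in> F k" for k y
    proof -
      have "corner (sc k) y \<in> F k" using F_cell[OF corner_in_dcell[OF sc]] y by simp
      then show ?thesis by (rule far_from_F(2)[OF x])
    qed
    have cm [measurable]: "(\<lambda>y. K x (corner (sc k) y)) \<in> borel_measurable lebesgue" for k
      by (rule adapted_borel_measurable[OF sc adapted_comp[OF adapted_corner]])
    have i1: "integrable lebesgue (\<lambda>y. K x y * b k y)" for k
    proof (rule Bochner_Integration.integrable_bound)
      show "integrable lebesgue (\<lambda>y. \<bar>cK\<bar> / (2 * real CARD('d) / sc k) ^ CARD('d) * norm (b k y))"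
        using b_integrable[of k] by simp
      show "AE y in lebesgue. norm (K x y * b k y) \<le> norm (\<bar>cK\<bar> / (2 * real CARD('d) / sc k) ^ CARD('d) * norm (b k y))"
      proof (intro AE_I2)
        fix y
        show "norm (K x y * b k y) \<le> norm (\<bar>cK\<bar> / (2 * real CARD('d) / sc k) ^ CARD('d) * norm (b k y))"
        proof (cases "y \<in> F k")
          case True
          show ?thesis using mult_right_mono[OF bd[OF far_from_F(2)[OF x True]] norm_ge_zero[of "b k y"]] s
            by (simp add: norm_mult abs_mult)
        qed (simp add: b_def)
      qed
    qed measurable
    have i2: "integrable lebesgue (\<lambda>y. K x (corner (sc k) y) * b k y)" for k
    proof (rule Bochner_Integration.integrable_bound)
      show "integrable lebesgue (\<lambda>y. \<bar>cK\<bar> / (2 * real CARD('d) / sc k) ^ CARD('d) * norm (b k y))"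
        using b_integrable[of k] by simp
      show "AE y in lebesgue. norm (K x (corner (sc k) y) * b k y) \<le> norm (\<bar>cK\<bar> / (2 * real CARD('d) / sc k) ^ CARD('d) * norm (b k y))"
      proof (intro AE_I2)
        fix y
        show "norm (K x (corner (sc k) y) * b k y) \<le> norm (\<bar>cK\<bar> / (2 * real CARD('d) / sc k) ^ CARD('d) * norm (b k y))"
        proof (cases "y \<in> F k")
          case True
          show ?thesis using mult_right_mono[OF bd[OF corner_far[OF True]] norm_ge_zero[of "b k y"]] s
            by (simp add: norm_mult abs_mult)
        qed (simp add: b_def)
      qed
    qed measurable
    have z: "(\<integral>y. K x (corner (sc k) y) * b k y \<partial>lebesgue) = 0" for k
      by (rule integral_adapted_zero[OF sc adapted_comp[OF adapted_corner] i2 b_cell_zero])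
    have each: "ennreal (norm (\<integral>y. K x y * b k y \<partial>lebesgue)) \<le> (\<Sum>l. ennreal (om l * (sc k / 2 ^ Suc l) ^ CARD('d)) *
      (\<integral>\<^sup>+y\<in>dstar (sc k / 2 ^ Suc l) x. ennreal (norm (b k y)) \<partial>lebesgue))" for k
    proof -
      let ?a = "\<lambda>l. ennreal (om l * (sc k / 2 ^ Suc l) ^ CARD('d))"
      have r: "sc k / 2 ^ Suc l > 0" for l using s by simp
      have "(\<integral>y. K x y * b k y \<partial>lebesgue) = (\<integral>y. K x y * b k y - K x (corner (sc k) y) * b k y \<partial>lebesgue)"
        using i1[of k] i2[of k] z[of k] by simp
      then have "ennreal (norm (\<integral>y. K x y * b k y \<partial>lebesgue)) \<le>
          (\<integral>\<^sup>+y. ennreal (norm (K x y * b k y - K x (corner (sc k) y) * b k y)) \<partial>lebesgue)"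
        using integral_norm_bound_ennreal[OF Bochner_Integration.integrable_diff[OF i1[of k] i2[of k]]] by simp
      also have "\<dots> \<le> (\<integral>\<^sup>+y. (\<Sum>l. ?a l * (ennreal (norm (b k y)) * indicator (dstar (sc k / 2 ^ Suc l) x) y)) \<partial>lebesgue)"
      proof (rule nn_integral_mono)
        fix y
        show "ennreal (norm (K x y * b k y - K x (corner (sc k) y) * b k y)) \<le>
            (\<Sum>l. ?a l * (ennreal (norm (b k y)) * indicator (dstar (sc k / 2 ^ Suc l) x) y))"
        proof (cases "y \<in> F k")
          case True
          have "ennreal (norm (K x y * b k y - K x (corner (sc k) y) * b k y)) =
              ennreal (norm (K x y - K x (corner (sc k) y))) * ennreal (norm (b k y))"
            by (simp add: ennreal_mult[symmetric] norm_mult[symmetric] left_diff_distrib)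
          also have "\<dots> \<le> ennreal (norm (K y x - K (corner (sc k) y) x) + norm (K x y - K x (corner (sc k) y))) * ennreal (norm (b k y))"
            by (intro mult_right_mono ennreal_leI) auto
          \<comment> \<open>The oscillation estimate is centred at \<open>y\<close>; symmetry of the
            star relation turns it into a condition on the star of \<open>x\<close>.\<close>
          also have "\<dots> \<le> (\<Sum>l. ?a l * indicator (dstar (sc k / 2 ^ Suc l) y) x) * ennreal (norm (b k y))"
            by (intro mult_right_mono K_oscillation[OF sc corner_in_dcell[OF sc] far_from_F(1)[OF x True]]) auto
          also have "\<dots> = (\<Sum>l. ?a l * (ennreal (norm (b k y)) * indicator (dstar (sc k / 2 ^ Suc l) x) y))"
            unfolding ennreal_suminf_multc[symmetric]
            by (intro suminf_cong) (simp add: indicator_def dstar_sym[of x] mult_ac)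
          finally show ?thesis .
        qed (simp add: b_def)
      qed
      also have "\<dots> = (\<Sum>l. \<integral>\<^sup>+y. ?a l * (ennreal (norm (b k y)) * indicator (dstar (sc k / 2 ^ Suc l) x) y) \<partial>lebesgue)"
        using r by (intro nn_integral_suminf borel_measurable_times_ennreal borel_measurable_indicator dstar_sets) auto
      also have "\<dots> = (\<Sum>l. ?a l * (\<integral>\<^sup>+y\<in>dstar (sc k / 2 ^ Suc l) x. ennreal (norm (b k y)) \<partial>lebesgue))"
        using r by (intro suminf_cong nn_integral_cmult borel_measurable_times_ennreal borel_measurable_indicator dstar_sets) auto
      finally show ?thesis .
    qed
    have "T (bn n) x = (\<Sum>k<n. \<integral>y. K x y * b k y \<partial>lebesgue)"
      unfolding T bn_def sum_distrib_left using i1 by (intro Bochner_Integration.integral_sum) auto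
    then have "ennreal (norm (T (bn n) x)) \<le> ennreal (\<Sum>k<n. norm (\<integral>y. K x y * b k y \<partial>lebesgue))"
      by (simp add: norm_sum ennreal_leI)
    also have "\<dots> = (\<Sum>k<n. ennreal (norm (\<integral>y. K x y * b k y \<partial>lebesgue)))"
      by (rule sum_ennreal[symmetric]) simp
    also have "\<dots> \<le> majorant n x" unfolding majorant_def by (intro sum_mono each)
    finally show "ennreal (norm (T (bn n) x)) \<le> majorant n x" .
  qed
qed

text \<open>The level is split into thirds: good part, first \<open>n\<close> generations of the bad
  part outside \<open>\<Omega>\<close>, and L2 tail. The \<open>9\<close> is the square of
  \<open>3\<close> in Chebyshev's inequality on L2, the \<open>6\<close> is \<open>3\<close> times
  the \<open>2\<close> of \<open>majorant_integral\<close>.\<close>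

lemma weak_type_step:
  "emeasure lebesgue {x. norm (T h x) > t} \<le>
    ennreal ((9 * B\<^sup>2 * 2 ^ CARD('d) + kappa TYPE('d) + 6 * kappa TYPE('d) * dini_const) * I / t +
      9 * B\<^sup>2 / t\<^sup>2 * (\<integral>y. (norm (bt y - bn n y))\<^sup>2 \<partial>lebesgue))"
proof -
  let ?E = "\<integral>y. (norm (bt y - bn n y))\<^sup>2 \<partial>lebesgue"
  let ?A = "{x. norm (T G x) > t / 3}" and ?C = "{x. ennreal (t / 3) \<le> majorant n x}"
    and ?D = "{x. norm (T (\<lambda>y. bt y - bn n y) x) > t / 3}"
  have t3: "t / 3 > 0" using t by simp
  note [measurable] = T_measurable[OF G_L2] T_measurable[OF e_L2[of n]]
  have "{x \<in> space lebesgue. norm (T G x) > t / 3} \<in> sets lebesgue"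
    "{x \<in> space lebesgue. ennreal (t / 3) \<le> majorant n x} \<in> sets lebesgue"
    "{x \<in> space lebesgue. norm (T (\<lambda>y. bt y - bn n y) x) > t / 3} \<in> sets lebesgue"
    by measurable
  then have sets: "?A \<in> sets lebesgue" "?C \<in> sets lebesgue" "?D \<in> sets lebesgue" by simp_all
  have a1: "AE x in lebesgue. T (\<lambda>y. bn n y + (bt y - bn n y)) x = T (bn n) x + T (\<lambda>y. bt y - bn n y) x"
    by (rule T_add[OF bn_L2 e_L2])
  have a2: "AE x in lebesgue. T (\<lambda>y. G y + bt y) x = T G x + T bt x"
    by (rule T_add[OF G_L2 bt_L2])
  have ae: "AE x in lebesgue. x \<in> {x. norm (T h x) > t} \<longrightarrow> x \<in> ?A \<union> \<Omega> \<union> ?C \<union> ?D"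
    using a1 a2 T_bn_bound[of n]
  proof eventually_elim
    case (elim x)
    have eq: "T h x = T G x + T (bn n) x + T (\<lambda>y. bt y - bn n y) x"
      using elim(1,2) by (simp add: G_def)
    show ?case
    proof (rule impI, rule ccontr)
      assume "x \<in> {x. norm (T h x) > t}" and "x \<notin> ?A \<union> \<Omega> \<union> ?C \<union> ?D"
      then have x: "norm (T h x) > t" "norm (T G x) \<le> t / 3" "x \<notin> \<Omega>" "majorant n x < ennreal (t / 3)"
        "norm (T (\<lambda>y. bt y - bn n y) x) \<le> t / 3" by auto
      have "ennreal (norm (T (bn n) x)) < ennreal (t / 3)" using elim(3) x(3,4) by (auto intro: le_less_trans)
      then have "norm (T (bn n) x) < t / 3" by (simp add: ennreal_less_iff)
      moreover have "norm (T h x) \<le> norm (T G x) + norm (T (bn n) x) + norm (T (\<lambda>y. bt y - bn n y) x)"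
        unfolding eq by (meson norm_triangle_mono order_refl norm_triangle_ineq)
      ultimately show False using x by linarith
    qed
  qed
  have C: "emeasure lebesgue ?C \<le> ennreal (6 * kappa TYPE('d) * dini_const * I / t)"
  proof -
    have "ennreal (t / 3) * emeasure lebesgue ?C \<le> (\<integral>\<^sup>+x. majorant n x \<partial>lebesgue)"
      using sets by (subst nn_integral_cmult_indicator[symmetric])
        (auto intro!: nn_integral_mono simp: indicator_def)
    also have "\<dots> \<le> ennreal (2 * kappa TYPE('d) * dini_const * I)" by (rule majorant_integral)
    finally have "ennreal (3 / t) * (ennreal (t / 3) * emeasure lebesgue ?C) \<le> ennreal (3 / t) * ennreal (2 * kappa TYPE('d) * dini_const * I)"
      by (intro mult_left_mono) auto
    then show ?thesis
      using t I_nonneg dini_const_nonneg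
      by (simp add: mult.assoc[symmetric] ennreal_mult[symmetric] less_imp_le[OF kappa_pos])
  qed
  have "emeasure lebesgue {x. norm (T h x) > t} \<le> emeasure lebesgue (?A \<union> \<Omega> \<union> ?C \<union> ?D)"
    using sets by (intro emeasure_mono_AE[OF ae]) auto
  also have "\<dots> \<le> emeasure lebesgue ?A + emeasure lebesgue \<Omega> + emeasure lebesgue ?C + emeasure lebesgue ?D"
    using sets by (intro order_trans[OF emeasure_subadditive] add_right_mono) auto
  also have "\<dots> \<le> ennreal (B\<^sup>2 / (t / 3)\<^sup>2 * (2 ^ CARD('d) * t * I)) + ennreal (kappa TYPE('d) * I / t) +
      ennreal (6 * kappa TYPE('d) * dini_const * I / t) + ennreal (B\<^sup>2 / (t / 3)\<^sup>2 * ?E)"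
    using order_trans[OF T_markov[OF G_L2 t3] ennreal_leI[OF mult_left_mono[OF G_square]]]
    by (intro add_mono C \<Omega>_measure T_markov[OF e_L2 t3]) auto
  also have "\<dots> = ennreal (B\<^sup>2 / (t / 3)\<^sup>2 * (2 ^ CARD('d) * t * I) + kappa TYPE('d) * I / t +
      6 * kappa TYPE('d) * dini_const * I / t + B\<^sup>2 / (t / 3)\<^sup>2 * ?E)"
    using t I_nonneg dini_const_nonneg less_imp_le[OF kappa_pos[where 'd='d]]
    by (subst ennreal_plus[symmetric], simp, simp)+ (auto simp del: ennreal_plus)
  also have "B\<^sup>2 / (t / 3)\<^sup>2 * (2 ^ CARD('d) * t * I) + kappa TYPE('d) * I / t +
      6 * kappa TYPE('d) * dini_const * I / t + B\<^sup>2 / (t / 3)\<^sup>2 * ?E =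
    (9 * B\<^sup>2 * 2 ^ CARD('d) + kappa TYPE('d) + 6 * kappa TYPE('d) * dini_const) * I / t + 9 * B\<^sup>2 / t\<^sup>2 * ?E"
    using t by (simp add: field_simps power2_eq_square)
  finally show ?thesis .
qed

lemma weak_type_at:
  "emeasure lebesgue {x. norm (T h x) > t} \<le>
    ennreal ((9 * B\<^sup>2 * 2 ^ CARD('d) + kappa TYPE('d) + 6 * kappa TYPE('d) * dini_const) * I / t)"
proof -
  let ?c = "(9 * B\<^sup>2 * 2 ^ CARD('d) + kappa TYPE('d) + 6 * kappa TYPE('d) * dini_const) * I / t"
  have "(\<lambda>n. ennreal (?c + 9 * B\<^sup>2 / t\<^sup>2 * (\<integral>y. (norm (bt y - bn n y))\<^sup>2 \<partial>lebesgue))) \<longlonglongrightarrow> ennreal (?c + 9 * B\<^sup>2 / t\<^sup>2 * 0)"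
    by (intro tendsto_ennrealI tendsto_intros e_lim)
  then have "(\<lambda>n. ennreal (?c + 9 * B\<^sup>2 / t\<^sup>2 * (\<integral>y. (norm (bt y - bn n y))\<^sup>2 \<partial>lebesgue))) \<longlonglongrightarrow> ennreal ?c"
    by simp
  then show ?thesis by (rule LIMSEQ_le_const) (use weak_type_step in blast)
qed

end

context cz_op
begin

definition weak_const :: real where
  "weak_const = 9 * B\<^sup>2 * 2 ^ CARD('d) + kappa TYPE('d) + 6 * kappa TYPE('d) * dini_const"

lemma weak_const_pos: "0 < weak_const"
  unfolding weak_const_def using kappa_pos[where 'd='d] dini_const_nonneg
  by (intro add_pos_nonneg add_nonneg_pos) (auto simp: less_imp_le)

lemma weak_type:
  assumes h: "nice h" and t: "t > 0"
  shows "emeasure lebesgue {x. norm (T h x) > t} \<le> ennreal (weak_const * (\<integral>x. norm (h x) \<partial>lebesgue) / t)"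
proof -
  define I where "I = (\<integral>x. norm (h x) \<partial>lebesgue)"
  have I: "0 \<le> I" by (simp add: I_def)
  \<comment> \<open>Any scale with \<open>s ^ d * I \<le> t\<close> would do. The cap at one gives
    \<open>s ^ d \<le> s\<close>, and \<open>I + 1\<close> avoids dividing by zero.\<close>
  define s where "s = min 1 (t / (I + 1))"
  have s: "0 < s" "s \<le> 1" "s \<le> t / (I + 1)" using t I by (auto simp: s_def)
  have "s ^ CARD('d) \<le> s ^ 1" using s by (intro power_decreasing) (auto simp: Suc_leI)
  then have "s ^ CARD('d) * I \<le> t / (I + 1) * I" using s I by (intro mult_right_mono) auto
  also have "\<dots> \<le> t" using t I by (simp add: field_simps)
  finally have top: "s ^ CARD('d) * I \<le> t" .
  interpret cz_decomposition T K cK \<omega> B h s t I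
    by unfold_locales (use h s t top in \<open>auto simp: I_def\<close>)
  show ?thesis using weak_type_at unfolding weak_const_def I_def .
qed

text \<open>Unlike the weak type inequality itself, this form survives the degenerate level \<open>a = 0\<close>.\<close>

lemma weak_type_level:
  assumes h: "nice h" and c: "c > 0" and m: "m \<ge> 0" and a: "a \<ge> 0"
    and le: "(\<integral>x. norm (h x) \<partial>lebesgue) \<le> a * m"
  shows "emeasure lebesgue {x. norm (T h x) > c * a} \<le> ennreal (weak_const / c * m)"
proof (cases "a = 0")
  case True
  then have "(\<integral>x. norm (h x) \<partial>lebesgue) = 0"
    using le by (intro antisym Bochner_Integration.integral_nonneg) auto
  then have "AE x in lebesgue. norm (h x) = 0"
    using nice_integrable[OF h] by (subst (asm) integral_nonneg_eq_0_iff_AE) auto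
  then have "AE x in lebesgue. T h x = 0" by (intro T_null[OF nice_L2[OF h]]) simp
  then have "emeasure lebesgue {x \<in> space lebesgue. norm (T h x) > c * a} = 0"
    using True by (intro emeasure_eq_0_AE) auto
  then show ?thesis by simp
next
  case False
  then have ca: "c * a > 0" using c a by simp
  have "weak_const * (\<integral>x. norm (h x) \<partial>lebesgue) / (c * a) \<le> weak_const * (a * m) / (c * a)"
    using ca weak_const_pos by (intro divide_right_mono mult_left_mono le) auto
  also have "\<dots> = weak_const / c * m" using False c by simp
  finally show ?thesis using weak_type[OF h ca] by (meson ennreal_leI order_trans)
qed

end

section \<open>A reverse Hoelder inequality\<close>

text \<open>Concavity of \<open>t \<mapsto> t powr e\<close>; this makes the sum over the times at which the running
  maximum increases telescope.\<close>

lemma powr_increment_le: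
  fixes x y e C :: real
  assumes x: "0 < x" "x \<le> y" "y \<le> C * x" and e: "0 < e" "e \<le> 1"
  shows "y * (y powr e - x powr e) \<le> C * e * (y powr (1 + e) - x powr (1 + e))"
proof -
  have y: "y > 0" using x by linarith
  have C: "C \<ge> 0" using x y by (smt (verit) mult_nonneg_nonneg mult_le_0_iff)
  have "(y / x) powr e * 1 powr (1 - e) \<le> e * (y / x) + (1 - e) * 1"
    using x y e by (intro Youngs_inequality_0) auto
  then have "(y / x) powr e \<le> 1 + e * (y / x - 1)" by (simp add: algebra_simps)
  then have "y powr e / x powr e \<le> 1 + e * (y / x - 1)" using x y by (simp add: powr_divide)
  then have "y powr e \<le> x powr e * (1 + e * (y / x - 1))"
    using x by (simp add: pos_divide_le_eq mult.commute)
  then have 1: "y powr e - x powr e \<le> x powr e * (e * (y / x - 1))" by (simp add: algebra_simps)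
  have mono: "x powr e \<le> y powr e" using x e by (intro powr_mono2) auto
  have "y * (y powr e - x powr e) \<le> C * x * (y powr e - x powr e)"
    using x mono by (intro mult_right_mono) auto
  also have "\<dots> \<le> C * x * (x powr e * (e * (y / x - 1)))"
    using 1 C x by (intro mult_left_mono) auto
  also have "\<dots> = C * e * (y * x powr e - x * x powr e)" using x by (simp add: field_simps)
  also have "\<dots> \<le> C * e * (y * y powr e - x * x powr e)"
    using C e y mono by (intro mult_left_mono diff_right_mono) auto
  also have "\<dots> = C * e * (y powr (1 + e) - x powr (1 + e))"
    using x y by (simp add: powr_add)
  finally show ?thesis .
qed

text \<open>The constants of a weight are defined with closed cubes while cells are half-open; the
  two differ by a null set.\<close>

lemma dcell_closure:
  fixes x :: "real^'d::finite"
  assumes s: "s > 0"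
  defines "C \<equiv> cbox (corner s x) (corner s x + vec (1 / s))"
  shows "C \<in> cubes" "dcell s x \<subseteq> C" "emeasure lebesgue C = emeasure lebesgue (dcell s x)"
    "u \<in> borel_measurable lebesgue \<Longrightarrow> (\<integral>\<^sup>+y\<in>C. u y \<partial>lebesgue) = (\<integral>\<^sup>+y\<in>dcell s x. u y \<partial>lebesgue)"
proof -
  have s1: "1 / s > 0" using s by simp
  note hb = halfopen_box_measure[OF s1, of "corner s x", folded dcell_box[OF s]]
  show "C \<in> cubes" unfolding C_def cubes_def using s1 by blast
  show sub: "dcell s x \<subseteq> C" unfolding C_def using hb(3) dcell_box[OF s] by metis
  show eq: "emeasure lebesgue C = emeasure lebesgue (dcell s x)"
    unfolding C_def using hb(2,4) dcell_box[OF s] by metis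
  have "C - dcell s x \<in> null_sets lebesgue"
  proof -
    have "emeasure lebesgue (C - dcell s x) = emeasure lebesgue C - emeasure lebesgue (dcell s x)"
      using sub s by (intro emeasure_Diff) (auto simp: emeasure_dcell C_def)
    then show ?thesis using eq s by (auto simp: null_sets_def C_def emeasure_dcell)
  qed
  then have "AE y in lebesgue. y \<notin> C - dcell s x" by (rule AE_not_in)
  then show "(\<integral>\<^sup>+y\<in>C. u y \<partial>lebesgue) = (\<integral>\<^sup>+y\<in>dcell s x. u y \<partial>lebesgue)"
    using sub by (intro nn_integral_cong_AE) (auto elim!: eventually_mono simp: indicator_def)
qed

text \<open>The exponent \<open>e\<close> is so small against \<open>1 / A\<close> that the
  contribution of the jumps of the running maximum can be absorbed into the left-hand side.\<close>

locale fw_weight =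
  fixes w :: "real^'d::finite \<Rightarrow> real" and s A e :: real
  assumes wm [measurable]: "w \<in> borel_measurable lebesgue" and w0: "\<And>x. 0 \<le> w x"
    and wpos: "AE x in lebesgue. 0 < w x"
    and wint: "\<And>x. (\<integral>\<^sup>+y\<in>dcell s x. ennreal (w y) \<partial>lebesgue) < \<infinity>"
    and s: "s > 0" and FW: "A_infinity_const w \<le> ennreal A" and A: "A \<ge> 1"
    and e: "e > 0" "2 ^ CARD('d) * e * A \<le> 1 / 2"
begin

lemma e1: "e \<le> 1"
proof -
  have "1 * e * 1 \<le> 2 ^ CARD('d) * e * A" using A e by (intro mult_mono) auto
  then show ?thesis using e(2) unfolding mult_1 mult_1_right by linarith
qed

section \<open>Averages along the grid and their running maximum\<close>

abbreviation sc :: "nat \<Rightarrow> real" where "sc k \<equiv> 2 ^ k * s"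

lemma sc: "sc k > 0" using s by simp

definition X :: "nat \<Rightarrow> real^'d \<Rightarrow> real" where
  "X k x = sc k ^ CARD('d) * enn2real (\<integral>\<^sup>+y\<in>dcell (sc k) x. ennreal (w y) \<partial>lebesgue)"

lemma X_adapted: "adapted (sc k) (X k)"
  unfolding X_def by (rule adapted_dcell)

lemma X_measurable [measurable]: "X k \<in> borel_measurable lebesgue"
  by (rule adapted_borel_measurable[OF sc X_adapted])

lemma cell_fin: "(\<integral>\<^sup>+y\<in>dcell (sc k) x. ennreal (w y) \<partial>lebesgue) < \<infinity>"
proof -
  have "(\<integral>\<^sup>+y\<in>dcell (sc k) x. ennreal (w y) \<partial>lebesgue) \<le> (\<integral>\<^sup>+y\<in>dcell s x. ennreal (w y) \<partial>lebesgue)"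
    using dcell_pow[of k s x] by (intro nn_integral_mono) (auto simp: indicator_def)
  then show ?thesis using wint[of x] by (rule le_less_trans)
qed

lemma X_cell: "ennreal (X k x) * emeasure lebesgue (dcell (sc k) x) = (\<integral>\<^sup>+y\<in>dcell (sc k) x. ennreal (w y) \<partial>lebesgue)"
proof -
  have "ennreal (X k x) * emeasure lebesgue (dcell (sc k) x) = ennreal (enn2real (\<integral>\<^sup>+y\<in>dcell (sc k) x. ennreal (w y) \<partial>lebesgue))"
    using s by (simp add: X_def emeasure_dcell[OF sc] ennreal_mult[symmetric])
  then show ?thesis using cell_fin[of k x] by simp
qed

lemma X_nonneg: "0 \<le> X k x"
  using s by (simp add: X_def)

lemma X_pos: "0 < X k x"
proof (rule ccontr)
  assume "\<not> 0 < X k x"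
  then have "X k x = 0" using X_nonneg[of k x] by simp
  then have "(\<integral>\<^sup>+y\<in>dcell (sc k) x. ennreal (w y) \<partial>lebesgue) = 0" using X_cell[of k x] by simp
  then have "AE y in lebesgue. ennreal (w y) * indicator (dcell (sc k) x) y = 0"
    using sc by (subst (asm) nn_integral_0_iff_AE) auto
  with wpos have "AE y in lebesgue. y \<notin> dcell (sc k) x"
    by eventually_elim (auto simp: indicator_def)
  then have "emeasure lebesgue {y \<in> space lebesgue. y \<in> dcell (sc k) x} = 0"
    by (intro emeasure_eq_0_AE)
  then show False using s by (simp add: emeasure_dcell[OF sc])
qed

lemma X_step: "X (Suc k) x \<le> 2 ^ CARD('d) * X k x"
proof -
  have "(\<integral>\<^sup>+y\<in>dcell (sc (Suc k)) x. ennreal (w y) \<partial>lebesgue) \<le> (\<integral>\<^sup>+y\<in>dcell (sc k) x. ennreal (w y) \<partial>lebesgue)"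
    using dcell_mono[of k "Suc k" s x] by (intro nn_integral_mono) (auto simp: indicator_def)
  then have "enn2real (\<integral>\<^sup>+y\<in>dcell (sc (Suc k)) x. ennreal (w y) \<partial>lebesgue) \<le> enn2real (\<integral>\<^sup>+y\<in>dcell (sc k) x. ennreal (w y) \<partial>lebesgue)"
    using cell_fin[of k x] by (intro enn2real_mono) auto
  moreover have "sc (Suc k) ^ CARD('d) = 2 ^ CARD('d) * sc k ^ CARD('d)" by (simp add: power_mult_distrib)
  ultimately show ?thesis
    unfolding X_def using s by (simp add: mult.assoc mult_left_mono)
qed

text \<open>The dyadic maximal function stopped after \<open>n\<close> generations. Stopping keeps
  the integrals finite, without which nothing could be absorbed.\<close>

fun M :: "nat \<Rightarrow> real^'d \<Rightarrow> real" where
  "M 0 x = X 0 x" | "M (Suc n) x = max (M n x) (X (Suc n) x)"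

lemma M_adapted: "adapted (sc n) (M n)"
proof (induction n)
  case 0
  show ?case using X_adapted[of 0] by (simp add: adapted_def)
next
  case (Suc n)
  have "adapted (sc (Suc n)) (M n)" by (rule adapted_mono[OF Suc]) simp
  then show ?case using X_adapted[of "Suc n"] unfolding adapted_def by simp
qed

lemma M_measurable [measurable]: "M n \<in> borel_measurable lebesgue"
  by (rule adapted_borel_measurable[OF sc M_adapted])

lemma X_le_M: "k \<le> n \<Longrightarrow> X k x \<le> M n x"
  by (induction n) (auto simp: le_Suc_eq)

lemma M_pos: "0 < M n x"
  using X_pos[of 0 x] X_le_M[of 0 n x] by simp

lemma M_mono: "M n x \<le> M (Suc n) x" by simp

lemma M_step: "M (Suc n) x \<le> 2 ^ CARD('d) * M n x"
proof -
  have "X (Suc n) x \<le> 2 ^ CARD('d) * M n x"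
    using X_step[of n x] X_le_M[of n n x] by (meson mult_left_mono order_trans zero_le_numeral zero_le_power order_refl)
  moreover have "1 * M n x \<le> 2 ^ CARD('d) * M n x"
    using M_pos[of n x] by (intro mult_right_mono one_le_power) auto
  ultimately show ?thesis by simp
qed

text \<open>If \<open>M k x\<close> is itself the average at time \<open>k\<close>, then every later
  maximum is an average at some time from \<open>k\<close> on, hence over a subcell. This is the
  form that \<open>fujii_wilson_cell\<close> accepts.\<close>

lemma M_cases: "n \<ge> k \<Longrightarrow> (\<exists>i. k \<le> i \<and> i \<le> n \<and> M n x = X i x) \<or> M n x = M k x"
proof (induction n rule: dec_induct)
  case (step n)
  show ?case
  proof (cases "M (Suc n) x = X (Suc n) x")
    case True
    then show ?thesis using step.hyps by (metis le_Suc_eq order_refl)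
  next
    case False
    then have "M (Suc n) x = M n x" by (simp add: max_def split: if_splits)
    then show ?thesis using step.IH by (metis le_SucI)
  qed
qed simp

lemma M_bounded: "M n x \<le> (2 ^ CARD('d)) ^ n * X 0 x"
proof (induction n)
  case (Suc n)
  have "M (Suc n) x \<le> 2 ^ CARD('d) * M n x" by (rule M_step)
  also have "\<dots> \<le> 2 ^ CARD('d) * ((2 ^ CARD('d)) ^ n * X 0 x)" by (intro mult_left_mono Suc) auto
  finally show ?case by (simp add: mult.assoc)
qed simp

text \<open>The increments in a summation by parts of \<open>M n powr e\<close>. Where an increment
  is nonzero, the current average sets a new record, and only the cells with a record
  matter.\<close>

definition D :: "nat \<Rightarrow> real^'d \<Rightarrow> real" where
  "D k x = M (Suc k) x powr e - M k x powr e"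

lemma D_nonneg: "0 \<le> D k x"
  unfolding D_def using M_mono[of k x] M_pos[of k x] e by (simp add: powr_mono2 del: M.simps)

lemma D_adapted: "adapted (sc (Suc k)) (D k)"
  unfolding D_def
proof (rule adapted_comp2[OF M_adapted, where h = "\<lambda>a b. a powr e - b powr e"])
  show "adapted (sc (Suc k)) (M k)" by (rule adapted_mono[OF M_adapted]) simp
qed

lemma D_measurable [measurable]: "D k \<in> borel_measurable lebesgue"
  by (rule adapted_borel_measurable[OF sc D_adapted])

lemma D_increment: "M (Suc k) x * D k x \<le> 2 ^ CARD('d) * e * (M (Suc k) x powr (1 + e) - M k x powr (1 + e))"
  unfolding D_def by (rule powr_increment_le) (use M_pos M_mono M_step e e1 in auto)

lemma D_nonzero: assumes "D k x \<noteq> 0" shows "M (Suc k) x = X (Suc k) x"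
proof (rule ccontr)
  assume "M (Suc k) x \<noteq> X (Suc k) x"
  then have "M (Suc k) x = M k x" by (simp add: max_def split: if_splits)
  then show False using assms unfolding D_def by simp
qed

text \<open>Averages over subcells do not notice that the weight is cut off to the closed cube, so
  they compete in the localised maximal function that defines \<open>A_infinity_const\<close>. The
  weight has positive finite integral there, which permits clearing the denominator.\<close>

lemma fujii_wilson_cell:
  assumes "\<And>y. y \<in> dcell (sc k) x \<Longrightarrow> \<exists>i\<ge>k. u y \<le> X i y"
  shows "(\<integral>\<^sup>+y\<in>dcell (sc k) x. ennreal (u y) \<partial>lebesgue) \<le> (\<integral>\<^sup>+y\<in>dcell (sc k) x. ennreal A * ennreal (w y) \<partial>lebesgue)"
proof -
  let ?C = "cbox (corner (sc k) x) (corner (sc k) x + vec (1 / sc k))"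
  note C = dcell_closure[OF sc[of k], where x = x]
  have "(\<integral>\<^sup>+y\<in>dcell (sc k) x. ennreal (u y) \<partial>lebesgue) \<le> (\<integral>\<^sup>+y\<in>?C. maximal (\<lambda>z. w z * indicator ?C z) y \<partial>lebesgue)"
  proof (rule nn_integral_mono)
    fix y
    show "ennreal (u y) * indicator (dcell (sc k) x) y \<le> maximal (\<lambda>z. w z * indicator ?C z) y * indicator ?C y"
    proof (cases "y \<in> dcell (sc k) x")
      case True
      then obtain i where i: "i \<ge> k" "u y \<le> X i y" using assms by blast
      let ?R = "cbox (corner (sc i) y) (corner (sc i) y + vec (1 / sc i))"
      note R = dcell_closure[OF sc[of i], where x = y]
      have sub: "dcell (sc i) y \<subseteq> ?C"
        using dcell_mono[OF i(1)] dcell_eq[OF True] C(2) by blast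
      have "ennreal (X i y) * emeasure lebesgue (dcell (sc i) y) \<le> (\<integral>\<^sup>+z\<in>?R. ennreal \<bar>w z * indicator ?C z\<bar> \<partial>lebesgue)"
        unfolding X_cell using sub R(2) w0 by (intro nn_integral_mono) (auto simp: indicator_def)
      then have "ennreal (X i y) * emeasure lebesgue ?R / emeasure lebesgue ?R \<le> average ?R (\<lambda>z. w z * indicator ?C z)"
        unfolding average_def R(3) by (rule divide_right_mono_ennreal)
      moreover have "ennreal (X i y) * emeasure lebesgue ?R / emeasure lebesgue ?R = ennreal (X i y)"
        unfolding R(3) using s by (simp add: emeasure_dcell[OF sc] mult_divide_eq_ennreal)
      moreover have "average ?R (\<lambda>z. w z * indicator ?C z) \<le> maximal (\<lambda>z. w z * indicator ?C z) y"
        unfolding maximal_def using R(1,2) dcell_self by (intro SUP_upper) blast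
      ultimately have "ennreal (X i y) \<le> maximal (\<lambda>z. w z * indicator ?C z) y" by simp
      then have "ennreal (u y) \<le> maximal (\<lambda>z. w z * indicator ?C z) y"
        using i(2) by (meson ennreal_leI order_trans)
      then show ?thesis using True C(2) by (auto simp: indicator_def)
    qed simp
  qed
  also have "\<dots> \<le> ennreal A * (\<integral>\<^sup>+y\<in>?C. ennreal (w y) \<partial>lebesgue)"
  proof -
    let ?b = "\<integral>\<^sup>+y\<in>?C. ennreal (w y) \<partial>lebesgue"
    let ?a = "\<integral>\<^sup>+y\<in>?C. maximal (\<lambda>z. w z * indicator ?C z) y \<partial>lebesgue"
    have b: "?b = ennreal (X k x) * emeasure lebesgue (dcell (sc k) x)" by (simp add: C(4) X_cell)
    have "?b \<noteq> 0" "?b \<noteq> top" unfolding b using X_pos[of k x] s by (auto simp: emeasure_dcell[OF sc] ennreal_mult_eq_top_iff)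
    have "?a / ?b \<le> A_infinity_const w"
      unfolding A_infinity_const_def using C(1) by (rule SUP_upper)
    then have "?a / ?b \<le> ennreal A" using FW by (rule order_trans)
    then have "?a / ?b * ?b \<le> ennreal A * ?b" by (rule mult_right_mono) simp
    moreover have "?a / ?b * ?b = ?a"
      using \<open>?b \<noteq> 0\<close> \<open>?b \<noteq> top\<close> by (simp add: ennreal_divide_times mult_divide_eq_ennreal ennreal_times_divide)
    ultimately show ?thesis by simp
  qed
  also have "\<dots> = ennreal A * (\<integral>\<^sup>+y\<in>dcell (sc k) x. ennreal (w y) \<partial>lebesgue)" by (simp add: C(4))
  also have "\<dots> = (\<integral>\<^sup>+y\<in>dcell (sc k) x. ennreal A * ennreal (w y) \<partial>lebesgue)"
    using sc by (subst nn_integral_cmult[symmetric]) (auto simp: mult.assoc)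
  finally show ?thesis .
qed

text \<open>After a record at time \<open>k + 1\<close>, all of \<open>M n\<close> on that cell
  comes from averages over its subcells, so the Fujii-Wilson condition applies to the cell.\<close>

lemma jump_integral_maximal:
  assumes c: "adapted (sc (Suc k)) c" and n: "n \<ge> Suc k"
  shows "(\<integral>\<^sup>+y. c y * ennreal (D k y) * ennreal (M n y) \<partial>lebesgue) \<le> (\<integral>\<^sup>+y. c y * ennreal (D k y) * (ennreal A * ennreal (w y)) \<partial>lebesgue)"
proof (rule adapted_nn_integral_le[OF sc[of "Suc k"]])
  show "adapted (sc (Suc k)) (\<lambda>y. c y * ennreal (D k y))"
    using adapted_comp2[OF c D_adapted, where h = "\<lambda>a b. a * ennreal b"] by simp
  fix x assume "c x * ennreal (D k x) \<noteq> 0"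
  then have D: "D k x \<noteq> 0" by auto
  show "(\<integral>\<^sup>+y\<in>dcell (sc (Suc k)) x. ennreal (M n y) \<partial>lebesgue) \<le> (\<integral>\<^sup>+y\<in>dcell (sc (Suc k)) x. ennreal A * ennreal (w y) \<partial>lebesgue)"
  proof (rule fujii_wilson_cell)
    fix y assume y: "y \<in> dcell (sc (Suc k)) x"
    then have "D k y \<noteq> 0" using D adaptedD[OF D_adapted y] by simp
    then have "M (Suc k) y = X (Suc k) y" by (rule D_nonzero)
    then show "\<exists>i\<ge>Suc k. M n y \<le> X i y" using M_cases[OF n, of y] by auto
  qed
qed measurable

text \<open>On a record cell the running maximum is the average of the weight, so the two integrals
  over the cell agree.\<close>

lemma jump_integral_weight:
  assumes c: "adapted (sc (Suc k)) c"
  shows "(\<integral>\<^sup>+y. c y * ennreal (D k y) * ennreal (w y) \<partial>lebesgue) \<le> (\<integral>\<^sup>+y. c y * ennreal (D k y) * ennreal (M (Suc k) y) \<partial>lebesgue)"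
proof (rule adapted_nn_integral_le[OF sc[of "Suc k"]])
  show "adapted (sc (Suc k)) (\<lambda>y. c y * ennreal (D k y))"
    using adapted_comp2[OF c D_adapted, where h = "\<lambda>a b. a * ennreal b"] by simp
  fix x assume "c x * ennreal (D k x) \<noteq> 0"
  then have D: "D k x \<noteq> 0" by auto
  have "(\<integral>\<^sup>+y\<in>dcell (sc (Suc k)) x. ennreal (w y) \<partial>lebesgue) = ennreal (M (Suc k) x) * emeasure lebesgue (dcell (sc (Suc k)) x)"
    unfolding D_nonzero[OF D] by (rule X_cell[symmetric])
  also have "\<dots> = (\<integral>\<^sup>+y. ennreal (M (Suc k) x) * indicator (dcell (sc (Suc k)) x) y \<partial>lebesgue)"
    using sc by (intro nn_integral_cmult_indicator[symmetric] dcell_sets)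
  also have "\<dots> = (\<integral>\<^sup>+y\<in>dcell (sc (Suc k)) x. ennreal (M (Suc k) y) \<partial>lebesgue)"
    using adaptedD[OF M_adapted[of "Suc k"]] by (intro nn_integral_cong) (auto simp: indicator_def simp del: M.simps)
  finally show "(\<integral>\<^sup>+y\<in>dcell (sc (Suc k)) x. ennreal (w y) \<partial>lebesgue) \<le> (\<integral>\<^sup>+y\<in>dcell (sc (Suc k)) x. ennreal (M (Suc k) y) \<partial>lebesgue)"
    by simp
qed measurable

section \<open>The self-improving estimate on a cell with average at most one\<close>

context
  fixes x0 :: "real^'d"
  assumes x0: "X 0 x0 \<le> 1"
begin

abbreviation q :: "real^'d \<Rightarrow> ennreal" where "q \<equiv> indicator (dcell s x0)"

lemma q_adapted: "adapted (sc k) q"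
proof -
  have "adapted (2 ^ 0 * s) q" by (auto simp: adapted_def indicator_def dcell_def)
  then show ?thesis by (rule adapted_mono) simp
qed

lemma q_measurable [measurable]: "q \<in> borel_measurable lebesgue"
  using s by simp

definition J :: "nat \<Rightarrow> ennreal" where "J n = (\<integral>\<^sup>+y. q y * ennreal (M n y powr (1 + e)) \<partial>lebesgue)"

lemma M0: "y \<in> dcell s x0 \<Longrightarrow> M 0 y \<le> 1"
  using adaptedD[OF X_adapted[of 0], of y x0] x0 by simp

lemma q_weight: "(\<integral>\<^sup>+y. q y * ennreal (w y) \<partial>lebesgue) \<le> emeasure lebesgue (dcell s x0)"
proof -
  have "(\<integral>\<^sup>+y. q y * ennreal (w y) \<partial>lebesgue) = ennreal (X 0 x0) * emeasure lebesgue (dcell s x0)"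
    using X_cell[of 0 x0] by (simp add: mult.commute)
  also have "\<dots> \<le> 1 * emeasure lebesgue (dcell s x0)"
    using x0 by (intro mult_right_mono) auto
  finally show ?thesis by simp
qed

lemma powr_M_sum: "M n y powr e = M 0 y powr e + (\<Sum>k<n. D k y)"
  by (induction n) (auto simp: D_def simp del: M.simps)

text \<open>\<open>D_increment\<close> bounds every term by a multiple of the increase of
  \<open>M powr (1 + e)\<close>, and these increases telescope.\<close>

lemma jumps_le: "(\<Sum>k<n. \<integral>\<^sup>+y. q y * ennreal (D k y) * ennreal (M (Suc k) y) \<partial>lebesgue) \<le> ennreal (2 ^ CARD('d) * e) * J n"
proof -
  have "(\<Sum>k<n. \<integral>\<^sup>+y. q y * ennreal (D k y) * ennreal (M (Suc k) y) \<partial>lebesgue) =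
      (\<integral>\<^sup>+y. (\<Sum>k<n. q y * ennreal (D k y) * ennreal (M (Suc k) y)) \<partial>lebesgue)"
    by (intro nn_integral_sum[symmetric]) measurable
  also have "\<dots> \<le> (\<integral>\<^sup>+y. ennreal (2 ^ CARD('d) * e) * (q y * ennreal (M n y powr (1 + e))) \<partial>lebesgue)"
  proof (rule nn_integral_mono)
    fix y
    have "(\<Sum>k<n. D k y * M (Suc k) y) \<le> (\<Sum>k<n. 2 ^ CARD('d) * e * (M (Suc k) y powr (1 + e) - M k y powr (1 + e)))"
      using D_increment[of _ y] by (intro sum_mono) (simp add: mult.commute)
    also have "\<dots> = 2 ^ CARD('d) * e * (M n y powr (1 + e) - M 0 y powr (1 + e))"
      unfolding sum_distrib_left[symmetric] by (subst sum_lessThan_telescope) simp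
    also have "\<dots> \<le> 2 ^ CARD('d) * e * M n y powr (1 + e)"
      using e by (intro mult_left_mono) auto
    finally have le: "(\<Sum>k<n. D k y * M (Suc k) y) \<le> 2 ^ CARD('d) * e * M n y powr (1 + e)" .
    have "(\<Sum>k<n. ennreal (D k y) * ennreal (M (Suc k) y)) = ennreal (\<Sum>k<n. D k y * M (Suc k) y)"
      using D_nonneg M_pos by (subst sum_ennreal[symmetric]) (auto simp: ennreal_mult less_imp_le simp del: M.simps)
    also have "\<dots> \<le> ennreal (2 ^ CARD('d) * e * M n y powr (1 + e))" by (rule ennreal_leI[OF le])
    also have "\<dots> = ennreal (2 ^ CARD('d) * e) * ennreal (M n y powr (1 + e))"
      using e by (intro ennreal_mult) auto
    finally show "(\<Sum>k<n. q y * ennreal (D k y) * ennreal (M (Suc k) y)) \<le> ennreal (2 ^ CARD('d) * e) * (q y * ennreal (M n y powr (1 + e)))"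
      by (auto simp: indicator_def)
  qed
  also have "\<dots> = ennreal (2 ^ CARD('d) * e) * J n"
    unfolding J_def by (intro nn_integral_cmult) measurable
  finally show ?thesis .
qed

text \<open>The maximum grows at most by \<open>2 ^ d\<close> per generation. The bound depends on
  \<open>n\<close>, but finiteness is all that the absorption needs.\<close>

lemma J_finite: "J n < \<infinity>"
proof -
  let ?m = "((2 ^ CARD('d)) ^ n) powr (1 + e)"
  have "M n y powr (1 + e) \<le> ?m" if "y \<in> dcell s x0" for y
  proof (rule powr_mono2)
    have "M n y \<le> (2 ^ CARD('d)) ^ n * X 0 y" by (rule M_bounded)
    also have "\<dots> \<le> (2 ^ CARD('d)) ^ n * 1" using M0[OF that] by (intro mult_left_mono) auto
    finally show "M n y \<le> (2 ^ CARD('d)) ^ n" by simp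
  qed (use e M_pos[of n y] in \<open>auto simp: less_imp_le\<close>)
  then have "J n \<le> (\<integral>\<^sup>+y. ennreal ?m * q y \<partial>lebesgue)"
    unfolding J_def by (intro nn_integral_mono) (auto simp: indicator_def ennreal_leI)
  also have "\<dots> = ennreal ?m * emeasure lebesgue (dcell s x0)"
    using s by (intro nn_integral_cmult_indicator) auto
  also have "\<dots> < \<infinity>" using s by (simp add: emeasure_dcell ennreal_mult_less_top)
  finally show ?thesis .
qed

text \<open>Expand \<open>M n powr e\<close> into \<open>M 0 powr e\<close> and its increments, and
  keep one factor \<open>M n\<close>. The first term is at most \<open>A\<close> times the measure
  of the cell. In the others the factor \<open>M n\<close> is traded for \<open>A * w\<close> and
  then for \<open>A * M (Suc k)\<close>; together they are at most
  \<open>2 ^ d * e * A * J n\<close>, that is, half of the left-hand side.\<close>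

lemma J_bound: "J n \<le> ennreal (2 * A) * emeasure lebesgue (dcell s x0)"
proof -
  let ?Q = "emeasure lebesgue (dcell s x0)"
  have "J n = (\<integral>\<^sup>+y. q y * ennreal (M 0 y powr e) * ennreal (M n y) + (\<Sum>k<n. q y * ennreal (D k y) * ennreal (M n y)) \<partial>lebesgue)"
    unfolding J_def
  proof (rule nn_integral_cong)
    fix y
    have "ennreal (M n y powr (1 + e)) = ennreal (M n y powr e) * ennreal (M n y)"
      using M_pos[of n y] by (simp add: powr_add ennreal_mult mult.commute)
    also have "ennreal (M n y powr e) = ennreal (M 0 y powr e) + (\<Sum>k<n. ennreal (D k y))"
      unfolding powr_M_sum[of n y] using D_nonneg by (subst ennreal_plus) (auto intro: sum_nonneg simp: sum_ennreal)
    finally show "q y * ennreal (M n y powr (1 + e)) = q y * ennreal (M 0 y powr e) * ennreal (M n y) + (\<Sum>k<n. q y * ennreal (D k y) * ennreal (M n y))"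
      by (simp add: distrib_left distrib_right sum_distrib_left sum_distrib_right mult.assoc)
  qed
  also have "\<dots> = (\<integral>\<^sup>+y. q y * ennreal (M 0 y powr e) * ennreal (M n y) \<partial>lebesgue) + (\<Sum>k<n. \<integral>\<^sup>+y. q y * ennreal (D k y) * ennreal (M n y) \<partial>lebesgue)"
    by (subst nn_integral_add) (auto intro!: nn_integral_sum)
  also have "\<dots> \<le> ennreal A * ?Q + ennreal (1 / 2) * J n"
  proof (rule add_mono)
    have "(\<integral>\<^sup>+y. q y * ennreal (M 0 y powr e) * ennreal (M n y) \<partial>lebesgue) \<le> (\<integral>\<^sup>+y\<in>dcell (sc 0) x0. ennreal (M n y) \<partial>lebesgue)"
    proof (rule nn_integral_mono)
      fix y
      have "ennreal (M 0 y powr e) * ennreal (M n y) \<le> 1 * ennreal (M n y)" if "y \<in> dcell s x0"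
        using M0[OF that] M_pos[of 0 y] e by (intro mult_right_mono) (auto simp: powr_le1 simp del: M.simps)
      then show "q y * ennreal (M 0 y powr e) * ennreal (M n y) \<le> ennreal (M n y) * indicator (dcell (sc 0) x0) y"
        by (auto simp: indicator_def)
    qed
    also have "\<dots> \<le> (\<integral>\<^sup>+y\<in>dcell (sc 0) x0. ennreal A * ennreal (w y) \<partial>lebesgue)"
    proof (rule fujii_wilson_cell)
      fix y show "\<exists>i\<ge>0. M n y \<le> X i y" using M_cases[of 0 n y] by auto
    qed
    also have "\<dots> = ennreal A * (\<integral>\<^sup>+y. q y * ennreal (w y) \<partial>lebesgue)"
      by (subst nn_integral_cmult[symmetric]) (auto simp: mult_ac)
    also have "\<dots> \<le> ennreal A * ?Q" by (intro mult_left_mono q_weight) auto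
    finally show "(\<integral>\<^sup>+y. q y * ennreal (M 0 y powr e) * ennreal (M n y) \<partial>lebesgue) \<le> ennreal A * ?Q" .
    have "(\<Sum>k<n. \<integral>\<^sup>+y. q y * ennreal (D k y) * ennreal (M n y) \<partial>lebesgue) \<le>
        (\<Sum>k<n. ennreal A * (\<integral>\<^sup>+y. q y * ennreal (D k y) * ennreal (M (Suc k) y) \<partial>lebesgue))"
    proof (rule sum_mono)
      fix k assume "k \<in> {..<n}"
      then have "(\<integral>\<^sup>+y. q y * ennreal (D k y) * ennreal (M n y) \<partial>lebesgue) \<le> (\<integral>\<^sup>+y. q y * ennreal (D k y) * (ennreal A * ennreal (w y)) \<partial>lebesgue)"
        by (intro jump_integral_maximal q_adapted) auto
      also have "\<dots> = ennreal A * (\<integral>\<^sup>+y. q y * ennreal (D k y) * ennreal (w y) \<partial>lebesgue)"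
        by (subst nn_integral_cmult[symmetric]) (auto simp: mult_ac)
      also have "\<dots> \<le> ennreal A * (\<integral>\<^sup>+y. q y * ennreal (D k y) * ennreal (M (Suc k) y) \<partial>lebesgue)"
        by (intro mult_left_mono jump_integral_weight q_adapted) auto
      finally show "(\<integral>\<^sup>+y. q y * ennreal (D k y) * ennreal (M n y) \<partial>lebesgue) \<le> ennreal A * (\<integral>\<^sup>+y. q y * ennreal (D k y) * ennreal (M (Suc k) y) \<partial>lebesgue)" .
    qed
    also have "\<dots> = ennreal A * (\<Sum>k<n. \<integral>\<^sup>+y. q y * ennreal (D k y) * ennreal (M (Suc k) y) \<partial>lebesgue)"
      by (rule sum_distrib_left[symmetric])
    also have "\<dots> \<le> ennreal A * (ennreal (2 ^ CARD('d) * e) * J n)"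
      by (intro mult_left_mono jumps_le) auto
    also have "\<dots> = ennreal (2 ^ CARD('d) * e * A) * J n"
      using A e by (subst mult.assoc[symmetric], subst ennreal_mult[symmetric]) (auto simp: mult_ac)
    also have "\<dots> \<le> ennreal (1 / 2) * J n"
      using e by (intro mult_right_mono ennreal_leI) auto
    finally show "(\<Sum>k<n. \<integral>\<^sup>+y. q y * ennreal (D k y) * ennreal (M n y) \<partial>lebesgue) \<le> ennreal (1 / 2) * J n" .
  qed
  finally have main: "J n \<le> ennreal A * ?Q + ennreal (1 / 2) * J n" .
  obtain j where j: "J n = ennreal j" "j \<ge> 0" using J_finite[of n] by (cases "J n") auto
  obtain r where r: "?Q = ennreal r" "r \<ge> 0" using s by (simp add: emeasure_dcell)
  have "ennreal j \<le> ennreal (A * r + 1 / 2 * j)"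
  proof -
    have "ennreal (A * r + 1 / 2 * j) = ennreal A * ennreal r + ennreal (1 / 2) * ennreal j"
      using A j(2) r(2) ennreal_plus[of "A * r" "1 / 2 * j"] ennreal_mult[of A r] ennreal_mult[of "1 / 2" j]
      by (simp only: zero_le_mult_iff) simp
    then show ?thesis using main unfolding j(1) r(1) by metis
  qed
  then have "j \<le> A * r + 1 / 2 * j" by (rule iffD1[OF ennreal_le_iff, rotated]) (use A j r in simp)
  then have "j \<le> 2 * A * r" by simp
  then show ?thesis using A j r by (simp add: ennreal_mult[symmetric] ennreal_leI)
qed

text \<open>The same expansion with \<open>w\<close> in place of \<open>M n\<close>. The increments
  now contribute \<open>2 ^ d * e * J n\<close>, and \<open>J_bound\<close> brings in a factor
  \<open>2 * A\<close> that the smallness of \<open>e\<close> cancels. The final constant is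
  therefore free of \<open>A\<close>.\<close>

lemma weight_times_maximal: "(\<integral>\<^sup>+y. q y * ennreal (w y * M n y powr e) \<partial>lebesgue) \<le> 2 * emeasure lebesgue (dcell s x0)"
proof -
  let ?Q = "emeasure lebesgue (dcell s x0)"
  have "(\<integral>\<^sup>+y. q y * ennreal (w y * M n y powr e) \<partial>lebesgue) =
      (\<integral>\<^sup>+y. q y * ennreal (M 0 y powr e) * ennreal (w y) + (\<Sum>k<n. q y * ennreal (D k y) * ennreal (w y)) \<partial>lebesgue)"
  proof (rule nn_integral_cong)
    fix y
    have "ennreal (w y * M n y powr e) = ennreal (M n y powr e) * ennreal (w y)"
      using w0[of y] by (simp add: ennreal_mult mult.commute)
    also have "ennreal (M n y powr e) = ennreal (M 0 y powr e) + (\<Sum>k<n. ennreal (D k y))"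
      unfolding powr_M_sum[of n y] using D_nonneg by (subst ennreal_plus) (auto intro: sum_nonneg simp: sum_ennreal)
    finally show "q y * ennreal (w y * M n y powr e) = q y * ennreal (M 0 y powr e) * ennreal (w y) + (\<Sum>k<n. q y * ennreal (D k y) * ennreal (w y))"
      by (simp add: distrib_left distrib_right sum_distrib_left sum_distrib_right mult.assoc)
  qed
  also have "\<dots> = (\<integral>\<^sup>+y. q y * ennreal (M 0 y powr e) * ennreal (w y) \<partial>lebesgue) + (\<Sum>k<n. \<integral>\<^sup>+y. q y * ennreal (D k y) * ennreal (w y) \<partial>lebesgue)"
    by (subst nn_integral_add) (auto intro!: nn_integral_sum)
  also have "\<dots> \<le> ?Q + ?Q"
  proof (rule add_mono)
    have "(\<integral>\<^sup>+y. q y * ennreal (M 0 y powr e) * ennreal (w y) \<partial>lebesgue) \<le> (\<integral>\<^sup>+y. q y * ennreal (w y) \<partial>lebesgue)"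
    proof (rule nn_integral_mono)
      fix y
      have "ennreal (M 0 y powr e) * ennreal (w y) \<le> 1 * ennreal (w y)" if "y \<in> dcell s x0"
        using M0[OF that] M_pos[of 0 y] e by (intro mult_right_mono) (auto simp: powr_le1 simp del: M.simps)
      then show "q y * ennreal (M 0 y powr e) * ennreal (w y) \<le> q y * ennreal (w y)"
        by (auto simp: indicator_def)
    qed
    then show "(\<integral>\<^sup>+y. q y * ennreal (M 0 y powr e) * ennreal (w y) \<partial>lebesgue) \<le> ?Q"
      using q_weight by (rule order_trans)
    have "(\<Sum>k<n. \<integral>\<^sup>+y. q y * ennreal (D k y) * ennreal (w y) \<partial>lebesgue) \<le>
        (\<Sum>k<n. \<integral>\<^sup>+y. q y * ennreal (D k y) * ennreal (M (Suc k) y) \<partial>lebesgue)"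
      by (intro sum_mono jump_integral_weight q_adapted)
    also have "\<dots> \<le> ennreal (2 ^ CARD('d) * e) * J n" by (rule jumps_le)
    also have "\<dots> \<le> ennreal (2 ^ CARD('d) * e) * (ennreal (2 * A) * ?Q)"
      by (intro mult_left_mono J_bound) auto
    also have "\<dots> = ennreal (2 * (2 ^ CARD('d) * e * A)) * ?Q"
      using A e by (subst mult.assoc[symmetric], subst ennreal_mult[symmetric]) (auto simp: mult_ac)
    also have "\<dots> \<le> ennreal 1 * ?Q"
      using e by (intro mult_right_mono ennreal_leI) auto
    finally show "(\<Sum>k<n. \<integral>\<^sup>+y. q y * ennreal (D k y) * ennreal (w y) \<partial>lebesgue) \<le> ?Q" by simp
  qed
  finally show ?thesis by (simp add: mult_2)
qed

text \<open>Differentiation along cells, applied at countably many levels. The factor two leaves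
  room for a rational level between the supremum of the averages and the value of the
  weight.\<close>

lemma weight_le_maximal: "AE y in lebesgue. \<exists>n. w y \<le> 2 * M n y"
proof -
  have "AE y in lebesgue. y \<in> {y. \<forall>n. M n y \<le> real_of_rat c} \<longrightarrow> ennreal (w y) \<le> ennreal (real_of_rat c)" if c: "c \<ge> 0" for c
  proof (rule cell_differentiation[OF s])
    have "{y. \<forall>n. M n y \<le> real_of_rat c} = (\<Inter>n. {y \<in> space lebesgue. M n y \<le> real_of_rat c})" by fastforce
    also have "\<dots> \<in> sets lebesgue" by measurable
    finally show "{y. \<forall>n. M n y \<le> real_of_rat c} \<in> sets lebesgue" .
    fix x k assume x: "x \<in> {y. \<forall>n. M n y \<le> real_of_rat c}"
    then have "M k x \<le> real_of_rat c" by simp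
    then have "X k x \<le> real_of_rat c" using X_le_M[of k k x] by linarith
    then show "(\<integral>\<^sup>+y\<in>dcell (sc k) x. ennreal (w y) \<partial>lebesgue) \<le> ennreal (real_of_rat c) * emeasure lebesgue (dcell (sc k) x)"
      unfolding X_cell[symmetric] by (intro mult_right_mono ennreal_leI) auto
  qed (use c in auto)
  then have "AE y in lebesgue. \<forall>c\<in>{0..}. y \<in> {y. \<forall>n. M n y \<le> real_of_rat c} \<longrightarrow> ennreal (w y) \<le> ennreal (real_of_rat c)"
    by (subst AE_ball_countable) auto
  with wpos show ?thesis
  proof eventually_elim
    case (elim y)
    show ?case
    proof (rule ccontr)
      assume "\<nexists>n. w y \<le> 2 * M n y"
      then have lt: "M n y < w y / 2" for n by (simp add: not_le) (metis mult.commute)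
      obtain c where c: "w y / 2 < real_of_rat c" "real_of_rat c < w y"
        using of_rat_dense[of "w y / 2" "w y"] elim by auto
      have "0 < real_of_rat c" using c elim by linarith
      then have "c \<ge> 0" by simp
      moreover have "M n y \<le> real_of_rat c" for n using lt[of n] c by linarith
      ultimately have "ennreal (w y) \<le> ennreal (real_of_rat c)" using elim by auto
      then show False using c \<open>0 < real_of_rat c\<close> by (simp add: ennreal_le_iff)
    qed
  qed
qed

text \<open>One power \<open>e\<close> of the weight is replaced by the running maximum, at the cost
  of \<open>2 powr e \<le> 2\<close>; monotone convergence handles the supremum over
  \<open>n\<close>. The other factor two is that of \<open>weight_times_maximal\<close>.\<close>

theorem reverse_holder: "(\<integral>\<^sup>+y\<in>dcell s x0. ennreal (w y powr (1 + e)) \<partial>lebesgue) \<le> 4 * emeasure lebesgue (dcell s x0)"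
proof -
  have "(\<integral>\<^sup>+y\<in>dcell s x0. ennreal (w y powr (1 + e)) \<partial>lebesgue) \<le> (\<integral>\<^sup>+y. 2 * (SUP n. q y * ennreal (w y * M n y powr e)) \<partial>lebesgue)"
  proof (rule nn_integral_mono_AE)
    show "AE y in lebesgue. ennreal (w y powr (1 + e)) * q y \<le> 2 * (SUP n. q y * ennreal (w y * M n y powr e))"
      using weight_le_maximal wpos
    proof eventually_elim
      case (elim y)
      then obtain n where n: "w y \<le> 2 * M n y" by blast
      have "w y powr e \<le> (2 * M n y) powr e" using n elim e by (intro powr_mono2) auto
      also have "\<dots> = 2 powr e * M n y powr e" using M_pos[of n y] by (simp add: powr_mult)
      also have "\<dots> \<le> 2 powr 1 * M n y powr e" using e e1 by (intro mult_right_mono powr_mono) auto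
      finally have "w y * w y powr e \<le> w y * (2 * M n y powr e)" using elim by (intro mult_left_mono) auto
      then have "ennreal (w y powr (1 + e)) \<le> ennreal (2 * (w y * M n y powr e))"
        using elim by (intro ennreal_leI) (simp add: powr_add mult_ac)
      also have "\<dots> = 2 * ennreal (w y * M n y powr e)" using elim by (simp add: ennreal_mult)
      finally have "ennreal (w y powr (1 + e)) * q y \<le> 2 * ennreal (w y * M n y powr e) * q y"
        by (rule mult_right_mono) simp
      also have "\<dots> = 2 * (q y * ennreal (w y * M n y powr e))" by (simp add: mult_ac)
      also have "\<dots> \<le> 2 * (SUP n. q y * ennreal (w y * M n y powr e))"
        by (intro mult_left_mono SUP_upper) auto
      finally show ?case .
    qed
  qed
  also have "\<dots> = 2 * (\<integral>\<^sup>+y. (SUP n. q y * ennreal (w y * M n y powr e)) \<partial>lebesgue)"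
    by (intro nn_integral_cmult) measurable
  also have "(\<integral>\<^sup>+y. (SUP n. q y * ennreal (w y * M n y powr e)) \<partial>lebesgue) = (SUP n. \<integral>\<^sup>+y. q y * ennreal (w y * M n y powr e) \<partial>lebesgue)"
  proof (rule nn_integral_monotone_convergence_SUP)
    show "incseq (\<lambda>n y. q y * ennreal (w y * M n y powr e))"
    proof (rule incseq_SucI, rule le_funI)
      fix n y
      have "M n y powr e \<le> M (Suc n) y powr e"
        using D_nonneg[of n y] by (simp add: D_def del: M.simps)
      then show "q y * ennreal (w y * M n y powr e) \<le> q y * ennreal (w y * M (Suc n) y powr e)"
        using w0[of y] by (intro mult_left_mono ennreal_leI) auto
    qed
  qed measurable
  also have "2 * (SUP n. \<integral>\<^sup>+y. q y * ennreal (w y * M n y powr e) \<partial>lebesgue) \<le> 2 * (2 * emeasure lebesgue (dcell s x0))"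
    by (intro mult_left_mono SUP_least weight_times_maximal) auto
  finally show ?thesis by (simp add: mult.assoc[symmetric])
qed

end

end

section \<open>Auerbach bases\<close>

lemma matrix_inv_invertible:
  fixes A :: "'a::semiring_1^'n::finite^'n"
  assumes "invertible A"
  shows "A ** matrix_inv A = mat 1" "matrix_inv A ** A = mat 1"
  using someI_ex[OF assms[unfolded invertible_def]] unfolding matrix_inv_def by auto

lemma of_real_smult: "of_real a *s v = a *\<^sub>R (v :: complex^'n::finite)"
  unfolding vec_eq_iff vector_smult_component vector_scaleR_component
  by (simp add: scaleR_conv_of_real)

lemma continuous_on_det: "continuous_on S (det :: complex^'n^'n::finite \<Rightarrow> complex)"
  unfolding det_def by (intro continuous_intros)

text \<open>An Auerbach basis: maximise \<open>\<bar>det\<bar>\<close> over all tuples of vectors in the unit ball of the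
  norm; by Cramer's rule the coordinate functionals of a maximiser are bounded by the norm.\<close>

lemma auerbach_basis:
  fixes N :: "complex^'n::finite \<Rightarrow> real"
  assumes tri: "\<And>u v. N (u + v) \<le> N u + N v" and hom: "\<And>c v. N (c *s v) = norm c * N v"
    and pos: "\<And>v. v \<noteq> 0 \<Longrightarrow> N v > 0"
  shows "\<exists>(E :: complex^'n^'n) V. (\<forall>v. v = (\<Sum>i\<in>UNIV. (V *v v) $ i *s E $ i)) \<and>
    (\<forall>v i. norm ((V *v v) $ i) \<le> N v) \<and> (\<forall>i. N (E $ i) \<le> 1)"
proof -
  have N0: "N 0 = 0" using hom[of 0 0] by simp
  have Nn: "N v \<ge> 0" for v using pos[of v] N0 by (cases "v = 0") auto
  have Nsum: "N (\<Sum>i\<in>I. f i) \<le> (\<Sum>i\<in>I. N (f i))" if "finite I" for f and I :: "'n set"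
    using that
  proof (induction rule: finite_induct)
    case (insert i I)
    have "N (\<Sum>j\<in>insert i I. f j) \<le> N (f i) + N (\<Sum>j\<in>I. f j)"
      using insert.hyps tri by simp
    then show ?case using insert by simp
  qed (simp add: N0)
  define C where "C = (\<Sum>i\<in>UNIV. N (axis i 1 :: complex^'n))"
  have NC: "N v \<le> C * norm v" for v
  proof -
    have "v = (\<Sum>i\<in>UNIV. v $ i *s axis i 1)" by (simp add: basis_expansion)
    then have "N v \<le> (\<Sum>i\<in>UNIV. N (v $ i *s axis i 1))" using Nsum[of UNIV "\<lambda>i. v $ i *s axis i 1"] by simp
    also have "\<dots> \<le> (\<Sum>i\<in>UNIV. norm v * N (axis i 1))"
      unfolding hom by (intro sum_mono mult_right_mono Finite_Cartesian_Product.norm_nth_le Nn)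
    finally show ?thesis by (simp add: C_def sum_distrib_left mult.commute)
  qed
  have C0: "C \<ge> 0" unfolding C_def by (intro sum_nonneg Nn)
  have Nneg: "N (- v) = N v" for v using hom[of "-1" v] by simp
  have Ndiff: "\<bar>N u - N v\<bar> \<le> C * norm (u - v)" for u v
    using tri[of v "u - v"] tri[of u "v - u"] NC[of "u - v"] Nneg[of "u - v"] by simp
  have Nc: "continuous_on S N" for S
    unfolding continuous_on_iff
  proof (intro ballI allI impI)
    fix x and e :: real assume e: "e > 0"
    show "\<exists>d>0. \<forall>x'\<in>S. dist x' x < d \<longrightarrow> dist (N x') (N x) < e"
    proof (intro exI[of _ "e / (C + 1)"] conjI ballI impI)
      fix x' assume d: "dist x' x < e / (C + 1)"
      have "dist (N x') (N x) \<le> C * dist x' x" using Ndiff[of x' x] by (simp add: dist_norm)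
      also have "\<dots> \<le> C * (e / (C + 1))" using d C0 by (intro mult_left_mono) auto
      also have "\<dots> < e" using C0 e by (simp add: field_simps)
      finally show "dist (N x') (N x) < e" .
    qed (use e C0 in auto)
  qed
  \<comment> \<open>Compactness of the Euclidean sphere gives the lower comparison of
    \<open>N\<close> with the norm, which makes the set \<open>S\<close> of tuples bounded.\<close>
  obtain d where d: "d > 0" "\<And>v. d * norm v \<le> N v"
  proof -
    have ne: "sphere (0 :: complex^'n) 1 \<noteq> {}" by simp
    obtain v0 where v0: "v0 \<in> sphere 0 1" "\<And>v. v \<in> sphere 0 1 \<Longrightarrow> N v0 \<le> N v"
      using continuous_attains_inf[OF compact_sphere ne Nc] by blast
    have "N v0 * norm v \<le> N v" for v
    proof (cases "v = 0")
      case False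
      have "norm (of_real (1 / norm v) *s v) = 1"
        unfolding of_real_smult using False by simp
      then have "N v0 \<le> N (of_real (1 / norm v) *s v)" by (intro v0) simp
      then show ?thesis using False unfolding hom norm_of_real by (simp add: field_simps)
    qed (simp add: N0)
    moreover have "N v0 > 0" using v0(1) by (intro pos) auto
    ultimately show ?thesis using that by blast
  qed
  define S where "S = {E :: complex^'n^'n. \<forall>i. N (E $ i) \<le> 1}"
  have "compact S"
  proof (rule compact_eq_bounded_closed[THEN iffD2], intro conjI)
    have "norm E \<le> real CARD('n) * (1 / d)" if "E \<in> S" for E
    proof -
      have "norm E \<le> (\<Sum>i\<in>UNIV. norm (E $ i))" unfolding norm_vec_def by (rule L2_set_le_sum) simp
      also have "\<dots> \<le> (\<Sum>i\<in>(UNIV :: 'n set). 1 / d)"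
      proof (rule sum_mono)
        fix i
        have "N (E $ i) \<le> 1" using that by (simp add: S_def)
        then have "d * norm (E $ i) \<le> 1" using d(2)[of "E $ i"] by linarith
        then show "norm (E $ i) \<le> 1 / d" using d(1) by (simp add: field_simps)
      qed
      finally show ?thesis by simp
    qed
    then show "bounded S" unfolding bounded_iff by blast
    have "S = (\<Inter>i. {E. N (E $ i) \<le> 1})" by (auto simp: S_def)
    moreover have "closed {E :: complex^'n^'n. N (E $ i) \<le> 1}" for i
      by (intro closed_Collect_le continuous_on_compose2[OF Nc[of UNIV]] continuous_intros) auto
    ultimately show "closed S" by auto
  qed
  moreover have "S \<noteq> {}" by (auto simp: S_def N0 intro!: exI[of _ 0])
  moreover have "continuous_on S (\<lambda>E. norm (det E))" by (intro continuous_intros continuous_on_det)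
  ultimately obtain E where E: "E \<in> S" "\<And>E'. E' \<in> S \<Longrightarrow> norm (det E') \<le> norm (det E)"
    using continuous_attains_sup[of S "\<lambda>E. norm (det E)"] by blast
  \<comment> \<open>A small multiple of the identity is admissible, so the maximal determinant is
    not zero.\<close>
  have det0: "det E \<noteq> 0"
  proof -
    define c where "c = 1 / (C + 1)"
    define G :: "complex^'n^'n" where "G = (\<chi> i j. if i = j then of_real c else 0)"
    have c: "c > 0" "c * C \<le> 1" using C0 by (auto simp: c_def)
    have "N (G $ i) \<le> 1" for i
    proof -
      have "G $ i = of_real c *s axis i 1"
        by (simp add: G_def vec_eq_iff axis_def)
      then have "N (G $ i) = c * N (axis i 1)" using c by (simp add: hom)
      also have "\<dots> \<le> c * C"
        using c unfolding C_def by (intro mult_left_mono member_le_sum) (auto simp: Nn)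
      finally show ?thesis using c by simp
    qed
    then have "G \<in> S" by (simp add: S_def)
    then have "norm (det G) \<le> norm (det E)" by (rule E(2))
    moreover have "det G = of_real c ^ CARD('n)"
      by (subst det_diagonal) (auto simp: G_def)
    then have "det G \<noteq> 0" using c by simp
    ultimately show ?thesis by auto
  qed
  define V where "V = matrix_inv (transpose E)"
  have inv: "invertible (transpose E)"
    using det0 by (simp add: invertible_det_nz det_transpose)
  have expand: "v = (\<Sum>i\<in>UNIV. (V *v v) $ i *s E $ i)" for v
  proof -
    have "v = transpose E *v (V *v v)"
      using inv by (simp add: V_def matrix_vector_mul_assoc matrix_inv_invertible(1))
    also have "\<dots> = (\<Sum>i\<in>UNIV. (V *v v) $ i *s E $ i)"
      by (simp add: matrix_mult_sum column_transpose row_def)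
    finally show ?thesis .
  qed
  have unit: "norm ((V *v v) $ k) \<le> 1" if v: "N v \<le> 1" for v k
  proof -
    let ?E' = "(\<chi> i. if i = k then sum (\<lambda>i. (V *v v) $ i *s row i E) UNIV else row i E) :: complex^'n^'n"
    have r: "row i E = E $ i" for i by (simp add: row_def)
    have "?E' \<in> S"
      using v E(1) expand[of v] by (auto simp: S_def r)
    then have "norm (det ?E') \<le> norm (det E)" by (rule E(2))
    moreover have "det ?E' = (V *v v) $ k * det E" by (rule cramer_lemma_transpose)
    ultimately show ?thesis using det0 by (simp add: norm_mult)
  qed
  have bound: "norm ((V *v v) $ k) \<le> N v" for v k
  proof (cases "v = 0")
    case False
    then have Np: "N v > 0" by (rule pos)
    let ?u = "of_real (1 / N v) *s v"
    have "N ?u \<le> 1" using Np unfolding hom norm_of_real by simp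
    from unit[OF this, of k] have "norm (of_real (1 / N v) * (V *v v) $ k) \<le> 1"
      by (simp only: vector_scalar_commute vector_smult_component)
    then show ?thesis using Np by (simp add: norm_mult norm_divide field_simps)
  qed (simp add: N0)
  show ?thesis using expand bound E(1) unfolding S_def by blast
qed

section \<open>Sparse sums\<close>

lemma ennreal_suminf_swap: "(\<Sum>i. \<Sum>j. f i j) = (\<Sum>j. \<Sum>i. f i j)" for f :: "nat \<Rightarrow> nat \<Rightarrow> ennreal"
proof -
  have "(\<Sum>i. \<Sum>j. f i j) = (\<Sum>i. \<integral>\<^sup>+j. f i j \<partial>count_space UNIV)" by (simp add: nn_integral_count_space_nat)
  also have "\<dots> = (\<integral>\<^sup>+j. (\<Sum>i. f i j) \<partial>count_space UNIV)" by (rule nn_integral_suminf[symmetric]) simp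
  finally show ?thesis by (simp add: nn_integral_count_space_nat)
qed

text \<open>The scalar problem left by the domination: the matrix weight survives in
  \<open>\<phi>\<close>, through its normalised \<open>1 + \<delta>\<close> power integrals on
  cells. The assumption \<open>last\<close> is sparseness read along time, half of each selected
  cell being free of later selections.\<close>

locale sparse_sum =
  fixes s :: real and \<sigma> :: "nat \<Rightarrow> real^'d::finite \<Rightarrow> bool" and \<phi> :: "nat \<Rightarrow> real^'d \<Rightarrow> real"
    and F :: "real^'d \<Rightarrow> ennreal" and C \<delta> t :: real
  assumes s: "s > 0" and \<sigma>: "\<And>k. adapted (2 ^ k * s) (\<sigma> k)"
    and \<phi>m [measurable]: "\<And>k. \<phi> k \<in> borel_measurable lebesgue" and \<phi>0: "\<And>k x. 0 \<le> \<phi> k x"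
    and \<phi>int: "\<And>k x. (\<integral>\<^sup>+y\<in>dcell (2 ^ k * s) x. ennreal (\<phi> k y powr (1 + \<delta>)) \<partial>lebesgue) \<le> ennreal C * emeasure lebesgue (dcell (2 ^ k * s) x)"
    and Fm [measurable]: "F \<in> borel_measurable lebesgue" and Ffin: "(\<integral>\<^sup>+x. F x \<partial>lebesgue) < \<infinity>"
    and C: "C \<ge> 0" and \<delta>: "0 < \<delta>" "\<delta> \<le> 1 / 2" and t: "t > 0"
    and last: "\<And>k x. \<sigma> k x \<Longrightarrow> emeasure lebesgue (dcell (2 ^ k * s) x) \<le>
      2 * emeasure lebesgue {y \<in> dcell (2 ^ k * s) x. \<forall>j>k. \<not> \<sigma> j y}"
begin

abbreviation sc :: "nat \<Rightarrow> real" where "sc k \<equiv> 2 ^ k * s"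

lemma sc: "sc k > 0" using s by simp

text \<open>Normalised by the volume of the cell rather than of the star, so it is the average over
  the star times \<open>kappa\<close>.\<close>

definition b :: "nat \<Rightarrow> real^'d \<Rightarrow> real" where
  "b k x = sc k ^ CARD('d) * enn2real (\<integral>\<^sup>+y\<in>dstar (sc k) x. F y \<partial>lebesgue)"

lemma b_adapted: "adapted (sc k) (b k)"
  unfolding b_def by (rule adapted_dstar)

lemma b_nonneg: "0 \<le> b k x" using s by (simp add: b_def)

lemma b_gt: assumes u: "u \<ge> 0" and gt: "b k x > u"
  shows "ennreal u * emeasure lebesgue (dcell (sc k) x) < (\<integral>\<^sup>+y\<in>dstar (sc k) x. F y \<partial>lebesgue)"
proof -
  have "(\<integral>\<^sup>+y\<in>dstar (sc k) x. F y \<partial>lebesgue) \<le> (\<integral>\<^sup>+y. F y \<partial>lebesgue)"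
    by (intro nn_integral_mono) (auto simp: indicator_def)
  then have fin: "(\<integral>\<^sup>+y\<in>dstar (sc k) x. F y \<partial>lebesgue) < \<infinity>" using Ffin by (rule le_less_trans)
  have sp: "sc k ^ CARD('d) > 0" using sc by simp
  have "ennreal u * emeasure lebesgue (dcell (sc k) x) = ennreal (u / sc k ^ CARD('d))"
    using u sp by (simp add: emeasure_dcell[OF sc] ennreal_mult[symmetric])
  also have "\<dots> < ennreal (enn2real (\<integral>\<^sup>+y\<in>dstar (sc k) x. F y \<partial>lebesgue))"
    using gt sp u by (subst ennreal_less_iff) (auto simp: b_def pos_divide_less_eq mult.commute)
  also have "\<dots> = (\<integral>\<^sup>+y\<in>dstar (sc k) x. F y \<partial>lebesgue)" using fin by simp
  finally show ?thesis .
qed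

lemma b_weak_type:
  assumes u: "u > 0"
  shows "emeasure lebesgue {x. \<exists>k. b k x > u} \<le> ennreal ((kappa TYPE('d))\<^sup>2 / u) * (\<integral>\<^sup>+y. F y \<partial>lebesgue)"
proof -
  have "emeasure lebesgue {x. \<exists>k. b k x > u} \<le>
      emeasure lebesgue {x. \<exists>k::nat. ennreal u * emeasure lebesgue (dcell (2 ^ k * s) x) < (\<integral>\<^sup>+y\<in>dstar (2 ^ k * s) x. F y \<partial>lebesgue)}"
    using b_gt[of u] u by (intro emeasure_mono maximal_star_weak_type(2)[OF s Fm u]) auto
  also have "\<dots> \<le> ennreal ((kappa TYPE('d))\<^sup>2 / u) * (\<integral>\<^sup>+y. F y \<partial>lebesgue)"
    by (rule maximal_star_weak_type(1)[OF s Fm u])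
  finally show ?thesis .
qed

lemma \<sigma>_sets [measurable]: "{x. \<sigma> k x} \<in> sets lebesgue"
  by (rule adapted_sets[OF sc \<sigma>])

lemma last_sets [measurable]: "{y. \<forall>j>k. \<not> \<sigma> j y} \<in> sets lebesgue"
proof -
  have "{y. \<forall>j>k. \<not> \<sigma> j y} = UNIV - (\<Union>j\<in>{k<..}. {y. \<sigma> j y})" by auto
  also have "\<dots> \<in> sets lebesgue" by (intro sets.Diff sets.countable_UN' \<sigma>_sets) auto
  finally show ?thesis .
qed

text \<open>The Carleson packing condition: each cell selected at time \<open>k\<close> is charged to the part of it
  on which nothing is selected afterwards, and those parts are disjoint.\<close>

lemma carleson:
  assumes c: "adapted (sc i) c"
  shows "(\<Sum>k. \<integral>\<^sup>+x. c x * indicator {x. \<sigma> k x \<and> i \<le> k} x \<partial>lebesgue) \<le> 2 * (\<integral>\<^sup>+x. c x \<partial>lebesgue)"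
proof -
  let ?L = "\<lambda>k. {y. \<forall>j>k. \<not> \<sigma> j y}"
  note [measurable] = adapted_borel_measurable[OF sc c]
  have ms: "{x. \<sigma> k x \<and> i \<le> k} \<in> sets lebesgue" for k
    by (cases "i \<le> k") auto
  have *: "(\<integral>\<^sup>+x. c x * indicator {x. \<sigma> k x \<and> i \<le> k} x \<partial>lebesgue) \<le>
      (\<integral>\<^sup>+x. c x * indicator {x. \<sigma> k x \<and> i \<le> k} x * (2 * indicator (?L k) x) \<partial>lebesgue)" for k
  proof (cases "i \<le> k")
    case True
    have "(\<integral>\<^sup>+x. c x * indicator {x. \<sigma> k x} x * 1 \<partial>lebesgue) \<le> (\<integral>\<^sup>+x. c x * indicator {x. \<sigma> k x} x * (2 * indicator (?L k) x) \<partial>lebesgue)"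
    proof (rule adapted_nn_integral_le[OF sc[of k]])
      have "adapted (sc k) c" by (rule adapted_mono[OF c True])
      then show "adapted (sc k) (\<lambda>x. c x * indicator {x. \<sigma> k x} x)"
        using \<sigma>[of k] by (simp add: adapted_def indicator_def)
      fix x assume "c x * indicator {x. \<sigma> k x} x \<noteq> 0"
      then have "\<sigma> k x" by (auto simp: indicator_def split: if_splits)
      from last[OF this] have "emeasure lebesgue (dcell (sc k) x) \<le> 2 * emeasure lebesgue {y \<in> dcell (sc k) x. \<forall>j>k. \<not> \<sigma> j y}" .
      also have "{y \<in> dcell (sc k) x. \<forall>j>k. \<not> \<sigma> j y} = ?L k \<inter> dcell (sc k) x" by auto
      also have "2 * emeasure lebesgue (?L k \<inter> dcell (sc k) x) = (\<integral>\<^sup>+y. 2 * indicator (?L k \<inter> dcell (sc k) x) y \<partial>lebesgue)"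
        using sc by (intro nn_integral_cmult_indicator[symmetric] sets.Int last_sets dcell_sets)
      also have "\<dots> = (\<integral>\<^sup>+y\<in>dcell (sc k) x. 2 * indicator (?L k) y \<partial>lebesgue)"
        by (intro nn_integral_cong) (auto simp: indicator_def)
      finally show "(\<integral>\<^sup>+y\<in>dcell (sc k) x. 1 \<partial>lebesgue) \<le> (\<integral>\<^sup>+y\<in>dcell (sc k) x. 2 * indicator (?L k) y \<partial>lebesgue)"
        using sc by simp
    qed (intro borel_measurable_const borel_measurable_times_ennreal borel_measurable_indicator last_sets)+
    then show ?thesis using True by simp
  qed simp
  have zero: "c x * indicator S x * (2 * indicator R x) = (0 :: ennreal)" if "x \<notin> S \<or> x \<notin> R" for x S R
    using that by auto
  have one: "(\<Sum>k. c x * indicator {x. \<sigma> k x \<and> i \<le> k} x * (2 * indicator (?L k) x)) \<le> 2 * c x" for x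
  proof (cases "\<exists>k. \<sigma> k x \<and> (\<forall>j>k. \<not> \<sigma> j x)")
    case True
    then obtain m where m: "\<sigma> m x" "\<forall>j>m. \<not> \<sigma> j x" by blast
    have "(\<Sum>k. c x * indicator {x. \<sigma> k x \<and> i \<le> k} x * (2 * indicator (?L k) x)) =
        (\<Sum>k\<in>{m}. c x * indicator {x. \<sigma> k x \<and> i \<le> k} x * (2 * indicator (?L k) x))"
    proof (rule suminf_finite)
      fix k assume "k \<notin> {m}"
      then have "x \<notin> {x. \<sigma> k x \<and> i \<le> k} \<or> x \<notin> ?L k"
        using m by (metis linorder_neqE_nat singletonI mem_Collect_eq)
      then show "c x * indicator {x. \<sigma> k x \<and> i \<le> k} x * (2 * indicator (?L k) x) = 0"
        by (rule zero)
    qed simp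
    also have "\<dots> = c x * indicator {x. \<sigma> m x \<and> i \<le> m} x * (2 * indicator (?L m) x)"
    proof -
      have "(\<Sum>k\<in>{m}. f k) = f m" for f :: "nat \<Rightarrow> ennreal" by simp
      then show ?thesis .
    qed
    also have "\<dots> \<le> c x * 1 * (2 * 1)"
      by (intro mult_mono order_refl) (auto split: split_indicator)
    also have "\<dots> = 2 * c x" by (simp add: mult.commute)
    finally show ?thesis .
  next
    case False
    then have "x \<notin> {x. \<sigma> k x \<and> i \<le> k} \<or> x \<notin> ?L k" for k by auto
    then have eq: "c x * indicator {x. \<sigma> k x \<and> i \<le> k} x * (2 * indicator (?L k) x) = 0" for k
      by (intro zero)
    show ?thesis unfolding eq by simp
  qed
  have "(\<Sum>k. \<integral>\<^sup>+x. c x * indicator {x. \<sigma> k x \<and> i \<le> k} x \<partial>lebesgue) \<le>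
      (\<Sum>k. \<integral>\<^sup>+x. c x * indicator {x. \<sigma> k x \<and> i \<le> k} x * (2 * indicator (?L k) x) \<partial>lebesgue)"
    by (intro suminf_le *) auto
  also have "\<dots> = (\<integral>\<^sup>+x. (\<Sum>k. c x * indicator {x. \<sigma> k x \<and> i \<le> k} x * (2 * indicator (?L k) x)) \<partial>lebesgue)"
    by (intro nn_integral_suminf[symmetric] borel_measurable_times_ennreal borel_measurable_indicator
        borel_measurable_const ms last_sets adapted_borel_measurable[OF sc c])
  also have "\<dots> \<le> (\<integral>\<^sup>+x. 2 * c x \<partial>lebesgue)" by (intro nn_integral_mono one)
  also have "\<dots> = 2 * (\<integral>\<^sup>+x. c x \<partial>lebesgue)" by (intro nn_integral_cmult) measurable
  finally show ?thesis .
qed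

section \<open>Dyadic levels of the star averages\<close>

definition L :: "nat \<Rightarrow> nat \<Rightarrow> real^'d \<Rightarrow> bool" where
  "L m k x \<longleftrightarrow> \<sigma> k x \<and> t / 2 ^ Suc m < b k x \<and> b k x \<le> t / 2 ^ m"

lemma L_adapted: "adapted (sc k) (L m k)"
  using \<sigma>[of k] b_adapted[of k] unfolding adapted_def L_def by simp

lemma L_sets [measurable]: "{x. L m k x} \<in> sets lebesgue"
  by (rule adapted_sets[OF sc L_adapted])

text \<open>The generation of a cell within its level, counted from zero.\<close>

definition g :: "nat \<Rightarrow> nat \<Rightarrow> real^'d \<Rightarrow> nat" where
  "g m k x = card {i. i < k \<and> L m i x}"

lemma g_adapted: "adapted (sc k) (g m k)"
proof -
  have "{i. i < k \<and> L m i y} = {i. i < k \<and> L m i x}" if "y \<in> dcell (sc k) x" for x y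
    using adaptedD[OF adapted_mono[OF L_adapted] that] by (auto simp: less_imp_le)
  then show ?thesis by (simp add: adapted_def g_def)
qed

lemma g_Suc: "g m (Suc k) x = (if L m k x then Suc (g m k x) else g m k x)"
proof -
  have "{i. i < Suc k \<and> L m i x} = (if L m k x then insert k {i. i < k \<and> L m i x} else {i. i < k \<and> L m i x})"
    by (auto simp: less_Suc_eq)
  then show ?thesis by (simp add: g_def)
qed

text \<open>Every selection in the level raises the count by one, so the weights telescope. Their
  sum stays below one however many cells of the level contain \<open>x\<close>.\<close>

lemma g_sum: "(\<Sum>k<n. if L m k x then 1 / ((1 + real (g m k x)) * (2 + real (g m k x))) else 0) = 1 - 1 / (1 + real (g m n x))"
proof (induction n)
  case (Suc n)
  have "1 / ((1 + a) * (2 + a)) = 1 / (1 + a) - 1 / (2 + a)" if "a \<ge> 0" for a :: real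
    by (subst diff_frac_eq) (use that in auto)
  from this[of "real (g m n x)"] Suc show ?case by (simp add: g_Suc)
qed (simp add: g_def)

lemma L_exists:
  assumes "\<sigma> k x" "0 < b k x" "b k x \<le> t"
  shows "\<exists>m. L m k x"
proof -
  obtain n :: nat where n: "t / b k x < 2 ^ n" using real_arch_pow[of 2 "t / b k x"] by auto
  then have ex: "\<exists>n. t / 2 ^ n < b k x" using assms(2) by (auto simp: field_simps)
  define n where "n = (LEAST n. t / 2 ^ n < b k x)"
  have n: "t / 2 ^ n < b k x" unfolding n_def using ex by (rule LeastI_ex)
  with assms(3) have "n \<noteq> 0" by (intro notI) simp
  then obtain m where m: "n = Suc m" by (cases n) auto
  have "\<not> t / 2 ^ m < b k x" using not_less_Least[of m "\<lambda>n. t / 2 ^ n < b k x"] m by (simp add: n_def)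
  then show ?thesis using assms(1) n m by (auto simp: L_def)
qed

lemma L_weak_type: "emeasure lebesgue {x. \<exists>k. L m k x} \<le> ennreal ((kappa TYPE('d))\<^sup>2 * 2 ^ Suc m / t) * (\<integral>\<^sup>+y. F y \<partial>lebesgue)"
proof -
  have u: "t / 2 ^ Suc m > 0" using t by simp
  have "{x. \<exists>k. b k x > t / 2 ^ Suc m} \<in> sets lebesgue"
    by (rule sets_ex_adapted[OF s]) (intro adapted_comp[of _ _ "\<lambda>v. v > t / 2 ^ Suc m"] b_adapted)
  then have "emeasure lebesgue {x. \<exists>k. L m k x} \<le> emeasure lebesgue {x. \<exists>k. b k x > t / 2 ^ Suc m}"
    by (intro emeasure_mono) (auto simp: L_def)
  also have "\<dots> \<le> ennreal ((kappa TYPE('d))\<^sup>2 / (t / 2 ^ Suc m)) * (\<integral>\<^sup>+y. F y \<partial>lebesgue)"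
    by (rule b_weak_type[OF u])
  finally show ?thesis by simp
qed

text \<open>Two applications of the packing condition: once for the pairs of selected cells in one level,
  once for the first selected cell of the level.\<close>

lemma level_sum: "(\<Sum>k. \<integral>\<^sup>+x. indicator {x. L m k x} x * (1 + of_nat (g m k x)) \<partial>lebesgue) \<le> 4 * emeasure lebesgue {x. \<exists>k. L m k x}"
proof -
  have gm [measurable]: "(\<lambda>x. of_nat (g m k x) :: ennreal) \<in> borel_measurable lebesgue" for k
    by (rule adapted_borel_measurable[OF sc adapted_comp[OF g_adapted]])
  have pm: "{x. L m k x \<and> i \<le> k} \<in> sets lebesgue" "{x. \<sigma> k x \<and> i \<le> k} \<in> sets lebesgue" for i k
    by (cases "i \<le> k"; auto)+
  \<comment> \<open>At a selected cell \<open>1 + g\<close> is the number of cells of the level up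
    to and including time \<open>k\<close> that contain \<open>x\<close>, so the integral counts
    pairs of nested cells.\<close>
  have count: "indicator {x. L m k x} x * (1 + of_nat (g m k x)) =
      (\<Sum>i. indicator {x. L m i x} x * indicator {x. L m k x \<and> i \<le> k} x :: ennreal)" for k x
  proof -
    have "(\<Sum>i. indicator {x. L m i x} x * indicator {x. L m k x \<and> i \<le> k} x :: ennreal) =
        (\<Sum>i\<in>{..k}. indicator {x. L m i x} x * indicator {x. L m k x \<and> i \<le> k} x)"
      by (rule suminf_finite) auto
    also have "\<dots> = indicator {x. L m k x} x * (\<Sum>i\<in>{..k}. of_bool (L m i x))"
      unfolding sum_distrib_left by (intro sum.cong) (auto simp: indicator_def)
    also have "(\<Sum>i\<in>{..k}. of_bool (L m i x) :: ennreal) = of_nat (g m (Suc k) x)"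
      by (subst sum_of_bool_eq) (auto simp: g_def less_Suc_eq_le intro!: arg_cong[where f = card])
    finally show ?thesis by (simp add: g_Suc indicator_def)
  qed
  have "(\<Sum>k. \<integral>\<^sup>+x. indicator {x. L m k x} x * (1 + of_nat (g m k x)) \<partial>lebesgue) =
      (\<Sum>k. \<Sum>i. \<integral>\<^sup>+x. indicator {x. L m i x} x * indicator {x. L m k x \<and> i \<le> k} x \<partial>lebesgue)"
    unfolding count
    by (intro suminf_cong nn_integral_suminf borel_measurable_times_ennreal borel_measurable_indicator L_sets pm)
  also have "\<dots> = (\<Sum>i. \<Sum>k. \<integral>\<^sup>+x. indicator {x. L m i x} x * indicator {x. L m k x \<and> i \<le> k} x \<partial>lebesgue)"
    by (rule ennreal_suminf_swap)
  also have "\<dots> \<le> (\<Sum>i. 2 * (\<integral>\<^sup>+x. indicator {x. L m i x} x \<partial>lebesgue))"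
  proof (intro suminf_le allI)
    fix i
    have "(\<Sum>k. \<integral>\<^sup>+x. indicator {x. L m i x} x * indicator {x. L m k x \<and> i \<le> k} x \<partial>lebesgue) \<le>
        (\<Sum>k. \<integral>\<^sup>+x. indicator {x. L m i x} x * indicator {x. \<sigma> k x \<and> i \<le> k} x \<partial>lebesgue)"
      by (intro suminf_le nn_integral_mono) (auto simp: indicator_def L_def)
    also have "\<dots> \<le> 2 * (\<integral>\<^sup>+x. indicator {x. L m i x} x \<partial>lebesgue)"
      by (rule carleson) (use L_adapted[of i m] in \<open>simp add: adapted_def indicator_def\<close>)
    finally show "(\<Sum>k. \<integral>\<^sup>+x. indicator {x. L m i x} x * indicator {x. L m k x \<and> i \<le> k} x \<partial>lebesgue) \<le>
        2 * (\<integral>\<^sup>+x. indicator {x. L m i x} x \<partial>lebesgue)" .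
  qed auto
  also have "\<dots> = 2 * (\<Sum>k. \<integral>\<^sup>+x. indicator {x. L m k x} x \<partial>lebesgue)"
    by (rule ennreal_suminf_cmult)
  also have "\<dots> \<le> 2 * (2 * emeasure lebesgue {x. \<exists>k. L m k x})"
  proof (rule mult_left_mono)
    let ?f = "\<lambda>i. {x. first_time (L m) i x}"
    have fa: "adapted (sc i) (first_time (L m) i)" for i by (rule adapted_first_time[OF L_adapted])
    have fs [measurable]: "?f i \<in> sets lebesgue" for i by (rule adapted_sets[OF sc fa])
    have split: "indicator {x. L m k x} x \<le> (\<Sum>i. indicator (?f i) x * indicator {x. \<sigma> k x \<and> i \<le> k} x :: ennreal)" for k x
    proof (cases "L m k x")
      case True
      from first_time_exists[where P = "L m", OF True] obtain i where i: "i \<le> k" "first_time (L m) i x" by blast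
      have "indicator {x. L m k x} x \<le> (indicator (?f i) x * indicator {x. \<sigma> k x \<and> i \<le> k} x :: ennreal)"
        using True i by (simp add: L_def)
      also have "\<dots> \<le> (\<Sum>i. indicator (?f i) x * indicator {x. \<sigma> k x \<and> i \<le> k} x :: ennreal)"
        by (rule ennreal_term_le_suminf)
      finally show ?thesis .
    qed simp
    have "(\<Sum>k. \<integral>\<^sup>+x. indicator {x. L m k x} x \<partial>lebesgue) \<le>
        (\<Sum>k. \<integral>\<^sup>+x. (\<Sum>i. indicator (?f i) x * indicator {x. \<sigma> k x \<and> i \<le> k} x) \<partial>lebesgue)"
      by (intro suminf_le nn_integral_mono split) auto
    also have "\<dots> = (\<Sum>k. \<Sum>i. \<integral>\<^sup>+x. indicator (?f i) x * indicator {x. \<sigma> k x \<and> i \<le> k} x \<partial>lebesgue)"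
      by (intro suminf_cong nn_integral_suminf borel_measurable_times_ennreal borel_measurable_indicator fs pm)
    also have "\<dots> = (\<Sum>i. \<Sum>k. \<integral>\<^sup>+x. indicator (?f i) x * indicator {x. \<sigma> k x \<and> i \<le> k} x \<partial>lebesgue)"
      by (rule ennreal_suminf_swap)
    also have "\<dots> \<le> (\<Sum>i. 2 * (\<integral>\<^sup>+x. indicator (?f i) x \<partial>lebesgue))"
      by (intro suminf_le carleson) (use fa in \<open>auto simp: adapted_def indicator_def\<close>)
    also have "\<dots> = 2 * (\<Sum>i. \<integral>\<^sup>+x. 1 * indicator (?f i) x \<partial>lebesgue)"
      by (simp add: ennreal_suminf_cmult)
    also have "\<dots> = 2 * (\<integral>\<^sup>+x. 1 * indicator {x. \<exists>k. L m k x} x \<partial>lebesgue)"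
      by (subst nn_integral_first_time[where P = "L m", OF s L_adapted]) auto
    also have "\<dots> = 2 * emeasure lebesgue {x. \<exists>k. L m k x}"
      using sets_ex_adapted[where P = "L m", OF s L_adapted] by simp
    finally show "(\<Sum>k. \<integral>\<^sup>+x. indicator {x. L m k x} x \<partial>lebesgue) \<le> 2 * emeasure lebesgue {x. \<exists>k. L m k x}" .
  qed simp
  finally show ?thesis by (simp add: mult.assoc[symmetric])
qed

text \<open>\<open>2 / 3\<close> is the product of \<open>4 / 3\<close>, the inverse ratio of the
  thresholds, and \<open>1 / 2\<close>, the ratio of consecutive levels. The geometric series of
  \<open>\<eta>\<close> has sum at most \<open>3 / \<delta>\<close>, which is where the factor
  \<open>1 / \<delta>\<close> of the sparse bound comes from.\<close>

definition \<eta> :: real where "\<eta> = (2 / 3) powr \<delta>"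

lemma eta: "0 < \<eta>" "\<eta> \<le> 1 - \<delta> / 3"
proof -
  show "0 < \<eta>" by (simp add: \<eta>_def)
  have "(2 / 3) powr \<delta> * 1 powr (1 - \<delta>) \<le> \<delta> * (2 / 3) + (1 - \<delta>) * (1 :: real)"
    using \<delta> by (intro Youngs_inequality_0) auto
  then show "\<eta> \<le> 1 - \<delta> / 3" by (simp add: \<eta>_def)
qed

lemma eta_sum: "(\<Sum>m. ennreal (\<eta> ^ m)) \<le> ennreal (3 / \<delta>)"
proof -
  have n: "norm \<eta> < 1" using eta \<delta> by simp
  have "(\<Sum>m. ennreal (\<eta> ^ m)) = ennreal (\<Sum>m. \<eta> ^ m)"
    using n eta(1) by (intro suminf_ennreal2 summable_geometric) auto
  also have "(\<Sum>m. \<eta> ^ m) = 1 / (1 - \<eta>)" by (rule suminf_geometric[OF n])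
  also have "ennreal (1 / (1 - \<eta>)) \<le> ennreal (3 / \<delta>)"
    using eta \<delta> by (intro ennreal_leI) (simp add: field_simps)
  finally show ?thesis .
qed

text \<open>With \<open>\<rho> = (3/4)^m / ((1 + g) (2 + g))\<close>, use \<open>z \<le> \<rho> + \<rho> powr (- \<delta>) * z powr (1 + \<delta>)\<close>: the first
  terms have bounded sum, and the second ones decay geometrically in the level \<open>m\<close>.\<close>

lemma pointwise_split:
  assumes L: "L m k x"
  shows "b k x / t * \<phi> k x \<le> (3 / 4) ^ m * (1 / ((1 + real (g m k x)) * (2 + real (g m k x)))) +
    2 * (1 + real (g m k x)) * (\<eta> ^ m / 2 ^ m) * \<phi> k x powr (1 + \<delta>)"
proof -
  let ?g = "real (g m k x)"
  define \<rho> where "\<rho> = (3 / 4 :: real) ^ m * (1 / ((1 + ?g) * (2 + ?g)))"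
  define z where "z = b k x / t * \<phi> k x"
  have \<rho>: "\<rho> > 0" unfolding \<rho>_def by (intro mult_pos_pos) auto
  have z0: "z \<ge> 0" unfolding z_def using b_nonneg \<phi>0 t by simp
  have zb: "z \<le> (1 / 2) ^ m * \<phi> k x"
    unfolding z_def using L t \<phi>0[of k x] by (intro mult_right_mono) (auto simp: L_def field_simps power_one_over)
  show ?thesis
  proof (cases "z \<le> \<rho>")
    case True
    moreover have "0 \<le> 2 * (1 + ?g) * (\<eta> ^ m / 2 ^ m) * \<phi> k x powr (1 + \<delta>)"
      using eta(1) by simp
    ultimately show ?thesis unfolding z_def \<rho>_def by linarith
  next
    case False
    then have zp: "z > \<rho>" "z > 0" using \<rho> by auto
    have "z = z powr (- \<delta>) * z powr (1 + \<delta>)" using zp by (simp add: powr_add[symmetric])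
    also have "\<dots> \<le> \<rho> powr (- \<delta>) * z powr (1 + \<delta>)"
      using zp \<rho> \<delta> by (intro mult_right_mono powr_mono2') auto
    also have "\<dots> \<le> (2 * (1 + ?g) * (4 / 3) powr (\<delta> * m)) * ((1 / 2) ^ m * (1 / 2) powr (\<delta> * m) * \<phi> k x powr (1 + \<delta>))"
    proof (rule mult_mono)
      have "\<rho> powr (- \<delta>) = (1 / \<rho>) powr \<delta>" using \<rho> by (simp add: powr_minus_divide powr_divide)
      also have "1 / \<rho> = (4 / 3) ^ m * ((1 + ?g) * (2 + ?g))"
        by (simp add: \<rho>_def power_divide field_simps)
      also have "\<dots> powr \<delta> = ((4 / 3) ^ m) powr \<delta> * ((1 + ?g) * (2 + ?g)) powr \<delta>"
        by (rule powr_mult)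
      also have "((4 / 3 :: real) ^ m) powr \<delta> = (4 / 3) powr (\<delta> * m)"
        by (simp add: powr_realpow[symmetric] powr_powr mult.commute)
      \<comment> \<open>Since \<open>\<delta> \<le> 1 / 2\<close>, the power of this quadratic
        expression grows at most linearly in the generation, and a linear weight is what
        \<open>level_sum\<close> can afford.\<close>
      also have "((1 + ?g) * (2 + ?g)) powr \<delta> \<le> 2 * (1 + ?g)"
      proof -
        have "((1 + ?g) * (2 + ?g)) powr \<delta> \<le> ((2 * (1 + ?g)) ^ 2) powr \<delta>"
          using \<delta> by (intro powr_mono2) (auto simp: power2_eq_square intro!: mult_mono)
        also have "\<dots> \<le> ((2 * (1 + ?g)) ^ 2) powr (1 / 2)"
          using \<delta> by (intro powr_mono) (auto intro!: one_le_power)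
        also have "\<dots> = 2 * (1 + ?g)" by (simp add: powr_half_sqrt)
        finally show ?thesis .
      qed
      finally show "\<rho> powr (- \<delta>) \<le> 2 * (1 + ?g) * (4 / 3) powr (\<delta> * m)"
        by (simp add: mult.commute mult_left_mono)
      have "z powr (1 + \<delta>) \<le> ((1 / 2) ^ m * \<phi> k x) powr (1 + \<delta>)"
        using z0 zb \<delta> by (intro powr_mono2) auto
      also have "\<dots> = ((1 / 2) ^ m) powr (1 + \<delta>) * \<phi> k x powr (1 + \<delta>)"
        by (rule powr_mult)
      also have "((1 / 2 :: real) ^ m) powr (1 + \<delta>) = (1 / 2) ^ m * (1 / 2) powr (\<delta> * m)"
        by (simp add: powr_realpow[symmetric] powr_powr powr_add[symmetric] algebra_simps)
      finally show "z powr (1 + \<delta>) \<le> (1 / 2) ^ m * (1 / 2) powr (\<delta> * m) * \<phi> k x powr (1 + \<delta>)" .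
    qed auto
    also have "\<dots> = 2 * (1 + ?g) * (((4 / 3) powr (\<delta> * m) * (1 / 2) powr (\<delta> * m)) / 2 ^ m) * \<phi> k x powr (1 + \<delta>)"
      by (simp add: power_one_over field_simps)
    also have "(4 / 3) powr (\<delta> * m) * (1 / 2) powr (\<delta> * m) = \<eta> ^ m"
      by (simp add: \<eta>_def powr_powr[symmetric] powr_realpow flip: power_mult_distrib powr_mult)
    finally have "z \<le> 2 * (1 + ?g) * (\<eta> ^ m / 2 ^ m) * \<phi> k x powr (1 + \<delta>)" .
    then show ?thesis using \<rho> unfolding z_def \<rho>_def by linarith
  qed
qed

definition H :: "real^'d \<Rightarrow> ennreal" where
  "H x = (\<Sum>m. \<Sum>k. ennreal (2 * (\<eta> ^ m / 2 ^ m)) * (indicator {x. L m k x} x * (1 + of_nat (g m k x)) * ennreal (\<phi> k x powr (1 + \<delta>))))"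

lemma g_measurable [measurable]: "(\<lambda>x. of_nat (g m k x) :: ennreal) \<in> borel_measurable lebesgue"
  by (rule adapted_borel_measurable[OF sc adapted_comp[OF g_adapted]])

lemma H_measurable [measurable]: "H \<in> borel_measurable lebesgue"
  unfolding H_def by measurable

text \<open>The weak type bound of level \<open>m\<close> grows like \<open>2 ^ Suc m\<close>, which
  the \<open>2 ^ m\<close> in the denominator of \<open>H\<close> offsets; what remains is geometric
  in \<open>\<eta>\<close>. The \<open>48\<close> is the \<open>2\<close> in \<open>H\<close>, the
  \<open>4\<close> of \<open>level_sum\<close>, the \<open>2\<close> from \<open>Suc m\<close> and
  the \<open>3\<close> of \<open>eta_sum\<close>.\<close>

lemma H_integral: "(\<integral>\<^sup>+x. H x \<partial>lebesgue) \<le> ennreal (48 * C * (kappa TYPE('d))\<^sup>2 / (\<delta> * t)) * (\<integral>\<^sup>+x. F x \<partial>lebesgue)"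
proof -
  let ?F = "\<integral>\<^sup>+x. F x \<partial>lebesgue" and ?k = "(kappa TYPE('d))\<^sup>2"
  have "(\<integral>\<^sup>+x. H x \<partial>lebesgue) = (\<Sum>m. \<Sum>k. ennreal (2 * (\<eta> ^ m / 2 ^ m)) *
      (\<integral>\<^sup>+x. indicator {x. L m k x} x * (1 + of_nat (g m k x)) * ennreal (\<phi> k x powr (1 + \<delta>)) \<partial>lebesgue))"
    unfolding H_def by (simp add: nn_integral_suminf nn_integral_cmult)
  also have "\<dots> \<le> (\<Sum>m. ennreal (16 * C * ?k / t) * ?F * ennreal (\<eta> ^ m))"
  proof (intro suminf_le allI)
    fix m
    have each: "(\<integral>\<^sup>+x. indicator {x. L m k x} x * (1 + of_nat (g m k x)) * ennreal (\<phi> k x powr (1 + \<delta>)) \<partial>lebesgue) \<le>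
        ennreal C * (\<integral>\<^sup>+x. indicator {x. L m k x} x * (1 + of_nat (g m k x)) \<partial>lebesgue)" for k
    proof -
      have "(\<integral>\<^sup>+x. indicator {x. L m k x} x * (1 + of_nat (g m k x)) * ennreal (\<phi> k x powr (1 + \<delta>)) \<partial>lebesgue) \<le>
          (\<integral>\<^sup>+x. indicator {x. L m k x} x * (1 + of_nat (g m k x)) * ennreal C \<partial>lebesgue)"
      proof (rule adapted_nn_integral_le[OF sc[of k]])
        show "adapted (sc k) (\<lambda>x. indicator {x. L m k x} x * (1 + of_nat (g m k x)) :: ennreal)"
          using L_adapted[of k m] g_adapted[of k m] by (simp add: adapted_def indicator_def)
        fix x
        show "(\<integral>\<^sup>+y\<in>dcell (sc k) x. ennreal (\<phi> k y powr (1 + \<delta>)) \<partial>lebesgue) \<le> (\<integral>\<^sup>+y\<in>dcell (sc k) x. ennreal C \<partial>lebesgue)"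
          using \<phi>int[of k x] sc by (simp add: nn_integral_cmult_indicator)
      qed measurable
      also have "\<dots> = ennreal C * (\<integral>\<^sup>+x. indicator {x. L m k x} x * (1 + of_nat (g m k x)) \<partial>lebesgue)"
        by (subst nn_integral_cmult[symmetric]) (auto simp: mult_ac)
      finally show ?thesis .
    qed
    have "(\<Sum>k. ennreal (2 * (\<eta> ^ m / 2 ^ m)) *
        (\<integral>\<^sup>+x. indicator {x. L m k x} x * (1 + of_nat (g m k x)) * ennreal (\<phi> k x powr (1 + \<delta>)) \<partial>lebesgue)) \<le>
      (\<Sum>k. ennreal (2 * (\<eta> ^ m / 2 ^ m)) * (ennreal C * (\<integral>\<^sup>+x. indicator {x. L m k x} x * (1 + of_nat (g m k x)) \<partial>lebesgue)))"
      by (intro suminf_le mult_left_mono each) auto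
    also have "\<dots> = ennreal (2 * (\<eta> ^ m / 2 ^ m)) * (ennreal C * (\<Sum>k. \<integral>\<^sup>+x. indicator {x. L m k x} x * (1 + of_nat (g m k x)) \<partial>lebesgue))"
      by (simp only: ennreal_suminf_cmult)
    also have "\<dots> \<le> ennreal (2 * (\<eta> ^ m / 2 ^ m)) * (ennreal C * (ennreal 4 * (ennreal (?k * 2 ^ Suc m / t) * ?F)))"
    proof (intro mult_left_mono)
      have "(\<Sum>k. \<integral>\<^sup>+x. indicator {x. L m k x} x * (1 + of_nat (g m k x)) \<partial>lebesgue) \<le> 4 * emeasure lebesgue {x. \<exists>k. L m k x}"
        by (rule level_sum)
      also have "\<dots> \<le> 4 * (ennreal (?k * 2 ^ Suc m / t) * ?F)"
        by (intro mult_left_mono L_weak_type) simp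
      finally show "(\<Sum>k. \<integral>\<^sup>+x. indicator {x. L m k x} x * (1 + of_nat (g m k x)) \<partial>lebesgue) \<le> ennreal 4 * (ennreal (?k * 2 ^ Suc m / t) * ?F)"
        by simp
    qed auto
    also have "\<dots> = ennreal (2 * (\<eta> ^ m / 2 ^ m) * (C * (4 * (?k * 2 ^ Suc m / t)))) * ?F"
    proof -
      have "ennreal a * (ennreal C * (ennreal 4 * (ennreal d * ?F))) = ennreal (a * (C * (4 * d))) * ?F"
        if "a \<ge> 0" "d \<ge> 0" for a d :: real
        using that C by (simp add: ennreal_mult mult.assoc)
      then show ?thesis using eta(1) t by simp
    qed
    also have "2 * (\<eta> ^ m / 2 ^ m) * (C * (4 * (?k * 2 ^ Suc m / t))) = 16 * C * ?k / t * \<eta> ^ m"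
      by simp
    also have "ennreal (16 * C * ?k / t * \<eta> ^ m) * ?F = ennreal (16 * C * ?k / t) * ?F * ennreal (\<eta> ^ m)"
      using eta(1) C t by (subst ennreal_mult) (auto simp: mult_ac)
    finally show "(\<Sum>k. ennreal (2 * (\<eta> ^ m / 2 ^ m)) *
        (\<integral>\<^sup>+x. indicator {x. L m k x} x * (1 + of_nat (g m k x)) * ennreal (\<phi> k x powr (1 + \<delta>)) \<partial>lebesgue)) \<le>
      ennreal (16 * C * ?k / t) * ?F * ennreal (\<eta> ^ m)" .
  qed auto
  also have "\<dots> = ennreal (16 * C * ?k / t) * ?F * (\<Sum>m. ennreal (\<eta> ^ m))"
    by (rule ennreal_suminf_cmult)
  also have "\<dots> \<le> ennreal (16 * C * ?k / t) * ?F * ennreal (3 / \<delta>)"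
    by (intro mult_left_mono eta_sum) auto
  also have "\<dots> = ennreal (16 * C * ?k / t * (3 / \<delta>)) * ?F"
    using C t \<delta> by (subst ennreal_mult) (auto simp: mult_ac)
  also have "16 * C * ?k / t * (3 / \<delta>) = 48 * C * ?k / (\<delta> * t)" by (simp add: mult_ac)
  finally show ?thesis .
qed

text \<open>In each level the thresholds sum to at most \<open>(3 / 4) ^ m\<close> by
  \<open>g_sum\<close>, and these sum to four. A selected cell with \<open>b k x = 0\<close> belongs
  to no level and contributes nothing.\<close>

lemma sparse_pointwise:
  assumes x: "\<And>k. b k x \<le> t"
  shows "(\<Sum>k. indicator {x. \<sigma> k x} x * ennreal (b k x / t * \<phi> k x)) \<le> 4 + H x"
proof -
  let ?r = "\<lambda>m k. (3 / 4 :: real) ^ m * (if L m k x then 1 / ((1 + real (g m k x)) * (2 + real (g m k x))) else 0)"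
  let ?h = "\<lambda>m k. ennreal (2 * (\<eta> ^ m / 2 ^ m)) * (indicator {x. L m k x} x * (1 + of_nat (g m k x)) * ennreal (\<phi> k x powr (1 + \<delta>)))"
  have r0: "?r m k \<ge> 0" for m k by simp
  have each: "indicator {x. \<sigma> k x} x * ennreal (b k x / t * \<phi> k x) \<le> (\<Sum>m. ennreal (?r m k) + ?h m k)" for k
  proof (cases "\<sigma> k x \<and> b k x > 0")
    case True
    then obtain m where m: "L m k x" using L_exists x by blast
    have "ennreal (b k x / t * \<phi> k x) \<le> ennreal (?r m k + 2 * (1 + real (g m k x)) * (\<eta> ^ m / 2 ^ m) * \<phi> k x powr (1 + \<delta>))"
      using pointwise_split[OF m] m by (intro ennreal_leI) simp
    also have "\<dots> = ennreal (?r m k) + ennreal (2 * (1 + real (g m k x)) * (\<eta> ^ m / 2 ^ m) * \<phi> k x powr (1 + \<delta>))"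
      using r0 eta(1) by (intro ennreal_plus) auto
    also have "ennreal (2 * (1 + real (g m k x)) * (\<eta> ^ m / 2 ^ m) * \<phi> k x powr (1 + \<delta>)) =
        ennreal (2 * (\<eta> ^ m / 2 ^ m)) * (ennreal (1 + real (g m k x)) * ennreal (\<phi> k x powr (1 + \<delta>)))"
      using eta(1) by (simp only: ennreal_mult[symmetric] ennreal_mult'[symmetric])
        (subst ennreal_mult[symmetric], auto simp: ennreal_mult[symmetric] mult_ac simp del: ennreal_plus)
    also have "ennreal (1 + real (g m k x)) = 1 + of_nat (g m k x)"
      by (simp add: ennreal_of_nat_eq_real_of_nat)
    also have "ennreal (?r m k) + ennreal (2 * (\<eta> ^ m / 2 ^ m)) * ((1 + of_nat (g m k x)) * ennreal (\<phi> k x powr (1 + \<delta>))) = ennreal (?r m k) + ?h m k"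
      using m by simp
    also have "\<dots> \<le> (\<Sum>m. ennreal (?r m k) + ?h m k)" by (rule ennreal_term_le_suminf)
    finally show ?thesis using True by simp
  next
    case False
    then have eq: "indicator {x. \<sigma> k x} x * ennreal (b k x / t * \<phi> k x) = 0"
      using b_nonneg[of k x] by (cases "\<sigma> k x") (auto simp: not_less)
    show ?thesis unfolding eq by (rule zero_le)
  qed
  have "(\<Sum>k. indicator {x. \<sigma> k x} x * ennreal (b k x / t * \<phi> k x)) \<le> (\<Sum>k. \<Sum>m. ennreal (?r m k) + ?h m k)"
    by (intro suminf_le each) auto
  also have "\<dots> = (\<Sum>m. \<Sum>k. ennreal (?r m k) + ?h m k)" by (rule ennreal_suminf_swap)
  also have "\<dots> = (\<Sum>m. (\<Sum>k. ennreal (?r m k)) + (\<Sum>k. ?h m k))"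
    by (intro suminf_cong suminf_add[symmetric]) auto
  also have "\<dots> = (\<Sum>m. \<Sum>k. ennreal (?r m k)) + H x"
    unfolding H_def by (intro suminf_add[symmetric]) auto
  also have "(\<Sum>m. \<Sum>k. ennreal (?r m k)) \<le> (\<Sum>m. ennreal ((3 / 4) ^ m))"
  proof (intro suminf_le allI)
    fix m
    show "(\<Sum>k. ennreal (?r m k)) \<le> ennreal ((3 / 4) ^ m)"
    proof (rule suminf_le_const)
      fix n
      have "(\<Sum>k<n. ?r m k) = (3 / 4) ^ m * (1 - 1 / (1 + real (g m n x)))"
        unfolding sum_distrib_left[symmetric] g_sum ..
      also have "\<dots> \<le> (3 / 4) ^ m * 1" by (intro mult_left_mono) auto
      finally have "ennreal (\<Sum>k<n. ?r m k) \<le> ennreal ((3 / 4) ^ m)" by (intro ennreal_leI) simp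
      then show "(\<Sum>k<n. ennreal (?r m k)) \<le> ennreal ((3 / 4) ^ m)" using r0 by (simp only: sum_ennreal)
    qed simp
  qed auto
  also have "(\<Sum>m. ennreal ((3 / 4) ^ m)) = ennreal (\<Sum>m. (3 / 4) ^ m)"
    by (intro suminf_ennreal2 summable_geometric) auto
  also have "(\<Sum>m. (3 / 4 :: real) ^ m) = 4" by (subst suminf_geometric) auto
  finally show ?thesis by (simp add: add_right_mono)
qed

text \<open>Where all star averages are at most \<open>t\<close>, a sum above five forces
  \<open>H\<close> above one, and Chebyshev's inequality applies to \<open>H\<close>. The remaining
  set is covered by the maximal inequality for stars.\<close>

theorem sparse_weak_type:
  "emeasure lebesgue {x. 5 < (\<Sum>k. indicator {x. \<sigma> k x} x * ennreal (b k x / t * \<phi> k x))} \<le>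
    ennreal ((kappa TYPE('d))\<^sup>2 * (1 + 48 * C / \<delta>) / t) * (\<integral>\<^sup>+x. F x \<partial>lebesgue)"
proof -
  let ?F = "\<integral>\<^sup>+x. F x \<partial>lebesgue" and ?k = "(kappa TYPE('d))\<^sup>2"
  let ?A = "{x. \<exists>k. b k x > t}" and ?B = "{x. 1 \<le> H x}"
  have A: "?A \<in> sets lebesgue"
    by (rule sets_ex_adapted[OF s]) (intro adapted_comp[of _ _ "\<lambda>v. v > t"] b_adapted)
  have "{x \<in> space lebesgue. 1 \<le> H x} \<in> sets lebesgue" by measurable
  then have B: "?B \<in> sets lebesgue" by simp
  have sub: "{x. 5 < (\<Sum>k. indicator {x. \<sigma> k x} x * ennreal (b k x / t * \<phi> k x))} \<subseteq> ?A \<union> ?B"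
  proof
    fix x assume x: "x \<in> {x. 5 < (\<Sum>k. indicator {x. \<sigma> k x} x * ennreal (b k x / t * \<phi> k x))}"
    show "x \<in> ?A \<union> ?B"
    proof (rule ccontr)
      assume n: "x \<notin> ?A \<union> ?B"
      then have "5 < 4 + H x" using sparse_pointwise[of x] x by (auto simp: not_less intro: less_le_trans)
      moreover have "4 + H x \<le> 4 + 1" using n by (intro add_left_mono) auto
      ultimately show False by simp
    qed
  qed
  have "emeasure lebesgue {x. 5 < (\<Sum>k. indicator {x. \<sigma> k x} x * ennreal (b k x / t * \<phi> k x))} \<le> emeasure lebesgue (?A \<union> ?B)"
    using A B by (intro emeasure_mono sub) auto
  also have "\<dots> \<le> emeasure lebesgue ?A + emeasure lebesgue ?B" by (rule emeasure_subadditive[OF A B])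
  also have "\<dots> \<le> ennreal (?k / t) * ?F + ennreal (48 * C * ?k / (\<delta> * t)) * ?F"
  proof (rule add_mono[OF b_weak_type[OF t]])
    have "emeasure lebesgue ?B = (\<integral>\<^sup>+x. indicator ?B x \<partial>lebesgue)" using B by simp
    also have "\<dots> \<le> (\<integral>\<^sup>+x. H x \<partial>lebesgue)" by (intro nn_integral_mono) (auto simp: indicator_def)
    finally show "emeasure lebesgue ?B \<le> ennreal (48 * C * ?k / (\<delta> * t)) * ?F"
      using H_integral by (rule order_trans)
  qed
  also have "\<dots> = ennreal (?k / t + 48 * C * ?k / (\<delta> * t)) * ?F"
    using C t \<delta> by (subst ennreal_plus) (auto simp: distrib_right)
  also have "?k / t + 48 * C * ?k / (\<delta> * t) = ?k * (1 + 48 * C / \<delta>) / t"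
    using t \<delta> by (simp add: field_simps)
  finally show ?thesis .
qed

end

section \<open>Exceptional sets of a matrix weight\<close>

context cz_op
begin

lemma kernel_far:
  assumes s: "s > 0" and y: "y \<notin> dstar s x"
  shows "norm (K x y) \<le> \<bar>cK\<bar> / (2 * real CARD('d) / s) ^ CARD('d)"
proof -
  have d: "norm (x - y) > 2 * real CARD('d) / s" by (rule not_dstar_dist[OF s y])
  have p: "2 * real CARD('d) / s > 0" using s by simp
  then have "x \<noteq> y" using d by auto
  then have "norm (K x y) \<le> cK / norm (x - y) ^ CARD('d)" by (rule K_size)
  also have "\<dots> \<le> \<bar>cK\<bar> / norm (x - y) ^ CARD('d)" by (intro divide_right_mono) auto
  also have "\<dots> \<le> \<bar>cK\<bar> / (2 * real CARD('d) / s) ^ CARD('d)"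
    using p d by (intro divide_left_mono power_mono mult_pos_pos zero_less_power) auto
  finally show ?thesis .
qed

text \<open>A function vanishing on the star keeps a gap of at least \<open>2 d / s\<close> from
  every point of the cell, so the closure of its support misses the cell.\<close>

lemma T_off_support:
  assumes s: "s > 0" and h: "nice h" and zero: "\<And>y. y \<in> dstar s z \<Longrightarrow> h y = 0"
  shows "AE x in lebesgue. x \<in> dcell s z \<longrightarrow> T h x = (\<integral>y. K x y * h y \<partial>lebesgue)"
  using K_rep[OF nice_L2[OF h]]
proof eventually_elim
  case (elim x)
  show ?case
  proof
    assume x: "x \<in> dcell s z"
    have "x \<notin> closure {y. h y \<noteq> 0}"
    proof
      assume "x \<in> closure {y. h y \<noteq> 0}"
      moreover have "2 * real CARD('d) / s > 0" using s by simp
      ultimately obtain y where y: "h y \<noteq> 0" "dist y x < 2 * real CARD('d) / s"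
        unfolding closure_approachable by blast
      then have "y \<notin> dstar s x" using zero[of y] dstar_eq[OF x] by auto
      from not_dstar_dist[OF s this] y(2) show False by (simp add: dist_norm norm_minus_commute)
    qed
    then show "T h x = (\<integral>y. K x y * h y \<partial>lebesgue)" using elim by blast
  qed
qed

lemma kernel_integrable:
  assumes s: "s > 0" and h: "nice h" and zero: "\<And>y. y \<in> dstar s x \<Longrightarrow> h y = 0"
  shows "integrable lebesgue (\<lambda>y. K x y * h y)"
proof (rule Bochner_Integration.integrable_bound)
  note [measurable] = nice_measurable[OF h]
  show "integrable lebesgue (\<lambda>y. \<bar>cK\<bar> / (2 * real CARD('d) / s) ^ CARD('d) * norm (h y))"
    using nice_integrable[OF h] by simp
  show "(\<lambda>y. K x y * h y) \<in> borel_measurable lebesgue" by measurable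
  show "AE y in lebesgue. norm (K x y * h y) \<le> norm (\<bar>cK\<bar> / (2 * real CARD('d) / s) ^ CARD('d) * norm (h y))"
  proof (intro AE_I2)
    fix y
    show "norm (K x y * h y) \<le> norm (\<bar>cK\<bar> / (2 * real CARD('d) / s) ^ CARD('d) * norm (h y))"
    proof (cases "y \<in> dstar s x")
      case True
      then show ?thesis using zero[of y] by simp
    next
      case False
      show ?thesis using mult_right_mono[OF kernel_far[OF s False] norm_ge_zero[of "h y"]] s
        by (simp add: norm_mult abs_mult)
    qed
  qed
qed

lemma kernel_integral_oscillation:
  assumes s: "s > 0" and h: "nice h" and zero: "\<And>y. y \<in> dstar s x \<Longrightarrow> h y = 0" and x': "x' \<in> dcell s x"
  shows "ennreal (norm ((\<integral>y. K x y * h y \<partial>lebesgue) - (\<integral>y. K x' y * h y \<partial>lebesgue))) \<le>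
    (\<Sum>l. ennreal (om l * (s / 2 ^ Suc l) ^ CARD('d)) * (\<integral>\<^sup>+y\<in>dstar (s / 2 ^ Suc l) x. ennreal (norm (h y)) \<partial>lebesgue))"
proof -
  let ?a = "\<lambda>l. ennreal (om l * (s / 2 ^ Suc l) ^ CARD('d))"
  have r: "s / 2 ^ Suc l > 0" for l using s by simp
  have hm: "(\<lambda>y. ennreal (norm (h y))) \<in> borel_measurable lebesgue"
    using nice_measurable[OF h] by measurable
  have i1: "integrable lebesgue (\<lambda>y. K x y * h y)" by (rule kernel_integrable[OF s h zero])
  have i2: "integrable lebesgue (\<lambda>y. K x' y * h y)"
    by (rule kernel_integrable[OF s h]) (use zero dstar_eq[OF x'] in auto)
  have "ennreal (norm ((\<integral>y. K x y * h y \<partial>lebesgue) - (\<integral>y. K x' y * h y \<partial>lebesgue))) =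
      ennreal (norm (\<integral>y. K x y * h y - K x' y * h y \<partial>lebesgue))" using i1 i2 by simp
  also have "\<dots> \<le> (\<integral>\<^sup>+y. ennreal (norm (K x y * h y - K x' y * h y)) \<partial>lebesgue)"
    by (intro integral_norm_bound_ennreal Bochner_Integration.integrable_diff i1 i2)
  also have "\<dots> \<le> (\<integral>\<^sup>+y. (\<Sum>l. ?a l * (ennreal (norm (h y)) * indicator (dstar (s / 2 ^ Suc l) x) y)) \<partial>lebesgue)"
  proof (rule nn_integral_mono)
    fix y
    show "ennreal (norm (K x y * h y - K x' y * h y)) \<le>
        (\<Sum>l. ?a l * (ennreal (norm (h y)) * indicator (dstar (s / 2 ^ Suc l) x) y))"
    proof (cases "y \<in> dstar s x")
      case True
      then show ?thesis using zero[of y] by simp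
    next
      case False
      have "ennreal (norm (K x y * h y - K x' y * h y)) = ennreal (norm (K x y - K x' y)) * ennreal (norm (h y))"
        by (simp add: ennreal_mult[symmetric] norm_mult[symmetric] left_diff_distrib)
      also have "\<dots> \<le> ennreal (norm (K x y - K x' y) + norm (K y x - K y x')) * ennreal (norm (h y))"
        by (intro mult_right_mono ennreal_leI) auto
      also have "\<dots> \<le> (\<Sum>l. ?a l * indicator (dstar (s / 2 ^ Suc l) x) y) * ennreal (norm (h y))"
        by (intro mult_right_mono K_oscillation[OF s x' False]) auto
      also have "\<dots> = (\<Sum>l. ?a l * (ennreal (norm (h y)) * indicator (dstar (s / 2 ^ Suc l) x) y))"
        unfolding ennreal_suminf_multc[symmetric] by (intro suminf_cong) (simp add: mult_ac)
      finally show ?thesis .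
    qed
  qed
  also have "\<dots> = (\<Sum>l. \<integral>\<^sup>+y. ?a l * (ennreal (norm (h y)) * indicator (dstar (s / 2 ^ Suc l) x) y) \<partial>lebesgue)"
    using r hm by (intro nn_integral_suminf borel_measurable_times_ennreal borel_measurable_indicator dstar_sets) auto
  also have "\<dots> = (\<Sum>l. ?a l * (\<integral>\<^sup>+y\<in>dstar (s / 2 ^ Suc l) x. ennreal (norm (h y)) \<partial>lebesgue))"
    using r hm by (intro suminf_cong nn_integral_cmult borel_measurable_times_ennreal borel_measurable_indicator dstar_sets) auto
  finally show ?thesis .
qed

end

section \<open>A truncated function and a matrix weight\<close>

lemma norm_vec_measurable:
  fixes f :: "'a \<Rightarrow> complex^'n::finite"
  assumes "\<And>i. (\<lambda>x. f x $ i) \<in> borel_measurable M"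
  shows "(\<lambda>x. norm (f x)) \<in> borel_measurable M"
  unfolding norm_vec_def L2_set_def using assms by measurable

text \<open>Here \<open>g\<close> stands for a truncation of \<open>W^-1 f\<close>. In
  \<open>A1\<close> the quantifier over \<open>v\<close> lies inside the almost everywhere
  statement: the vector used at \<open>y\<close> will be \<open>g y\<close>, so the null set must
  not depend on it.\<close>

locale matrix_estimate = cz_op T K cK \<omega> B
  for T :: "(real^'d::finite \<Rightarrow> complex) \<Rightarrow> real^'d \<Rightarrow> complex" and K cK \<omega> B +
  fixes W :: "real^'d \<Rightarrow> complex^'n::finite^'n" and g :: "real^'d \<Rightarrow> complex^'n" and A Ai s :: real
  assumes s: "s > 0" and A: "A > 0" and Ai: "Ai \<ge> 1"
    and nice_g: "\<And>i. nice (\<lambda>y. g y $ i)"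
    and Wm: "\<And>i j. (\<lambda>x. W x $ i $ j) \<in> borel_measurable lebesgue"
    and Wint: "\<And>u x v. u > 0 \<Longrightarrow> (\<integral>\<^sup>+y\<in>dcell u x. ennreal (norm (W y *v v)) \<partial>lebesgue) < \<infinity>"
    and Winj: "AE x in lebesgue. \<forall>v. v \<noteq> 0 \<longrightarrow> W x *v v \<noteq> 0"
    and A1: "\<And>u x. u > 0 \<Longrightarrow> AE y in lebesgue. y \<in> dstar u x \<longrightarrow>
      (\<forall>v. (\<integral>\<^sup>+z\<in>dcell u x. ennreal (norm (W z *v v)) \<partial>lebesgue) \<le>
        ennreal (kappa TYPE('d) * A * norm (W y *v v)) * emeasure lebesgue (dcell u x))"
    and Ainf: "\<And>e. e \<noteq> 0 \<Longrightarrow> A_infinity_const (\<lambda>x. norm (W x *v e)) \<le> ennreal Ai"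
    and Fint: "(\<integral>\<^sup>+y. ennreal (norm (W y *v g y)) \<partial>lebesgue) < \<infinity>"
begin

abbreviation sc :: "nat \<Rightarrow> real" where "sc k \<equiv> 2 ^ k * s"
abbreviation Q :: "nat \<Rightarrow> real^'d \<Rightarrow> (real^'d) set" where "Q k x \<equiv> dcell (sc k) x"
abbreviation Q' :: "nat \<Rightarrow> real^'d \<Rightarrow> (real^'d) set" where "Q' k x \<equiv> dstar (sc k) x"

lemma sc: "sc k > 0" using s by simp

lemma Wv_measurable: "(\<lambda>x. norm (W x *v v)) \<in> borel_measurable lebesgue"
proof (rule norm_vec_measurable)
  note [measurable] = Wm
  show "(\<lambda>x. (W x *v v) $ i) \<in> borel_measurable lebesgue" for i
    by (simp add: matrix_vector_mult_def)
qed

definition F :: "real^'d \<Rightarrow> ennreal" where "F y = ennreal (norm (W y *v g y))"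

lemma F_measurable [measurable]: "F \<in> borel_measurable lebesgue"
proof -
  note [measurable] = Wm nice_measurable[OF nice_g]
  have "(\<lambda>y. (W y *v g y) $ i) \<in> borel_measurable lebesgue" for i
    by (simp add: matrix_vector_mult_def)
  from norm_vec_measurable[OF this] show ?thesis unfolding F_def by measurable
qed

text \<open>An Auerbach basis of the norm that averages \<open>norm (W z *v v)\<close> over
  \<open>S\<close>, with denominators cleared. The rows of \<open>E\<close> are the basis vectors
  and \<open>V\<close> computes coordinates.\<close>

definition adapted_basis :: "(real^'d) set \<Rightarrow> complex^'n^'n \<Rightarrow> complex^'n^'n \<Rightarrow> bool" where
  "adapted_basis S E V \<longleftrightarrow> (\<forall>v. v = (\<Sum>i\<in>UNIV. (V *v v) $ i *s E $ i)) \<and>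
    (\<forall>v i. ennreal (norm ((V *v v) $ i)) * emeasure lebesgue S \<le> (\<integral>\<^sup>+z\<in>S. ennreal (norm (W z *v v)) \<partial>lebesgue)) \<and>
    (\<forall>i. (\<integral>\<^sup>+z\<in>S. ennreal (norm (W z *v (E $ i))) \<partial>lebesgue) \<le> emeasure lebesgue S)"

lemma adapted_basis_exists:
  assumes u: "u > 0"
  shows "\<exists>E V. adapted_basis (dcell u x) E V"
proof -
  define I where "I v = (\<integral>\<^sup>+z\<in>dcell u x. ennreal (norm (W z *v v)) \<partial>lebesgue)" for v
  define N where "N v = u ^ CARD('d) * enn2real (I v)" for v
  have fin: "I v < \<infinity>" for v unfolding I_def by (rule Wint[OF u])
  have up: "u ^ CARD('d) > 0" using u by simp
  note [measurable] = Wv_measurable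
  have tri: "N (v + w) \<le> N v + N w" for v w
  proof -
    have "I (v + w) \<le> (\<integral>\<^sup>+z. ennreal (norm (W z *v v)) * indicator (dcell u x) z + ennreal (norm (W z *v w)) * indicator (dcell u x) z \<partial>lebesgue)"
      unfolding I_def
      by (intro nn_integral_mono)
        (auto simp: indicator_def matrix_vector_right_distrib norm_triangle_ineq simp flip: ennreal_plus intro!: ennreal_leI)
    also have "\<dots> = I v + I w"
      unfolding I_def using u by (intro nn_integral_add) auto
    finally have "enn2real (I (v + w)) \<le> enn2real (I v + I w)"
      using fin by (intro enn2real_mono) auto
    also have "\<dots> = enn2real (I v) + enn2real (I w)"
      using fin by (intro enn2real_plus) auto
    finally show ?thesis using up by (simp add: N_def distrib_left[symmetric] mult_left_mono)
  qed
  have hom: "N (c *s v) = norm c * N v" for c v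
  proof -
    have n: "norm (W z *v (c *s v)) = norm c * norm (W z *v v)" for z
      unfolding vector_scalar_commute by (simp add: norm_vec_def L2_set_def norm_mult power_mult_distrib sum_distrib_left[symmetric] real_sqrt_mult)
    have "I (c *s v) = (\<integral>\<^sup>+z. ennreal (norm c) * (ennreal (norm (W z *v v)) * indicator (dcell u x) z) \<partial>lebesgue)"
      unfolding I_def n by (simp add: ennreal_mult mult.assoc)
    also have "\<dots> = ennreal (norm c) * I v"
      unfolding I_def using u by (intro nn_integral_cmult) auto
    finally show ?thesis by (simp add: N_def enn2real_mult)
  qed
  have pos: "N v > 0" if v: "v \<noteq> 0" for v
  proof -
    have "I v \<noteq> 0"
    proof
      assume "I v = 0"
      then have "AE z in lebesgue. ennreal (norm (W z *v v)) * indicator (dcell u x) z = 0"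
        unfolding I_def using u by (subst (asm) nn_integral_0_iff_AE) auto
      with Winj have "AE z in lebesgue. z \<notin> dcell u x"
        by eventually_elim (use v in \<open>auto simp: indicator_def\<close>)
      then have "emeasure lebesgue {z \<in> space lebesgue. z \<in> dcell u x} = 0"
        by (intro emeasure_eq_0_AE)
      then show False using u by (simp add: emeasure_dcell)
    qed
    then have "enn2real (I v) > 0" using fin[of v] by (simp add: enn2real_positive_iff zero_less_iff_neq_zero)
    then show ?thesis using up by (simp add: N_def)
  qed
  have IN: "I v = ennreal (N v) * emeasure lebesgue (dcell u x)" for v
  proof -
    have "ennreal (N v) * emeasure lebesgue (dcell u x) = ennreal (enn2real (I v))"
      using up u by (simp add: emeasure_dcell N_def ennreal_mult[symmetric])
    then show ?thesis using fin[of v] by simp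
  qed
  obtain E V :: "complex^'n^'n" where EV: "\<forall>v. v = (\<Sum>i\<in>UNIV. (V *v v) $ i *s E $ i)"
    "\<forall>v i. norm ((V *v v) $ i) \<le> N v" "\<forall>i. N (E $ i) \<le> 1"
    using auerbach_basis[of N, OF tri hom pos] by blast
  have "ennreal (norm ((V *v v) $ i)) * emeasure lebesgue (dcell u x) \<le> I v" for v i
    unfolding IN using EV(2) by (intro mult_right_mono ennreal_leI) auto
  moreover have "I (E $ i) \<le> emeasure lebesgue (dcell u x)" for i
  proof -
    have "I (E $ i) \<le> ennreal 1 * emeasure lebesgue (dcell u x)"
      unfolding IN using EV(3) by (intro mult_right_mono ennreal_leI) auto
    then show ?thesis by simp
  qed
  ultimately show ?thesis using EV(1) unfolding adapted_basis_def I_def by blast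
qed

text \<open>The choice is made as a function of the set, so that it is the same for all points of a
  cell and hence adapted.\<close>

definition basis_pair :: "(real^'d) set \<Rightarrow> (complex^'n^'n) \<times> (complex^'n^'n)" where
  "basis_pair S = (SOME p. adapted_basis S (fst p) (snd p))"

definition E :: "nat \<Rightarrow> real^'d \<Rightarrow> complex^'n^'n" where "E k x = fst (basis_pair (Q k x))"
definition V :: "nat \<Rightarrow> real^'d \<Rightarrow> complex^'n^'n" where "V k x = snd (basis_pair (Q k x))"

lemma E_adapted: "adapted (sc k) (E k)" unfolding E_def by (rule adapted_dcell)
lemma V_adapted: "adapted (sc k) (V k)" unfolding V_def by (rule adapted_dcell)

lemma EV: "adapted_basis (Q k x) (E k x) (V k x)"
proof -
  obtain E' V' where "adapted_basis (Q k x) E' V'" using adapted_basis_exists[OF sc] by blast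
  then show ?thesis unfolding E_def V_def basis_pair_def
    by (intro someI[of "\<lambda>p. adapted_basis (Q k x) (fst p) (snd p)" "(E', V')"]) simp
qed

definition \<phi> :: "nat \<Rightarrow> real^'d \<Rightarrow> real" where
  "\<phi> k x = (\<Sum>i\<in>UNIV. norm (W x *v (E k x $ i)))"

lemma phi_nonneg: "0 \<le> \<phi> k x" unfolding \<phi>_def by (intro sum_nonneg) auto

lemma phi_measurable: "\<phi> k \<in> borel_measurable lebesgue"
proof -
  note [measurable] = Wm
  have [measurable]: "(\<lambda>x. E k x $ i $ j) \<in> borel_measurable lebesgue" for i j
    by (rule adapted_borel_measurable[OF sc adapted_comp[OF E_adapted]])
  have "(\<lambda>x. (W x *v (E k x $ i)) $ j) \<in> borel_measurable lebesgue" for i j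
    by (simp add: matrix_vector_mult_def)
  from norm_vec_measurable[OF this] show ?thesis unfolding \<phi>_def by measurable
qed

lemma matrix_norm_le_phi:
  assumes "\<And>i. norm ((V k x *v v) $ i) \<le> a"
  shows "norm (W x *v v) \<le> a * \<phi> k x"
proof -
  have "W x *v v = W x *v (\<Sum>i\<in>UNIV. (V k x *v v) $ i *s E k x $ i)"
    using EV[of k x] unfolding adapted_basis_def by metis
  also have "\<dots> = (\<Sum>i\<in>UNIV. (V k x *v v) $ i *s (W x *v (E k x $ i)))"
    by (simp only: linear_sum[OF bounded_linear.linear[OF matrix_vector_mul_bounded_linear]] vector_scalar_commute)
  also have "norm \<dots> \<le> (\<Sum>i\<in>UNIV. norm ((V k x *v v) $ i *s (W x *v (E k x $ i))))"
    by (rule norm_sum)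
  also have "\<dots> \<le> (\<Sum>i\<in>UNIV. a * norm (W x *v (E k x $ i)))"
  proof (rule sum_mono)
    fix i
    have "norm ((V k x *v v) $ i *s (W x *v (E k x $ i))) = norm ((V k x *v v) $ i) * norm (W x *v (E k x $ i))"
      by (simp add: norm_vec_def L2_set_def norm_mult power_mult_distrib sum_distrib_left[symmetric] real_sqrt_mult)
    then show "norm ((V k x *v v) $ i *s (W x *v (E k x $ i))) \<le> a * norm (W x *v (E k x $ i))"
      using assms[of i] by (simp add: mult_right_mono)
  qed
  finally show ?thesis by (simp add: \<phi>_def sum_distrib_left)
qed

text \<open>The largest exponent that the reverse Hoelder inequality admits:
  \<open>2 ^ d * \<delta> * Ai\<close> equals one half.\<close>

definition \<delta> :: real where "\<delta> = 1 / (2 ^ Suc CARD('d) * Ai)"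

lemma delta: "\<delta> > 0" "\<delta> \<le> 1 / 2" "2 ^ CARD('d) * \<delta> * Ai \<le> 1 / 2"
proof -
  show "\<delta> > 0" using Ai by (simp add: \<delta>_def)
  have "2 * 1 \<le> 2 ^ Suc CARD('d) * Ai"
    using Ai power_increasing[of 1 "Suc CARD('d)" "2 :: real"] by (intro mult_mono) auto
  then show "\<delta> \<le> 1 / 2" using Ai by (simp add: \<delta>_def field_simps)
  show "2 ^ CARD('d) * \<delta> * Ai \<le> 1 / 2" using Ai by (simp add: \<delta>_def field_simps)
qed

lemma basis_reverse_holder:
  "(\<integral>\<^sup>+y\<in>Q k x. ennreal (norm (W y *v (E k x $ i)) powr (1 + \<delta>)) \<partial>lebesgue) \<le> 4 * emeasure lebesgue (Q k x)"
proof (cases "E k x $ i = 0")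
  case True
  then show ?thesis by simp
next
  case False
  \<comment> \<open>Restarting the grid at scale \<open>sc k\<close> makes \<open>Q k x\<close> a
    cell of time zero, on which the basis vector is normalised to average at most one.\<close>
  interpret fw: fw_weight "\<lambda>y. norm (W y *v (E k x $ i))" "sc k" Ai \<delta>
  proof
    show "AE y in lebesgue. 0 < norm (W y *v (E k x $ i))"
      using Winj by eventually_elim (use False in auto)
  qed (use False Wv_measurable Wint sc Ainf Ai delta in auto)
  have "(\<integral>\<^sup>+y\<in>dcell (2 ^ 0 * sc k) x. ennreal (norm (W y *v (E k x $ i))) \<partial>lebesgue) \<le> emeasure lebesgue (Q k x)"
    using EV[of k x] by (simp add: adapted_basis_def)
  then have "ennreal (fw.X 0 x) * emeasure lebesgue (Q k x) \<le> 1 * emeasure lebesgue (Q k x)"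
    using fw.X_cell[of 0 x] by simp
  then have "ennreal (fw.X 0 x * (1 / sc k ^ CARD('d))) \<le> ennreal (1 * (1 / sc k ^ CARD('d)))"
    using s fw.X_nonneg[of 0 x] unfolding emeasure_dcell[OF sc[of k]]
    by (subst (1 2) ennreal_mult) auto
  then have "fw.X 0 x * (1 / sc k ^ CARD('d)) \<le> 1 * (1 / sc k ^ CARD('d))"
    by (rule iffD1[OF ennreal_le_iff, rotated]) (use s in simp)
  then have "fw.X 0 x \<le> 1" using s by (simp add: divide_le_cancel)
  then show ?thesis by (rule fw.reverse_holder)
qed

text \<open>Bounding the sum by \<open>n\<close> times its largest term costs \<open>n ^ 2\<close>,
  as \<open>1 + \<delta> \<le> 2\<close>; the third factor \<open>n\<close> counts the basis
  vectors, and the \<open>4\<close> is that of the reverse Hoelder inequality.\<close>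

lemma phi_integral:
  "(\<integral>\<^sup>+y\<in>Q k x. ennreal (\<phi> k y powr (1 + \<delta>)) \<partial>lebesgue) \<le> ennreal (4 * real CARD('n) ^ 3) * emeasure lebesgue (Q k x)"
proof -
  let ?n = "real CARD('n)"
  let ?w = "\<lambda>i y. norm (W y *v (E k x $ i))"
  note [measurable] = Wv_measurable
  have pt: "\<phi> k y powr (1 + \<delta>) \<le> ?n ^ 2 * (\<Sum>i\<in>UNIV. ?w i y powr (1 + \<delta>))" if y: "y \<in> Q k x" for y
  proof -
    have Ey: "E k y = E k x" by (rule adaptedD[OF E_adapted y])
    obtain m where m: "\<And>i. ?w i y \<le> ?w m y"
    proof -
      have "Max (range (\<lambda>i. ?w i y)) \<in> range (\<lambda>i. ?w i y)" by (rule Max_in) auto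
      then obtain m where "Max (range (\<lambda>i. ?w i y)) = ?w m y" by blast
      moreover have "?w i y \<le> Max (range (\<lambda>i. ?w i y))" for i by (rule Max_ge) auto
      ultimately show ?thesis using that by metis
    qed
    have "\<phi> k y \<le> (\<Sum>i\<in>(UNIV::'n set). ?w m y)" unfolding \<phi>_def Ey by (intro sum_mono m)
    then have "\<phi> k y \<le> ?n * ?w m y" by simp
    then have "\<phi> k y powr (1 + \<delta>) \<le> (?n * ?w m y) powr (1 + \<delta>)"
      using delta phi_nonneg by (intro powr_mono2) auto
    also have "\<dots> = ?n powr (1 + \<delta>) * ?w m y powr (1 + \<delta>)" by (rule powr_mult)
    also have "\<dots> \<le> ?n powr 2 * ?w m y powr (1 + \<delta>)"
      using delta by (intro mult_right_mono powr_mono) (auto simp: Suc_leI)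
    also have "?n powr 2 = ?n ^ 2" by (simp add: powr_numeral)
    also have "?n ^ 2 * ?w m y powr (1 + \<delta>) \<le> ?n ^ 2 * (\<Sum>i\<in>UNIV. ?w i y powr (1 + \<delta>))"
      by (intro mult_left_mono member_le_sum) auto
    finally show ?thesis .
  qed
  have "(\<integral>\<^sup>+y\<in>Q k x. ennreal (\<phi> k y powr (1 + \<delta>)) \<partial>lebesgue) \<le>
      (\<integral>\<^sup>+y. ennreal (?n ^ 2) * (\<Sum>i\<in>UNIV. ennreal (?w i y powr (1 + \<delta>)) * indicator (Q k x) y) \<partial>lebesgue)"
  proof (rule nn_integral_mono)
    fix y
    show "ennreal (\<phi> k y powr (1 + \<delta>)) * indicator (Q k x) y \<le> ennreal (?n ^ 2) * (\<Sum>i\<in>UNIV. ennreal (?w i y powr (1 + \<delta>)) * indicator (Q k x) y)"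
    proof (cases "y \<in> Q k x")
      case True
      have "ennreal (\<phi> k y powr (1 + \<delta>)) \<le> ennreal (?n ^ 2 * (\<Sum>i\<in>UNIV. ?w i y powr (1 + \<delta>)))"
        by (rule ennreal_leI[OF pt[OF True]])
      also have "\<dots> = ennreal (?n ^ 2) * (\<Sum>i\<in>UNIV. ennreal (?w i y powr (1 + \<delta>)))"
        by (subst ennreal_mult) (auto intro!: sum_nonneg simp: sum_ennreal)
      finally show ?thesis using True by simp
    qed simp
  qed
  also have "\<dots> = ennreal (?n ^ 2) * (\<integral>\<^sup>+y. (\<Sum>i\<in>UNIV. ennreal (?w i y powr (1 + \<delta>)) * indicator (Q k x) y) \<partial>lebesgue)"
    using sc by (intro nn_integral_cmult) measurable
  also have "(\<integral>\<^sup>+y. (\<Sum>i\<in>UNIV. ennreal (?w i y powr (1 + \<delta>)) * indicator (Q k x) y) \<partial>lebesgue) =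
      (\<Sum>i\<in>UNIV. \<integral>\<^sup>+y\<in>Q k x. ennreal (?w i y powr (1 + \<delta>)) \<partial>lebesgue)"
    using sc by (intro nn_integral_sum) measurable
  also have "\<dots> \<le> (\<Sum>i\<in>(UNIV::'n set). 4 * emeasure lebesgue (Q k x))"
    by (intro sum_mono basis_reverse_holder)
  also have "ennreal (?n ^ 2) * (\<Sum>i\<in>(UNIV::'n set). 4 * emeasure lebesgue (Q k x)) = ennreal (4 * ?n ^ 3) * emeasure lebesgue (Q k x)"
  proof -
    have "(\<Sum>i\<in>(UNIV::'n set). 4 * emeasure lebesgue (Q k x)) = ennreal (?n * 4) * emeasure lebesgue (Q k x)"
      by (simp add: ennreal_mult ennreal_of_nat_eq_real_of_nat mult.assoc)
    then show ?thesis
      by (simp add: mult.assoc[symmetric] ennreal_mult[symmetric] power2_eq_square power3_eq_cube)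
        (simp add: mult_ac)
  qed
  finally show ?thesis by (simp add: mult_left_mono)
qed

section \<open>Coordinates of the function on stars\<close>

definition b :: "nat \<Rightarrow> real^'d \<Rightarrow> real" where
  "b k x = sc k ^ CARD('d) * enn2real (\<integral>\<^sup>+y\<in>Q' k x. F y \<partial>lebesgue)"

lemma b_adapted: "adapted (sc k) (b k)" unfolding b_def by (rule adapted_dstar)

lemma b_nonneg: "0 \<le> b k x" using s by (simp add: b_def)

lemma star_F: "(\<integral>\<^sup>+y\<in>Q' k x. F y \<partial>lebesgue) = ennreal (b k x / sc k ^ CARD('d))"
proof -
  have "(\<integral>\<^sup>+y\<in>Q' k x. F y \<partial>lebesgue) \<le> (\<integral>\<^sup>+y. F y \<partial>lebesgue)"
    by (intro nn_integral_mono) (auto simp: indicator_def)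
  then have "(\<integral>\<^sup>+y\<in>Q' k x. F y \<partial>lebesgue) < \<infinity>" using Fint unfolding F_def[symmetric] by (rule le_less_trans)
  then show ?thesis using s by (simp add: b_def)
qed

definition hV :: "complex^'n^'n \<Rightarrow> 'n \<Rightarrow> (real^'d) set \<Rightarrow> real^'d \<Rightarrow> complex" where
  "hV M i S y = (M *v g y) $ i * indicator S y"

lemma nice_hV: assumes S: "S \<in> sets lebesgue" shows "nice (hV M i S)"
proof -
  have "nice (\<lambda>y. \<Sum>l\<in>UNIV. M $ i $ l * (g y $ l))" by (intro nice_sum nice_g) simp
  then have "nice (\<lambda>y. (M *v g y) $ i)" by (simp add: matrix_vector_mult_def)
  from nice_indicator[OF this S] show ?thesis by (simp add: hV_def[abs_def])
qed

definition TS :: "(real^'d) set \<Rightarrow> real^'d \<Rightarrow> complex^'n" where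
  "TS S x = (\<chi> l. T (\<lambda>y. g y $ l * indicator S y) x)"

text \<open>A constant matrix commutes with \<open>T\<close> almost everywhere by linearity. This
  lets scalar inequalities be applied to coordinates in the basis of a fixed cell.\<close>

lemma TS_hV: assumes S: "S \<in> sets lebesgue"
  shows "AE x in lebesgue. (M *v TS S x) $ i = T (hV M i S) x"
proof -
  have "hV M i S = (\<lambda>y. \<Sum>l\<in>UNIV. M $ i $ l * (g y $ l * indicator S y))"
    by (auto simp: hV_def matrix_vector_mult_def sum_distrib_right mult.assoc)
  then have "AE x in lebesgue. T (hV M i S) x = (\<Sum>l\<in>UNIV. M $ i $ l * T (\<lambda>y. g y $ l * indicator S y) x)"
    using T_sum[of UNIV "\<lambda>l y. g y $ l * indicator S y" "\<lambda>l. M $ i $ l"] nice_indicator[OF nice_g S] by simp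
  then show ?thesis by eventually_elim (simp add: TS_def matrix_vector_mult_def)
qed

text \<open>The coordinate of \<open>g y\<close> is at most the average over the cell of
  \<open>norm (W z *v g y)\<close>, with the vector \<open>g y\<close> frozen. The A1 condition
  bounds that average by the value at \<open>z = y\<close>, which is \<open>F y\<close>.\<close>

lemma hV_bound: "AE y in lebesgue. y \<in> Q' k x \<longrightarrow> (\<forall>i. ennreal (norm ((V k x *v g y) $ i)) \<le> ennreal (kappa TYPE('d) * A) * F y)"
  using A1[OF sc[of k], of x]
proof eventually_elim
  case (elim y)
  show ?case
  proof (intro impI allI)
    fix i assume y: "y \<in> Q' k x"
    let ?m = "1 / sc k ^ CARD('d)"
    have m: "?m > 0" using s by simp
    have "ennreal (norm ((V k x *v g y) $ i)) * emeasure lebesgue (Q k x) \<le> ennreal (kappa TYPE('d) * A * norm (W y *v g y)) * emeasure lebesgue (Q k x)"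
      using EV[of k x] elim y unfolding adapted_basis_def by (meson order_trans)
    then have "ennreal (norm ((V k x *v g y) $ i) * ?m) \<le> ennreal (kappa TYPE('d) * A * norm (W y *v g y) * ?m)"
      using m A less_imp_le[OF kappa_pos[where 'd='d]] unfolding emeasure_dcell[OF sc] by (subst (1 2) ennreal_mult) auto
    then have "norm ((V k x *v g y) $ i) * ?m \<le> kappa TYPE('d) * A * norm (W y *v g y) * ?m"
      by (rule iffD1[OF ennreal_le_iff, rotated]) (use m A less_imp_le[OF kappa_pos[where 'd='d]] in simp)
    then have "norm ((V k x *v g y) $ i) \<le> kappa TYPE('d) * A * norm (W y *v g y)" using m by (simp only: mult_le_cancel_right_pos)
    then have "ennreal (norm ((V k x *v g y) $ i)) \<le> ennreal (kappa TYPE('d) * A * norm (W y *v g y))" by (rule ennreal_leI)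
    also have "\<dots> = ennreal (kappa TYPE('d) * A) * F y" unfolding F_def
      using A less_imp_le[OF kappa_pos[where 'd='d]] by (subst ennreal_mult) auto
    finally show "ennreal (norm ((V k x *v g y) $ i)) \<le> ennreal (kappa TYPE('d) * A) * F y" .
  qed
qed

lemma hV_integral:
  assumes R: "R \<in> sets lebesgue" and S: "S \<subseteq> Q' k x" and Sm: "S \<in> sets lebesgue"
  shows "(\<integral>\<^sup>+y\<in>R. ennreal (norm (hV (V k x) i S y)) \<partial>lebesgue) \<le> ennreal (kappa TYPE('d) * A) * (\<integral>\<^sup>+y\<in>R \<inter> S. F y \<partial>lebesgue)"
proof -
  have "(\<integral>\<^sup>+y\<in>R. ennreal (norm (hV (V k x) i S y)) \<partial>lebesgue) \<le> (\<integral>\<^sup>+y. ennreal (kappa TYPE('d) * A) * (F y * indicator (R \<inter> S) y) \<partial>lebesgue)"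
  proof (rule nn_integral_mono_AE)
    show "AE y in lebesgue. ennreal (norm (hV (V k x) i S y)) * indicator R y \<le> ennreal (kappa TYPE('d) * A) * (F y * indicator (R \<inter> S) y)"
      using hV_bound[of k x]
    proof eventually_elim
      case (elim y)
      show ?case
      proof (cases "y \<in> R \<inter> S")
        case True
        then show ?thesis using elim S by (auto simp: hV_def)
      next
        case False
        then show ?thesis by (auto simp: hV_def)
      qed
    qed
  qed
  also have "\<dots> = ennreal (kappa TYPE('d) * A) * (\<integral>\<^sup>+y\<in>R \<inter> S. F y \<partial>lebesgue)"
    using R Sm by (intro nn_integral_cmult borel_measurable_times_ennreal borel_measurable_indicator) auto
  finally show ?thesis .
qed

text \<open>The basis belongs to the coarser cell of time \<open>k\<close>, the cutoff to the star
  of a subcell. Stars are nested, so the coordinate bound on the larger star applies.\<close>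

lemma hV_star_integral:
  assumes jk: "k \<le> j" and y: "y \<in> Q k x"
  shows "(\<integral>z. norm (hV (V k x) i (Q' j y) z) \<partial>lebesgue) \<le> kappa TYPE('d) * A * b j y * (1 / sc j ^ CARD('d))"
proof -
  have sub: "Q' j y \<subseteq> Q' k x" using dstar_mono[OF jk, of s y] dstar_eq[OF y] by simp
  have "ennreal (\<integral>z. norm (hV (V k x) i (Q' j y) z) \<partial>lebesgue) = (\<integral>\<^sup>+z\<in>UNIV. ennreal (norm (hV (V k x) i (Q' j y) z)) \<partial>lebesgue)"
    using nice_integrable[OF nice_hV[OF dstar_sets[OF sc]]] by (simp add: nn_integral_eq_integral)
  also have "\<dots> \<le> ennreal (kappa TYPE('d) * A) * (\<integral>\<^sup>+z\<in>UNIV \<inter> Q' j y. F z \<partial>lebesgue)"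
    by (rule hV_integral[OF _ sub]) (auto simp: sc)
  also have "\<dots> = ennreal (kappa TYPE('d) * A * (b j y / sc j ^ CARD('d)))"
    unfolding Int_UNIV_left star_F using A b_nonneg[of j y] s less_imp_le[OF kappa_pos[where 'd='d]]
    by (subst ennreal_mult[symmetric]) auto
  finally have "ennreal (\<integral>z. norm (hV (V k x) i (Q' j y) z) \<partial>lebesgue) \<le> ennreal (kappa TYPE('d) * A * (b j y / sc j ^ CARD('d)))" .
  then have "(\<integral>z. norm (hV (V k x) i (Q' j y) z) \<partial>lebesgue) \<le> kappa TYPE('d) * A * (b j y / sc j ^ CARD('d))"
    by (rule iffD1[OF ennreal_le_iff, rotated]) (use A b_nonneg[of j y] s less_imp_le[OF kappa_pos[where 'd='d]] in simp)
  then show ?thesis by simp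
qed

text \<open>Chosen so that the weak type bounds of the \<open>n\<close> coordinates and the maximal
  inequality together leave an exceptional set of relative measure at most
  \<open>1 / 2 ^ (d + 3)\<close>.\<close>

definition c :: real where "c = 2 ^ (CARD('d) + 3) * (real CARD('n) * weak_const + (kappa TYPE('d))\<^sup>2)"

lemma c_ge_1: "1 \<le> c"
proof -
  have "1 * 1 \<le> 2 ^ (CARD('d) + 3) * (real CARD('n) * weak_const + (kappa TYPE('d))\<^sup>2)"
    using weak_const_pos kappa_ge_1[where 'd='d]
    by (intro mult_mono one_le_power add_increasing) auto
  then show ?thesis by (simp add: c_def)
qed

lemma weak_part:
  assumes jk: "k \<le> j" and y: "y \<in> Q k x"
  shows "emeasure lebesgue {z. \<exists>i. norm (T (hV (V k x) i (Q' j y)) z) > c * (kappa TYPE('d) * A * b j y)} \<le>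
    ennreal (real CARD('n) * weak_const / c * (1 / sc j ^ CARD('d)))"
    and "{z. \<exists>i. norm (T (hV (V k x) i (Q' j y)) z) > c * (kappa TYPE('d) * A * b j y)} \<in> sets lebesgue"
proof -
  let ?S = "\<lambda>i. {z. norm (T (hV (V k x) i (Q' j y)) z) > c * (kappa TYPE('d) * A * b j y)}"
  have eq: "{z. \<exists>i. norm (T (hV (V k x) i (Q' j y)) z) > c * (kappa TYPE('d) * A * b j y)} = (\<Union>i\<in>UNIV. ?S i)" by auto
  have m: "?S i \<in> sets lebesgue" for i
  proof -
    note [measurable] = T_measurable[OF nice_L2[OF nice_hV[OF dstar_sets[OF sc]]]]
    have "{z \<in> space lebesgue. norm (T (hV (V k x) i (Q' j y)) z) > c * (kappa TYPE('d) * A * b j y)} \<in> sets lebesgue" by measurable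
    then show ?thesis by simp
  qed
  show "{z. \<exists>i. norm (T (hV (V k x) i (Q' j y)) z) > c * (kappa TYPE('d) * A * b j y)} \<in> sets lebesgue"
    unfolding eq using m by blast
  have "emeasure lebesgue (\<Union>i\<in>UNIV. ?S i) \<le> (\<Sum>i\<in>UNIV. emeasure lebesgue (?S i))"
    using m by (intro emeasure_subadditive_finite) auto
  also have "\<dots> \<le> (\<Sum>i\<in>(UNIV::'n set). ennreal (weak_const / c * (1 / sc j ^ CARD('d))))"
    using s A c_ge_1 b_nonneg[of j y] hV_star_integral[OF jk y] less_imp_le[OF kappa_pos[where 'd='d]]
    by (intro sum_mono weak_type_level nice_hV dstar_sets sc) auto
  also have "\<dots> = ennreal (\<Sum>i\<in>(UNIV::'n set). weak_const / c * (1 / sc j ^ CARD('d)))"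
    using s c_ge_1 weak_const_pos by (intro sum_ennreal) auto
  finally show "emeasure lebesgue {z. \<exists>i. norm (T (hV (V k x) i (Q' j y)) z) > c * (kappa TYPE('d) * A * b j y)} \<le>
    ennreal (real CARD('n) * weak_const / c * (1 / sc j ^ CARD('d)))"
    unfolding eq by simp
qed

text \<open>Two events are excluded: a large value of \<open>T\<close> of a localised coordinate,
  and a star average along the descendants that exceeds \<open>c\<close> times the present one. The
  second exclusion controls the intermediate dilates when the kernel is summed over annuli.\<close>

definition bad :: "nat \<Rightarrow> real^'d \<Rightarrow> (real^'d) set" where
  "bad k x = {y \<in> Q k x. (\<exists>i. norm (T (hV (V k x) i (Q' k x)) y) > c * (kappa TYPE('d) * A * b k x)) \<or> (\<exists>j\<ge>k. b j y > c * b k x)}"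

lemma bad_adapted: "adapted (sc k) (bad k)"
  unfolding adapted_def
proof (intro allI ballI)
  fix x y assume y: "y \<in> Q k x"
  show "bad k y = bad k x"
    unfolding bad_def dcell_eq[OF y] dstar_eq[OF y] adaptedD[OF V_adapted y] adaptedD[OF b_adapted y] ..
qed

lemma maximal_part:
  "emeasure lebesgue {y \<in> Q k x. \<exists>j\<ge>k. b j y > c * b k x} \<le> ennreal ((kappa TYPE('d))\<^sup>2 / c * (1 / sc k ^ CARD('d)))"
  "{y \<in> Q k x. \<exists>j\<ge>k. b j y > c * b k x} \<in> sets lebesgue"
proof -
  have "{y. b j y > c * b k x} \<in> sets lebesgue" for j
    by (rule adapted_sets[OF sc adapted_comp[OF b_adapted]])
  then have "Q k x \<inter> (\<Union>j\<in>{k..}. {y. b j y > c * b k x}) \<in> sets lebesgue"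
    using sc by (intro sets.Int sets.countable_UN') auto
  also have "Q k x \<inter> (\<Union>j\<in>{k..}. {y. b j y > c * b k x}) = {y \<in> Q k x. \<exists>j\<ge>k. b j y > c * b k x}" by auto
  finally show "{y \<in> Q k x. \<exists>j\<ge>k. b j y > c * b k x} \<in> sets lebesgue" .
  have sub: "Q' j y \<subseteq> Q' k x" if "y \<in> Q k x" "j \<ge> k" for j y
    using dstar_mono[OF that(2), of s y] dstar_eq[OF that(1)] by simp
  show "emeasure lebesgue {y \<in> Q k x. \<exists>j\<ge>k. b j y > c * b k x} \<le> ennreal ((kappa TYPE('d))\<^sup>2 / c * (1 / sc k ^ CARD('d)))"
  proof (cases "b k x = 0")
    \<comment> \<open>The maximal inequality needs a positive level. Here \<open>F\<close> vanishes
      almost everywhere on the star, so all later averages vanish too.\<close>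
    case True
    have "b j y = 0" if "y \<in> Q k x" "j \<ge> k" for j y
    proof -
      have "(\<integral>\<^sup>+z\<in>Q' j y. F z \<partial>lebesgue) \<le> (\<integral>\<^sup>+z\<in>Q' k x. F z \<partial>lebesgue)"
        using sub[OF that] by (intro nn_integral_mono) (auto simp: indicator_def)
      also have "\<dots> = 0" using star_F[of k x] True by simp
      finally show ?thesis by (simp add: b_def)
    qed
    then have "{y \<in> Q k x. \<exists>j\<ge>k. b j y > c * b k x} = {}" using True by auto
    then show ?thesis by (simp only:) simp
  next
    case False
    then have t: "c * b k x > 0" using b_nonneg[of k x] c_ge_1 by simp
    let ?v = "\<lambda>z. F z * indicator (Q' k x) z"
    have vm: "?v \<in> borel_measurable lebesgue" using sc by measurable
    let ?M = "{y. \<exists>l::nat. ennreal (c * b k x) * emeasure lebesgue (dcell (2 ^ l * sc k) y) < (\<integral>\<^sup>+z\<in>dstar (2 ^ l * sc k) y. ?v z \<partial>lebesgue)}"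
    have "{y \<in> Q k x. \<exists>j\<ge>k. b j y > c * b k x} \<subseteq> ?M"
    proof
      fix y assume "y \<in> {y \<in> Q k x. \<exists>j\<ge>k. b j y > c * b k x}"
      then obtain j where j: "y \<in> Q k x" "j \<ge> k" "b j y > c * b k x" by blast
      have e: "2 ^ (j - k) * sc k = sc j" using j(2) by (simp add: power_add[symmetric] mult.assoc[symmetric])
      have "ennreal (c * b k x) * emeasure lebesgue (Q j y) = ennreal (c * b k x / sc j ^ CARD('d))"
        using t s by (simp add: emeasure_dcell[OF sc] ennreal_mult[symmetric])
      also have "\<dots> < ennreal (b j y / sc j ^ CARD('d))"
        using j(3) t s by (intro ennreal_lessI divide_strict_right_mono divide_pos_pos) auto
      also have "\<dots> = (\<integral>\<^sup>+z\<in>Q' j y. F z \<partial>lebesgue)" by (rule star_F[symmetric])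
      also have "\<dots> = (\<integral>\<^sup>+z\<in>Q' j y. ?v z \<partial>lebesgue)"
        using sub[OF j(1,2)] by (intro nn_integral_cong) (auto simp: indicator_def)
      finally have "ennreal (c * b k x) * emeasure lebesgue (dcell (2 ^ (j - k) * sc k) y) < (\<integral>\<^sup>+z\<in>dstar (2 ^ (j - k) * sc k) y. ?v z \<partial>lebesgue)"
        unfolding e .
      then show "y \<in> ?M" by blast
    qed
    then have "emeasure lebesgue {y \<in> Q k x. \<exists>j\<ge>k. b j y > c * b k x} \<le> emeasure lebesgue ?M"
      by (rule emeasure_mono[OF _ maximal_star_weak_type(2)[OF sc vm t]])
    also have "\<dots> \<le> ennreal ((kappa TYPE('d))\<^sup>2 / (c * b k x)) * (\<integral>\<^sup>+z. ?v z \<partial>lebesgue)"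
      by (rule maximal_star_weak_type(1)[OF sc vm t])
    also have "\<dots> = ennreal ((kappa TYPE('d))\<^sup>2 / (c * b k x) * (b k x / sc k ^ CARD('d)))"
      unfolding star_F using t b_nonneg[of k x] s by (subst ennreal_mult) auto
    also have "(kappa TYPE('d))\<^sup>2 / (c * b k x) * (b k x / sc k ^ CARD('d)) = (kappa TYPE('d))\<^sup>2 / c * (1 / sc k ^ CARD('d))"
      using False by simp
    finally show ?thesis .
  qed
qed

lemma bad_sets [measurable]: "bad k x \<in> sets lebesgue"
  and bad_measure: "emeasure lebesgue (bad k x) \<le> ennreal (1 / 2 ^ (CARD('d) + 3)) * emeasure lebesgue (Q k x)"
proof -
  let ?A = "{z. \<exists>i. norm (T (hV (V k x) i (Q' k x)) z) > c * (kappa TYPE('d) * A * b k x)}"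
    and ?B = "{y \<in> Q k x. \<exists>j\<ge>k. b j y > c * b k x}"
  note wp = weak_part[of k k x x, OF order_refl dcell_self]
  have eq: "bad k x = (Q k x \<inter> ?A) \<union> ?B" unfolding bad_def by blast
  show "bad k x \<in> sets lebesgue" unfolding eq by (intro sets.Un sets.Int dcell_sets sc wp(2) maximal_part(2))
  have "emeasure lebesgue (bad k x) \<le> emeasure lebesgue (?A \<union> ?B)"
    unfolding eq by (intro emeasure_mono sets.Un wp(2) maximal_part(2)) blast
  also have "\<dots> \<le> emeasure lebesgue ?A + emeasure lebesgue ?B"
    by (intro emeasure_subadditive wp(2) maximal_part(2))
  also have "\<dots> \<le> ennreal (real CARD('n) * weak_const / c * (1 / sc k ^ CARD('d))) + ennreal ((kappa TYPE('d))\<^sup>2 / c * (1 / sc k ^ CARD('d)))"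
    by (intro add_mono wp(1) maximal_part(1))
  also have "\<dots> = ennreal (real CARD('n) * weak_const / c * (1 / sc k ^ CARD('d)) + (kappa TYPE('d))\<^sup>2 / c * (1 / sc k ^ CARD('d)))"
    using s c_ge_1 weak_const_pos by (intro ennreal_plus[symmetric]) auto
  also have "real CARD('n) * weak_const / c * (1 / sc k ^ CARD('d)) + (kappa TYPE('d))\<^sup>2 / c * (1 / sc k ^ CARD('d)) =
      (real CARD('n) * weak_const + (kappa TYPE('d))\<^sup>2) / c * (1 / sc k ^ CARD('d))"
    by (simp add: add_divide_distrib distrib_right)
  also have "(real CARD('n) * weak_const + (kappa TYPE('d))\<^sup>2) / c = 1 / 2 ^ (CARD('d) + 3)"
  proof -
    have "real CARD('n) * weak_const + (kappa TYPE('d))\<^sup>2 > 0" using weak_const_pos by (intro add_pos_nonneg) auto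
    then show ?thesis unfolding c_def by simp
  qed
  also have "ennreal (1 / 2 ^ (CARD('d) + 3) * (1 / sc k ^ CARD('d))) = ennreal (1 / 2 ^ (CARD('d) + 3)) * emeasure lebesgue (Q k x)"
    using s unfolding emeasure_dcell[OF sc] by (intro ennreal_mult) auto
  finally show "emeasure lebesgue (bad k x) \<le> ennreal (1 / 2 ^ (CARD('d) + 3)) * emeasure lebesgue (Q k x)" .
qed

end

section \<open>Stopping cells and pointwise domination\<close>

context matrix_estimate
begin

text \<open>The threshold is twice the relative measure of \<open>bad\<close> in its own cell, so
  the maximal crowded cells fill at most half of that cell. It is also \<open>2 ^ -d\<close> times
  one quarter, so a child of an uncrowded cell still has at most a quarter of its measure in
  \<open>bad\<close>.\<close>

definition crowded :: "nat \<Rightarrow> nat \<Rightarrow> real^'d \<Rightarrow> bool" where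
  "crowded k j x \<longleftrightarrow> ennreal (1 / 2 ^ (CARD('d) + 2)) * emeasure lebesgue (Q j x) < emeasure lebesgue (bad k x \<inter> Q j x)"

lemma Q_mono: "k \<le> j \<Longrightarrow> y \<in> Q j x \<Longrightarrow> y \<in> Q k x"
  using dcell_mono[of k j s x] by blast

lemma crowded_adapted:
  assumes "k \<le> j" shows "adapted (sc j) (crowded k j)"
  unfolding adapted_def
proof (intro allI ballI)
  fix x y assume y: "y \<in> Q j x"
  have "bad k y = bad k x" using adaptedD[OF bad_adapted Q_mono[OF assms y]] .
  then show "crowded k j y = crowded k j x" unfolding crowded_def dcell_eq[OF y] by simp
qed

text \<open>The tree of stopping cells is recorded as the latest stopping time along the branch of
  \<open>x\<close>. Crowding is always measured against the exceptional set of that latest stopping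
  cell, and time zero counts as a stop.\<close>

fun last_stop :: "nat \<Rightarrow> real^'d \<Rightarrow> nat" where
  "last_stop 0 x = 0"
| "last_stop (Suc j) x = (if crowded (last_stop j x) (Suc j) x then Suc j else last_stop j x)"

lemma last_stop_le: "last_stop j x \<le> j"
  by (induction j) (auto simp: le_SucI)

lemma last_stop_adapted: "adapted (sc j) (last_stop j)"
proof (induction j)
  case 0
  show ?case by (simp add: adapted_def)
next
  case (Suc j)
  show ?case unfolding adapted_def
  proof (intro allI ballI)
    fix x y assume y: "y \<in> Q (Suc j) x"
    have "last_stop j y = last_stop j x"
      using adaptedD[OF Suc Q_mono[OF _ y, of j]] by simp
    moreover have "crowded (last_stop j x) (Suc j) y = crowded (last_stop j x) (Suc j) x"
      using adaptedD[OF crowded_adapted y] last_stop_le[of j x] by (simp add: le_SucI)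
    ultimately show "last_stop (Suc j) y = last_stop (Suc j) x" by simp
  qed
qed

definition \<sigma> :: "nat \<Rightarrow> real^'d \<Rightarrow> bool" where "\<sigma> k x \<longleftrightarrow> last_stop k x = k"

lemma sigma_adapted: "adapted (sc k) (\<sigma> k)"
  unfolding \<sigma>_def by (rule adapted_comp[OF last_stop_adapted])

lemma last_stop_const:
  assumes "\<sigma> k x" "k \<le> m" "\<And>j. k < j \<Longrightarrow> j \<le> m \<Longrightarrow> \<not> \<sigma> j x"
  shows "last_stop m x = k"
  using assms(2,3)
proof (induction m rule: dec_induct)
  case base
  show ?case using assms(1) by (simp add: \<sigma>_def)
next
  case (step m)
  then have "last_stop m x = k" by auto
  moreover have "\<not> \<sigma> (Suc m) x" using step.prems step.hyps by auto
  ultimately show ?case by (auto simp: \<sigma>_def split: if_splits)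
qed

lemma not_crowded_after:
  assumes "\<sigma> k x" "\<And>j. k < j \<Longrightarrow> \<not> \<sigma> j x" "k < j"
  shows "\<not> crowded k j x"
proof
  assume c: "crowded k j x"
  obtain m where m: "j = Suc m" using assms(3) by (cases j) auto
  have "last_stop m x = k" using assms m by (intro last_stop_const) auto
  then have "\<sigma> j x" using c m by (simp add: \<sigma>_def)
  then show False using assms by blast
qed

lemma crowded_before_stop:
  assumes "\<sigma> k x" "\<sigma> j x" "k < j"
  shows "\<exists>i>k. crowded k i x"
proof -
  define i where "i = (LEAST i. k < i \<and> \<sigma> i x)"
  have i: "k < i" "\<sigma> i x" unfolding i_def using LeastI[of "\<lambda>i. k < i \<and> \<sigma> i x" j] assms by auto
  have min: "\<not> \<sigma> l x" if "k < l" "l < i" for l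
    using not_less_Least[of l "\<lambda>i. k < i \<and> \<sigma> i x"] that unfolding i_def by blast
  obtain m where m: "i = Suc m" using i(1) by (cases i) auto
  have "last_stop m x = k" using assms(1) min m i(1) by (intro last_stop_const) auto
  then have "crowded k i x" using i(2) m last_stop_le[of m x] by (auto simp: \<sigma>_def split: if_splits)
  then show ?thesis using i(1) by blast
qed

text \<open>A point with a later stop lies in a cell that is crowded for time \<open>k\<close>. The
  maximal crowded cells have total measure at most \<open>2 ^ (d + 2)\<close> times that of
  \<open>bad\<close>, hence at most half of the cell.\<close>

lemma sigma_packing:
  assumes \<sigma>: "\<sigma> k x"
  shows "emeasure lebesgue (Q k x) \<le> 2 * emeasure lebesgue {y \<in> Q k x. \<forall>j>k. \<not> \<sigma> j y}"
proof -
  let ?D = "2 ^ (CARD('d) + 2) :: real"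
  define P where "P l y \<longleftrightarrow> y \<in> Q k x \<and> crowded k (k + l) y" for l y
  have e: "2 ^ l * sc k = sc (k + l)" for l by (simp add: power_add mult_ac)
  have Pa: "adapted (2 ^ l * sc k) (P l)" for l
    unfolding e P_def
  proof (rule adapted_comp2[OF _ crowded_adapted, where h = "(\<and>)"])
    show "adapted (sc (k + l)) (\<lambda>y. y \<in> Q k x)"
      unfolding adapted_def
    proof (intro allI ballI)
      fix u y assume "y \<in> Q (k + l) u"
      then have "y \<in> Q k u" by (rule Q_mono[rotated]) simp
      then have "Q k y = Q k u" by (rule dcell_eq)
      then show "(y \<in> Q k x) = (u \<in> Q k x)" using dcell_sym[of _ "sc k" x] by simp
    qed
  qed simp
  have badeq: "bad k y = bad k x" if "y \<in> Q k x" for y by (rule adaptedD[OF bad_adapted that])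
  have vm: "(\<lambda>y. ennreal ?D * indicator (bad k x) y) \<in> borel_measurable lebesgue"
    using bad_sets by (intro borel_measurable_times_ennreal borel_measurable_indicator) auto
  \<comment> \<open>Crowding says that this multiple of the indicator of \<open>bad\<close> has
    average above one, so the maximal inequality applies with level one.\<close>
  have "emeasure lebesgue {y. \<exists>l. P l y} \<le> (\<integral>\<^sup>+y. ennreal ?D * indicator (bad k x) y * indicator {y. \<exists>l. P l y} y \<partial>lebesgue)"
  proof (rule maximal_weak_type[OF sc Pa vm])
    fix l y assume P: "P l y"
    have "emeasure lebesgue (Q (k + l) y) = ennreal ?D * (ennreal (1 / ?D) * emeasure lebesgue (Q (k + l) y))"
      by (simp add: mult.assoc[symmetric] ennreal_mult[symmetric] del: power_add)
    also have "\<dots> \<le> ennreal ?D * emeasure lebesgue (bad k x \<inter> Q (k + l) y)"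
    proof (rule mult_left_mono)
      have "bad k y = bad k x" by (rule badeq) (use P in \<open>simp add: P_def\<close>)
      moreover have "crowded k (k + l) y" using P by (simp add: P_def)
      ultimately show "ennreal (1 / ?D) * emeasure lebesgue (Q (k + l) y) \<le> emeasure lebesgue (bad k x \<inter> Q (k + l) y)"
        unfolding crowded_def by simp
    qed simp
    also have "\<dots> = (\<integral>\<^sup>+z. ennreal ?D * indicator (bad k x \<inter> Q (k + l) y) z \<partial>lebesgue)"
      by (intro nn_integral_cmult_indicator[symmetric] sets.Int bad_sets dcell_sets sc)
    also have "\<dots> = (\<integral>\<^sup>+z\<in>Q (k + l) y. ennreal ?D * indicator (bad k x) z \<partial>lebesgue)"
      by (intro nn_integral_cong) (auto simp: indicator_def)
    finally show "emeasure lebesgue (dcell (2 ^ l * sc k) y) \<le> (\<integral>\<^sup>+z\<in>dcell (2 ^ l * sc k) y. ennreal ?D * indicator (bad k x) z \<partial>lebesgue)"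
      unfolding e .
  qed
  also have "\<dots> \<le> (\<integral>\<^sup>+y. ennreal ?D * indicator (bad k x) y \<partial>lebesgue)"
    by (intro nn_integral_mono) (auto split: split_indicator)
  also have "\<dots> = ennreal ?D * emeasure lebesgue (bad k x)"
    by (intro nn_integral_cmult_indicator bad_sets)
  also have "\<dots> \<le> ennreal ?D * (ennreal (1 / 2 ^ (CARD('d) + 3)) * emeasure lebesgue (Q k x))"
    by (intro mult_left_mono bad_measure) auto
  also have "\<dots> = ennreal (?D * (1 / 2 ^ (CARD('d) + 3))) * emeasure lebesgue (Q k x)"
    by (subst ennreal_mult) (auto simp: mult.assoc)
  also have "?D * (1 / 2 ^ (CARD('d) + 3)) = 1 / 2" by (simp add: power_add)
  finally have small: "emeasure lebesgue {y. \<exists>l. P l y} \<le> ennreal (1 / 2) * emeasure lebesgue (Q k x)" .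
  let ?L = "{y \<in> Q k x. \<forall>j>k. \<not> \<sigma> j y}"
  have sj: "{y. \<sigma> j y} \<in> sets lebesgue" for j by (rule adapted_sets[OF sc sigma_adapted])
  have Leq: "?L = Q k x - (\<Union>j\<in>{k<..}. {y. \<sigma> j y})" by auto
  have Ls: "?L \<in> sets lebesgue" unfolding Leq using sj by (intro sets.Diff sets.countable_UN' dcell_sets sc) auto
  have Ps: "{y. \<exists>l. P l y} \<in> sets lebesgue" by (rule sets_ex_adapted[OF sc Pa])
  have "Q k x \<subseteq> ?L \<union> {y. \<exists>l. P l y}"
  proof
    fix y assume y: "y \<in> Q k x"
    show "y \<in> ?L \<union> {y. \<exists>l. P l y}"
    proof (cases "\<exists>j>k. \<sigma> j y")
      case True
      then obtain j where j: "j > k" "\<sigma> j y" by blast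
      have "\<sigma> k y" using \<sigma> adaptedD[OF sigma_adapted y] by simp
      then obtain i where i: "i > k" "crowded k i y" using crowded_before_stop j by blast
      then have "P (i - k) y" using y by (simp add: P_def)
      then show ?thesis by blast
    qed (use y in blast)
  qed
  then have "emeasure lebesgue (Q k x) \<le> emeasure lebesgue (?L \<union> {y. \<exists>l. P l y})"
    using Ls Ps by (intro emeasure_mono sets.Un)
  also have "\<dots> \<le> emeasure lebesgue ?L + emeasure lebesgue {y. \<exists>l. P l y}" by (rule emeasure_subadditive[OF Ls Ps])
  also have "\<dots> \<le> emeasure lebesgue ?L + ennreal (1 / 2) * emeasure lebesgue (Q k x)"
    by (intro add_left_mono small)
  finally have main: "emeasure lebesgue (Q k x) \<le> emeasure lebesgue ?L + ennreal (1 / 2) * emeasure lebesgue (Q k x)" .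
  show ?thesis
  \<comment> \<open>The half on the right is moved to the left, a subtraction that has to take place
    among the reals.\<close>
  proof (cases "emeasure lebesgue ?L")
    case (real l)
    define q where "q = 1 / sc k ^ CARD('d)"
    have q: "q \<ge> 0" using s by (simp add: q_def)
    have "ennreal q \<le> ennreal (l + 1 / 2 * q)"
    proof -
      have "ennreal (l + 1 / 2 * q) = ennreal l + ennreal (1 / 2) * ennreal q"
        using q real(1) ennreal_plus[of l "1 / 2 * q"] ennreal_mult[of "1 / 2" q] by simp
      then show ?thesis using main unfolding real(2) emeasure_dcell[OF sc] q_def[symmetric] by metis
    qed
    then have "q \<le> l + 1 / 2 * q" by (rule iffD1[OF ennreal_le_iff, rotated]) (use q real(1) in simp)
    then have "q \<le> 2 * l" by simp
    then have "ennreal q \<le> 2 * ennreal l" using real(1) ennreal_leI[of q "2 * l"] by (simp add: ennreal_mult)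
    then show ?thesis unfolding real(2) emeasure_dcell[OF sc] q_def[symmetric] .
  next
    case top
    then show ?thesis by (simp add: ennreal_mult_top)
  qed
qed

lemma sparse: "t > 0 \<Longrightarrow> sparse_sum s \<sigma> \<phi> F (4 * real CARD('n) ^ 3) \<delta> t"
proof (unfold_locales)
  show "(\<integral>\<^sup>+x. F x \<partial>lebesgue) < \<infinity>" using Fint unfolding F_def .
  show "(\<integral>\<^sup>+y\<in>Q k x. ennreal (\<phi> k y powr (1 + \<delta>)) \<partial>lebesgue) \<le> ennreal (4 * real CARD('n) ^ 3) * emeasure lebesgue (Q k x)" for k x
    by (rule phi_integral)
  show "emeasure lebesgue (Q k x) \<le> 2 * emeasure lebesgue {y \<in> Q k x. \<forall>j>k. \<not> \<sigma> j y}" if "\<sigma> k x" for k x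
    by (rule sigma_packing[OF that])
  show "\<delta> \<le> 1 / 2" by (rule delta)
qed (auto simp: s sigma_adapted phi_measurable phi_nonneg delta(1))

text \<open>By packing, the number of stops has finite integral over each initial cell, so it is
  finite almost everywhere.\<close>

lemma finitely_many_stops: "AE x in lebesgue. \<exists>m. \<forall>j>m. \<not> \<sigma> j x"
proof (rule AE_cells[where s = s and P = "\<lambda>z x. \<exists>m. \<forall>j>m. \<not> \<sigma> j x"])
  fix z :: "real^'d"
  interpret sp: sparse_sum s \<sigma> \<phi> F "4 * real CARD('n) ^ 3" \<delta> 1 by (rule sparse) simp
  have ms: "{x. \<sigma> k x} \<in> sets lebesgue" for k by (rule adapted_sets[OF sc sigma_adapted])
  have ad: "adapted (2 ^ 0 * s) (indicator (dcell s z) :: _ \<Rightarrow> ennreal)"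
    by (auto simp: adapted_def indicator_def dcell_def)
  have "(\<integral>\<^sup>+x. (\<Sum>k. indicator (dcell s z) x * indicator {x. \<sigma> k x} x) \<partial>lebesgue) =
      (\<Sum>k. \<integral>\<^sup>+x. indicator (dcell s z) x * indicator {x. \<sigma> k x} x \<partial>lebesgue)"
    by (intro nn_integral_suminf borel_measurable_times_ennreal borel_measurable_indicator dcell_sets s ms)
  also have "\<dots> \<le> 2 * (\<integral>\<^sup>+x. indicator (dcell s z) x \<partial>lebesgue)" using sp.carleson[OF ad] by simp
  also have "\<dots> < \<infinity>" using s by (simp add: emeasure_dcell ennreal_mult_less_top)
  finally have fin: "(\<integral>\<^sup>+x. (\<Sum>k. indicator (dcell s z) x * indicator {x. \<sigma> k x} x) \<partial>lebesgue) \<noteq> \<infinity>" by simp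
  have "AE x in lebesgue. (\<Sum>k. indicator (dcell s z) x * indicator {x. \<sigma> k x} x) \<noteq> (\<infinity> :: ennreal)"
    using fin
    by (intro nn_integral_PInf_AE borel_measurable_suminf_order borel_measurable_times_ennreal borel_measurable_indicator dcell_sets s ms)
  then show "AE x in lebesgue. x \<in> dcell s z \<longrightarrow> (\<exists>m. \<forall>j>m. \<not> \<sigma> j x)"
  proof eventually_elim
    case (elim x)
    show ?case
    proof
      assume "x \<in> dcell s z"
      then have "(\<Sum>k. indicator {x. \<sigma> k x} x :: ennreal) \<noteq> top" using elim by simp
      then have "(\<Sum>k. ennreal (of_bool (\<sigma> k x))) \<noteq> top"
        by (simp add: indicator_def of_bool_def if_distrib[of ennreal] cong: if_cong)
      then have "summable (\<lambda>k. of_bool (\<sigma> k x) :: real)" by (intro summable_suminf_not_top) auto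
      then have "(\<lambda>k. of_bool (\<sigma> k x) :: real) \<longlonglongrightarrow> 0" by (rule summable_LIMSEQ_zero)
      then obtain m where m: "\<And>k. k \<ge> m \<Longrightarrow> norm (of_bool (\<sigma> k x) - 0 :: real) < 1"
        using LIMSEQ_D[of _ 0 1] by (metis zero_less_one)
      have "\<not> \<sigma> j x" if "j > m" for j using m[of j] that by (auto split: if_splits)
      then show "\<exists>m. \<forall>j>m. \<not> \<sigma> j x" by blast
    qed
  qed
qed (simp add: adapted_def)

text \<open>The three terms of the local comparison: \<open>T\<close> of the part on the large star
  and \<open>T\<close> of the part on the small star, both at a good point, and the oscillation over
  the cell. The small star costs a second \<open>c\<close> because its average may be
  \<open>c\<close> times larger.\<close>

definition C1 :: real where "C1 = c + c * c + dini_const * c"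

lemma C1_bounds: "c \<le> C1" "0 < C1"
proof -
  have "0 \<le> c * c" "0 \<le> dini_const * c" using c_ge_1 dini_const_nonneg by auto
  then show "c \<le> C1" unfolding C1_def by linarith
  then show "0 < C1" using c_ge_1 by linarith
qed

section \<open>Comparison of consecutive stopping cells\<close>

lemma Q_double: "emeasure lebesgue (Q m x) = ennreal (2 ^ CARD('d)) * emeasure lebesgue (Q (Suc m) x)"
  unfolding emeasure_dcell[OF sc] using s
  by (subst ennreal_mult[symmetric]) (auto simp: power_mult_distrib field_simps)

text \<open>The cell itself may just have become crowded, but its parent is either the stopping cell
  or uncrowded. Passing from the parent to the child costs \<open>2 ^ d\<close>.\<close>

lemma bad_sparse_in_stop:
  assumes kj: "k < j" and st: "last_stop (j - 1) z = k"
  shows "emeasure lebesgue (bad k z \<inter> Q j z) \<le> ennreal (1 / 4) * emeasure lebesgue (Q j z)"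
proof -
  obtain m where m: "j = Suc m" using kj by (cases j) auto
  have st': "last_stop m z = k" using st m by simp
  have "emeasure lebesgue (bad k z \<inter> Q m z) \<le> ennreal (1 / 2 ^ (CARD('d) + 2)) * emeasure lebesgue (Q m z)"
  proof (cases "m = k")
    case True
    have "emeasure lebesgue (bad k z \<inter> Q m z) \<le> emeasure lebesgue (bad k z)"
      by (intro emeasure_mono bad_sets) auto
    also have "\<dots> \<le> ennreal (1 / 2 ^ (CARD('d) + 3)) * emeasure lebesgue (Q m z)"
      using bad_measure[of k z] True by simp
    also have "\<dots> \<le> ennreal (1 / 2 ^ (CARD('d) + 2)) * emeasure lebesgue (Q m z)"
      by (intro mult_right_mono ennreal_leI divide_left_mono power_increasing) auto
    finally show ?thesis .
  next
    case False
    then obtain l where l: "m = Suc l" using st' last_stop_le[of m z] by (cases m) auto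
    have "last_stop l z = k" "\<not> crowded k m z"
      using st' False unfolding l by (auto split: if_splits)
    then show ?thesis by (simp add: crowded_def not_less)
  qed
  moreover have "emeasure lebesgue (bad k z \<inter> Q j z) \<le> emeasure lebesgue (bad k z \<inter> Q m z)"
    using Q_mono[of m j _ z] m by (intro emeasure_mono sets.Int bad_sets dcell_sets sc) auto
  moreover have "ennreal (1 / 2 ^ (CARD('d) + 2)) * emeasure lebesgue (Q m z) = ennreal (1 / 4) * emeasure lebesgue (Q j z)"
    unfolding Q_double[of m z] m mult.assoc[symmetric]
    by (subst ennreal_mult[symmetric]) (auto simp: power_add)
  ultimately show ?thesis by simp
qed

lemma hV_diff:
  assumes "S2 \<subseteq> S1" shows "hV M i (S1 - S2) = (\<lambda>y. hV M i S1 y - hV M i S2 y)"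
proof (rule ext)
  fix y
  show "hV M i (S1 - S2) y = hV M i S1 y - hV M i S2 y"
    using assms by (cases "y \<in> S1"; cases "y \<in> S2") (auto simp: hV_def)
qed

text \<open>The Dini sum runs over the dilates of the cell. As long as a dilate is not coarser than
  time \<open>k\<close>, its star average is at most \<open>c\<close> times that of time
  \<open>k\<close>, because \<open>y0\<close> has the same star and is not bad. Larger dilates see
  no more than the star of time \<open>k\<close>, where \<open>H\<close> lives.\<close>

lemma far_part:
  fixes i :: 'n
  assumes kj: "k < j" and x: "x \<in> Q j z" and y0: "y0 \<in> Q j z" "y0 \<notin> bad k z"
  defines "H \<equiv> hV (V k z) i (Q' k z - Q' j z)"
  shows "norm ((\<integral>y. K x y * H y \<partial>lebesgue) - (\<integral>y. K y0 y * H y \<partial>lebesgue)) \<le> dini_const * c * (kappa TYPE('d) * A * b k z)"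
proof -
  let ?a = "kappa TYPE('d) * A"
  have a0: "?a \<ge> 0" using A less_imp_le[OF kappa_pos[where 'd='d]] by simp
  have S: "Q' k z - Q' j z \<in> sets lebesgue" by (intro sets.Diff dstar_sets sc)
  have nH: "nice H" unfolding H_def by (rule nice_hV[OF S])
  have zk: "z \<in> Q k z" "x \<in> Q k z" using kj x Q_mono[of k j x z] by auto
  have y0x: "y0 \<in> Q j x" using y0(1) dcell_eq[OF x] by simp
  have zero: "H y = 0" if "y \<in> Q' j x" for y using that dstar_eq[OF x] by (simp add: H_def hV_def)
  have bb: "b l x \<le> c * b k z" if l: "k \<le> l" "l \<le> j" for l
  proof -
    have "y0 \<in> Q k z" using Q_mono[OF _ y0(1), of k] kj by simp
    then have "b l y0 \<le> c * b k z" using y0(2) l(1) by (auto simp: bad_def not_less)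
    moreover have "y0 \<in> Q l x" using Q_mono[OF l(2) y0x] .
    ultimately show ?thesis using adaptedD[OF b_adapted, of y0 l x] by simp
  qed
  have cab: "0 \<le> c * (?a * b k z)"
    using mult_nonneg_nonneg[OF _ mult_nonneg_nonneg[OF a0 b_nonneg]] c_ge_1 by simp
  have tm: "ennreal ((sc j / 2 ^ Suc l) ^ CARD('d)) * (\<integral>\<^sup>+y\<in>dstar (sc j / 2 ^ Suc l) x. ennreal (norm (H y)) \<partial>lebesgue) \<le> ennreal (c * (?a * b k z))" for l
  proof -
    let ?r = "sc j / 2 ^ Suc l"
    have r: "?r > 0" using s by simp
    have HI: "(\<integral>\<^sup>+y\<in>dstar ?r x. ennreal (norm (H y)) \<partial>lebesgue) \<le> ennreal ?a * (\<integral>\<^sup>+y\<in>dstar ?r x \<inter> (Q' k z - Q' j z). F y \<partial>lebesgue)"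
      unfolding H_def by (rule hV_integral[OF dstar_sets[OF r] _ S]) auto
    show ?thesis
    proof (cases "k + Suc l \<le> j")
      case True
      define i where "i = j - Suc l"
      have i: "k \<le> i" "i \<le> j" "j = i + Suc l" using True by (auto simp: i_def)
      have ri: "?r = sc i" unfolding i(3) by (simp add: power_add)
      have "(\<integral>\<^sup>+y\<in>dstar ?r x \<inter> (Q' k z - Q' j z). F y \<partial>lebesgue) \<le> (\<integral>\<^sup>+y\<in>Q' i x. F y \<partial>lebesgue)"
        unfolding ri by (intro nn_integral_mono) (auto split: split_indicator)
      also have "\<dots> = ennreal (b i x / sc i ^ CARD('d))" by (rule star_F)
      finally have "ennreal (?r ^ CARD('d)) * (\<integral>\<^sup>+y\<in>dstar ?r x. ennreal (norm (H y)) \<partial>lebesgue) \<le> ennreal (?r ^ CARD('d)) * (ennreal ?a * ennreal (b i x / sc i ^ CARD('d)))"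
        using HI by (meson mult_left_mono order_trans zero_le)
      also have "\<dots> = ennreal (sc i ^ CARD('d) * (?a * (b i x / sc i ^ CARD('d))))"
        unfolding ri using a0 b_nonneg[of i x] s by (simp only: ennreal_mult divide_nonneg_nonneg zero_le_power mult_nonneg_nonneg less_imp_le[OF sc])
      also have "sc i ^ CARD('d) * (?a * (b i x / sc i ^ CARD('d))) = ?a * b i x" using s by simp
      also have "ennreal (?a * b i x) \<le> ennreal (?a * (c * b k z))"
        by (intro ennreal_leI mult_left_mono bb i a0)
      finally show ?thesis by (simp add: mult_ac)
    next
      case False
      have le: "?r \<le> sc k"
      proof -
        have "(2::real) ^ j \<le> 2 ^ (k + Suc l)" using False by (intro power_increasing) auto
        then have "2 ^ j / 2 ^ Suc l \<le> (2 ^ k :: real)" by (simp add: power_add field_simps)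
        then show ?thesis using mult_right_mono[of "2 ^ j / 2 ^ Suc l" "2 ^ k" s] s by simp
      qed
      have "(\<integral>\<^sup>+y\<in>dstar ?r x \<inter> (Q' k z - Q' j z). F y \<partial>lebesgue) \<le> (\<integral>\<^sup>+y\<in>Q' k z. F y \<partial>lebesgue)"
        by (intro nn_integral_mono) (auto split: split_indicator)
      also have "\<dots> = ennreal (b k z / sc k ^ CARD('d))" by (rule star_F)
      finally have "(\<integral>\<^sup>+y\<in>dstar ?r x. ennreal (norm (H y)) \<partial>lebesgue) \<le> ennreal ?a * ennreal (b k z / sc k ^ CARD('d))"
        using HI by (meson mult_left_mono order_trans zero_le)
      moreover have "ennreal (?r ^ CARD('d)) \<le> ennreal (sc k ^ CARD('d))"
        using le r by (intro ennreal_leI power_mono) auto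
      ultimately have "ennreal (?r ^ CARD('d)) * (\<integral>\<^sup>+y\<in>dstar ?r x. ennreal (norm (H y)) \<partial>lebesgue) \<le> ennreal (sc k ^ CARD('d)) * (ennreal ?a * ennreal (b k z / sc k ^ CARD('d)))"
        by (intro mult_mono) auto
      also have "\<dots> = ennreal (sc k ^ CARD('d) * (?a * (b k z / sc k ^ CARD('d))))"
        using a0 b_nonneg[of k z] s by (simp only: ennreal_mult divide_nonneg_nonneg zero_le_power mult_nonneg_nonneg less_imp_le[OF sc])
      also have "sc k ^ CARD('d) * (?a * (b k z / sc k ^ CARD('d))) = 1 * (?a * b k z)" using s by simp
      also have "ennreal (1 * (?a * b k z)) \<le> ennreal (c * (?a * b k z))"
        using c_ge_1 a0 b_nonneg[of k z] by (intro ennreal_leI mult_right_mono) auto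
      finally show ?thesis .
    qed
  qed
  have "ennreal (norm ((\<integral>y. K x y * H y \<partial>lebesgue) - (\<integral>y. K y0 y * H y \<partial>lebesgue))) \<le>
      (\<Sum>l. ennreal (om l * (sc j / 2 ^ Suc l) ^ CARD('d)) * (\<integral>\<^sup>+y\<in>dstar (sc j / 2 ^ Suc l) x. ennreal (norm (H y)) \<partial>lebesgue))"
    by (rule kernel_integral_oscillation[OF sc nH zero y0x])
  also have "\<dots> = (\<Sum>l. ennreal (om l) * (ennreal ((sc j / 2 ^ Suc l) ^ CARD('d)) * (\<integral>\<^sup>+y\<in>dstar (sc j / 2 ^ Suc l) x. ennreal (norm (H y)) \<partial>lebesgue)))"
    using om_nonneg s by (intro suminf_cong) (subst ennreal_mult, auto simp: mult.assoc)
  also have "\<dots> \<le> (\<Sum>l. ennreal (om l) * ennreal (c * (?a * b k z)))"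
    by (intro suminf_le mult_left_mono tm) auto
  also have "\<dots> = (\<Sum>l. ennreal (om l)) * ennreal (c * (?a * b k z))" by (rule ennreal_suminf_multc)
  also have "\<dots> = ennreal (dini_const * c * (?a * b k z))"
    unfolding suminf_om ennreal_mult[OF dini_const_nonneg cab, symmetric] by (simp only: mult.assoc)
  finally have "ennreal (norm ((\<integral>y. K x y * H y \<partial>lebesgue) - (\<integral>y. K y0 y * H y \<partial>lebesgue))) \<le> ennreal (dini_const * c * (?a * b k z))" .
  moreover have "0 \<le> dini_const * c * (?a * b k z)"
    using mult_nonneg_nonneg[OF dini_const_nonneg cab] by (simp only: mult.assoc)
  ultimately show ?thesis by (simp only: ennreal_le_iff)
qed

text \<open>The local comparison of Lerner and Ombrosi: on a newly selected cell, \<open>T\<close> of the part of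
  the function lying between the two stars is controlled at one point that avoids the exceptional
  sets, and its oscillation over the cell is controlled by the Dini condition.\<close>

lemma stop_step_cell:
  assumes kj: "k < j" and st: "last_stop (j - 1) z = k"
  shows "AE x in lebesgue. x \<in> Q j z \<longrightarrow>
    (\<forall>i. norm ((V k z *v (TS (Q' k z) x - TS (Q' j z) x)) $ i) \<le> C1 * (kappa TYPE('d) * A * b k z))"
proof -
  let ?a = "kappa TYPE('d) * A" and ?V = "V k z" and ?S1 = "Q' k z" and ?S2 = "Q' j z"
  have a0: "?a \<ge> 0" using A less_imp_le[OF kappa_pos[where 'd='d]] by simp
  let ?H = "\<lambda>i. hV ?V i (?S1 - ?S2)"
  have sub: "?S2 \<subseteq> ?S1" using dstar_mono[of k j s z] kj by simp
  have m1: "?S1 \<in> sets lebesgue" and m2: "?S2 \<in> sets lebesgue" by (rule dstar_sets[OF sc])+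
  then have m3: "?S1 - ?S2 \<in> sets lebesgue" by (rule sets.Diff)
  \<comment> \<open>The almost everywhere identities are gathered in one set of full measure because
    they are needed at \<open>x\<close> and at the point \<open>y0\<close> chosen below.\<close>
  define G where "G x \<longleftrightarrow> (\<forall>i\<in>UNIV. (?V *v TS ?S1 x) $ i = T (hV ?V i ?S1) x \<and> (?V *v TS ?S2 x) $ i = T (hV ?V i ?S2) x \<and>
      T (?H i) x = T (hV ?V i ?S1) x - T (hV ?V i ?S2) x \<and> (x \<in> Q j z \<longrightarrow> T (?H i) x = (\<integral>y. K x y * ?H i y \<partial>lebesgue)))" for x
  have G: "AE x in lebesgue. G x"
    unfolding G_def
  proof (subst AE_finite_all[OF finite_class.finite_UNIV], intro ballI)
    fix i
    have "AE x in lebesgue. T (?H i) x = T (hV ?V i ?S1) x - T (hV ?V i ?S2) x"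
      unfolding hV_diff[OF sub] by (intro T_diff nice_L2 nice_hV m1 m2)
    moreover have "AE x in lebesgue. x \<in> Q j z \<longrightarrow> T (?H i) x = (\<integral>y. K x y * ?H i y \<partial>lebesgue)"
      by (rule T_off_support[OF sc nice_hV[OF m3]]) (simp add: hV_def)
    ultimately show "AE x in lebesgue. (?V *v TS ?S1 x) $ i = T (hV ?V i ?S1) x \<and> (?V *v TS ?S2 x) $ i = T (hV ?V i ?S2) x \<and>
      T (?H i) x = T (hV ?V i ?S1) x - T (hV ?V i ?S2) x \<and> (x \<in> Q j z \<longrightarrow> T (?H i) x = (\<integral>y. K x y * ?H i y \<partial>lebesgue))"
      using TS_hV[OF m1, of ?V i] TS_hV[OF m2, of ?V i] by eventually_elim simp
  qed
  have zk: "z \<in> Q k z" by simp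
  let ?Z = "{y. \<exists>i. norm (T (hV ?V i ?S2) y) > c * (?a * b j z)}"
  note wp = weak_part[OF less_imp_le[OF kj] zk]
  \<comment> \<open>Each of the two exceptional sets takes up at most a quarter of the cell, so a
    point of full validity remains.\<close>
  obtain y0 where y0: "y0 \<in> Q j z" "y0 \<notin> bad k z" "y0 \<notin> ?Z" "G y0"
  proof -
    have "\<not> (AE x in lebesgue. x \<in> Q j z \<longrightarrow> x \<in> (bad k z \<inter> Q j z) \<union> ?Z)"
    proof
      assume ae: "AE x in lebesgue. x \<in> Q j z \<longrightarrow> x \<in> (bad k z \<inter> Q j z) \<union> ?Z"
      have Bs: "bad k z \<inter> Q j z \<in> sets lebesgue" by (intro sets.Int bad_sets dcell_sets sc)
      have "emeasure lebesgue (Q j z) \<le> emeasure lebesgue ((bad k z \<inter> Q j z) \<union> ?Z)"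
        by (rule emeasure_mono_AE[OF ae sets.Un[OF Bs wp(2)]])
      also have "\<dots> \<le> emeasure lebesgue (bad k z \<inter> Q j z) + emeasure lebesgue ?Z"
        by (rule emeasure_subadditive[OF Bs wp(2)])
      also have "\<dots> \<le> ennreal (1 / 4) * emeasure lebesgue (Q j z) + ennreal (real CARD('n) * weak_const / c * (1 / sc j ^ CARD('d)))"
        by (intro add_mono bad_sparse_in_stop[OF kj st] wp(1))
      also have "\<dots> \<le> ennreal (1 / 4 * (1 / sc j ^ CARD('d))) + ennreal (1 / 4 * (1 / sc j ^ CARD('d)))"
      proof (rule add_mono)
        show "ennreal (1 / 4) * emeasure lebesgue (Q j z) \<le> ennreal (1 / 4 * (1 / sc j ^ CARD('d)))"
          unfolding emeasure_dcell[OF sc] using s by (subst ennreal_mult[symmetric]) auto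
        have p: "real CARD('n) * weak_const > 0" using weak_const_pos by simp
        have "4 * (real CARD('n) * weak_const) \<le> c"
        proof -
          have "(2::real) ^ 2 \<le> 2 ^ (CARD('d) + 3)" by (intro power_increasing) auto
          then have "(4::real) \<le> 2 ^ (CARD('d) + 3)" by simp
          then show ?thesis unfolding c_def using p by (intro mult_mono) auto
        qed
        then have "real CARD('n) * weak_const / c \<le> 1 / 4" using c_ge_1 by (simp add: field_simps)
        then show "ennreal (real CARD('n) * weak_const / c * (1 / sc j ^ CARD('d))) \<le> ennreal (1 / 4 * (1 / sc j ^ CARD('d)))"
          using s by (intro ennreal_leI mult_right_mono) auto
      qed
      also have "\<dots> = ennreal (1 / 2 * (1 / sc j ^ CARD('d)))"
        using s by (subst ennreal_plus[symmetric]) auto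
      finally have "1 / sc j ^ CARD('d) \<le> 1 / 2 * (1 / sc j ^ CARD('d))"
        unfolding emeasure_dcell[OF sc] by (rule iffD1[OF ennreal_le_iff, rotated]) (use s in simp)
      moreover have "1 / sc j ^ CARD('d) > 0" using s by simp
      ultimately show False by linarith
    qed
    moreover define Y where "Y = (bad k z \<inter> Q j z) \<union> ?Z"
    ultimately have nAE: "\<not> (AE x in lebesgue. x \<in> Q j z \<longrightarrow> x \<in> Y)" by simp
    have "\<exists>x. G x \<and> x \<in> Q j z \<and> x \<notin> Y"
    proof (rule ccontr)
      assume no: "\<nexists>x. G x \<and> x \<in> Q j z \<and> x \<notin> Y"
      have "AE x in lebesgue. x \<in> Q j z \<longrightarrow> x \<in> Y"
        using G by (rule eventually_mono) (use no in blast)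
      with nAE show False by contradiction
    qed
    then obtain x where x: "G x" "x \<in> Q j z" "x \<notin> Y" by blast
    show ?thesis by (rule that[of x]) (use x in \<open>unfold Y_def, blast+\<close>)
  qed
  have y0k: "y0 \<in> Q k z" using Q_mono[OF less_imp_le[OF kj] y0(1)] .
  have bj: "b j z \<le> c * b k z"
  proof -
    have "\<forall>l\<ge>k. b l y0 \<le> c * b k z" using y0(2) y0k by (auto simp: bad_def not_less)
    then have "b j y0 \<le> c * b k z" using kj by simp
    then show ?thesis using adaptedD[OF b_adapted y0(1)] by simp
  qed
  have Hy0: "norm (T (?H i) y0) \<le> c * (?a * b k z) + c * (?a * (c * b k z))" for i
  proof -
    have "norm (T (?H i) y0) \<le> norm (T (hV ?V i ?S1) y0) + norm (T (hV ?V i ?S2) y0)"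
      using y0(4) by (simp add: G_def norm_triangle_ineq4)
    moreover have "norm (T (hV ?V i ?S1) y0) \<le> c * (?a * b k z)"
      using y0(2) y0k by (auto simp: bad_def not_less)
    moreover have "norm (T (hV ?V i ?S2) y0) \<le> c * (?a * b j z)"
      using y0(3) by (auto simp: not_less)
    moreover have "c * (?a * b j z) \<le> c * (?a * (c * b k z))"
      using c_ge_1 a0 by (intro mult_left_mono bj) auto
    ultimately show ?thesis by linarith
  qed
  show ?thesis
    using G
  proof eventually_elim
    case (elim x)
    show ?case
    proof (intro impI allI)
      fix i assume x: "x \<in> Q j z"
      have "(?V *v (TS ?S1 x - TS ?S2 x)) $ i = T (?H i) x"
        using elim by (simp add: G_def matrix_vector_mult_diff_distrib)
      also have "\<dots> = T (?H i) y0 + ((\<integral>y. K x y * ?H i y \<partial>lebesgue) - (\<integral>y. K y0 y * ?H i y \<partial>lebesgue))"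
      proof -
        have "T (?H i) x = (\<integral>y. K x y * ?H i y \<partial>lebesgue)" "T (?H i) y0 = (\<integral>y. K y0 y * ?H i y \<partial>lebesgue)"
          using elim y0(1,4) x unfolding G_def by blast+
        then show ?thesis by simp
      qed
      finally have "norm ((?V *v (TS ?S1 x - TS ?S2 x)) $ i) \<le> norm (T (?H i) y0) + norm ((\<integral>y. K x y * ?H i y \<partial>lebesgue) - (\<integral>y. K y0 y * ?H i y \<partial>lebesgue))"
        by (simp add: norm_triangle_ineq)
      also have "\<dots> \<le> (c * (?a * b k z) + c * (?a * (c * b k z))) + dini_const * c * (?a * b k z)"
        by (intro add_mono Hy0 far_part[OF kj x y0(1,2)])
      also have "\<dots> = C1 * (?a * b k z)" by (simp add: C1_def algebra_simps)
      finally show "norm ((?V *v (TS ?S1 x - TS ?S2 x)) $ i) \<le> C1 * (?a * b k z)" .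
    qed
  qed
qed

lemma stop_step:
  assumes kj: "k < j"
  shows "AE x in lebesgue. last_stop (j - 1) x = k \<longrightarrow>
    (\<forall>i. norm ((V k x *v (TS (Q' k x) x - TS (Q' j x) x)) $ i) \<le> C1 * (kappa TYPE('d) * A * b k x))"
proof (rule AE_cells[where s = "sc j" and P = "\<lambda>z x. last_stop (j - 1) z = k \<longrightarrow>
    (\<forall>i. norm ((V k z *v (TS (Q' k z) x - TS (Q' j z) x)) $ i) \<le> C1 * (kappa TYPE('d) * A * b k z))"])
  fix z
  show "AE x in lebesgue. x \<in> Q j z \<longrightarrow> last_stop (j - 1) z = k \<longrightarrow>
      (\<forall>i. norm ((V k z *v (TS (Q' k z) x - TS (Q' j z) x)) $ i) \<le> C1 * (kappa TYPE('d) * A * b k z))"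
    using stop_step_cell[OF kj, of z] by (cases "last_stop (j - 1) z = k") auto
next
  show "adapted (sc j) (\<lambda>z x. last_stop (j - 1) z = k \<longrightarrow>
      (\<forall>i. norm ((V k z *v (TS (Q' k z) x - TS (Q' j z) x)) $ i) \<le> C1 * (kappa TYPE('d) * A * b k z)))"
    unfolding adapted_def
  proof (intro allI ballI)
    fix x y assume y: "y \<in> Q j x"
    have yk: "y \<in> Q k x" and yj: "y \<in> Q (j - 1) x" using kj Q_mono[OF _ y] by auto
    show "(\<lambda>x. last_stop (j - 1) y = k \<longrightarrow>
      (\<forall>i. norm ((V k y *v (TS (Q' k y) x - TS (Q' j y) x)) $ i) \<le> C1 * (kappa TYPE('d) * A * b k y))) =
      (\<lambda>u. last_stop (j - 1) x = k \<longrightarrow>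
      (\<forall>i. norm ((V k x *v (TS (Q' k x) u - TS (Q' j x) u)) $ i) \<le> C1 * (kappa TYPE('d) * A * b k x)))"
      unfolding dstar_eq[OF y] dstar_eq[OF yk] adaptedD[OF V_adapted yk] adaptedD[OF b_adapted yk]
        adaptedD[OF last_stop_adapted yj] ..
  qed
qed

text \<open>After the last stop no subcell is crowded, so by differentiation along cells the
  indicator of \<open>bad\<close> is below one almost everywhere there. Hence \<open>x\<close> is
  not bad, and the first condition in \<open>bad\<close> gives the bound.\<close>

lemma stop_end:
  "AE x in lebesgue. \<sigma> k x \<and> (\<forall>j>k. \<not> \<sigma> j x) \<longrightarrow>
    (\<forall>i. norm ((V k x *v TS (Q' k x) x) $ i) \<le> C1 * (kappa TYPE('d) * A * b k x))"
proof -
  let ?D = "2 ^ (CARD('d) + 2) :: real"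
  let ?P = "\<lambda>z x. \<not> (\<forall>j>k. \<not> crowded k j x) \<or>
    (\<forall>i. norm ((V k z *v TS (Q' k z) x) $ i) \<le> C1 * (kappa TYPE('d) * A * b k z))"
  have "AE x in lebesgue. ?P x x"
  proof (rule AE_cells[where s = "sc k" and P = ?P])
    fix z
    let ?B = "{y \<in> Q k z. \<forall>j>k. \<not> crowded k j y}"
    have "{y. crowded k j y} \<in> sets lebesgue" if "j > k" for j
      by (rule adapted_sets[OF sc crowded_adapted]) (use that in simp)
    then have "Q k z - (\<Union>j\<in>{k<..}. {y. crowded k j y}) \<in> sets lebesgue"
      by (intro sets.Diff sets.countable_UN' dcell_sets sc) auto
    also have "Q k z - (\<Union>j\<in>{k<..}. {y. crowded k j y}) = ?B" by auto
    finally have Bs: "?B \<in> sets lebesgue" .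
    \<comment> \<open>The grid restarts one generation later, since absence of crowding is given
      only for times after \<open>k\<close>.\<close>
    have e: "2 ^ l * sc (Suc k) = sc (Suc k + l)" for l by (simp add: power_add mult_ac)
    have "AE y in lebesgue. y \<in> ?B \<longrightarrow> indicator (bad k z) y \<le> ennreal (1 / ?D)"
    proof (rule cell_differentiation[OF sc[of "Suc k"] _ Bs])
      show "(indicator (bad k z) :: _ \<Rightarrow> ennreal) \<in> borel_measurable lebesgue"
        by (intro borel_measurable_indicator bad_sets)
      fix y l assume y: "y \<in> ?B"
      have "\<not> crowded k (Suc k + l) y" using y by simp
      then have "emeasure lebesgue (bad k z \<inter> Q (Suc k + l) y) \<le> ennreal (1 / ?D) * emeasure lebesgue (Q (Suc k + l) y)"
        using adaptedD[OF bad_adapted, of y k z] y by (simp add: crowded_def not_less)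
      moreover have "(\<integral>\<^sup>+x\<in>Q (Suc k + l) y. indicator (bad k z) x \<partial>lebesgue) = (\<integral>\<^sup>+x. indicator (bad k z \<inter> Q (Suc k + l) y) x \<partial>lebesgue)"
        by (intro nn_integral_cong) (auto split: split_indicator)
      moreover have "(\<integral>\<^sup>+x. indicator (bad k z \<inter> Q (Suc k + l) y) x \<partial>lebesgue) = emeasure lebesgue (bad k z \<inter> Q (Suc k + l) y)"
        by (intro nn_integral_indicator sets.Int bad_sets dcell_sets sc)
      ultimately show "(\<integral>\<^sup>+x\<in>dcell (2 ^ l * sc (Suc k)) y. indicator (bad k z) x \<partial>lebesgue) \<le>
          ennreal (1 / ?D) * emeasure lebesgue (dcell (2 ^ l * sc (Suc k)) y)" unfolding e by simp
    qed simp
    moreover have "AE x in lebesgue. \<forall>i\<in>UNIV. (V k z *v TS (Q' k z) x) $ i = T (hV (V k z) i (Q' k z)) x"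
      by (subst AE_finite_all[OF finite_class.finite_UNIV]) (intro ballI TS_hV dstar_sets sc)
    ultimately show "AE x in lebesgue. x \<in> Q k z \<longrightarrow> ?P z x"
    proof eventually_elim
      case (elim x)
      show ?case
      proof (intro impI)
        assume x: "x \<in> Q k z"
        show "?P z x"
        proof (cases "\<forall>j>k. \<not> crowded k j x")
          case True
          have "(1::ennreal) > ennreal (1 / ?D)"
          proof -
            have "(1::real) < 2 ^ (CARD('d) + 2)" by (rule one_less_power) auto
            then show ?thesis by (simp add: ennreal_less_iff flip: ennreal_1)
          qed
          then have "x \<notin> bad k z" using elim(1) x True by (auto simp: indicator_def not_less[symmetric])
          then have "norm (T (hV (V k z) i (Q' k z)) x) \<le> c * (kappa TYPE('d) * A * b k z)" for i
            using x by (auto simp: bad_def not_less)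
          then have "norm ((V k z *v TS (Q' k z) x) $ i) \<le> c * (kappa TYPE('d) * A * b k z)" for i
            using elim(2) by simp
          moreover have "c * (kappa TYPE('d) * A * b k z) \<le> C1 * (kappa TYPE('d) * A * b k z)"
            using C1_bounds A b_nonneg[of k z] less_imp_le[OF kappa_pos[where 'd='d]] by (intro mult_right_mono) auto
          ultimately show ?thesis by (meson order_trans)
        qed simp
      qed
    qed
  next
    show "adapted (sc k) ?P" unfolding adapted_def
    proof (intro allI ballI)
      fix x y assume y: "y \<in> Q k x"
      show "?P y = ?P x"
        unfolding dstar_eq[OF y] adaptedD[OF V_adapted y] adaptedD[OF b_adapted y] ..
    qed
  qed
  then show ?thesis
  proof eventually_elim
    case (elim x)
    show ?case using elim not_crowded_after[of k x] by blast
  qed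
qed

text \<open>Along the branch of \<open>x\<close> the star of one stop is exchanged for that of the
  next; each exchange costs the term of the stop that is left, and \<open>stop_end\<close> pays for
  the last. The chain is finite for almost every \<open>x\<close>, so no convergence of
  \<open>TS\<close> on shrinking stars is involved.\<close>

lemma domination:
  "AE x in lebesgue. ennreal (norm (W x *v TS (dstar s x) x)) \<le>
    ennreal (C1 * (kappa TYPE('d) * A)) * (\<Sum>k. indicator {x. \<sigma> k x} x * ennreal (b k x * \<phi> k x))"
proof -
  have "AE x in lebesgue. \<forall>k. \<sigma> k x \<and> (\<forall>j>k. \<not> \<sigma> j x) \<longrightarrow>
    (\<forall>i. norm ((V k x *v TS (Q' k x) x) $ i) \<le> C1 * (kappa TYPE('d) * A * b k x))"
    by (subst AE_all_countable) (intro allI stop_end)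
  moreover have "AE x in lebesgue. \<forall>k. \<forall>m. k \<le> m \<longrightarrow> last_stop m x = k \<longrightarrow>
    (\<forall>i. norm ((V k x *v (TS (Q' k x) x - TS (Q' (Suc m) x) x)) $ i) \<le> C1 * (kappa TYPE('d) * A * b k x))"
  proof (subst AE_all_countable, intro allI, subst AE_all_countable, intro allI)
    fix k m :: nat
    show "AE x in lebesgue. k \<le> m \<longrightarrow> last_stop m x = k \<longrightarrow>
      (\<forall>i. norm ((V k x *v (TS (Q' k x) x - TS (Q' (Suc m) x) x)) $ i) \<le> C1 * (kappa TYPE('d) * A * b k x))"
      using stop_step[of k "Suc m"] by (cases "k \<le> m") auto
  qed
  ultimately show ?thesis using finitely_many_stops
  proof eventually_elim
    case (elim x)
    let ?z = "\<lambda>k. C1 * (kappa TYPE('d) * A * b k x) * \<phi> k x"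
    have z0: "?z k \<ge> 0" for k
      using C1_bounds A b_nonneg[of k x] phi_nonneg[of k x] less_imp_le[OF kappa_pos[where 'd='d]] by auto
    have chain: "norm (W x *v TS (dstar s x) x) \<le> (\<Sum>k<last_stop m x. if \<sigma> k x then ?z k else 0) + norm (W x *v TS (Q' (last_stop m x) x) x) \<and> \<sigma> (last_stop m x) x" for m
    proof (induction m)
      case 0
      show ?case by (simp add: \<sigma>_def)
    next
      case (Suc m)
      show ?case
      proof (cases "crowded (last_stop m x) (Suc m) x")
        case True
        let ?k = "last_stop m x"
        have km: "?k \<le> m" by (rule last_stop_le)
        have ls: "last_stop (Suc m) x = Suc m" using True by simp
        have "W x *v TS (Q' ?k x) x = W x *v (TS (Q' ?k x) x - TS (Q' (Suc m) x) x) + W x *v TS (Q' (Suc m) x) x"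
          by (simp add: matrix_vector_mult_diff_distrib)
        then have "norm (W x *v TS (Q' ?k x) x) \<le> norm (W x *v (TS (Q' ?k x) x - TS (Q' (Suc m) x) x)) + norm (W x *v TS (Q' (Suc m) x) x)"
          by (metis norm_triangle_ineq)
        also have "norm (W x *v (TS (Q' ?k x) x - TS (Q' (Suc m) x) x)) \<le> ?z ?k"
          using elim(2) km by (intro matrix_norm_le_phi) auto
        finally have 1: "norm (W x *v TS (Q' ?k x) x) \<le> ?z ?k + norm (W x *v TS (Q' (Suc m) x) x)" by simp
        have "(\<Sum>k<?k. if \<sigma> k x then ?z k else 0) + ?z ?k = (\<Sum>k<Suc ?k. if \<sigma> k x then ?z k else 0)"
          using Suc by simp
        also have "\<dots> \<le> (\<Sum>k<Suc m. if \<sigma> k x then ?z k else 0)"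
          using km z0 by (intro sum_mono2) auto
        finally have "norm (W x *v TS (dstar s x) x) \<le> (\<Sum>k<Suc m. if \<sigma> k x then ?z k else 0) + norm (W x *v TS (Q' (Suc m) x) x)"
          using Suc 1 by linarith
        then show ?thesis unfolding ls by (simp add: \<sigma>_def True)
      next
        case False
        then show ?thesis using Suc by simp
      qed
    qed
    obtain m where m: "\<forall>j>m. \<not> \<sigma> j x" using elim(3) by blast
    let ?k = "last_stop m x"
    have \<sigma>k: "\<sigma> ?k x" using chain by blast
    have none: "\<not> \<sigma> j x" if j: "j > ?k" for j
    proof (cases "j > m")
      case False
      show ?thesis
      proof
        assume \<sigma>j: "\<sigma> j x"
        have "last_stop l x \<ge> j" if "l \<ge> j" for l
          using that
        proof (induction l rule: dec_induct)
          case base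
          show ?case using \<sigma>j by (simp add: \<sigma>_def)
        next
          case (step l)
          then show ?case by auto
        qed
        from this[of m] False j show False by simp
      qed
    qed (use m in blast)
    have "norm (W x *v TS (Q' ?k x) x) \<le> ?z ?k"
      using elim(1) \<sigma>k none by (intro matrix_norm_le_phi) blast
    then have "norm (W x *v TS (dstar s x) x) \<le> (\<Sum>k<Suc ?k. if \<sigma> k x then ?z k else 0)"
      using chain[of m] by simp
    then have "ennreal (norm (W x *v TS (dstar s x) x)) \<le> ennreal (\<Sum>k<Suc ?k. if \<sigma> k x then ?z k else 0)"
      by (rule ennreal_leI)
    also have "\<dots> = (\<Sum>k<Suc ?k. ennreal (if \<sigma> k x then ?z k else 0))"
      using z0 by (intro sum_ennreal[symmetric]) auto
    also have "\<dots> \<le> (\<Sum>k. ennreal (if \<sigma> k x then ?z k else 0))"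
      by (intro sum_le_suminf) auto
    also have "\<dots> = (\<Sum>k. ennreal (C1 * (kappa TYPE('d) * A)) * (indicator {x. \<sigma> k x} x * ennreal (b k x * \<phi> k x)))"
    proof (rule suminf_cong)
      fix k
      have "ennreal (?z k) = ennreal (C1 * (kappa TYPE('d) * A)) * ennreal (b k x * \<phi> k x)"
        using C1_bounds A b_nonneg[of k x] phi_nonneg[of k x] less_imp_le[OF kappa_pos[where 'd='d]]
        by (subst ennreal_mult[symmetric]) (auto simp: mult.assoc)
      then show "ennreal (if \<sigma> k x then ?z k else 0) = ennreal (C1 * (kappa TYPE('d) * A)) * (indicator {x. \<sigma> k x} x * ennreal (b k x * \<phi> k x))"
        by (cases "\<sigma> k x") simp_all
    qed
    also have "\<dots> = ennreal (C1 * (kappa TYPE('d) * A)) * (\<Sum>k. indicator {x. \<sigma> k x} x * ennreal (b k x * \<phi> k x))"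
      by (rule ennreal_suminf_cmult)
    finally show ?case .
  qed
qed

end

section \<open>Limits of truncations\<close>

context cz_op
begin

text \<open>Written out within \<open>cz_op\<close>, where no weight is in scope. The
  \<open>5\<close> is the threshold of the sparse bound; \<open>kappa\<close> enters twice through
  the star maximal inequality and once through the A1 condition on stars; \<open>384\<close> is
  \<open>48 * 4 * 2\<close>.\<close>

definition total_const :: "real \<Rightarrow> real" where
  "total_const n = (let c = 2 ^ (CARD('d) + 3) * (n * weak_const + (kappa TYPE('d))\<^sup>2) in
     5 * (c + c * c + dini_const * c) * (kappa TYPE('d)) ^ 3 * (1 + 384 * n ^ 3 * 2 ^ CARD('d)))"

end

context matrix_estimate
begin

lemma total_const_eq: "total_const (real CARD('n)) = 5 * C1 * (kappa TYPE('d)) ^ 3 * (1 + 384 * real CARD('n) ^ 3 * 2 ^ CARD('d))"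
  by (simp add: total_const_def C1_def c_def Let_def)

theorem local_weak_bound:
  assumes t: "t > 0" and S: "S \<subseteq> {x. norm (W x *v TS (dstar s x) x) > t}"
  shows "emeasure lebesgue S \<le>
    ennreal (total_const (real CARD('n)) * A * Ai / t) * (\<integral>\<^sup>+y. F y \<partial>lebesgue)"
proof -
  let ?k = "kappa TYPE('d)" and ?n = "real CARD('n)"
  let ?b = "C1 * (?k * A)"
  have b: "?b > 0" using C1_bounds A by simp
  \<comment> \<open>Scaled so that exceeding \<open>t\<close> forces the sparse sum above
    five.\<close>
  define t' where "t' = t / (5 * ?b)"
  have t': "t' > 0" using t b by (simp add: t'_def)
  interpret sp: sparse_sum s \<sigma> \<phi> F "4 * ?n ^ 3" \<delta> t' by (rule sparse[OF t'])
  have bsp: "sp.b k x = b k x" for k x by (simp add: sp.b_def b_def)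
  have ms: "{x. \<sigma> k x} \<in> sets lebesgue" for k by (rule adapted_sets[OF sc sigma_adapted])
  let ?S = "\<lambda>x. \<Sum>k. indicator {x. \<sigma> k x} x * ennreal (b k x / t' * \<phi> k x)"
  have "(\<lambda>x. ennreal (b k x / t' * \<phi> k x)) \<in> borel_measurable lebesgue" for k
    using adapted_borel_measurable[OF sc b_adapted, of k] phi_measurable[of k] by measurable
  then have "?S \<in> borel_measurable lebesgue"
    by (intro borel_measurable_suminf_order borel_measurable_times_ennreal borel_measurable_indicator ms)
  then have "{x \<in> space lebesgue. 5 < ?S x} \<in> sets lebesgue" by measurable
  then have m: "{x. 5 < ?S x} \<in> sets lebesgue" by simp
  have "AE x in lebesgue. x \<in> S \<longrightarrow> x \<in> {x. 5 < ?S x}"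
    using domination
  proof eventually_elim
    case (elim x)
    show ?case
    proof
      assume "x \<in> S"
      then have "norm (W x *v TS (dstar s x) x) > t" using S by blast
      then have "ennreal t < ennreal (norm (W x *v TS (dstar s x) x))" using t by (intro ennreal_lessI) auto
      also note elim
      finally have "ennreal (5 / t) * ennreal t < ennreal (5 / t) * (ennreal ?b * (\<Sum>k. indicator {x. \<sigma> k x} x * ennreal (b k x * \<phi> k x)))"
        using t by (intro ennreal_mult_strict_left_mono) auto
      also have "ennreal (5 / t) * ennreal t = 5" using t by (simp add: ennreal_mult[symmetric])
      also have "ennreal (5 / t) * (ennreal ?b * (\<Sum>k. indicator {x. \<sigma> k x} x * ennreal (b k x * \<phi> k x))) =
          ennreal (5 / t * ?b) * (\<Sum>k. indicator {x. \<sigma> k x} x * ennreal (b k x * \<phi> k x))"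
        using t b by (subst ennreal_mult) (auto simp: mult.assoc)
      also have "5 / t * ?b = 1 / t'" using t b by (simp add: t'_def)
      also have "ennreal (1 / t') * (\<Sum>k. indicator {x. \<sigma> k x} x * ennreal (b k x * \<phi> k x)) =
          (\<Sum>k. ennreal (1 / t') * (indicator {x. \<sigma> k x} x * ennreal (b k x * \<phi> k x)))"
        by (rule ennreal_suminf_cmult[symmetric])
      also have "\<dots> = ?S x"
      proof (rule suminf_cong)
        fix k
        have "ennreal (b k x / t' * \<phi> k x) = ennreal (1 / t') * ennreal (b k x * \<phi> k x)"
          using t' b_nonneg[of k x] phi_nonneg[of k x] by (subst ennreal_mult[symmetric]) auto
        then show "ennreal (1 / t') * (indicator {x. \<sigma> k x} x * ennreal (b k x * \<phi> k x)) = indicator {x. \<sigma> k x} x * ennreal (b k x / t' * \<phi> k x)"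
          by (simp only: mult.left_commute)
      qed
      finally show "x \<in> {x. 5 < ?S x}" by simp
    qed
  qed
  then have "emeasure lebesgue S \<le> emeasure lebesgue {x. 5 < ?S x}"
    by (rule emeasure_mono_AE[OF _ m])
  also have "\<dots> \<le> ennreal (?k\<^sup>2 * (1 + 48 * (4 * ?n ^ 3) / \<delta>) / t') * (\<integral>\<^sup>+y. F y \<partial>lebesgue)"
    using sp.sparse_weak_type unfolding bsp .
  also have "\<dots> \<le> ennreal (total_const ?n * A * Ai / t) * (\<integral>\<^sup>+y. F y \<partial>lebesgue)"
  proof (intro mult_right_mono ennreal_leI)
    have inv: "1 / \<delta> = 2 * 2 ^ CARD('d) * Ai" using Ai by (simp add: \<delta>_def)
    have "48 * (4 * ?n ^ 3) / \<delta> = 192 * ?n ^ 3 * (1 / \<delta>)" by simp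
    also have "\<dots> = 384 * ?n ^ 3 * 2 ^ CARD('d) * Ai" unfolding inv by simp
    finally have "1 + 48 * (4 * ?n ^ 3) / \<delta> \<le> (1 + 384 * ?n ^ 3 * 2 ^ CARD('d)) * Ai"
      using Ai by (simp add: distrib_right)
    then have "?k\<^sup>2 * (1 + 48 * (4 * ?n ^ 3) / \<delta>) / t' \<le> ?k\<^sup>2 * ((1 + 384 * ?n ^ 3 * 2 ^ CARD('d)) * Ai) / t'"
      using t' by (intro divide_right_mono mult_left_mono) auto
    also have "\<dots> = total_const ?n * A * Ai / t"
      unfolding total_const_eq t'_def using t b by (simp add: power2_eq_square power3_eq_cube)
    finally show "?k\<^sup>2 * (1 + 48 * (4 * ?n ^ 3) / \<delta>) / t' \<le> total_const ?n * A * Ai / t" .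
  qed simp
  finally show ?thesis .
qed

end

text \<open>The weight is the decay of the kernel at infinity, so finiteness of this norm is what
  the local definition of \<open>T\<close> requires.\<close>

definition decay_norm :: "(real^'d::finite \<Rightarrow> complex) \<Rightarrow> ennreal" where
  "decay_norm h = (\<integral>\<^sup>+y. ennreal (norm (h y) / (1 + norm y) ^ CARD('d)) \<partial>lebesgue)"

lemma norm_measurable_lebesgue [measurable]: "(norm :: real^'d::finite \<Rightarrow> real) \<in> borel_measurable lebesgue"
  by (intro measurable_completion) auto

lemma decay_norm_add:
  assumes [measurable]: "f \<in> borel_measurable lebesgue" "g \<in> borel_measurable lebesgue"
    and le: "\<And>y. norm (h y) \<le> norm (f y) + norm (g y)"
  shows "decay_norm h \<le> decay_norm f + decay_norm (g :: real^'d::finite \<Rightarrow> complex)"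
proof -
  have "decay_norm h \<le> (\<integral>\<^sup>+y. ennreal (norm (f y) / (1 + norm y) ^ CARD('d)) + ennreal (norm (g y) / (1 + norm y) ^ CARD('d)) \<partial>lebesgue)"
    unfolding decay_norm_def
    by (intro nn_integral_mono)
      (auto simp: add_divide_distrib[symmetric] intro!: ennreal_leI divide_right_mono le simp flip: ennreal_plus)
  also have "\<dots> = decay_norm f + decay_norm g"
    unfolding decay_norm_def by (intro nn_integral_add) measurable
  finally show ?thesis .
qed

lemma nice_truncation: "g \<in> borel_measurable lebesgue \<Longrightarrow> nice (truncation k g)"
proof -
  assume [measurable]: "g \<in> borel_measurable lebesgue"
  have "truncation k g \<in> borel_measurable lebesgue" unfolding truncation_def by measurable
  moreover have "norm (truncation k g x) \<le> real k \<and> (norm x > real k \<longrightarrow> truncation k g x = 0)" for x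
    by (simp add: truncation_def)
  ultimately show ?thesis unfolding nice_def by blast
qed

lemma decay_norm_cutoff:
  fixes g :: "real^'d::finite \<Rightarrow> complex"
  assumes [measurable]: "g \<in> borel_measurable lebesgue" "\<And>k. h k \<in> borel_measurable lebesgue"
    and fin: "decay_norm g < \<infinity>" and cut: "\<And>k y. h k y = g y \<or> h k y = 0"
    and ev: "\<And>y. \<forall>\<^sub>F k in sequentially. h k y = g y"
  shows "(\<lambda>k. decay_norm (\<lambda>y. h k y - g y)) \<longlonglongrightarrow> 0"
proof -
  have "(\<lambda>k. \<integral>\<^sup>+y. ennreal (norm (h k y - g y) / (1 + norm y) ^ CARD('d)) \<partial>lebesgue) \<longlonglongrightarrow> (\<integral>\<^sup>+y. 0 \<partial>(lebesgue :: (real^'d) measure))"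
  proof (rule nn_integral_dominated_convergence[where w = "\<lambda>y. ennreal (norm (g y) / (1 + norm y) ^ CARD('d))"])
    show "AE y in lebesgue. ennreal (norm (h k y - g y) / (1 + norm y) ^ CARD('d)) \<le> ennreal (norm (g y) / (1 + norm y) ^ CARD('d))" for k
    proof (intro AE_I2 ennreal_leI divide_right_mono)
      fix y show "norm (h k y - g y) \<le> norm (g y)" using cut[of k y] by auto
    qed auto
    show "(\<integral>\<^sup>+y. ennreal (norm (g y) / (1 + norm y) ^ CARD('d)) \<partial>lebesgue) < \<infinity>" using fin by (simp add: decay_norm_def)
    have "(\<lambda>k. ennreal (norm (h k y - g y) / (1 + norm y) ^ CARD('d))) \<longlonglongrightarrow> 0" for y
      by (rule tendsto_eventually) (use ev[of y] in \<open>auto elim!: eventually_mono\<close>)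
    then show "AE y in lebesgue. (\<lambda>k. ennreal (norm (h k y - g y) / (1 + norm y) ^ CARD('d))) \<longlonglongrightarrow> 0" by simp
  qed measurable
  then show ?thesis by (simp add: decay_norm_def)
qed

lemma local_set_measurable:
  assumes "f \<in> borel_measurable lebesgue"
  shows "{x \<in> ball 0 R. norm (f x :: complex) > \<epsilon>} \<in> sets (lebesgue :: (real^'d::finite) measure)"
proof -
  note [measurable] = assms
  have "ball 0 R \<inter> {x \<in> space lebesgue. norm (f x) > \<epsilon>} \<in> sets lebesgue"
    by (intro sets.Int fmeasurableD[OF lmeasurable_ball]) measurable
  then show ?thesis by (simp add: Int_def)
qed

context cz_op
begin

text \<open>Inside the ball of radius \<open>2 R + 1\<close> the weight is bounded below and the
  weak type inequality applies. Outside it \<open>norm (x - y)\<close> is at least a quarter of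
  \<open>1 + norm y\<close>, so the size bound of the kernel compares with the weight.\<close>

lemma local_decay_bound:
  assumes R: "R > 0"
  shows "\<exists>C\<ge>0. \<forall>h \<epsilon>. nice h \<longrightarrow> \<epsilon> > 0 \<longrightarrow>
    emeasure lebesgue {x \<in> ball 0 R. norm (T h x) > \<epsilon>} \<le> ennreal (C / \<epsilon>) * decay_norm h"
proof -
  define m where "m = measure lebesgue (ball (0 :: real^'d) R)"
  define D where "D = \<bar>cK\<bar> * 4 ^ CARD('d)"
  define C where "C = 2 * weak_const * (2 * R + 2) ^ CARD('d) + 2 * m * D"
  have nn: "m \<ge> 0" "D \<ge> 0" by (simp_all add: m_def D_def)
  have C0: "C \<ge> 0" unfolding C_def using weak_const_pos R nn by auto
  have "emeasure lebesgue {x \<in> ball 0 R. norm (T h x) > \<epsilon>} \<le> ennreal (C / \<epsilon>) * decay_norm h"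
    if h: "nice h" and \<epsilon>: "\<epsilon> > 0" for h \<epsilon>
  proof -
    let ?N = "ball (0 :: real^'d) (2 * R + 1)"
    define h1 where "h1 y = h y * indicator ?N y" for y
    define h2 where "h2 y = h y * indicator (- ?N) y" for y
    have Ns: "?N \<in> sets lebesgue" "- ?N \<in> sets lebesgue"
      by (auto intro!: sets.compl_sets simp: Compl_eq_Diff_UNIV)
    have n1: "nice h1" and n2: "nice h2"
      unfolding h1_def[abs_def] h2_def[abs_def] by (intro nice_indicator h Ns)+
    note [measurable] = nice_measurable[OF h] nice_measurable[OF n1] nice_measurable[OF n2]
      T_measurable[OF nice_L2[OF n1]] T_measurable[OF nice_L2[OF n2]]
    have hsum: "h = (\<lambda>y. h1 y + h2 y)" by (auto simp: h1_def h2_def indicator_def)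
    have ae1: "AE x in lebesgue. T h x = T h1 x + T h2 x"
      by (subst hsum) (rule T_add[OF nice_L2[OF n1] nice_L2[OF n2]])
    have near: "emeasure lebesgue {x. norm (T h1 x) > \<epsilon> / 2} \<le> ennreal (2 * weak_const * (2 * R + 2) ^ CARD('d) / \<epsilon>) * decay_norm h"
    proof -
      have "ennreal (\<integral>y. norm (h1 y) \<partial>lebesgue) = (\<integral>\<^sup>+y. ennreal (norm (h1 y)) \<partial>lebesgue)"
        using nice_integrable[OF n1] by (intro nn_integral_eq_integral[symmetric]) auto
      also have "\<dots> \<le> (\<integral>\<^sup>+y. ennreal ((2 * R + 2) ^ CARD('d)) * ennreal (norm (h y) / (1 + norm y) ^ CARD('d)) \<partial>lebesgue)"
      proof (rule nn_integral_mono)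
        fix y :: "real^'d"
        show "ennreal (norm (h1 y)) \<le> ennreal ((2 * R + 2) ^ CARD('d)) * ennreal (norm (h y) / (1 + norm y) ^ CARD('d))"
        proof (cases "y \<in> ?N")
          case True
          have p: "(1 + norm y) ^ CARD('d) > 0" by (intro zero_less_power add_pos_nonneg) auto
          have "(1 + norm y) ^ CARD('d) \<le> (2 * R + 2) ^ CARD('d)" using True by (intro power_mono) auto
          then have "norm (h y) * (1 + norm y) ^ CARD('d) \<le> norm (h y) * (2 * R + 2) ^ CARD('d)" by (intro mult_left_mono) auto
          then have "norm (h y) \<le> (2 * R + 2) ^ CARD('d) * (norm (h y) / (1 + norm y) ^ CARD('d))"
            using p by (simp add: pos_le_divide_eq mult.commute)
          then show ?thesis using True R p by (simp add: h1_def ennreal_mult[symmetric] ennreal_leI)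
        qed (simp add: h1_def)
      qed
      also have "\<dots> = ennreal ((2 * R + 2) ^ CARD('d)) * decay_norm h"
        unfolding decay_norm_def by (intro nn_integral_cmult) measurable
      finally have *: "ennreal (\<integral>y. norm (h1 y) \<partial>lebesgue) \<le> ennreal ((2 * R + 2) ^ CARD('d)) * decay_norm h" .
      have "emeasure lebesgue {x. norm (T h1 x) > \<epsilon> / 2} \<le> ennreal (weak_const * (\<integral>y. norm (h1 y) \<partial>lebesgue) / (\<epsilon> / 2))"
        using \<epsilon> by (intro weak_type n1) auto
      also have "\<dots> = ennreal (2 * weak_const / \<epsilon>) * ennreal (\<integral>y. norm (h1 y) \<partial>lebesgue)"
        using \<epsilon> weak_const_pos by (subst ennreal_mult[symmetric]) auto
      also have "\<dots> \<le> ennreal (2 * weak_const / \<epsilon>) * (ennreal ((2 * R + 2) ^ CARD('d)) * decay_norm h)"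
        by (intro mult_left_mono *) auto
      also have "\<dots> = ennreal (2 * weak_const / \<epsilon> * (2 * R + 2) ^ CARD('d)) * decay_norm h"
        using \<epsilon> weak_const_pos R by (subst ennreal_mult) (auto simp: mult.assoc)
      finally show ?thesis by simp
    qed
    have far_pt: "AE x in lebesgue. x \<in> ball 0 R \<longrightarrow> ennreal (norm (T h2 x)) \<le> ennreal D * decay_norm h"
      using K_rep[OF nice_L2[OF n2]]
    proof eventually_elim
      case (elim x)
      show ?case
      proof
        assume x: "x \<in> ball 0 R"
        have "ball (0 :: real^'d) R \<inter> {y. h2 y \<noteq> 0} = {}" using R by (auto simp: h2_def indicator_def)
        then have "x \<notin> closure {y. h2 y \<noteq> 0}" using x open_Int_closure_eq_empty[OF open_ball] by blast
        then have eq: "T h2 x = (\<integral>y. K x y * h2 y \<partial>lebesgue)" using elim by blast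
        have bound: "norm (K x y * h2 y) \<le> D * (norm (h y) / (1 + norm y) ^ CARD('d))" for y
        proof (cases "y \<in> ?N")
          case True
          then show ?thesis using nn by (simp add: h2_def)
        next
          case False
          then have y: "norm y \<ge> 2 * R + 1" by simp
          have "norm (x - y) \<ge> norm y - norm x" using norm_triangle_ineq2[of y x] by (simp add: norm_minus_commute)
          then have d: "norm (x - y) \<ge> (1 + norm y) / 4" using x y R by simp
          have p: "0 < (1 + norm y) / 4" by (intro divide_pos_pos add_pos_nonneg norm_ge_zero) auto
          then have "x \<noteq> y" using d by auto
          have "norm (K x y) \<le> cK / norm (x - y) ^ CARD('d)" by (rule K_size[OF \<open>x \<noteq> y\<close>])
          also have "\<dots> \<le> \<bar>cK\<bar> / norm (x - y) ^ CARD('d)" by (intro divide_right_mono) auto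
          also have "\<dots> \<le> \<bar>cK\<bar> / ((1 + norm y) / 4) ^ CARD('d)"
            using p d by (intro divide_left_mono power_mono mult_pos_pos zero_less_power) auto
          also have "\<dots> = D / (1 + norm y) ^ CARD('d)" by (simp add: D_def power_divide)
          finally have "norm (K x y) * norm (h y) \<le> D / (1 + norm y) ^ CARD('d) * norm (h y)"
            by (intro mult_right_mono) auto
          then show ?thesis using False by (simp add: h2_def norm_mult)
        qed
        show "ennreal (norm (T h2 x)) \<le> ennreal D * decay_norm h"
        proof (cases "integrable lebesgue (\<lambda>y. K x y * h2 y)")
          case True
          have "ennreal (norm (T h2 x)) \<le> (\<integral>\<^sup>+y. ennreal (norm (K x y * h2 y)) \<partial>lebesgue)"
            unfolding eq by (rule integral_norm_bound_ennreal[OF True])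
          also have "\<dots> \<le> (\<integral>\<^sup>+y. ennreal D * ennreal (norm (h y) / (1 + norm y) ^ CARD('d)) \<partial>lebesgue)"
            using nn bound by (intro nn_integral_mono) (simp add: ennreal_mult[symmetric] ennreal_leI)
          also have "\<dots> = ennreal D * decay_norm h"
            unfolding decay_norm_def by (intro nn_integral_cmult) measurable
          finally show ?thesis .
        next
          case False
          \<comment> \<open>The integral of a function that is not integrable is zero by convention,
            so the bound is trivial.\<close>
          then show ?thesis unfolding eq by (simp add: not_integrable_integral_eq)
        qed
      qed
    qed
    have far: "emeasure lebesgue {x \<in> ball 0 R. norm (T h2 x) > \<epsilon> / 2} \<le> ennreal (2 * m * D / \<epsilon>) * decay_norm h"
    \<comment> \<open>The far part is bounded on the ball by a single number. Either the level is
      below it, and the measure of the whole ball can be paid for, or the level set is null.\<close>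
    proof (cases "ennreal (\<epsilon> / 2) \<le> ennreal D * decay_norm h")
      case True
      have "emeasure lebesgue {x \<in> ball 0 R. norm (T h2 x) > \<epsilon> / 2} \<le> emeasure lebesgue (ball (0 :: real^'d) R)"
        by (intro emeasure_mono) auto
      also have "\<dots> = ennreal m" unfolding m_def by (intro emeasure_eq_measure2 lmeasurable_ball)
      also have "\<dots> = ennreal (2 * m / \<epsilon>) * ennreal (\<epsilon> / 2)" using \<epsilon> nn by (simp add: ennreal_mult[symmetric])
      also have "\<dots> \<le> ennreal (2 * m / \<epsilon>) * (ennreal D * decay_norm h)" by (intro mult_left_mono True) auto
      also have "\<dots> = ennreal (2 * m / \<epsilon> * D) * decay_norm h" using \<epsilon> nn by (subst ennreal_mult) (auto simp: mult.assoc)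
      finally show ?thesis by simp
    next
      case False
      have "AE x in lebesgue. \<not> (x \<in> ball 0 R \<and> norm (T h2 x) > \<epsilon> / 2)"
        using far_pt
      proof eventually_elim
        case (elim x)
        show ?case
        proof
          assume x: "x \<in> ball 0 R \<and> norm (T h2 x) > \<epsilon> / 2"
          then have "ennreal (\<epsilon> / 2) \<le> ennreal (norm (T h2 x))" by (intro ennreal_leI) simp
          with elim x False show False by (meson order_trans)
        qed
      qed
      then have "emeasure lebesgue {x \<in> space lebesgue. x \<in> ball 0 R \<and> norm (T h2 x) > \<epsilon> / 2} = 0"
        by (rule emeasure_eq_0_AE)
      then show ?thesis by simp
    qed
    have "{x \<in> space lebesgue. norm (T h1 x) > \<epsilon> / 2} \<in> sets lebesgue" by measurable
    then have s1: "{x. norm (T h1 x) > \<epsilon> / 2} \<in> sets lebesgue" by simp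
    have s2: "{x \<in> ball 0 R. norm (T h2 x) > \<epsilon> / 2} \<in> sets lebesgue"
      by (rule local_set_measurable) measurable
    have "emeasure lebesgue {x \<in> ball 0 R. norm (T h x) > \<epsilon>} \<le> emeasure lebesgue ({x. norm (T h1 x) > \<epsilon> / 2} \<union> {x \<in> ball 0 R. norm (T h2 x) > \<epsilon> / 2})"
    proof (rule emeasure_mono_AE[OF _ sets.Un[OF s1 s2]])
      show "AE x in lebesgue. x \<in> {x \<in> ball 0 R. norm (T h x) > \<epsilon>} \<longrightarrow> x \<in> {x. norm (T h1 x) > \<epsilon> / 2} \<union> {x \<in> ball 0 R. norm (T h2 x) > \<epsilon> / 2}"
        using ae1
      proof eventually_elim
        case (elim x)
        then show ?case using norm_triangle_ineq[of "T h1 x" "T h2 x"] by auto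
      qed
    qed
    also have "\<dots> \<le> emeasure lebesgue {x. norm (T h1 x) > \<epsilon> / 2} + emeasure lebesgue {x \<in> ball 0 R. norm (T h2 x) > \<epsilon> / 2}"
      by (rule emeasure_subadditive[OF s1 s2])
    also have "\<dots> \<le> ennreal (2 * weak_const * (2 * R + 2) ^ CARD('d) / \<epsilon>) * decay_norm h + ennreal (2 * m * D / \<epsilon>) * decay_norm h"
      by (intro add_mono near far)
    also have "\<dots> = ennreal (2 * weak_const * (2 * R + 2) ^ CARD('d) / \<epsilon> + 2 * m * D / \<epsilon>) * decay_norm h"
      using \<epsilon> nn weak_const_pos R by (subst ennreal_plus) (auto simp: distrib_right)
    also have "2 * weak_const * (2 * R + 2) ^ CARD('d) / \<epsilon> + 2 * m * D / \<epsilon> = C / \<epsilon>"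
      by (simp add: C_def add_divide_distrib)
    finally show ?thesis .
  qed
  then show ?thesis using C0 by blast
qed

text \<open>Makes images of approximations Cauchy in measure although \<open>T\<close> itself need
  not be meaningful at \<open>g\<close>.\<close>

lemma T_difference_decay:
  assumes R: "R > 0"
  shows "\<exists>C\<ge>0. \<forall>f h g \<epsilon>. nice f \<longrightarrow> nice h \<longrightarrow> g \<in> borel_measurable lebesgue \<longrightarrow> \<epsilon> > 0 \<longrightarrow>
    emeasure lebesgue {x \<in> ball 0 R. norm (T f x - T h x) > \<epsilon>} \<le>
      ennreal (C / \<epsilon>) * (decay_norm (\<lambda>y. f y - g y) + decay_norm (\<lambda>y. h y - g y))"
proof -
  obtain C where C: "C \<ge> 0" "\<And>h \<epsilon>. nice h \<Longrightarrow> \<epsilon> > 0 \<Longrightarrow>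
    emeasure lebesgue {x \<in> ball 0 R. norm (T h x) > \<epsilon>} \<le> ennreal (C / \<epsilon>) * decay_norm h"
    using local_decay_bound[OF R] by blast
  have "emeasure lebesgue {x \<in> ball 0 R. norm (T f x - T h x) > \<epsilon>} \<le>
      ennreal (C / \<epsilon>) * (decay_norm (\<lambda>y. f y - g y) + decay_norm (\<lambda>y. h y - g y))"
    if f: "nice f" and h: "nice h" and g [measurable]: "g \<in> borel_measurable lebesgue" and \<epsilon>: "\<epsilon> > 0" for f h g \<epsilon>
  proof -
    have n: "nice (\<lambda>y. f y - h y)" using nice_add[OF f h, of 1 "-1"] by simp
    note [measurable] = nice_measurable[OF f] nice_measurable[OF h]
    have "emeasure lebesgue {x \<in> ball 0 R. norm (T f x - T h x) > \<epsilon>} \<le> emeasure lebesgue {x \<in> ball 0 R. norm (T (\<lambda>y. f y - h y) x) > \<epsilon>}"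
    proof (rule emeasure_mono_AE)
      show "AE x in lebesgue. x \<in> {x \<in> ball 0 R. norm (T f x - T h x) > \<epsilon>} \<longrightarrow> x \<in> {x \<in> ball 0 R. norm (T (\<lambda>y. f y - h y) x) > \<epsilon>}"
        using T_diff[OF nice_L2[OF f] nice_L2[OF h]] by eventually_elim simp
      show "{x \<in> ball 0 R. norm (T (\<lambda>y. f y - h y) x) > \<epsilon>} \<in> sets lebesgue"
        by (rule local_set_measurable[OF T_measurable[OF nice_L2[OF n]]])
    qed
    also have "\<dots> \<le> ennreal (C / \<epsilon>) * decay_norm (\<lambda>y. f y - h y)" by (rule C(2)[OF n \<epsilon>])
    also have "\<dots> \<le> ennreal (C / \<epsilon>) * (decay_norm (\<lambda>y. f y - g y) + decay_norm (\<lambda>y. h y - g y))"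
    proof (intro mult_left_mono decay_norm_add)
      fix y
      show "norm (f y - h y) \<le> norm (f y - g y) + norm (h y - g y)"
        using norm_triangle_ineq4[of "f y - g y" "h y - g y"] by simp
    qed auto
    finally show ?thesis .
  qed
  then show ?thesis using C(1) by blast
qed

end

text \<open>Completeness of convergence in measure on bounded sets: a rapidly Cauchy subsequence
  converges almost everywhere by Borel-Cantelli, dominated convergence on a ball turns this into
  convergence in measure, and the Cauchy property extends it to the full sequence.\<close>

lemma local_limit_exists:
  fixes u :: "nat \<Rightarrow> real^'d::finite \<Rightarrow> complex"
  assumes um: "\<And>k. u k \<in> borel_measurable lebesgue"
    and cauchy: "\<And>R \<epsilon>. R > 0 \<Longrightarrow> \<epsilon> > 0 \<Longrightarrow> \<exists>e :: nat \<Rightarrow> ennreal. e \<longlonglongrightarrow> 0 \<and>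
      (\<forall>k l. emeasure lebesgue {x \<in> ball 0 R. norm (u k x - u l x) > \<epsilon>} \<le> e k + e l)"
  shows "\<exists>v. local_limit_in_measure u v"
proof -
  note [measurable] = um
  define P where "P j N \<longleftrightarrow> (\<forall>k\<ge>N. \<forall>l\<ge>N. emeasure lebesgue {x \<in> ball 0 (real (Suc j)). norm (u k x - u l x) > (1/2)^j} \<le> ennreal ((1/2)^j))" for j N
  have "\<exists>N. P j N" for j
  proof -
    obtain e :: "nat \<Rightarrow> ennreal" where e: "e \<longlonglongrightarrow> 0"
      "\<And>k l. emeasure lebesgue {x \<in> ball 0 (real (Suc j)). norm (u k x - u l x) > (1/2)^j} \<le> e k + e l"
      using cauchy[of "real (Suc j)" "(1/2)^j"] by auto
    have "(0::ennreal) < ennreal ((1/2)^Suc j)" by simp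
    from order_tendstoD(2)[OF e(1) this] obtain N where N: "\<And>k. k \<ge> N \<Longrightarrow> e k < ennreal ((1/2)^Suc j)"
      by (auto simp: eventually_sequentially)
    have "emeasure lebesgue {x \<in> ball 0 (real (Suc j)). norm (u k x - u l x) > (1/2)^j} \<le> ennreal ((1/2)^j)"
      if "k \<ge> N" "l \<ge> N" for k l
    proof -
      have "e k + e l \<le> ennreal ((1/2)^Suc j) + ennreal ((1/2)^Suc j)"
        using N that by (intro add_mono less_imp_le) auto
      also have "\<dots> = ennreal ((1/2)^j)" by (subst ennreal_plus[symmetric]) auto
      finally show ?thesis using e(2)[of k l] by (rule order_trans[rotated])
    qed
    then show ?thesis unfolding P_def by blast
  qed
  then have "\<forall>j. \<exists>N. P j N" by blast
  from choice[OF this] obtain N where PN: "\<forall>j. P j (N j)" by blast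
  have N: "\<And>j k l. k \<ge> N j \<Longrightarrow> l \<ge> N j \<Longrightarrow>
    emeasure lebesgue {x \<in> ball 0 (real (Suc j)). norm (u k x - u l x) > (1/2)^j} \<le> ennreal ((1/2)^j)"
    using PN unfolding P_def by blast
  define n where "n = rec_nat (N 0) (\<lambda>j m. max (N (Suc j)) (Suc m))"
  have n_Suc: "n (Suc j) = max (N (Suc j)) (Suc (n j))" for j by (simp add: n_def)
  have n_mono: "strict_mono n" unfolding strict_mono_Suc_iff by (simp add: n_Suc less_max_iff_disj)
  have nN: "n j \<ge> N j" for j by (cases j) (simp_all add: n_Suc, simp add: n_def)
  have nN': "n (Suc j) \<ge> N j" for j using nN[of j] n_Suc[of j] by simp
  \<comment> \<open>The radii grow with \<open>j\<close>, so that every point eventually lies in the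
    balls under consideration.\<close>
  define A where "A j = {x \<in> ball 0 (real (Suc j)). norm (u (n j) x - u (n (Suc j)) x) > (1/2)^j}" for j
  have As: "A j \<in> sets lebesgue" for j unfolding A_def by (rule local_set_measurable) measurable
  have Ae: "emeasure lebesgue (A j) \<le> ennreal ((1/2)^j)" for j unfolding A_def by (rule N[OF nN nN'])
  have "AE x in lebesgue. \<forall>\<^sub>F j in sequentially. x \<in> space lebesgue - A j"
  proof (rule borel_cantelli_AE1[OF As])
    show "emeasure lebesgue (A j) < \<infinity>" for j using Ae[of j] by (auto intro: le_less_trans)
    have "norm (measure lebesgue (A j)) \<le> (1/2)^j" for j
    proof -
      have "enn2real (emeasure lebesgue (A j)) \<le> enn2real (ennreal ((1/2)^j))"
        using Ae[of j] by (intro enn2real_mono) auto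
      then show ?thesis by (simp add: measure_def)
    qed
    then show "summable (\<lambda>j. measure lebesgue (A j))"
      by (intro summable_comparison_test'[OF summable_geometric[of "1/2 :: real"]]) auto
  qed
  define v where "v x = lim (\<lambda>j. u (n j) x)" for x
  have vm [measurable]: "v \<in> borel_measurable lebesgue"
    unfolding v_def by (rule borel_measurable_lim_metric) measurable
  have lim: "AE x in lebesgue. (\<lambda>j. u (n j) x) \<longlonglongrightarrow> v x"
    using \<open>AE x in lebesgue. \<forall>\<^sub>F j in sequentially. x \<in> space lebesgue - A j\<close>
  proof eventually_elim
    case (elim x)
    then obtain J1 where J1: "\<And>j. j \<ge> J1 \<Longrightarrow> x \<notin> A j" by (auto simp: eventually_sequentially)
    obtain J2 :: nat where J2: "norm x < real J2" using reals_Archimedean2 by blast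
    have step: "norm (u (n (Suc j)) x - u (n j) x) \<le> (1/2)^j" if "j \<ge> max J1 J2" for j
    proof -
      have "x \<in> ball 0 (real (Suc j))" using J2 that by simp
      moreover have "x \<notin> A j" using J1 that by simp
      ultimately show ?thesis by (simp add: A_def norm_minus_commute not_less)
    qed
    have "summable (\<lambda>j. u (n (Suc j)) x - u (n j) x)"
    proof (rule summable_comparison_test'[where N = "max J1 J2" and g = "\<lambda>j. (1/2)^j"])
      show "summable (\<lambda>j. (1/2 :: real)^j)" by (rule summable_geometric) simp
      show "norm (u (n (Suc j)) x - u (n j) x) \<le> (1/2)^j" if "j \<ge> max J1 J2" for j by (rule step[OF that])
    qed
    then have "(\<lambda>m. \<Sum>j<m. u (n (Suc j)) x - u (n j) x) \<longlonglongrightarrow> (\<Sum>j. u (n (Suc j)) x - u (n j) x)"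
      by (rule summable_LIMSEQ)
    then have "(\<lambda>m. u (n m) x - u (n 0) x) \<longlonglongrightarrow> (\<Sum>j. u (n (Suc j)) x - u (n j) x)"
      by (simp only: sum_lessThan_telescope[of "\<lambda>j. u (n j) x"])
    then have "(\<lambda>m. (u (n m) x - u (n 0) x) + u (n 0) x) \<longlonglongrightarrow> (\<Sum>j. u (n (Suc j)) x - u (n j) x) + u (n 0) x"
      by (intro tendsto_intros)
    then have "convergent (\<lambda>m. u (n m) x)" by (auto simp: convergent_def)
    then show ?case unfolding v_def by (simp add: convergent_LIMSEQ_iff)
  qed
  have "local_limit_in_measure u v"
    unfolding local_limit_in_measure_def
  proof (intro conjI allI impI um vm)
    fix R \<epsilon> :: real assume R: "R > 0" and \<epsilon>: "\<epsilon> > 0"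
    obtain e :: "nat \<Rightarrow> ennreal" where e: "e \<longlonglongrightarrow> 0"
      "\<And>k l. emeasure lebesgue {x \<in> ball 0 R. norm (u k x - u l x) > \<epsilon> / 2} \<le> e k + e l"
      using cauchy[OF R, of "\<epsilon> / 2"] \<epsilon> by auto
    let ?S = "\<lambda>j. {x \<in> ball 0 R. norm (u (n j) x - v x) > \<epsilon> / 2}"
    have Ss: "?S j \<in> sets lebesgue" for j by (rule local_set_measurable) measurable
    have S0: "(\<lambda>j. emeasure lebesgue (?S j)) \<longlonglongrightarrow> 0"
    proof -
      have "(\<lambda>j. \<integral>\<^sup>+x. indicator (?S j) x \<partial>lebesgue) \<longlonglongrightarrow> (\<integral>\<^sup>+x. 0 \<partial>(lebesgue :: (real^'d) measure))"
      proof (rule nn_integral_dominated_convergence[where w = "indicator (ball 0 R)"])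
        show "(\<integral>\<^sup>+x. indicator (ball (0 :: real^'d) R) x \<partial>lebesgue) < \<infinity>"
          using fmeasurableD2[OF lmeasurable_ball, of "0 :: real^'d" R] by (simp add: less_top)
        show "AE x in lebesgue. (\<lambda>j. indicator (?S j) x :: ennreal) \<longlonglongrightarrow> 0"
          using lim
        proof eventually_elim
          case (elim x)
          have "\<epsilon> / 2 > 0" using \<epsilon> by simp
          from tendstoD[OF elim this] have "\<forall>\<^sub>F j in sequentially. (indicator (?S j) x :: ennreal) = 0"
            by eventually_elim (auto simp: indicator_def dist_norm)
          then show ?case by (rule tendsto_eventually)
        qed
        show "(\<lambda>x. indicator (?S j) x) \<in> borel_measurable lebesgue" for j by (rule borel_measurable_indicator[OF Ss])
        show "(indicator (ball (0 :: real^'d) R) :: _ \<Rightarrow> ennreal) \<in> borel_measurable lebesgue"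
          by (intro borel_measurable_indicator fmeasurableD[OF lmeasurable_ball])
        show "AE x in lebesgue. indicator (?S j) x \<le> (indicator (ball 0 R) x :: ennreal)" for j
          by (auto simp: indicator_def)
      qed simp
      then show ?thesis using Ss by simp
    qed
    have bd: "emeasure lebesgue {x \<in> ball 0 R. norm (u k x - v x) > \<epsilon>} \<le> e k" for k
    proof -
      have le: "emeasure lebesgue {x \<in> ball 0 R. norm (u k x - v x) > \<epsilon>} \<le> e k + e (n j) + emeasure lebesgue (?S j)" for j
      proof -
        let ?D = "{x \<in> ball 0 R. norm (u k x - u (n j) x) > \<epsilon> / 2}"
        have Ds: "?D \<in> sets lebesgue" by (rule local_set_measurable) measurable
        have sub: "{x \<in> ball 0 R. norm (u k x - v x) > \<epsilon>} \<subseteq> ?D \<union> ?S j"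
        proof
          fix x assume x: "x \<in> {x \<in> ball 0 R. norm (u k x - v x) > \<epsilon>}"
          have "norm (u k x - v x) \<le> norm (u k x - u (n j) x) + norm (u (n j) x - v x)"
            using norm_triangle_ineq[of "u k x - u (n j) x" "u (n j) x - v x"] by simp
          then show "x \<in> ?D \<union> ?S j" using x by (cases "norm (u k x - u (n j) x) > \<epsilon> / 2") auto
        qed
        have "emeasure lebesgue {x \<in> ball 0 R. norm (u k x - v x) > \<epsilon>} \<le> emeasure lebesgue (?D \<union> ?S j)"
          by (rule emeasure_mono[OF sub sets.Un[OF Ds Ss]])
        also have "\<dots> \<le> emeasure lebesgue ?D + emeasure lebesgue (?S j)" by (rule emeasure_subadditive[OF Ds Ss])
        also have "\<dots> \<le> e k + e (n j) + emeasure lebesgue (?S j)" by (intro add_right_mono e(2))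
        finally show ?thesis .
      qed
      have "(\<lambda>j. e k + e (n j) + emeasure lebesgue (?S j)) \<longlonglongrightarrow> e k + 0 + 0"
        using LIMSEQ_subseq_LIMSEQ[OF e(1) n_mono] by (intro tendsto_intros S0) (simp add: o_def)
      then have "emeasure lebesgue {x \<in> ball 0 R. norm (u k x - v x) > \<epsilon>} \<le> e k + 0 + 0"
        by (rule LIMSEQ_le_const) (use le in blast)
      then show ?thesis by simp
    qed
    show "(\<lambda>k. emeasure lebesgue {x \<in> ball 0 R. norm (u k x - v x) > \<epsilon>}) \<longlonglongrightarrow> 0"
      by (rule tendsto_sandwich[OF _ _ tendsto_const e(1)]) (use bd in auto)
  qed
  then show ?thesis by blast
qed

lemma truncation_eventually: "\<forall>\<^sub>F k in sequentially. truncation k g y = g y"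
proof -
  obtain m :: nat where m: "max (norm y) (norm (g y)) < real m" using reals_Archimedean2 by blast
  then have "truncation k g y = g y" if "k \<ge> m" for k
    using that by (auto simp: truncation_def not_le)
  then show ?thesis by (auto simp: eventually_sequentially)
qed

context cz_op
begin

lemma extension_limit:
  assumes g: "g \<in> borel_measurable lebesgue" and fin: "decay_norm g < \<infinity>"
  shows "local_limit_in_measure (\<lambda>k. T (truncation k g)) (extension T g)"
proof -
  let ?t = "\<lambda>k. truncation k g"
  have n: "nice (?t k)" for k by (rule nice_truncation[OF g])
  have lim: "(\<lambda>k. decay_norm (\<lambda>y. ?t k y - g y)) \<longlonglongrightarrow> 0"
    by (rule decay_norm_cutoff[OF g nice_measurable[OF n] fin])
      (auto simp: truncation_eventually, auto simp: truncation_def)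
  have "\<exists>v. local_limit_in_measure (\<lambda>k. T (?t k)) v"
  proof (rule local_limit_exists)
    show "T (?t k) \<in> borel_measurable lebesgue" for k by (rule T_measurable[OF nice_L2[OF n]])
    fix R \<epsilon> :: real assume R: "R > 0" and \<epsilon>: "\<epsilon> > 0"
    obtain C where C: "C \<ge> 0" "\<And>f h g \<epsilon>. nice f \<Longrightarrow> nice h \<Longrightarrow> g \<in> borel_measurable lebesgue \<Longrightarrow> \<epsilon> > 0 \<Longrightarrow>
      emeasure lebesgue {x \<in> ball 0 R. norm (T f x - T h x) > \<epsilon>} \<le>
        ennreal (C / \<epsilon>) * (decay_norm (\<lambda>y. f y - g y) + decay_norm (\<lambda>y. h y - g y))"
      using T_difference_decay[OF R] by blast
    show "\<exists>e. e \<longlonglongrightarrow> 0 \<and> (\<forall>k l. emeasure lebesgue {x \<in> ball 0 R. norm (T (?t k) x - T (?t l) x) > \<epsilon>} \<le> e k + e l)"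
    proof (intro exI[of _ "\<lambda>k. ennreal (C / \<epsilon>) * decay_norm (\<lambda>y. ?t k y - g y)"] conjI allI)
      show "(\<lambda>k. ennreal (C / \<epsilon>) * decay_norm (\<lambda>y. ?t k y - g y)) \<longlonglongrightarrow> 0"
        using ennreal_tendsto_cmult[OF _ lim, of "ennreal (C / \<epsilon>)"] by simp
      show "emeasure lebesgue {x \<in> ball 0 R. norm (T (?t k) x - T (?t l) x) > \<epsilon>} \<le>
          ennreal (C / \<epsilon>) * decay_norm (\<lambda>y. ?t k y - g y) + ennreal (C / \<epsilon>) * decay_norm (\<lambda>y. ?t l y - g y)" for k l
        using C(2)[OF n n g \<epsilon>, of k l] by (simp add: distrib_left)
    qed
  qed
  then show ?thesis unfolding extension_def by (rule someI_ex)
qed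

text \<open>\<open>extension\<close> truncates each scalar component by its own size, while the
  weighted argument must cut all components on one common set. Any nice approximation in
  \<open>decay_norm\<close> leads to the same limit.\<close>

lemma extension_limit_nice:
  assumes g: "g \<in> borel_measurable lebesgue" and fin: "decay_norm g < \<infinity>"
    and h: "\<And>k. nice (h k)" and lim: "(\<lambda>k. decay_norm (\<lambda>y. h k y - g y)) \<longlonglongrightarrow> 0"
    and R: "R > 0" and \<epsilon>: "\<epsilon> > 0"
  shows "(\<lambda>k. emeasure lebesgue {x \<in> ball 0 R. norm (T (h k) x - extension T g x) > \<epsilon>}) \<longlonglongrightarrow> 0"
proof -
  let ?t = "\<lambda>k. truncation k g"
  have n: "nice (?t k)" for k by (rule nice_truncation[OF g])
  have limt: "(\<lambda>k. decay_norm (\<lambda>y. ?t k y - g y)) \<longlonglongrightarrow> 0"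
    by (rule decay_norm_cutoff[OF g nice_measurable[OF n] fin])
      (auto simp: truncation_eventually, auto simp: truncation_def)
  have \<epsilon>2: "\<epsilon> / 2 > 0" using \<epsilon> by simp
  obtain C where C: "C \<ge> 0" "\<And>f h g \<epsilon>. nice f \<Longrightarrow> nice h \<Longrightarrow> g \<in> borel_measurable lebesgue \<Longrightarrow> \<epsilon> > 0 \<Longrightarrow>
    emeasure lebesgue {x \<in> ball 0 R. norm (T f x - T h x) > \<epsilon>} \<le>
      ennreal (C / \<epsilon>) * (decay_norm (\<lambda>y. f y - g y) + decay_norm (\<lambda>y. h y - g y))"
    using T_difference_decay[OF R] by blast
  note ext = extension_limit[OF g fin]
  have em [measurable]: "extension T g \<in> borel_measurable lebesgue" using ext by (simp add: local_limit_in_measure_def)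
  note [measurable] = T_measurable[OF nice_L2[OF n]] T_measurable[OF nice_L2[OF h]]
  let ?S = "\<lambda>k. {x \<in> ball 0 R. norm (T (?t k) x - extension T g x) > \<epsilon> / 2}"
  let ?D = "\<lambda>k. {x \<in> ball 0 R. norm (T (h k) x - T (?t k) x) > \<epsilon> / 2}"
  let ?e = "\<lambda>k. ennreal (C / (\<epsilon> / 2)) * (decay_norm (\<lambda>y. h k y - g y) + decay_norm (\<lambda>y. ?t k y - g y)) + emeasure lebesgue (?S k)"
  have S0: "(\<lambda>k. emeasure lebesgue (?S k)) \<longlonglongrightarrow> 0"
    using ext R \<epsilon>2 unfolding local_limit_in_measure_def by blast
  have "(\<lambda>k. decay_norm (\<lambda>y. h k y - g y) + decay_norm (\<lambda>y. ?t k y - g y)) \<longlonglongrightarrow> 0 + 0"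
    by (intro tendsto_add lim limt)
  from ennreal_tendsto_cmult[OF _ this, of "ennreal (C / (\<epsilon> / 2))"]
  have "(\<lambda>k. ennreal (C / (\<epsilon> / 2)) * (decay_norm (\<lambda>y. h k y - g y) + decay_norm (\<lambda>y. ?t k y - g y))) \<longlonglongrightarrow> 0" by simp
  from tendsto_add[OF this S0] have e0: "?e \<longlonglongrightarrow> 0" by simp
  have le: "emeasure lebesgue {x \<in> ball 0 R. norm (T (h k) x - extension T g x) > \<epsilon>} \<le> ?e k" for k
  proof -
    have Ds: "?D k \<in> sets lebesgue" and Ss: "?S k \<in> sets lebesgue" by (rule local_set_measurable; measurable)+
    have sub: "{x \<in> ball 0 R. norm (T (h k) x - extension T g x) > \<epsilon>} \<subseteq> ?D k \<union> ?S k"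
    proof
      fix x assume x: "x \<in> {x \<in> ball 0 R. norm (T (h k) x - extension T g x) > \<epsilon>}"
      have "norm (T (h k) x - extension T g x) \<le> norm (T (h k) x - T (?t k) x) + norm (T (?t k) x - extension T g x)"
        using norm_triangle_ineq[of "T (h k) x - T (?t k) x" "T (?t k) x - extension T g x"] by simp
      then show "x \<in> ?D k \<union> ?S k" using x by (cases "norm (T (h k) x - T (?t k) x) > \<epsilon> / 2") auto
    qed
    have "emeasure lebesgue {x \<in> ball 0 R. norm (T (h k) x - extension T g x) > \<epsilon>} \<le> emeasure lebesgue (?D k \<union> ?S k)"
      by (rule emeasure_mono[OF sub sets.Un[OF Ds Ss]])
    also have "\<dots> \<le> emeasure lebesgue (?D k) + emeasure lebesgue (?S k)" by (rule emeasure_subadditive[OF Ds Ss])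
    also have "\<dots> \<le> ?e k" by (intro add_right_mono C(2) h n g \<epsilon>2)
    finally show ?thesis .
  qed
  show ?thesis
    by (rule tendsto_sandwich[OF _ _ tendsto_const e0]) (use le in auto)
qed

end

section \<open>The weighted weak type inequality\<close>

lemma invertible_positive_definite:
  fixes A :: "complex^'n::finite^'n"
  assumes "positive_definite A" shows "invertible A"
proof -
  have "v = 0" if "A *v v = 0" for v
  proof (rule ccontr)
    assume "v \<noteq> 0"
    then have "0 < Re (\<Sum>i\<in>UNIV. (A *v v) $ i * cnj (v $ i))"
      using assms by (simp add: positive_definite_def)
    then show False by (simp add: that)
  qed
  then show ?thesis by (simp add: invertible_left_inverse matrix_left_invertible_ker)
qed

lemma op_norm_bound: "norm (A *v v) \<le> op_norm A * norm (v :: complex^'n::finite)"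
  unfolding op_norm_def by (rule onorm[OF matrix_vector_mul_bounded_linear])

lemma norm_vec_le_sum: "norm v \<le> (\<Sum>i\<in>UNIV. norm (v $ i))" for v :: "complex^'n::finite"
  unfolding norm_vec_def by (rule L2_set_le_sum) simp

lemma norm_matrix_vector_le:
  fixes M :: "complex^'n::finite^'n"
  assumes v: "\<And>j. norm (v $ j) \<le> e"
  shows "norm (M *v v) \<le> (\<Sum>i\<in>UNIV. \<Sum>j\<in>UNIV. norm (M $ i $ j)) * e"
proof -
  have "norm (M *v v) \<le> (\<Sum>i\<in>UNIV. norm ((M *v v) $ i))" by (rule norm_vec_le_sum)
  also have "\<dots> \<le> (\<Sum>i\<in>UNIV. \<Sum>j\<in>UNIV. norm (M $ i $ j) * e)"
  proof (rule sum_mono)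
    fix i
    have "norm ((M *v v) $ i) \<le> (\<Sum>j\<in>UNIV. norm (M $ i $ j * v $ j))"
      unfolding matrix_vector_mult_def by (simp add: norm_sum)
    also have "\<dots> \<le> (\<Sum>j\<in>UNIV. norm (M $ i $ j) * e)"
      unfolding norm_mult by (intro sum_mono mult_left_mono v) auto
    finally show "norm ((M *v v) $ i) \<le> (\<Sum>j\<in>UNIV. norm (M $ i $ j) * e)" .
  qed
  finally show ?thesis by (simp add: sum_distrib_right)
qed

lemma average_le_iff_cube:
  fixes Q :: "(real^'d::finite) set"
  assumes "Q \<in> cubes"
  shows "emeasure lebesgue Q \<noteq> 0" "emeasure lebesgue Q \<noteq> top" "Q \<in> sets lebesgue" "compact Q"
proof -
  obtain a l where Q: "Q = cbox a (a + vec l)" "0 < l" using assms by (auto simp: cubes_def)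
  have "emeasure lebesgue Q = ennreal (l ^ CARD('d))" unfolding Q(1) by (rule halfopen_box_measure(4)[OF Q(2)])
  then show "emeasure lebesgue Q \<noteq> 0" "emeasure lebesgue Q \<noteq> top" using Q(2) by simp_all
  show "Q \<in> sets lebesgue" "compact Q" unfolding Q(1) by auto
qed

lemma common_cube:
  fixes y :: "real^'d::finite"
  shows "\<exists>Q\<in>cubes. emeasure lebesgue Q = ennreal ((2 * (1 + norm y)) ^ CARD('d)) \<and> y \<in> Q \<and> dcell 1 0 \<subseteq> Q"
proof -
  define r where "r = 1 + norm y"
  have r: "2 * r > 0" "r \<ge> 1" using norm_ge_zero[of y] by (auto simp: r_def simp del: norm_ge_zero)
  define Q :: "(real^'d) set" where "Q = cbox (- vec r) (- vec r + vec (2 * r))"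
  have "Q \<in> cubes" unfolding Q_def cubes_def using r(1) by blast
  moreover have "emeasure lebesgue Q = ennreal ((2 * r) ^ CARD('d))"
    unfolding Q_def by (rule halfopen_box_measure(4)[OF r(1)])
  moreover have "y \<in> Q" unfolding Q_def mem_box_cart
  proof
    fix i
    have "\<bar>y $ i\<bar> \<le> r" using component_le_norm_cart[of y i] by (simp add: r_def)
    then show "(- vec r) $ i \<le> y $ i \<and> y $ i \<le> (- vec r + vec (2 * r)) $ i" by (auto simp: abs_le_iff)
  qed
  moreover have "dcell 1 0 \<subseteq> Q"
  proof
    fix z :: "real^'d" assume z: "z \<in> dcell 1 0"
    show "z \<in> Q" unfolding Q_def mem_box_cart
    proof
      fix i
      have "\<lfloor>z $ i\<rfloor> = 0" using z by (simp add: dcell_def)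
      then have "0 \<le> z $ i" "z $ i < 1" by linarith+
      then show "(- vec r) $ i \<le> z $ i \<and> z $ i \<le> (- vec r + vec (2 * r)) $ i" using r by simp
    qed
  qed
  ultimately show ?thesis unfolding r_def by blast
qed

section \<open>Consequences of the A1 condition\<close>

locale a1_weight =
  fixes W :: "real^'d::finite \<Rightarrow> complex^'n::finite^'n" and A :: real
  assumes W: "matrix_weight W" and A0: "A \<ge> 0" and A: "A1_const W = ennreal A"
begin

lemma W_measurable: "(\<lambda>x. W x $ i $ j) \<in> borel_measurable lebesgue"
proof (rule borel_measurable_LIMSEQ_metric)
  show "(\<lambda>x. indicator (cball 0 (real m)) x *\<^sub>R W x $ i $ j) \<in> borel_measurable lebesgue" for m
    using W compact_cball[of "0 :: real^'d" "real m"] unfolding matrix_weight_def set_integrable_def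
    by (blast intro: borel_measurable_integrable)
  fix x :: "real^'d"
  obtain m0 :: nat where m0: "norm x < real m0" using reals_Archimedean2 by blast
  show "(\<lambda>m. indicator (cball 0 (real m)) x *\<^sub>R W x $ i $ j) \<longlonglongrightarrow> W x $ i $ j"
  proof (rule tendsto_eventually)
    have "indicator (cball 0 (real m)) x *\<^sub>R W x $ i $ j = W x $ i $ j" if "m \<ge> m0" for m
      using m0 that by simp
    then show "\<forall>\<^sub>F m in sequentially. indicator (cball 0 (real m)) x *\<^sub>R W x $ i $ j = W x $ i $ j"
      by (auto simp: eventually_sequentially)
  qed
qed

lemma W_invertible: "AE x in lebesgue. invertible (W x)"
proof -
  have "AE x in lebesgue. positive_definite (W x)" using W by (simp add: matrix_weight_def)
  then show ?thesis by eventually_elim (rule invertible_positive_definite)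
qed

lemma W_injective: "AE x in lebesgue. \<forall>v. v \<noteq> 0 \<longrightarrow> W x *v v \<noteq> 0"
  using W_invertible
proof eventually_elim
  case (elim x)
  show ?case
    using elim by (auto simp: invertible_left_inverse matrix_left_invertible_ker)
qed

lemma Wv_measurable [measurable]: "(\<lambda>x. norm (W x *v v)) \<in> borel_measurable lebesgue"
proof (rule norm_vec_measurable)
  note [measurable] = W_measurable
  show "(\<lambda>x. (W x *v v) $ i) \<in> borel_measurable lebesgue" for i
    by (simp add: matrix_vector_mult_def)
qed

text \<open>By Cramer's rule the coordinates are almost everywhere quotients of determinants, which
  are polynomials in measurable entries.\<close>

lemma inverse_measurable:
  assumes f: "\<And>i. (\<lambda>x. f x $ i) \<in> borel_measurable lebesgue"
  shows "(\<lambda>x. (matrix_inv (W x) *v f x) $ k) \<in> borel_measurable lebesgue"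
proof (rule borel_measurable_AE)
  note [measurable] = W_measurable f
  show "(\<lambda>x. det (\<chi> i j. if j = k then f x $ i else W x $ i $ j) / det (W x)) \<in> borel_measurable lebesgue"
    unfolding det_def by (simp add: if_distrib[of "\<lambda>u. _ u"] cong: if_cong) measurable
  show "AE x in lebesgue. det (\<chi> i j. if j = k then f x $ i else W x $ i $ j) / det (W x) = (matrix_inv (W x) *v f x) $ k"
    using W_invertible
  proof eventually_elim
    case (elim x)
    have "W x *v (matrix_inv (W x) *v f x) = f x"
      using elim by (simp add: matrix_vector_mul_assoc matrix_inv_invertible(1))
    moreover have "det (W x) \<noteq> 0" using elim by (simp add: invertible_det_nz)
    ultimately have "matrix_inv (W x) *v f x = (\<chi> k. det (\<chi> i j. if j = k then f x $ i else W x $ i $ j) / det (W x))"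
      by (subst cramer[symmetric]) auto
    then show ?case by simp
  qed
qed

text \<open>The supremum over cubes lies inside the essential supremum, so one null set serves all
  cubes. It also serves all vectors, because \<open>v\<close> is recovered from
  \<open>W x *v v\<close> and the operator norm bound is uniform.\<close>

lemma A1_pointwise: "AE x in lebesgue. \<forall>Q\<in>cubes. x \<in> Q \<longrightarrow> (\<forall>v.
    (\<integral>\<^sup>+z\<in>Q. ennreal (norm (W z *v v)) \<partial>lebesgue) \<le> ennreal (A * norm (W x *v v)) * emeasure lebesgue Q)"
proof -
  have "AE x in lebesgue. (SUP Q\<in>{Q\<in>cubes. x \<in> Q}. average Q (\<lambda>y. op_norm (W y ** matrix_inv (W x)))) \<le> ennreal A"
    using esssup_AE[of "\<lambda>x. SUP Q\<in>{Q\<in>cubes. x \<in> Q}. average Q (\<lambda>y. op_norm (W y ** matrix_inv (W x)))" lebesgue] A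
    by (simp add: A1_const_def)
  with W_invertible show ?thesis
  proof eventually_elim
    case (elim x)
    show ?case
    proof (intro ballI impI allI)
      fix Q v assume Q: "Q \<in> cubes" and x: "x \<in> Q"
      note q = average_le_iff_cube[OF Q]
      let ?w = "W x *v v"
      have inv: "matrix_inv (W x) *v ?w = v"
        using elim(1) by (simp add: matrix_vector_mul_assoc matrix_inv_invertible(2))
      show "(\<integral>\<^sup>+z\<in>Q. ennreal (norm (W z *v v)) \<partial>lebesgue) \<le> ennreal (A * norm ?w) * emeasure lebesgue Q"
      proof (cases "?w = 0")
        case True
        then have "v = 0" using inv by (metis matrix_vector_mult_0_right)
        then show ?thesis by simp
      next
        case False
        then have n: "norm ?w > 0" by simp
        have pt: "norm (W z *v v) / norm ?w \<le> \<bar>op_norm (W z ** matrix_inv (W x))\<bar>" for z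
        proof -
          have "W z *v v = (W z ** matrix_inv (W x)) *v ?w" by (simp only: matrix_vector_mul_assoc[symmetric] inv)
          then have "norm (W z *v v) \<le> op_norm (W z ** matrix_inv (W x)) * norm ?w" by (metis op_norm_bound)
          then have "norm (W z *v v) / norm ?w \<le> op_norm (W z ** matrix_inv (W x))" using n by (simp add: pos_divide_le_eq)
          then show ?thesis by linarith
        qed
        have "average Q (\<lambda>y. op_norm (W y ** matrix_inv (W x))) \<le> ennreal A"
          by (rule order_trans[OF SUP_upper elim(2)]) (use Q x in simp)
        then have "average Q (\<lambda>y. op_norm (W y ** matrix_inv (W x))) * emeasure lebesgue Q \<le> ennreal A * emeasure lebesgue Q"
          by (rule mult_right_mono) simp
        then have av: "(\<integral>\<^sup>+ y\<in>Q. ennreal \<bar>op_norm (W y ** matrix_inv (W x))\<bar> \<partial>lebesgue) \<le> ennreal A * emeasure lebesgue Q"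
          using q(1,2) unfolding average_def by (simp add: ennreal_divide_times mult_divide_eq_ennreal ennreal_times_divide)
        have "(\<integral>\<^sup>+z\<in>Q. ennreal (norm (W z *v v)) \<partial>lebesgue) = (\<integral>\<^sup>+z. ennreal (norm ?w) * (ennreal (norm (W z *v v) / norm ?w) * indicator Q z) \<partial>lebesgue)"
          using n by (intro nn_integral_cong) (simp add: mult.assoc[symmetric] ennreal_mult[symmetric])
        also have "\<dots> = ennreal (norm ?w) * (\<integral>\<^sup>+z\<in>Q. ennreal (norm (W z *v v) / norm ?w) \<partial>lebesgue)"
          by (intro nn_integral_cmult borel_measurable_times_ennreal borel_measurable_indicator[OF q(3)]
              measurable_compose[OF _ measurable_ennreal] borel_measurable_divide Wv_measurable borel_measurable_const)
        also have "\<dots> \<le> ennreal (norm ?w) * (\<integral>\<^sup>+ y\<in>Q. ennreal \<bar>op_norm (W y ** matrix_inv (W x))\<bar> \<partial>lebesgue)"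
          by (intro mult_left_mono nn_integral_mono mult_right_mono ennreal_leI pt) auto
        also have "\<dots> \<le> ennreal (norm ?w) * (ennreal A * emeasure lebesgue Q)"
          by (intro mult_left_mono av) auto
        also have "\<dots> = ennreal (A * norm ?w) * emeasure lebesgue Q"
          using A0 by (simp add: ennreal_mult mult_ac)
        finally show ?thesis .
      qed
    qed
  qed
qed

lemma cube_integral_finite:
  assumes Q: "Q \<in> cubes" shows "(\<integral>\<^sup>+z\<in>Q. ennreal (norm (W z *v v)) \<partial>lebesgue) < \<infinity>"
proof -
  note q = average_le_iff_cube[OF Q]
  have "\<exists>x\<in>Q. (\<integral>\<^sup>+z\<in>Q. ennreal (norm (W z *v v)) \<partial>lebesgue) \<le> ennreal (A * norm (W x *v v)) * emeasure lebesgue Q"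
  proof (rule ccontr)
    assume no: "\<not> ?thesis"
    have "AE x in lebesgue. \<not> x \<in> Q"
      using A1_pointwise
    proof eventually_elim
      case (elim x)
      show ?case using no elim Q by blast
    qed
    then have "emeasure lebesgue {x \<in> space lebesgue. x \<in> Q} = 0" by (rule emeasure_eq_0_AE)
    then show False using q(1) by simp
  qed
  then obtain x where "(\<integral>\<^sup>+z\<in>Q. ennreal (norm (W z *v v)) \<partial>lebesgue) \<le> ennreal (A * norm (W x *v v)) * emeasure lebesgue Q"
    by blast
  also have "\<dots> < \<infinity>" using q(2) by (simp add: ennreal_mult_less_top less_top)
  finally show ?thesis .
qed

lemma cell_integral_finite:
  assumes u: "u > 0" shows "(\<integral>\<^sup>+y\<in>dcell u x. ennreal (norm (W y *v v)) \<partial>lebesgue) < \<infinity>"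
  using cube_integral_finite[OF dcell_closure(1)[OF u, of x], of v]
  by (subst (asm) dcell_closure(4)[OF u]) auto

text \<open>The star spans a closed cube whose volume is \<open>kappa\<close> times that of the cell
  and which contains both the cell and \<open>y\<close>.\<close>

lemma A1_cells:
  assumes u: "u > 0"
  shows "AE y in lebesgue. y \<in> dstar u x \<longrightarrow>
      (\<forall>v. (\<integral>\<^sup>+z\<in>dcell u x. ennreal (norm (W z *v v)) \<partial>lebesgue) \<le>
        ennreal (kappa TYPE('d) * A * norm (W y *v v)) * emeasure lebesgue (dcell u x))"
  using A1_pointwise
proof eventually_elim
  case (elim y)
  show ?case
  proof (intro impI allI)
    fix v assume y: "y \<in> dstar u x"
    define a where "a = corner u x - vec (2 * real CARD('d) / u)"
    define l where "l = (4 * real CARD('d) + 1) / u"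
    have l: "l > 0" using u by (simp add: l_def)
    have sub: "dstar u x \<subseteq> cbox a (a + vec l)"
      unfolding dstar_box[OF u] a_def[symmetric] l_def[symmetric] by (rule halfopen_box_measure(3)[OF l])
    have em: "emeasure lebesgue (cbox a (a + vec l)) = ennreal (kappa TYPE('d)) * emeasure lebesgue (dcell u x)"
      using u unfolding halfopen_box_measure(4)[OF l] emeasure_dcell[OF u]
      by (subst ennreal_mult[symmetric]) (auto simp: l_def kappa_def power_divide)
    have "(\<integral>\<^sup>+z\<in>dcell u x. ennreal (norm (W z *v v)) \<partial>lebesgue) \<le> (\<integral>\<^sup>+z\<in>cbox a (a + vec l). ennreal (norm (W z *v v)) \<partial>lebesgue)"
      using sub dcell_subset_dstar[of u x] by (intro nn_integral_mono) (auto simp: indicator_def)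
    also have "\<dots> \<le> ennreal (A * norm (W y *v v)) * emeasure lebesgue (cbox a (a + vec l))"
      using elim y sub l unfolding cubes_def by blast
    also have "\<dots> = ennreal (kappa TYPE('d) * A * norm (W y *v v)) * emeasure lebesgue (dcell u x)"
      unfolding em using A0 less_imp_le[OF kappa_pos[where 'd='d]]
      by (simp add: ennreal_mult mult_ac)
    finally show "(\<integral>\<^sup>+z\<in>dcell u x. ennreal (norm (W z *v v)) \<partial>lebesgue) \<le>
        ennreal (kappa TYPE('d) * A * norm (W y *v v)) * emeasure lebesgue (dcell u x)" .
  qed
qed

text \<open>The maximal function of \<open>norm (W x *v e)\<close> is at most \<open>A\<close> times
  the function itself almost everywhere. This makes the A-infinity constant finite whenever the A1
  constant is.\<close>

lemma A_infinity_le: "A_infinity_const (\<lambda>x. norm (W x *v e)) \<le> ennreal A"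
  unfolding A_infinity_const_def
proof (rule SUP_least)
  fix Q :: "(real^'d) set" assume Q: "Q \<in> cubes"
  note q = average_le_iff_cube[OF Q]
  let ?w = "\<lambda>x. norm (W x *v e)"
  let ?b = "\<integral>\<^sup>+x\<in>Q. ennreal (?w x) \<partial>lebesgue"
  have "(\<integral>\<^sup>+x\<in>Q. maximal (\<lambda>y. ?w y * indicator Q y) x \<partial>lebesgue) \<le> (\<integral>\<^sup>+x. ennreal A * (ennreal (?w x) * indicator Q x) \<partial>lebesgue)"
  proof (rule nn_integral_mono_AE)
    show "AE x in lebesgue. maximal (\<lambda>y. ?w y * indicator Q y) x * indicator Q x \<le> ennreal A * (ennreal (?w x) * indicator Q x)"
      using A1_pointwise
    proof eventually_elim
      case (elim x)
      have "average R (\<lambda>y. ?w y * indicator Q y) \<le> ennreal A * ennreal (?w x)" if R: "R \<in> cubes" "x \<in> R" for R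
      proof -
        note r = average_le_iff_cube[OF R(1)]
        have "(\<integral>\<^sup>+y\<in>R. ennreal \<bar>?w y * indicator Q y\<bar> \<partial>lebesgue) \<le> (\<integral>\<^sup>+y\<in>R. ennreal (?w y) \<partial>lebesgue)"
          by (intro nn_integral_mono mult_right_mono ennreal_leI) (auto simp: indicator_def)
        also have "\<dots> \<le> ennreal (A * ?w x) * emeasure lebesgue R" using elim R by blast
        finally have "average R (\<lambda>y. ?w y * indicator Q y) \<le> ennreal (A * ?w x) * emeasure lebesgue R / emeasure lebesgue R"
          unfolding average_def by (rule divide_right_mono_ennreal)
        also have "\<dots> = ennreal (A * ?w x)" using r(1,2) by (simp add: mult_divide_eq_ennreal)
        finally show ?thesis using A0 by (simp add: ennreal_mult)
      qed
      then have "maximal (\<lambda>y. ?w y * indicator Q y) x \<le> ennreal A * ennreal (?w x)"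
        unfolding maximal_def by (intro SUP_least) auto
      then have "maximal (\<lambda>y. ?w y * indicator Q y) x * indicator Q x \<le> ennreal A * ennreal (?w x) * indicator Q x"
        by (rule mult_right_mono) simp
      then show ?case by (simp only: mult.assoc)
    qed
  qed
  also have "\<dots> = ennreal A * ?b"
    by (intro nn_integral_cmult borel_measurable_times_ennreal borel_measurable_indicator[OF q(3)]
        measurable_compose[OF Wv_measurable measurable_ennreal])
  finally have "(\<integral>\<^sup>+x\<in>Q. maximal (\<lambda>y. ?w y * indicator Q y) x \<partial>lebesgue) / ?b \<le> ennreal A * ?b / ?b"
    by (rule divide_right_mono_ennreal)
  also have "ennreal A * ?b / ?b \<le> ennreal A"
  \<comment> \<open>For \<open>e = 0\<close> the weight vanishes, and \<open>0 / 0\<close> is zero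
    in \<open>ennreal\<close>.\<close>
  proof (cases "?b = 0")
    case False
    have "?b \<noteq> top" using cube_integral_finite[OF Q, of e] by simp
    then show ?thesis using False by (simp add: mult_divide_eq_ennreal)
  qed simp
  finally show "(\<integral>\<^sup>+x\<in>Q. maximal (\<lambda>y. ?w y * indicator Q y) x \<partial>lebesgue) / ?b \<le> ennreal A" .
qed

text \<open>On a cube the localised maximal function is at least the average over that cube. Hence
  both constants of the weight are at least one.\<close>

lemma A_infinity_ge:
  assumes e: "e \<noteq> 0" shows "1 \<le> A_infinity_const (\<lambda>x. norm (W x *v e))"
proof -
  let ?w = "\<lambda>x. norm (W x *v e)"
  define Q where "Q = cbox (0 :: real^'d) (0 + vec 1)"
  have Q: "Q \<in> cubes" unfolding Q_def cubes_def by (rule CollectI) (intro exI conjI, rule refl, simp)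
  note q = average_le_iff_cube[OF Q]
  let ?b = "\<integral>\<^sup>+x\<in>Q. ennreal (?w x) \<partial>lebesgue"
  let ?a = "\<integral>\<^sup>+x\<in>Q. maximal (\<lambda>y. ?w y * indicator Q y) x \<partial>lebesgue"
  have b: "?b \<noteq> top" using cube_integral_finite[OF Q, of e] by simp
  have b0: "?b \<noteq> 0"
  proof
    assume "?b = 0"
    then have "AE x in lebesgue. ennreal (?w x) * indicator Q x = 0"
      using q(3) by (subst (asm) nn_integral_0_iff_AE) auto
    with W_injective have "AE x in lebesgue. \<not> x \<in> Q"
      by eventually_elim (use e in \<open>auto simp: indicator_def\<close>)
    then have "emeasure lebesgue {x \<in> space lebesgue. x \<in> Q} = 0" by (rule emeasure_eq_0_AE)
    then show False using q(1) by simp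
  qed
  have "?b / emeasure lebesgue Q * indicator Q x \<le> maximal (\<lambda>y. ?w y * indicator Q y) x * indicator Q x" for x
  proof (cases "x \<in> Q")
    case True
    have "?b = (\<integral>\<^sup>+y\<in>Q. ennreal \<bar>?w y * indicator Q y\<bar> \<partial>lebesgue)"
      by (intro nn_integral_cong) (auto simp: indicator_def)
    then have "?b / emeasure lebesgue Q = average Q (\<lambda>y. ?w y * indicator Q y)" by (simp add: average_def)
    also have "\<dots> \<le> maximal (\<lambda>y. ?w y * indicator Q y) x"
      unfolding maximal_def using Q True by (intro SUP_upper) simp
    finally show ?thesis by (intro mult_right_mono) auto
  qed simp
  then have "(\<integral>\<^sup>+x. ?b / emeasure lebesgue Q * indicator Q x \<partial>lebesgue) \<le> ?a" by (intro nn_integral_mono)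
  also have "(\<integral>\<^sup>+x. ?b / emeasure lebesgue Q * indicator Q x \<partial>lebesgue) = ?b / emeasure lebesgue Q * emeasure lebesgue Q"
    by (rule nn_integral_cmult_indicator[OF q(3)])
  also have "\<dots> = ?b" using q(1,2) by (simp add: ennreal_divide_times mult_divide_eq_ennreal ennreal_times_divide)
  finally have "?b / ?b \<le> ?a / ?b" by (rule divide_right_mono_ennreal)
  also have "?a / ?b \<le> A_infinity_const ?w" unfolding A_infinity_const_def using Q by (rule SUP_upper)
  finally show ?thesis using b b0 by (simp add: ennreal_divide_self less_top zero_less_iff_neq_zero)
qed

lemma matrix_estimateI:
  assumes T: "cz_op T K cK \<omega> B" and s: "s > 0" and A1: "A > 0" and Ai: "Ai \<ge> 1"
    and Ainf: "\<And>e. e \<noteq> 0 \<Longrightarrow> A_infinity_const (\<lambda>x. norm (W x *v e)) \<le> ennreal Ai"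
    and g: "\<And>i. nice (\<lambda>y. g y $ i)" and F: "(\<integral>\<^sup>+y. ennreal (norm (W y *v g y)) \<partial>lebesgue) < \<infinity>"
  shows "matrix_estimate T K cK \<omega> B W g A Ai s"
proof -
  interpret cz_op T K cK \<omega> B by (rule T)
  show ?thesis
    by unfold_locales (use s A1 Ai Ainf g F W_measurable cell_integral_finite W_injective A1_cells in blast)+
qed

text \<open>Comparing averages over a fixed cell and over a cube that also contains \<open>y\<close> shows that the
  norm of the inverse weight grows at most like \<open>(1 + norm y) ^ d\<close>.\<close>

lemma inverse_growth:
  fixes T :: "(real^'d \<Rightarrow> complex) \<Rightarrow> real^'d \<Rightarrow> complex"
  assumes T: "cz_op T K cK \<omega> B" and A1: "A > 0"
  shows "\<exists>C\<ge>0. AE y in lebesgue. \<forall>v. norm v \<le> C * (1 + norm y) ^ CARD('d) * norm (W y *v v)"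
proof -
  have "A \<ge> 1"
  proof -
    have "(axis undefined 1 :: complex^'n) \<noteq> 0" by (simp add: axis_eq_0_iff)
    from order_trans[OF A_infinity_ge[OF this] A_infinity_le] show ?thesis by simp
  qed
  \<comment> \<open>Only the basis of a cell is wanted here, so the zero function and the crude
    A-infinity bound \<open>A\<close> are enough.\<close>
  interpret me: matrix_estimate T K cK \<omega> B W "\<lambda>y. 0" A A 1
    by (rule matrix_estimateI[OF T]) (use A1 \<open>A \<ge> 1\<close> A_infinity_le nice_zero in auto)
  obtain E V where EV: "me.adapted_basis (dcell 1 (0 :: real^'d)) E V" using me.adapted_basis_exists[of 1 0] by auto
  define G where "G = (\<Sum>i\<in>UNIV. norm (E $ i))"
  have "AE y in lebesgue. \<forall>v. norm v \<le> (G * A * 2 ^ CARD('d)) * (1 + norm y) ^ CARD('d) * norm (W y *v v)"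
    using A1_pointwise
  proof eventually_elim
    case (elim y)
    show ?case
    proof
      fix v
      define l where "l = 2 * (1 + norm y)"
      obtain Q where Q: "Q \<in> cubes" "emeasure lebesgue Q = ennreal (l ^ CARD('d))" "y \<in> Q" "dcell 1 0 \<subseteq> Q"
        using common_cube[of y] unfolding l_def by blast
      have l: "l \<ge> 0" by (simp add: l_def)
      have bd: "norm ((V *v v) $ i) \<le> A * norm (W y *v v) * l ^ CARD('d)" for i
      proof -
        have "ennreal (norm ((V *v v) $ i)) * emeasure lebesgue (dcell 1 (0 :: real^'d)) \<le> (\<integral>\<^sup>+z\<in>dcell 1 0. ennreal (norm (W z *v v)) \<partial>lebesgue)"
          using EV by (simp add: me.adapted_basis_def)
        also have "\<dots> \<le> (\<integral>\<^sup>+z\<in>Q. ennreal (norm (W z *v v)) \<partial>lebesgue)"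
          using Q(4) by (intro nn_integral_mono) (auto simp: indicator_def)
        also have "\<dots> \<le> ennreal (A * norm (W y *v v)) * emeasure lebesgue Q" using elim Q(1,3) by blast
        also have "\<dots> = ennreal (A * norm (W y *v v) * l ^ CARD('d))"
          unfolding Q(2) using A0 l by (intro ennreal_mult[symmetric]) auto
        finally have "ennreal (norm ((V *v v) $ i)) \<le> ennreal (A * norm (W y *v v) * l ^ CARD('d))"
          by (simp add: emeasure_dcell)
        moreover have "0 \<le> A * norm (W y *v v) * l ^ CARD('d)" using A0 l by auto
        ultimately show ?thesis by (simp only: ennreal_le_iff)
      qed
      have "v = (\<Sum>i\<in>UNIV. (V *v v) $ i *s E $ i)" using EV unfolding me.adapted_basis_def by blast
      then have "norm v \<le> (\<Sum>i\<in>UNIV. norm ((V *v v) $ i *s E $ i))" by (metis norm_sum)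
      also have "\<dots> \<le> (\<Sum>i\<in>UNIV. A * norm (W y *v v) * l ^ CARD('d) * norm (E $ i))"
      proof (rule sum_mono)
        fix i
        have "norm ((V *v v) $ i *s E $ i) = norm ((V *v v) $ i) * norm (E $ i)"
          by (simp add: norm_vec_def L2_set_def norm_mult power_mult_distrib sum_distrib_left[symmetric] real_sqrt_mult)
        then show "norm ((V *v v) $ i *s E $ i) \<le> A * norm (W y *v v) * l ^ CARD('d) * norm (E $ i)"
          using bd[of i] by (simp add: mult_right_mono)
      qed
      also have "\<dots> = (G * A * 2 ^ CARD('d)) * (1 + norm y) ^ CARD('d) * norm (W y *v v)"
        unfolding l_def power_mult_distrib by (simp add: G_def sum_distrib_left sum_distrib_right mult_ac)
      finally show "norm v \<le> (G * A * 2 ^ CARD('d)) * (1 + norm y) ^ CARD('d) * norm (W y *v v)" .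
    qed
  qed
  moreover have "G * A * 2 ^ CARD('d) \<ge> 0" using A0 unfolding G_def by (intro mult_nonneg_nonneg sum_nonneg) auto
  ultimately show ?thesis by blast
qed

end

context cz_op
begin

text \<open>The local bound for truncations is uniform in the truncation and in the ball, and is
  carried to the limit in measure. Halving the level to separate the error of approximation accounts
  for the factor two.\<close>

theorem weighted_weak_type:
  fixes W :: "real^'d \<Rightarrow> complex^'n::finite^'n" and f :: "real^'d \<Rightarrow> complex^'n"
  assumes W: "a1_weight W A" and A: "A \<ge> 1" and Ai: "Ai \<ge> 1"
    and Ainf: "\<And>e. e \<noteq> 0 \<Longrightarrow> A_infinity_const (\<lambda>x. norm (W x *v e)) \<le> ennreal Ai"
    and f: "integrable lebesgue f" and t: "t > 0"
  shows "emeasure lebesgue {x. norm (weighted_operator T W f x) > t} \<le>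
    ennreal (2 * total_const (real CARD('n)) * A * Ai / t) * (\<integral>\<^sup>+x. ennreal (norm (f x)) \<partial>lebesgue)"
proof -
  interpret w: a1_weight W A by (rule W)
  have czop: "cz_op T K cK \<omega> B" by unfold_locales
  have A0: "A > 0" using A by simp
  let ?f = "\<integral>\<^sup>+x. ennreal (norm (f x)) \<partial>lebesgue"
  define g where "g y = matrix_inv (W y) *v f y" for y
  have fm: "(\<lambda>y. f y $ i) \<in> borel_measurable lebesgue" for i
  proof -
    have "f \<in> borel_measurable lebesgue" using f by simp
    then show ?thesis by (intro borel_measurable_continuous_on[OF _ \<open>f \<in> borel_measurable lebesgue\<close>] continuous_intros)
  qed
  have gm [measurable]: "(\<lambda>y. g y $ i) \<in> borel_measurable lebesgue" for i
    unfolding g_def by (rule w.inverse_measurable[OF fm])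
  have gn [measurable]: "(\<lambda>y. norm (g y)) \<in> borel_measurable lebesgue" by (rule norm_vec_measurable) measurable
  have Wg: "AE y in lebesgue. W y *v g y = f y"
    using w.W_invertible by eventually_elim (simp add: g_def matrix_vector_mul_assoc matrix_inv_invertible(1))
  have ffin: "?f < \<infinity>" using f by (simp add: integrable_iff_bounded)
  have decay: "decay_norm (\<lambda>y. g y $ i) < \<infinity>" for i
  proof -
    obtain C where C: "C \<ge> 0" "AE y in lebesgue. \<forall>v. norm v \<le> C * (1 + norm y) ^ CARD('d) * norm (W y *v v)"
      using w.inverse_growth[OF czop A0] by blast
    have "decay_norm (\<lambda>y. g y $ i) \<le> (\<integral>\<^sup>+y. ennreal C * ennreal (norm (f y)) \<partial>lebesgue)"
      unfolding decay_norm_def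
    proof (rule nn_integral_mono_AE)
      show "AE y in lebesgue. ennreal (norm (g y $ i) / (1 + norm y) ^ CARD('d)) \<le> ennreal C * ennreal (norm (f y))"
        using C(2) Wg
      proof eventually_elim
        case (elim y)
        have p: "(1 + norm y) ^ CARD('d) > 0" by (intro zero_less_power add_pos_nonneg) auto
        have "norm (g y $ i) \<le> norm (g y)" by (rule Finite_Cartesian_Product.norm_nth_le)
        also have "\<dots> \<le> C * (1 + norm y) ^ CARD('d) * norm (f y)" using elim by metis
        finally have "norm (g y $ i) / (1 + norm y) ^ CARD('d) \<le> C * norm (f y)"
          using p by (simp add: pos_divide_le_eq mult_ac)
        then show ?case using C(1) by (simp add: ennreal_mult[symmetric] ennreal_leI)
      qed
    qed
    also have "\<dots> = ennreal C * ?f" using f by (intro nn_integral_cmult) auto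
    also have "\<dots> < \<infinity>" using ffin by (simp add: ennreal_mult_less_top)
    finally show ?thesis .
  qed
  \<comment> \<open>All components are cut on one set, so that \<open>W\<close> applied to the
    truncation is almost everywhere either \<open>f\<close> or zero.\<close>
  define S where "S k = {y. norm y \<le> real k \<and> norm (g y) \<le> real k}" for k :: nat
  have Ss: "S k \<in> sets lebesgue" for k
  proof -
    have "{y \<in> space lebesgue. norm y \<le> real k \<and> norm (g y) \<le> real k} \<in> sets lebesgue" by measurable
    then show ?thesis by (simp add: S_def)
  qed
  define h where "h k i y = g y $ i * indicator (S k) y" for k i y
  have hn: "nice (h k i)" for k i
  proof -
    have "h k i \<in> borel_measurable lebesgue"
      unfolding h_def using Ss by (intro borel_measurable_times borel_measurable_indicator gm)
    moreover have "norm (h k i y) \<le> real k \<and> (norm y > real k \<longrightarrow> h k i y = 0)" for y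
      using order_trans[OF Finite_Cartesian_Product.norm_nth_le[of "g y" i]] by (auto simp: h_def S_def indicator_def)
    ultimately show ?thesis unfolding nice_def by blast
  qed
  have hev: "\<forall>\<^sub>F k in sequentially. h k i y = g y $ i" for i y
  proof -
    obtain m :: nat where m: "max (norm y) (norm (g y)) < real m" using reals_Archimedean2 by blast
    then have "h k i y = g y $ i" if "k \<ge> m" for k
      using that by (auto simp: h_def S_def indicator_def)
    then show ?thesis by (auto simp: eventually_sequentially)
  qed
  have hlim: "(\<lambda>k. decay_norm (\<lambda>y. h k i y - g y $ i)) \<longlonglongrightarrow> 0" for i
    by (rule decay_norm_cutoff[OF gm nice_measurable[OF hn] decay]) (auto simp: hev, auto simp: h_def indicator_def)
  define U where "U x = (\<chi> i. extension T (\<lambda>y. g y $ i) x)" for x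
  have em [measurable]: "extension T (\<lambda>y. g y $ i) \<in> borel_measurable lebesgue" for i
    using extension_limit[OF gm decay] by (simp add: local_limit_in_measure_def)
  have Um: "(\<lambda>x. U x $ i) \<in> borel_measurable lebesgue" for i unfolding U_def by (simp add: em)
  have op: "weighted_operator T W f x = W x *v U x" for x
    by (simp add: weighted_operator_def U_def g_def)
  note [measurable] = w.W_measurable
  have WUm [measurable]: "(\<lambda>x. norm (W x *v U x)) \<in> borel_measurable lebesgue"
  proof (rule norm_vec_measurable)
    note [measurable] = Um
    show "(\<lambda>x. (W x *v U x) $ i) \<in> borel_measurable lebesgue" for i by (simp add: matrix_vector_mult_def)
  qed
  define D where "D = ennreal (2 * total_const (real CARD('n)) * A * Ai / t) * ?f"
  have approx: "emeasure lebesgue {x \<in> ball 0 R. norm (W x *v (\<chi> i. T (h k i) x)) > t / 2} \<le> D" if R: "R > 0" for R k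
  proof -
    \<comment> \<open>Cells so large that, for every \<open>x\<close> in the ball, the star of
      \<open>x\<close> contains the support of the truncation; restricting to the star then changes
      nothing.\<close>
    define s where "s = 1 / (R + real k + 1)"
    have s: "s > 0" using R by (simp add: s_def)
    define gk where "gk y = (\<chi> i. h k i y)" for y
    have gk: "gk y = (if y \<in> S k then g y else 0)" for y by (simp add: gk_def h_def vec_eq_iff)
    have Fle: "AE y in lebesgue. ennreal (norm (W y *v gk y)) \<le> ennreal (norm (f y))"
      using Wg by eventually_elim (simp add: gk)
    then have Fint: "(\<integral>\<^sup>+y. ennreal (norm (W y *v gk y)) \<partial>lebesgue) \<le> ?f" by (rule nn_integral_mono_AE)
    interpret me: matrix_estimate T K cK \<omega> B W gk A Ai s
      by (rule w.matrix_estimateI[OF czop s A0 Ai Ainf]) (use Fint ffin hn in \<open>auto simp: gk_def intro: le_less_trans\<close>)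
    have t2: "t / 2 > 0" using t by simp
    have "emeasure lebesgue {x \<in> ball 0 R. norm (W x *v (\<chi> i. T (h k i) x)) > t / 2} \<le>
        ennreal (total_const (real CARD('n)) * A * Ai / (t / 2)) * (\<integral>\<^sup>+y. me.F y \<partial>lebesgue)"
    proof (rule me.local_weak_bound[OF t2])
      show "{x \<in> ball 0 R. norm (W x *v (\<chi> i. T (h k i) x)) > t / 2} \<subseteq> {x. norm (W x *v me.TS (dstar s x) x) > t / 2}"
      proof
        fix x assume "x \<in> {x \<in> ball 0 R. norm (W x *v (\<chi> i. T (h k i) x)) > t / 2}"
        then have x: "norm x < R" "norm (W x *v (\<chi> i. T (h k i) x)) > t / 2" by auto
        have "(\<lambda>y. gk y $ i * indicator (dstar s x) y) = h k i" for i
        proof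
          fix y
          show "gk y $ i * indicator (dstar s x) y = h k i y"
          proof (cases "y \<in> S k")
            case True
            then have "norm y \<le> real k" by (simp add: S_def)
            then have "y \<in> dstar s x"
              using x(1) R s by (intro small_in_dstar) (auto simp: s_def field_simps)
            then show ?thesis by (simp add: gk_def)
          qed (simp add: gk_def h_def)
        qed
        then have "me.TS (dstar s x) x = (\<chi> i. T (h k i) x)" by (simp add: me.TS_def)
        then show "x \<in> {x. norm (W x *v me.TS (dstar s x) x) > t / 2}" using x(2) by simp
      qed
    qed
    also have "\<dots> \<le> ennreal (total_const (real CARD('n)) * A * Ai / (t / 2)) * ?f"
      using Fint by (intro mult_left_mono) (auto simp: me.F_def)
    finally show ?thesis by (simp add: D_def mult_ac)
  qed
  \<comment> \<open>Convergence in measure survives multiplication by \<open>W\<close> only where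
    its entries are bounded, hence the exhaustion by sets with bounded entries inside balls.\<close>
  define Y where "Y m = {x \<in> ball 0 (real m). (\<Sum>i\<in>UNIV. \<Sum>j\<in>UNIV. norm (W x $ i $ j)) \<le> real m \<and> norm (W x *v U x) > t}" for m :: nat
  have Ys: "Y m \<in> sets lebesgue" for m
  proof -
    have "ball 0 (real m) \<inter> {x \<in> space lebesgue. (\<Sum>i\<in>UNIV. \<Sum>j\<in>UNIV. norm (W x $ i $ j)) \<le> real m \<and> norm (W x *v U x) > t} \<in> sets lebesgue"
      by (intro sets.Int fmeasurableD[OF lmeasurable_ball]) measurable
    then show ?thesis by (simp add: Y_def Int_def)
  qed
  have YD: "emeasure lebesgue (Y m) \<le> D" for m
  proof (cases "m = 0")
    case True
    then show ?thesis by (simp add: Y_def)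
  next
    case False
    then have m: "real m > 0" by simp
    \<comment> \<open>On \<open>Y m\<close> the matrix magnifies errors by at most \<open>m\<close>,
      so an error of this size contributes at most \<open>t / 2\<close>.\<close>
    define \<epsilon> where "\<epsilon> = t / (2 * real m)"
    have \<epsilon>: "\<epsilon> > 0" using t m by (simp add: \<epsilon>_def)
    let ?B = "\<lambda>k i. {x \<in> ball 0 (real m). norm (T (h k i) x - extension T (\<lambda>y. g y $ i) x) > \<epsilon>}"
    let ?G = "\<lambda>k. {x \<in> ball 0 (real m). norm (W x *v (\<chi> i. T (h k i) x)) > t / 2}"
    have le: "emeasure lebesgue (Y m) \<le> D + (\<Sum>i\<in>UNIV. emeasure lebesgue (?B k i))" for k
    proof -
      note [measurable] = T_measurable[OF nice_L2[OF hn]]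
      have Bs: "?B k i \<in> sets lebesgue" for i by (rule local_set_measurable) measurable
      have "(\<lambda>x. norm (W x *v (\<chi> i. T (h k i) x))) \<in> borel_measurable lebesgue"
        by (rule norm_vec_measurable) (simp add: matrix_vector_mult_def)
      note [measurable] = this
      have "ball 0 (real m) \<inter> {x \<in> space lebesgue. norm (W x *v (\<chi> i. T (h k i) x)) > t / 2} \<in> sets lebesgue"
        by (intro sets.Int fmeasurableD[OF lmeasurable_ball]) measurable
      then have Gs: "?G k \<in> sets lebesgue" by (simp add: Int_def)
      have sub: "Y m \<subseteq> ?G k \<union> (\<Union>i\<in>UNIV. ?B k i)"
      proof
        fix x assume x: "x \<in> Y m"
        show "x \<in> ?G k \<union> (\<Union>i\<in>UNIV. ?B k i)"
        proof (rule ccontr)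
          assume n: "x \<notin> ?G k \<union> (\<Union>i\<in>UNIV. ?B k i)"
          have xb: "x \<in> ball 0 (real m)" using x by (simp add: Y_def)
          let ?T = "\<chi> i. T (h k i) x"
          have close: "norm ((U x - ?T) $ i) \<le> \<epsilon>" for i
          proof -
            have "x \<notin> ?B k i" using n by blast
            then show ?thesis using xb by (simp add: U_def norm_minus_commute not_less)
          qed
          have "norm (W x *v (U x - ?T)) \<le> (\<Sum>i\<in>UNIV. \<Sum>j\<in>UNIV. norm (W x $ i $ j)) * \<epsilon>"
            by (rule norm_matrix_vector_le[OF close])
          also have "\<dots> \<le> real m * \<epsilon>" using x \<epsilon> by (intro mult_right_mono) (auto simp: Y_def)
          also have "\<dots> = t / 2" using m by (simp add: \<epsilon>_def)
          finally have 1: "norm (W x *v (U x - ?T)) \<le> t / 2" .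
          have 2: "norm (W x *v ?T) \<le> t / 2" using n xb by (auto simp: not_less)
          have "W x *v U x = W x *v (U x - ?T) + W x *v ?T" by (simp add: matrix_vector_mult_diff_distrib)
          then have "norm (W x *v U x) \<le> t" using 1 2 norm_triangle_ineq[of "W x *v (U x - ?T)" "W x *v ?T"] by simp
          then show False using x by (simp add: Y_def)
        qed
      qed
      have Us: "(\<Union>i\<in>UNIV. ?B k i) \<in> sets lebesgue" using Bs by (intro sets.finite_UN) auto
      have "emeasure lebesgue (Y m) \<le> emeasure lebesgue (?G k \<union> (\<Union>i\<in>UNIV. ?B k i))"
        by (rule emeasure_mono[OF sub sets.Un[OF Gs Us]])
      also have "\<dots> \<le> emeasure lebesgue (?G k) + emeasure lebesgue (\<Union>i\<in>UNIV. ?B k i)"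
        by (rule emeasure_subadditive[OF Gs Us])
      also have "\<dots> \<le> D + (\<Sum>i\<in>UNIV. emeasure lebesgue (?B k i))"
        using Bs by (intro add_mono approx m emeasure_subadditive_finite) auto
      finally show ?thesis .
    qed
    have "(\<lambda>k. D + (\<Sum>i\<in>UNIV. emeasure lebesgue (?B k i))) \<longlonglongrightarrow> D + (\<Sum>i\<in>(UNIV :: 'n set). 0)"
      by (intro tendsto_add tendsto_const tendsto_sum extension_limit_nice[OF gm decay hn hlim m \<epsilon>])
    then have "emeasure lebesgue (Y m) \<le> D + (\<Sum>i\<in>(UNIV :: 'n set). 0)"
      by (rule LIMSEQ_le_const) (use le in blast)
    then show ?thesis by simp
  qed
  have "incseq Y"
    by (rule incseq_SucI) (auto simp: Y_def)
  moreover have "(\<Union>m. Y m) = {x. norm (weighted_operator T W f x) > t}"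
  proof -
    have "\<exists>m. x \<in> Y m" if "norm (W x *v U x) > t" for x
    proof -
      obtain m :: nat where "max (norm x) (\<Sum>i\<in>UNIV. \<Sum>j\<in>UNIV. norm (W x $ i $ j)) < real m" using reals_Archimedean2 by blast
      then show ?thesis using that by (intro exI[of _ m]) (auto simp: Y_def)
    qed
    then show ?thesis unfolding op by (auto simp: Y_def)
  qed
  ultimately have "emeasure lebesgue {x. norm (weighted_operator T W f x) > t} = (SUP m. emeasure lebesgue (Y m))"
    using SUP_emeasure_incseq[of Y lebesgue] Ys by (simp add: image_subset_iff)
  also have "\<dots> \<le> D" by (intro SUP_least YD)
  finally show ?thesis unfolding D_def .
qed

end

section \<open>The final constant\<close>

lemma cz_operator_obtain:
  assumes "cz_operator T"
  obtains K cK \<omega> B where "cz_op T K cK \<omega> B"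
proof -
  obtain B K where BK: "\<And>f. L2_function f \<Longrightarrow> L2_norm_of (T f) \<le> B * L2_norm_of f" "cz_kernel K"
    "\<And>f. L2_function f \<Longrightarrow> AE x in lebesgue. x \<notin> closure {y. f y \<noteq> 0} \<longrightarrow> T f x = (\<integral>y. K x y * f y \<partial>lebesgue)"
    using assms unfolding cz_operator_def by blast
  obtain cK where cK: "\<And>x y. x \<noteq> y \<Longrightarrow> norm (K x y) \<le> cK / norm (x - y) ^ CARD('a)"
    using BK(2) unfolding cz_kernel_def by blast
  obtain \<omega> where \<omega>: "dini_modulus \<omega>" "\<And>x x' y. norm (x - y) > 2 * norm (x - x') \<Longrightarrow>
      norm (K x y - K x' y) + norm (K y x - K y x') \<le> \<omega> (norm (x - x') / norm (x - y)) / norm (x - y) ^ CARD('a)"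
    using BK(2) unfolding cz_kernel_def by blast
  have "cz_op T K cK \<omega> B"
  proof
    show "L2_function (T f)" if "L2_function f" for f using assms that unfolding cz_operator_def by blast
    show "AE x in lebesgue. T (\<lambda>y. a * f y + b * g y) x = a * T f x + b * T g x"
      if "L2_function f" "L2_function g" for f g a b using assms that unfolding cz_operator_def by blast
  qed (use BK cK \<omega> in blast)+
  then show ?thesis by (rule that)
qed

theorem theorem1p2:
  fixes T :: "(real^'d::finite \<Rightarrow> complex) \<Rightarrow> (real^'d \<Rightarrow> complex)"
  assumes "cz_operator T"
  shows "\<exists>C::real. C > 0 \<and>
    (\<forall>(W :: real^'d \<Rightarrow> complex^'n::finite^'n) (f :: real^'d \<Rightarrow> complex^'n) (t::real).
       matrix_weight W \<longrightarrow> A1_const W < \<infinity> \<longrightarrow> integrable lebesgue f \<longrightarrow> t > 0 \<longrightarrow>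
       emeasure lebesgue {x. norm (weighted_operator T W f x) > t}
         \<le> ennreal C * ((A1_const W * A_infinity_sc_const W) / ennreal t)
             * (\<integral>\<^sup>+ x. ennreal (norm (f x)) \<partial>lebesgue))"
proof -
  obtain K cK \<omega> B where "cz_op T K cK \<omega> B" using cz_operator_obtain[OF assms] by blast
  then interpret cz_op T K cK \<omega> B .
  let ?C = "2 * total_const (real CARD('n))"
  have C: "?C > 0"
  proof -
    define c where "c = 2 ^ (CARD('d) + 3) * (real CARD('n) * weak_const + (kappa TYPE('d))\<^sup>2)"
    have "c > 0" unfolding c_def using weak_const_pos by (intro mult_pos_pos add_pos_nonneg) auto
    then have "0 < 5 * (c + c * c + dini_const * c) * (kappa TYPE('d)) ^ 3 * (1 + 384 * real CARD('n) ^ 3 * 2 ^ CARD('d))"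
      using dini_const_nonneg by (intro mult_pos_pos add_pos_nonneg zero_less_power kappa_pos mult_nonneg_nonneg) auto
    then show ?thesis by (simp add: total_const_def Let_def c_def)
  qed
  have main: "emeasure lebesgue {x. norm (weighted_operator T W f x) > t}
      \<le> ennreal ?C * ((A1_const W * A_infinity_sc_const W) / ennreal t) * (\<integral>\<^sup>+ x. ennreal (norm (f x)) \<partial>lebesgue)"
    if W: "matrix_weight W" "A1_const W < \<infinity>" and f: "integrable lebesgue f" and t: "t > 0"
    for W :: "real^'d \<Rightarrow> complex^'n::finite^'n" and f t
  proof -
    define A where "A = enn2real (A1_const W)"
    have AA: "A1_const W = ennreal A" "A \<ge> 0" using W(2) by (simp_all add: A_def)
    have w: "a1_weight W A" by unfold_locales (use W AA in auto)
    interpret a1_weight W A by (rule w)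
    \<comment> \<open>Finiteness of the A1 constant passes to the A-infinity constant, so both can
      be treated as real numbers.\<close>
    have le: "A_infinity_sc_const W \<le> ennreal A"
      unfolding A_infinity_sc_const_def by (intro SUP_least A_infinity_le)
    define e where "e = (axis undefined 1 :: complex^'n)"
    have e: "e \<noteq> 0" by (simp add: e_def axis_eq_0_iff)
    have ge: "1 \<le> A_infinity_sc_const W"
    proof -
      have "1 \<le> A_infinity_const (\<lambda>x. norm (W x *v e))" by (rule A_infinity_ge[OF e])
      also have "\<dots> \<le> A_infinity_sc_const W"
        unfolding A_infinity_sc_const_def using e by (intro SUP_upper) auto
      finally show ?thesis .
    qed
    define Ai where "Ai = enn2real (A_infinity_sc_const W)"
    have "A_infinity_sc_const W < top" using le by (rule le_less_trans) simp
    then have Ai: "A_infinity_sc_const W = ennreal Ai" by (simp add: Ai_def)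
    have Ai1: "Ai \<ge> 1" using ge unfolding Ai by simp
    have A1: "A \<ge> 1" using order_trans[OF ge le] by simp
    have Ainf: "A_infinity_const (\<lambda>x. norm (W x *v e)) \<le> ennreal Ai" if "e \<noteq> 0" for e
      unfolding Ai[symmetric] A_infinity_sc_const_def using that by (intro SUP_upper) auto
    have "emeasure lebesgue {x. norm (weighted_operator T W f x) > t} \<le>
        ennreal (?C * A * Ai / t) * (\<integral>\<^sup>+x. ennreal (norm (f x)) \<partial>lebesgue)"
      by (rule weighted_weak_type[OF w A1 Ai1 Ainf f t])
    also have "ennreal (?C * A * Ai / t) = ennreal ?C * ((A1_const W * A_infinity_sc_const W) / ennreal t)"
    proof -
      have "A1_const W * A_infinity_sc_const W / ennreal t = ennreal (A * Ai / t)"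
        unfolding AA(1) Ai using AA(2) Ai1 t by (subst ennreal_mult[symmetric]) (auto simp: divide_ennreal)
      then show ?thesis using C AA(2) Ai1 t by (simp add: ennreal_mult[symmetric] mult.assoc)
    qed
    finally show ?thesis .
  qed
  show ?thesis using C main by blast
qed

end
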